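(* Let $n\ge1$ and let $\lambda=(\lambda_1,\dots,\lambda_k)$ be a partition of a positive integer $l$ with length $k\le n+1$ (so $\lambda_1\ge\cdots\ge\lambda_k>0$). Then the connected component of the crystal graph of $[\mathscr C_\lambda]$ which contains $$[W^{\lambda_1}_{\lambda_1,0,\dots,0}\otimes W^{\lambda_2}_{0,\lambda_2,0,\dots,0}\otimes\cdots\otimes W^{\lambda_k}_{0,\dots,0,\lambda_k,0,\dots,0}]$$ (where in the $j$-th factor, for the subscript sequence indexed by $0,\dots,n$, the entry $\lambda_j$ is in position $j-1$ and all other entries are $0$) is isomorphic, as a $gl_{n+1}(\mathbb C)$-crystal, to $B(\lambda)$, the crystal basis of the irreducible polynomial $U_q(gl_{n+1})$-module $V(\lambda)$ of highest weight $\lambda_1\epsilon_1+\cdots+\lambda_k\epsilon_k$.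
   Context: Algebra. Fix $n\ge1$. In the ring $\mathbb Z_2^n$ (componentwise operations) let $u_i$ be the element with $i$-th component $1$ and other components $0$. For $m\ge1$, $P_m$ is the set of $m\times m$ matrices over $\mathbb Z_2^n$ with entries in $\{0,u_1,\dots,u_n\}$ such that (a) each row and each column has at most one nonzero entry; (b) for no $1\le i\le n$ is there a $2\times2$ submatrix $\begin{pmatrix}0 & u_i \\ u_i & 0\end{pmatrix}$. $P_m$ is a semigroup under matrix multiplication; $\mathbb CP_m$ is its semigroup algebra over $\mathbb C$. For $d_1\in P_{m_1},d_2\in P_{m_2}$, $d_1\otimes d_2\in P_{m_1+m_2}$ is the block diagonal matrix with blocks $d_1,d_2$; this extends bilinearly to an embedding $\mathbb CP_{m_1}\otimes\mathbb CP_{m_2}\to\mathbb CP_{m_1+m_2}$. Let $I_i=(u_i)$ ($1\le i\le n$) and $I_0=(0)$ in $P_1$, $e_1=\sum_{i=1}^nI_i-(n-1)I_0$; the identity of $\mathbb CP_m$ is $e_m=e_1^{\otimes m}$. For $d\in P_m$, $size(d)$ is the number of nonzero entries; $d'\subseteq d$ means $d'$ is obtained from $d$ by replacing some nonzero entries by $0$; $x_d=\sum_{d'\subseteq d}(-1)^{size(d)-size(d')}d'$. The $x_d$ form a basis of $\mathbb CP_m$. For $1\le k\le n$, $\beta_k(d)$ is the set of $j$ such that column $j$ of $d$ contains $u_k$, and $\beta_0(d)$ is the set of indices of zero columns; $\beta(d)=(\beta_0(d),\dots,\beta_n(d))$. Let $X_m$ be the set of $(n+1)$-tuples $T=(T_0,\dots,T_n)$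 of pairwise disjoint, possibly empty, sets with union $\{1,\dots,m\}$. For $T\in X_m$, $W^m_T=\mathrm{span}_{\mathbb C}\{x_d: d\in P_m,\ \beta(d)=T\}$, a left $\mathbb CP_m$-module. Modules are left and unital. It is known that $\mathbb CP_m$ is semisimple, the $W^m_T$ are irreducible and exhaust the irreducibles up to isomorphism, and $W^m_T\cong W^m_{T'}$ iff $|T_i|=|T'_i|$ for all $0\le i\le n$. $W^m_{m_0,\dots,m_n}$ denotes $W^m_T$ for the $T$ consisting of consecutive intervals of sizes $m_0,\dots,m_n$ (in this order), where $\sum m_i=m$. Functors. $\mathscr C_m$ is the category of finite-dimensional $\mathbb CP_m$-modules. For $m\ge2$ let $\psi_{i,m}:\mathbb CP_{m-1}\to\mathbb CP_m$ be the (non-unital) algebra embedding $x\mapsto x\otimes(I_i-I_0)$ for $1\le i\le n$, and $x\mapsto x\otimes I_0$ for $i=0$. Then $Res_{i,m}:\mathscr C_m\to\mathscr C_{m-1}$ is $Res_{i,m}(M)=\psi_{i,m}(e_{m-1})M$ with $x\in\mathbb CP_{m-1}$ acting as $\psi_{i,m}(x)$, and $Ind_{i,m}:\mathscr C_{m-1}\to\mathscr C_m$ is $Ind_{i,m}(M)=\mathbb CP_m\otimes_{\mathbb CP_{m-1}}M$, where $\mathbb CP_{m-1}$ acts on $\mathbb CP_m$ on the right through $\psi_{i,m}$. For $1\le i\le n$, $m\ge1$: $\tilde{\mathscr E}_{i,m}=Res_{i,m+1}\circ Ind_{i-1,m+1}$, $\tilde{\mathscr F}_{i,m}=Res_{i-1,m+1}\circ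 Ind_{i,m+1}$. Put $wt([W^m_{m_0,\dots,m_n}])=\sum_{j=0}^nm_j\epsilon_{j+1}$. The crystal $[\mathscr C_\lambda]$. For $\lambda=(\lambda_1,\dots,\lambda_k)$ with positive integer parts, $\mathbb CP_\lambda=\mathbb CP_{\lambda_1}\otimes\cdots\otimes\mathbb CP_{\lambda_k}$, and $[\mathscr C_\lambda]$ is the set of isomorphism classes of irreducible finite-dimensional $\mathbb CP_\lambda$-modules; its elements are $[M]=[W^{\lambda_1}_{\lambda_{10},\dots,\lambda_{1n}}\otimes\cdots\otimes W^{\lambda_k}_{\lambda_{k0},\dots,\lambda_{kn}}]$ with $\lambda_{ij}\in\mathbb N$, $\sum_{j=0}^n\lambda_{ij}=\lambda_i$. For $1\le i\le n$ assign to $[M]$ the sequence of signs which is the concatenation, for $j=1,\dots,k$, of the $j$-th component consisting of $\lambda_{ji}$ signs $-$ followed by $\lambda_{j,i-1}$ signs $+$. Repeatedly delete adjacent pairs $(+,-)$ until a sequence of the form $(-,\dots,-,+,\dots,+)$ remains. If the rightmost remaining $-$ comes from the $s$-th component, $\tilde e_{i,\lambda}([M])$ is the class obtained by applying $\tilde{\mathscr E}_{i,\lambda_s}$ to the $s$-th tensor factor; if the leftmost remaining $+$ comes from the $t$-th component, $\tilde f_{i,\lambda}([M])$ is the class obtained by applying $\tilde{\mathscr F}_{i,\lambda_t}$ to the $t$-th tensor factor; if no $-$ (resp. no $+$) remains, $\tilde e_{i,\lambda}([M])=0$ (resp. $\tilde f_{i,\lambda}([M])=0$). Also $wt([M])=\sum_jwt([W^{\lambda_j}_{\lambda_{j0},\dots,\lambda_{jn}}])$,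 $\varepsilon_{i,\lambda}([M])=\max\{j\ge0:\tilde e_{i,\lambda}^j([M])\ne0\}$, $\varphi_{i,\lambda}([M])=\max\{j\ge0:\tilde f_{i,\lambda}^j([M])\neq0\}$. Crystals. $\mathfrak h$ is the diagonal Cartan subalgebra of $gl_{n+1}(\mathbb C)$, $\epsilon_i(E_{jj})=\delta_{ij}$, $P=\bigoplus_{i=1}^{n+1}\mathbb Z\epsilon_i$. A $gl_{n+1}(\mathbb C)$-crystal is a set $B$ with maps $wt:B\to P$, $\varepsilon_i,\varphi_i:B\to\mathbb Z\cup\{-\infty\}$, $\tilde e_i,\tilde f_i:B\to B\cup\{0\}$ ($1\le i\le n$) such that: (a) $\varphi_i(b)=\varepsilon_i(b)+wt(b)(E_{ii}-E_{i+1,i+1})$; (b) $wt(\tilde e_ib)=wt(b)+\epsilon_i-\epsilon_{i+1}$ if $\tilde e_ib\in B$, and $wt(\tilde f_ib)=wt(b)-\epsilon_i+\epsilon_{i+1}$ if $\tilde f_ib\in B$; (c) for $b_1,b_2\in B$, $\tilde f_ib_2=b_1$ iff $\tilde e_ib_1=b_2$; (d) if $\varepsilon_i(b)=-\infty$ then $\tilde e_ib=\tilde f_ib=0$. The crystal graph has vertex set $B$ and an arrow of color $i$ from $b_1$ to $b_2$ when $\tilde f_ib_1=b_2$; a connected component carries the restricted crystal structure. An isomorphism of crystals is a bijection commuting with all these maps (with $0\mapsto0$). Tensor product: $B_1\otimes B_2=\{b_1\otimes b_2\}$ with $\tilde e_i(b_1\otimes b_2)=\tilde e_ib_1\otimes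 b_2$ if $\varphi_i(b_1)\ge\varepsilon_i(b_2)$ and $b_1\otimes\tilde e_ib_2$ otherwise; $\tilde f_i(b_1\otimes b_2)=\tilde f_ib_1\otimes b_2$ if $\varphi_i(b_1)>\varepsilon_i(b_2)$ and $b_1\otimes\tilde f_ib_2$ otherwise; $wt(b_1\otimes b_2)=wt(b_1)+wt(b_2)$; $\varepsilon_i(b_1\otimes b_2)=\max\{\varepsilon_i(b_1),\varepsilon_i(b_2)-wt(b_1)(E_{ii}-E_{i+1,i+1})\}$; $\varphi_i(b_1\otimes b_2)=\max\{\varphi_i(b_2),\varphi_i(b_1)+wt(b_2)(E_{ii}-E_{i+1,i+1})\}$ (and $b\otimes0=0\otimes b=0$). $B(\epsilon_1)$ is the set of boxes filled with $j\in\{0,1,\dots,n\}$, with $wt(j)=\epsilon_{j+1}$, $\varepsilon_i(j)=\delta_{i,j}$, $\varphi_i(j)=\delta_{i,j+1}$, $\tilde f_i(i-1)=i$, $\tilde e_i(i)=i-1$, all other values of $\tilde e_i,\tilde f_i$ being $0$. $B(\lambda)$ is realized on semistandard Young tableaux of shape $\lambda$ with entries in $\{0,\dots,n\}$, its crystal structure being induced from $B(\epsilon_1)^{\otimes|\lambda|}$ via the Middle-Eastern reading (a tableau is sent to the tensor product of its boxes read right to left in each row, rows from top to bottom). *)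

theory Defs
  imports
    Complex_Main
    "HOL-Library.Function_Algebras"
    "HOL-Library.Z2"
    "HOL-Library.Extended"
    "HOL-Algebra.Module"
    "Jordan_Normal_Form.Matrix"
begin

section \<open>Spaces of complex functions\<close>

definition cscale :: "complex \<Rightarrow> ('a \<Rightarrow> complex) \<Rightarrow> 'a \<Rightarrow> complex" where
  "cscale c f = (\<lambda>x. c * f x)"

global_interpretation cfun: vector_space cscale
  by unfold_locales (auto simp: cscale_def fun_eq_iff algebra_simps)

definition delta :: "'a \<Rightarrow> 'a \<Rightarrow> complex" where
  "delta x = (\<lambda>y. if y = x then 1 else 0)"

text \<open>The linear extension of a map given on the basis vectors \<^term>\<open>delta x\<close>,
  for finitely supported arguments.\<close>

definition lin_ext :: "('a \<Rightarrow> 'b \<Rightarrow> complex) \<Rightarrow> ('a \<Rightarrow> complex) \<Rightarrow> 'b \<Rightarrow> complex" where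
  "lin_ext g f = (\<Sum>x | f x \<noteq> 0. cscale (f x) (g x))"


section \<open>Left modules over a not necessarily commutative ring\<close>

text \<open>The record type of HOL-Algebra modules is reused; its ring components \<^const>\<open>mult\<close> and
  \<^const>\<open>one\<close> play no role. (The locale of that name asks for a commutative ring of scalars.)\<close>

locale left_module = R?: ring R + M?: abelian_group M
  for R :: "('a, 'r) ring_scheme" (structure)
    and M :: "('a, 'b, 'm) module_scheme" (structure) +
  assumes smult_closed:
      "a \<in> carrier R \<Longrightarrow> x \<in> carrier M \<Longrightarrow> a \<odot>\<^bsub>M\<^esub> x \<in> carrier M"
    and smult_l_distr:
      "a \<in> carrier R \<Longrightarrow> b \<in> carrier R \<Longrightarrow> x \<in> carrier M \<Longrightarrow>
       (a \<oplus>\<^bsub>R\<^esub> b) \<odot>\<^bsub>M\<^esub> x = a \<odot>\<^bsub>M\<^esub> x \<oplus>\<^bsub>M\<^esub> b \<odot>\<^bsub>M\<^esub> x"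
    and smult_r_distr:
      "a \<in> carrier R \<Longrightarrow> x \<in> carrier M \<Longrightarrow> y \<in> carrier M \<Longrightarrow>
       a \<odot>\<^bsub>M\<^esub> (x \<oplus>\<^bsub>M\<^esub> y) = a \<odot>\<^bsub>M\<^esub> x \<oplus>\<^bsub>M\<^esub> a \<odot>\<^bsub>M\<^esub> y"
    and smult_assoc1:
      "a \<in> carrier R \<Longrightarrow> b \<in> carrier R \<Longrightarrow> x \<in> carrier M \<Longrightarrow>
       (a \<otimes>\<^bsub>R\<^esub> b) \<odot>\<^bsub>M\<^esub> x = a \<odot>\<^bsub>M\<^esub> (b \<odot>\<^bsub>M\<^esub> x)"
    and smult_one:
      "x \<in> carrier M \<Longrightarrow> \<one>\<^bsub>R\<^esub> \<odot>\<^bsub>M\<^esub> x = x"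

definition irreducible_module ::
  "('a, 'r) ring_scheme \<Rightarrow> ('a, 'b, 'm) module_scheme \<Rightarrow> bool" where
  "irreducible_module R M \<longleftrightarrow>
     carrier M \<noteq> {\<zero>\<^bsub>M\<^esub>} \<and>
     (\<forall>H. submodule H R M \<longrightarrow> H = {\<zero>\<^bsub>M\<^esub>} \<or> H = carrier M)"

definition module_isomorphic ::
  "('a, 'r) ring_scheme \<Rightarrow> ('a, 'b, 'm) module_scheme \<Rightarrow> ('a, 'c, 'k) module_scheme \<Rightarrow> bool"
  where
  "module_isomorphic R M N \<longleftrightarrow> (\<exists>h. bij_betw h (carrier M) (carrier N) \<and>
     (\<forall>x\<in>carrier M. \<forall>y\<in>carrier M. h (x \<oplus>\<^bsub>M\<^esub> y) = h x \<oplus>\<^bsub>N\<^esub> h y) \<and>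
     (\<forall>a\<in>carrier R. \<forall>x\<in>carrier M. h (a \<odot>\<^bsub>M\<^esub> x) = a \<odot>\<^bsub>N\<^esub> h x))"

text \<open>All rings below are complex algebras realised on spaces of complex functions; the complex
  structure of a unital module is the one given by the multiples of the identity.\<close>

definition csmult ::
  "('s \<Rightarrow> complex, 'r) ring_scheme \<Rightarrow> ('s \<Rightarrow> complex, 'b, 'm) module_scheme \<Rightarrow>
   complex \<Rightarrow> 'b \<Rightarrow> 'b" where
  "csmult R M c v = cscale c \<one>\<^bsub>R\<^esub> \<odot>\<^bsub>M\<^esub> v"

definition finite_dim_module ::
  "('s \<Rightarrow> complex, 'r) ring_scheme \<Rightarrow> ('s \<Rightarrow> complex, 'b, 'm) module_scheme \<Rightarrow> bool" where
  "finite_dim_module R M \<longleftrightarrow> (\<exists>B. finite B \<and> B \<subseteq> carrier M \<and>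
     (\<forall>v\<in>carrier M. \<exists>c. v = finsum M (\<lambda>b. csmult R M (c b) b) B))"

text \<open>Isomorphism classes are taken among the modules whose vectors are of type
  \<^typ>\<open>nat \<Rightarrow> complex\<close> (with an arbitrary carrier and arbitrary operations). Every
  finite-dimensional module, of whatever type, has an isomorphic copy among them.\<close>

type_synonym 's umodule = "('s \<Rightarrow> complex, nat \<Rightarrow> complex) module"

definition iso_class ::
  "('s \<Rightarrow> complex, 'r) ring_scheme \<Rightarrow> ('s \<Rightarrow> complex, 'b, 'm) module_scheme \<Rightarrow> 's umodule set"
  where
  "iso_class R M = {N. left_module R N \<and> finite_dim_module R N \<and> module_isomorphic R M N}"

definition umodel ::
  "('s \<Rightarrow> complex, 'r) ring_scheme \<Rightarrow> ('s \<Rightarrow> complex, 'b, 'm) module_scheme \<Rightarrow> 's umodule" where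
  "umodel R M = (SOME N. N \<in> iso_class R M)"

definition irreducible_classes ::
  "('s \<Rightarrow> complex, 'r) ring_scheme \<Rightarrow> 's umodule set set" where
  "irreducible_classes R = {iso_class R M | M :: 's umodule.
     left_module R M \<and> finite_dim_module R M \<and> irreducible_module R M}"

text \<open>The quotient of the free complex vector space on \<open>S\<close> by the span of \<open>Rel\<close>; a scalar
  \<open>a\<close> sends the class of a generator \<open>x\<close> to the class of \<open>act a x\<close>.\<close>

definition quot_module ::
  "'x set \<Rightarrow> ('x \<Rightarrow> complex) set \<Rightarrow> ('a \<Rightarrow> 'x \<Rightarrow> 'x \<Rightarrow> complex) \<Rightarrow>
   ('a, ('x \<Rightarrow> complex) set) module" where
  "quot_module S Rel act = \<lparr>
     carrier = {{x + r | r. r \<in> cfun.span Rel} | x. x \<in> cfun.span (delta ` S)},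
     mult = undefined, one = undefined,
     zero = cfun.span Rel,
     add = (\<lambda>X Y. {x + y | x y. x \<in> X \<and> y \<in> Y}),
     smult = (\<lambda>a X. {lin_ext (act a) x + r | x r. x \<in> X \<and> r \<in> cfun.span Rel})\<rparr>"

text \<open>Restriction and induction along a not necessarily unital homomorphism \<open>psi\<close>
  from \<open>B\<close> to \<open>A\<close>.\<close>

definition res_module ::
  "('a, 'r) ring_scheme \<Rightarrow> ('b \<Rightarrow> 'a) \<Rightarrow> ('b, 'q) ring_scheme \<Rightarrow>
   ('a, 'v, 'm) module_scheme \<Rightarrow> ('b, 'v) module" where
  "res_module A psi B M = \<lparr>
     carrier = (\<lambda>v. psi \<one>\<^bsub>B\<^esub> \<odot>\<^bsub>M\<^esub> v) ` carrier M,
     mult = undefined, one = undefined,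
     zero = \<zero>\<^bsub>M\<^esub>,
     add = (\<lambda>v w. v \<oplus>\<^bsub>M\<^esub> w),
     smult = (\<lambda>b v. psi b \<odot>\<^bsub>M\<^esub> v)\<rparr>"

definition balanced_rel ::
  "('s \<Rightarrow> complex, 'r) ring_scheme \<Rightarrow> ('b \<Rightarrow> 's \<Rightarrow> complex) \<Rightarrow> ('b, 'q) ring_scheme \<Rightarrow>
   ('b, 'v, 'm) module_scheme \<Rightarrow> (('s \<Rightarrow> complex) \<times> 'v \<Rightarrow> complex) set" where
  "balanced_rel A psi B M =
     {delta (a \<oplus>\<^bsub>A\<^esub> a', v) - delta (a, v) - delta (a', v) | a a' v.
        a \<in> carrier A \<and> a' \<in> carrier A \<and> v \<in> carrier M} \<union>
     {delta (a, v \<oplus>\<^bsub>M\<^esub> v') - delta (a, v) - delta (a, v') | a v v'.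
        a \<in> carrier A \<and> v \<in> carrier M \<and> v' \<in> carrier M} \<union>
     {delta (cscale c a, v) - cscale c (delta (a, v)) | c a v.
        a \<in> carrier A \<and> v \<in> carrier M} \<union>
     {delta (a \<otimes>\<^bsub>A\<^esub> psi b, v) - delta (a, b \<odot>\<^bsub>M\<^esub> v) | a b v.
        a \<in> carrier A \<and> b \<in> carrier B \<and> v \<in> carrier M}"

definition ind_module ::
  "('s \<Rightarrow> complex, 'r) ring_scheme \<Rightarrow> ('b \<Rightarrow> 's \<Rightarrow> complex) \<Rightarrow> ('b, 'q) ring_scheme \<Rightarrow>
   ('b, 'v, 'm) module_scheme \<Rightarrow>
   ('s \<Rightarrow> complex, (('s \<Rightarrow> complex) \<times> 'v \<Rightarrow> complex) set) module" where
  "ind_module A psi B M =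
     quot_module (carrier A \<times> carrier M) (balanced_rel A psi B M)
       (\<lambda>a (a', v). delta (a \<otimes>\<^bsub>A\<^esub> a', v))"


section \<open>The semigroups \<open>P_m\<close> and their algebras\<close>

text \<open>The elements of the ring \<open>Z_2^n\<close> are the functions \<^typ>\<open>nat \<Rightarrow> bit\<close> vanishing outside
  \<open>{1..n}\<close>, with pointwise operations. Rows and columns of an \<open>m \<times> m\<close> matrix are numbered
  \<open>0, \<dots>, m - 1\<close>.\<close>

type_synonym pmat = "(nat \<Rightarrow> bit) mat"

definition uvec :: "nat \<Rightarrow> nat \<Rightarrow> bit" where
  "uvec i = (\<lambda>j. if j = i then 1 else 0)"

definition Pmat :: "nat \<Rightarrow> nat \<Rightarrow> pmat set" where
  "Pmat n m = {d \<in> carrier_mat m m.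
     (\<forall>r<m. \<forall>c<m. d $$ (r, c) \<in> insert 0 (uvec ` {1..n})) \<and>
     (\<forall>r<m. \<forall>c<m. \<forall>c'<m. d $$ (r, c) \<noteq> 0 \<and> d $$ (r, c') \<noteq> 0 \<longrightarrow> c = c') \<and>
     (\<forall>c<m. \<forall>r<m. \<forall>r'<m. d $$ (r, c) \<noteq> 0 \<and> d $$ (r', c) \<noteq> 0 \<longrightarrow> r = r') \<and>
     (\<forall>i\<in>{1..n}. \<not> (\<exists>r r' c c'. r < r' \<and> r' < m \<and> c < c' \<and> c' < m \<and>
        d $$ (r, c) = 0 \<and> d $$ (r, c') = uvec i \<and>
        d $$ (r', c) = uvec i \<and> d $$ (r', c') = 0))}"

definition semigroup_algebra ::
  "'s set \<Rightarrow> ('s \<Rightarrow> 's \<Rightarrow> 's) \<Rightarrow> ('s \<Rightarrow> complex) \<Rightarrow> ('s \<Rightarrow> complex) ring" where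
  "semigroup_algebra S op e = \<lparr>
     carrier = {f. \<forall>s. s \<notin> S \<longrightarrow> f s = 0},
     mult = (\<lambda>f g s. \<Sum>(a, b) \<in> {(a, b). a \<in> S \<and> b \<in> S \<and> op a b = s}. f a * g b),
     one = e,
     zero = 0,
     add = (\<lambda>f g. f + g)\<rparr>"

definition block_diag :: "pmat \<Rightarrow> pmat \<Rightarrow> pmat" where
  "block_diag a b =
     four_block_mat a (0\<^sub>m (dim_row a) (dim_col b)) (0\<^sub>m (dim_row b) (dim_col a)) b"

definition tens ::
  "nat \<Rightarrow> nat \<Rightarrow> nat \<Rightarrow> (pmat \<Rightarrow> complex) \<Rightarrow> (pmat \<Rightarrow> complex) \<Rightarrow> pmat \<Rightarrow> complex" where
  "tens n m1 m2 f g = (\<lambda>d. \<Sum>(a, b) \<in> {(a, b). a \<in> Pmat n m1 \<and> b \<in> Pmat n m2 \<and>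
     block_diag a b = d}. f a * g b)"

text \<open>\<open>Ielt i\<close> is the basis vector of the algebra at the \<open>1 \<times> 1\<close> matrix \<open>(u_i)\<close>, or at \<open>(0)\<close>
  if \<open>i = 0\<close>; the latter is not the zero of the algebra.\<close>

definition Ielt :: "nat \<Rightarrow> pmat \<Rightarrow> complex" where
  "Ielt i = delta (mat 1 1 (\<lambda>_. if i = 0 then 0 else uvec i))"

definition unit1 :: "nat \<Rightarrow> pmat \<Rightarrow> complex" where
  "unit1 n = (\<Sum>i\<in>{1..n}. Ielt i) - cscale (of_nat n - 1) (Ielt 0)"

text \<open>The recursion for \<open>e_m\<close> starts with the empty matrix; this gives
  \<open>unit_elt n 1 = unit1 n\<close>.\<close>

primrec unit_elt :: "nat \<Rightarrow> nat \<Rightarrow> pmat \<Rightarrow> complex" where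
  "unit_elt n 0 = delta (0\<^sub>m 0 0)"
| "unit_elt n (Suc m) = tens n m 1 (unit_elt n m) (unit1 n)"

definition CP :: "nat \<Rightarrow> nat \<Rightarrow> (pmat \<Rightarrow> complex) ring" where
  "CP n m = semigroup_algebra (Pmat n m) (\<lambda>a b. a * b) (unit_elt n m)"


section \<open>The modules \<open>W^m_T\<close>\<close>

definition dsize :: "pmat \<Rightarrow> nat" where
  "dsize d = card {(r, c). r < dim_row d \<and> c < dim_col d \<and> d $$ (r, c) \<noteq> 0}"

definition dsub :: "pmat \<Rightarrow> pmat \<Rightarrow> bool" where
  "dsub d' d \<longleftrightarrow> d' \<in> carrier_mat (dim_row d) (dim_col d) \<and>
     (\<forall>r<dim_row d. \<forall>c<dim_col d. d' $$ (r, c) = 0 \<or> d' $$ (r, c) = d $$ (r, c))"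

definition xelt :: "pmat \<Rightarrow> pmat \<Rightarrow> complex" where
  "xelt d = (\<lambda>d'. if dsub d' d then (- 1) ^ (dsize d - dsize d') else 0)"

definition beta :: "nat \<Rightarrow> pmat \<Rightarrow> nat set" where
  "beta k d = {c. c < dim_col d \<and>
     (if k = 0 then \<forall>r<dim_row d. d $$ (r, c) = 0
      else \<exists>r<dim_row d. d $$ (r, c) = uvec k)}"

text \<open>Tuples \<open>(T_0, \<dots>, T_n)\<close> and \<open>(m_0, \<dots>, m_n)\<close> are lists of length \<open>n + 1\<close>.\<close>

definition WT :: "nat \<Rightarrow> nat \<Rightarrow> nat set list \<Rightarrow> (pmat \<Rightarrow> complex, pmat \<Rightarrow> complex) module" where
  "WT n m T = \<lparr>
     carrier = cfun.span (xelt ` {d \<in> Pmat n m. map (\<lambda>k. beta k d) [0..<Suc n] = T}),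
     mult = undefined, one = undefined,
     zero = 0,
     add = (\<lambda>f g. f + g),
     smult = (\<lambda>a f. a \<otimes>\<^bsub>CP n m\<^esub> f)\<rparr>"

definition intervals :: "nat list \<Rightarrow> nat set list" where
  "intervals mu =
     map (\<lambda>i. {sum_list (take i mu)..<sum_list (take (Suc i) mu)}) [0..<length mu]"

definition Wmod :: "nat \<Rightarrow> nat list \<Rightarrow> (pmat \<Rightarrow> complex, pmat \<Rightarrow> complex) module" where
  "Wmod n mu = WT n (sum_list mu) (intervals mu)"


section \<open>The functors\<close>

definition psi :: "nat \<Rightarrow> nat \<Rightarrow> nat \<Rightarrow> (pmat \<Rightarrow> complex) \<Rightarrow> pmat \<Rightarrow> complex" where
  "psi n i m x = tens n (m - 1) 1 x (if i = 0 then Ielt 0 else Ielt i - Ielt 0)"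

definition Res ::
  "nat \<Rightarrow> nat \<Rightarrow> nat \<Rightarrow> (pmat \<Rightarrow> complex, 'v) module \<Rightarrow> (pmat \<Rightarrow> complex, 'v) module" where
  "Res n i m M = res_module (CP n m) (psi n i m) (CP n (m - 1)) M"

definition Ind ::
  "nat \<Rightarrow> nat \<Rightarrow> nat \<Rightarrow> (pmat \<Rightarrow> complex, 'v) module \<Rightarrow>
   (pmat \<Rightarrow> complex, ((pmat \<Rightarrow> complex) \<times> 'v \<Rightarrow> complex) set) module" where
  "Ind n i m M = ind_module (CP n m) (psi n i m) (CP n (m - 1)) M"

definition Efun ::
  "nat \<Rightarrow> nat \<Rightarrow> nat \<Rightarrow> (pmat \<Rightarrow> complex, 'v) module \<Rightarrow>
   (pmat \<Rightarrow> complex, ((pmat \<Rightarrow> complex) \<times> 'v \<Rightarrow> complex) set) module" where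
  "Efun n i m M = Res n i (m + 1) (Ind n (i - 1) (m + 1) M)"

definition Ffun ::
  "nat \<Rightarrow> nat \<Rightarrow> nat \<Rightarrow> (pmat \<Rightarrow> complex, 'v) module \<Rightarrow>
   (pmat \<Rightarrow> complex, ((pmat \<Rightarrow> complex) \<times> 'v \<Rightarrow> complex) set) module" where
  "Ffun n i m M = Res n (i - 1) (m + 1) (Ind n i (m + 1) M)"


section \<open>The algebra \<open>CP_\<lambda>\<close> and outer tensor products of modules\<close>

definition Plist :: "nat \<Rightarrow> nat list \<Rightarrow> pmat list set" where
  "Plist n lam = {ds. list_all2 (\<lambda>d m. d \<in> Pmat n m) ds lam}"

text \<open>The tensor product of the algebras \<open>CP_{\<lambda>_j}\<close>: the list \<open>[d_1, \<dots>, d_k]\<close> stands for the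
  basis vector \<open>d_1 \<otimes> \<dots> \<otimes> d_k\<close>.\<close>

definition CPlist :: "nat \<Rightarrow> nat list \<Rightarrow> (pmat list \<Rightarrow> complex) ring" where
  "CPlist n lam = semigroup_algebra (Plist n lam) (map2 (\<lambda>a b. a * b))
     (\<lambda>ds. if length ds = length lam then \<Prod>j<length lam. unit_elt n (lam ! j) (ds ! j) else 0)"

definition outer_gens :: "('a, 'v) module list \<Rightarrow> 'v list set" where
  "outer_gens Ms = {vs. list_all2 (\<lambda>v M. v \<in> carrier M) vs Ms}"

definition multilinear_rel ::
  "nat \<Rightarrow> nat list \<Rightarrow> (pmat \<Rightarrow> complex, 'v) module list \<Rightarrow> ('v list \<Rightarrow> complex) set" where
  "multilinear_rel n lam Ms =
     {delta (vs[j := v \<oplus>\<^bsub>Ms ! j\<^esub> w]) - delta (vs[j := v]) - delta (vs[j := w]) | vs j v w.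
        vs \<in> outer_gens Ms \<and> j < length Ms \<and> v \<in> carrier (Ms ! j) \<and> w \<in> carrier (Ms ! j)} \<union>
     {delta (vs[j := csmult (CP n (lam ! j)) (Ms ! j) c v]) - cscale c (delta (vs[j := v]))
        | vs j c v. vs \<in> outer_gens Ms \<and> j < length Ms \<and> v \<in> carrier (Ms ! j)}"

definition outer_tensor ::
  "nat \<Rightarrow> nat list \<Rightarrow> (pmat \<Rightarrow> complex, 'v) module list \<Rightarrow>
   (pmat list \<Rightarrow> complex, ('v list \<Rightarrow> complex) set) module" where
  "outer_tensor n lam Ms =
     quot_module (outer_gens Ms) (multilinear_rel n lam Ms)
       (\<lambda>f vs. \<Sum>ds\<in>Plist n lam. cscale (f ds)
          (delta (map2 (\<lambda>(M, d) v. delta d \<odot>\<^bsub>M\<^esub> v) (zip Ms ds) vs)))"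


section \<open>\<open>gl_{n+1}\<close>-crystals\<close>

text \<open>A weight is the function \<open>nat \<Rightarrow> int\<close> of its coefficients at \<open>\<epsilon>_1, \<dots>, \<epsilon>_{n+1}\<close>, zero at
  all other indices. In the values of the operators \<open>None\<close> stands for \<open>0\<close>. Only the colors
  \<open>1 \<le> i \<le> n\<close> matter.\<close>

record 'b crystal =
  verts :: "'b set"
  cwt :: "'b \<Rightarrow> nat \<Rightarrow> int"
  ceps :: "nat \<Rightarrow> 'b \<Rightarrow> int extended"
  cphi :: "nat \<Rightarrow> 'b \<Rightarrow> int extended"
  ce :: "nat \<Rightarrow> 'b \<Rightarrow> 'b option"
  cf :: "nat \<Rightarrow> 'b \<Rightarrow> 'b option"

definition epsw :: "nat \<Rightarrow> nat \<Rightarrow> int" where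
  "epsw j = (\<lambda>p. if p = j then 1 else 0)"

definition is_crystal :: "nat \<Rightarrow> 'b crystal \<Rightarrow> bool" where
  "is_crystal n B \<longleftrightarrow>
     (\<forall>b\<in>verts B. \<forall>p. p \<notin> {1..n + 1} \<longrightarrow> cwt B b p = 0) \<and>
     (\<forall>i\<in>{1..n}. \<forall>b\<in>verts B.
        ceps B i b \<noteq> Pinf \<and> cphi B i b \<noteq> Pinf \<and>
        set_option (ce B i b) \<subseteq> verts B \<and> set_option (cf B i b) \<subseteq> verts B \<and>
        cphi B i b = ceps B i b + Fin (cwt B b i - cwt B b (i + 1)) \<and>
        (\<forall>b'. ce B i b = Some b' \<longrightarrow> cwt B b' = cwt B b + epsw i - epsw (i + 1)) \<and>
        (\<forall>b'. cf B i b = Some b' \<longrightarrow> cwt B b' = cwt B b - epsw i + epsw (i + 1)) \<and>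
        (\<forall>b'\<in>verts B. cf B i b' = Some b \<longleftrightarrow> ce B i b = Some b') \<and>
        (ceps B i b = Minf \<longrightarrow> ce B i b = None \<and> cf B i b = None))"

definition crystal_arrow :: "nat \<Rightarrow> 'b crystal \<Rightarrow> 'b \<Rightarrow> 'b \<Rightarrow> bool" where
  "crystal_arrow n B b1 b2 \<longleftrightarrow>
     b1 \<in> verts B \<and> b2 \<in> verts B \<and> (\<exists>i\<in>{1..n}. cf B i b1 = Some b2)"

definition crystal_component :: "nat \<Rightarrow> 'b crystal \<Rightarrow> 'b \<Rightarrow> 'b crystal" where
  "crystal_component n B b = B\<lparr>verts := {b' \<in> verts B. equivclp (crystal_arrow n B) b b'}\<rparr>"

definition crystal_isomorphic :: "nat \<Rightarrow> 'b crystal \<Rightarrow> 'c crystal \<Rightarrow> bool" where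
  "crystal_isomorphic n B C \<longleftrightarrow> is_crystal n B \<and> is_crystal n C \<and>
     (\<exists>h. bij_betw h (verts B) (verts C) \<and>
        (\<forall>b\<in>verts B. cwt C (h b) = cwt B b \<and>
           (\<forall>i\<in>{1..n}. ceps C i (h b) = ceps B i b \<and> cphi C i (h b) = cphi B i b \<and>
              ce C i (h b) = map_option h (ce B i b) \<and>
              cf C i (h b) = map_option h (cf B i b))))"

definition crystal_tensor :: "'b crystal \<Rightarrow> 'c crystal \<Rightarrow> ('b \<times> 'c) crystal" where
  "crystal_tensor B C = \<lparr>
     verts = verts B \<times> verts C,
     cwt = (\<lambda>(b, c). cwt B b + cwt C c),
     ceps = (\<lambda>i (b, c). max (ceps B i b) (ceps C i c - Fin (cwt B b i - cwt B b (i + 1)))),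
     cphi = (\<lambda>i (b, c). max (cphi C i c) (cphi B i b + Fin (cwt C c i - cwt C c (i + 1)))),
     ce = (\<lambda>i (b, c). if cphi B i b \<ge> ceps C i c
        then map_option (\<lambda>b'. (b', c)) (ce B i b) else map_option (\<lambda>c'. (b, c')) (ce C i c)),
     cf = (\<lambda>i (b, c). if cphi B i b > ceps C i c
        then map_option (\<lambda>b'. (b', c)) (cf B i b) else map_option (\<lambda>c'. (b, c')) (cf C i c))\<rparr>"

text \<open>The crystal structure on \<open>S\<close> induced from \<open>B\<close> along an injective map \<open>g\<close> from \<open>S\<close> into
  the vertices of \<open>B\<close> whose image is stable under the operators.\<close>

definition crystal_induced :: "'c set \<Rightarrow> ('c \<Rightarrow> 'b) \<Rightarrow> 'b crystal \<Rightarrow> 'c crystal" where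
  "crystal_induced S g B = \<lparr>
     verts = S,
     cwt = (\<lambda>c. cwt B (g c)),
     ceps = (\<lambda>i c. ceps B i (g c)),
     cphi = (\<lambda>i c. cphi B i (g c)),
     ce = (\<lambda>i c. map_option (inv_into S g) (ce B i (g c))),
     cf = (\<lambda>i c. map_option (inv_into S g) (cf B i (g c)))\<rparr>"

text \<open>The tensor power \<open>B \<otimes> (B \<otimes> (\<dots> \<otimes> B))\<close> with \<open>b_1 \<otimes> \<dots> \<otimes> b_N\<close> written as the list
  \<open>[b_1, \<dots>, b_N]\<close>. The zeroth power, which is not needed, is the one-element crystal
  of weight \<open>0\<close>.\<close>

fun crystal_power :: "'b crystal \<Rightarrow> nat \<Rightarrow> 'b list crystal" where
  "crystal_power B 0 = \<lparr>verts = {[]}, cwt = (\<lambda>_ _. 0), ceps = (\<lambda>_ _. 0), cphi = (\<lambda>_ _. 0),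
     ce = (\<lambda>_ _. None), cf = (\<lambda>_ _. None)\<rparr>"
| "crystal_power B (Suc 0) = crystal_induced {[b] | b. b \<in> verts B} hd B"
| "crystal_power B (Suc (Suc N)) =
     crystal_induced {b # bs | b bs. b \<in> verts B \<and> bs \<in> verts (crystal_power B (Suc N))}
       (\<lambda>w. (hd w, tl w)) (crystal_tensor B (crystal_power B (Suc N)))"


section \<open>The crystal \<open>B(\<lambda>)\<close>\<close>

definition box_crystal :: "nat \<Rightarrow> nat crystal" where
  "box_crystal n = \<lparr>
     verts = {0..n},
     cwt = (\<lambda>j. epsw (j + 1)),
     ceps = (\<lambda>i j. Fin (if i = j then 1 else 0)),
     cphi = (\<lambda>i j. Fin (if i = j + 1 then 1 else 0)),
     ce = (\<lambda>i j. if i \<in> {1..n} \<and> j = i then Some (i - 1) else None),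
     cf = (\<lambda>i j. if i \<in> {1..n} \<and> j = i - 1 then Some i else None)\<rparr>"

text \<open>A tableau is the list of its rows, from top to bottom.\<close>

definition SSYT :: "nat \<Rightarrow> nat list \<Rightarrow> nat list list set" where
  "SSYT n lam = {t. map length t = lam \<and>
     (\<forall>row\<in>set t. sorted row \<and> set row \<subseteq> {0..n}) \<and>
     (\<forall>r c. Suc r < length t \<and> c < length (t ! Suc r) \<longrightarrow> t ! r ! c < t ! Suc r ! c)}"

definition middle_eastern_reading :: "nat list list \<Rightarrow> nat list" where
  "middle_eastern_reading t = concat (map rev t)"

definition B_crystal :: "nat \<Rightarrow> nat list \<Rightarrow> nat list list crystal" where
  "B_crystal n lam = crystal_induced (SSYT n lam) middle_eastern_reading
     (crystal_power (box_crystal n) (sum_list lam))"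


section \<open>The crystal \<open>[C_\<lambda>]\<close>\<close>

text \<open>Every irreducible \<open>CP_\<lambda>\<close>-module is isomorphic to an outer tensor product of modules
  \<^const>\<open>Wmod\<close> for exactly one family \<open>(\<lambda>_{ij})\<close>; \<open>label_of\<close> below recovers that family.\<close>

definition labels :: "nat \<Rightarrow> nat list \<Rightarrow> nat list list set" where
  "labels n lam = {L. list_all2 (\<lambda>mu m. length mu = n + 1 \<and> sum_list mu = m) L lam}"

definition Wfactors :: "nat \<Rightarrow> nat list \<Rightarrow> nat list list \<Rightarrow> pmat umodule list" where
  "Wfactors n lam L = map2 (\<lambda>m mu. umodel (CP n m) (Wmod n mu)) lam L"

definition outer_class :: "nat \<Rightarrow> nat list \<Rightarrow> pmat umodule list \<Rightarrow> pmat list umodule set" where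
  "outer_class n lam Ms = iso_class (CPlist n lam) (outer_tensor n lam Ms)"

definition Wclass :: "nat \<Rightarrow> nat list \<Rightarrow> nat list list \<Rightarrow> pmat list umodule set" where
  "Wclass n lam L = outer_class n lam (Wfactors n lam L)"

definition label_of :: "nat \<Rightarrow> nat list \<Rightarrow> pmat list umodule set \<Rightarrow> nat list list" where
  "label_of n lam c = (THE L. L \<in> labels n lam \<and> c = Wclass n lam L)"

datatype sign = Minus | Plus

text \<open>Each sign is paired with the (zero-based) number of the component it comes from.\<close>

definition sign_seq :: "nat \<Rightarrow> nat list list \<Rightarrow> (sign \<times> nat) list" where
  "sign_seq i L = concat (map (\<lambda>j. replicate (L ! j ! i) (Minus, j) @
     replicate (L ! j ! (i - 1)) (Plus, j)) [0..<length L])"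

definition sign_cancel :: "(sign \<times> nat) list \<Rightarrow> (sign \<times> nat) list \<Rightarrow> bool" where
  "sign_cancel xs ys \<longleftrightarrow>
     (\<exists>us vs j j'. xs = us @ [(Plus, j), (Minus, j')] @ vs \<and> ys = us @ vs)"

definition reduced_seq :: "(sign \<times> nat) list \<Rightarrow> (sign \<times> nat) list" where
  "reduced_seq xs = (THE ys. sign_cancel\<^sup>*\<^sup>* xs ys \<and> \<not> (\<exists>zs. sign_cancel ys zs))"

definition C_e :: "nat \<Rightarrow> nat list \<Rightarrow> nat \<Rightarrow> pmat list umodule set \<Rightarrow> pmat list umodule set option"
  where
  "C_e n lam i c =
     (let L = label_of n lam c;
          minuses = filter (\<lambda>x. fst x = Minus) (reduced_seq (sign_seq i L))
      in if minuses = [] then None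
         else let s = snd (last minuses) in
           Some (outer_class n lam ((Wfactors n lam L)
             [s := umodel (CP n (lam ! s)) (Efun n i (lam ! s) (Wmod n (L ! s)))])))"

definition C_f :: "nat \<Rightarrow> nat list \<Rightarrow> nat \<Rightarrow> pmat list umodule set \<Rightarrow> pmat list umodule set option"
  where
  "C_f n lam i c =
     (let L = label_of n lam c;
          pluses = filter (\<lambda>x. fst x = Plus) (reduced_seq (sign_seq i L))
      in if pluses = [] then None
         else let t = snd (hd pluses) in
           Some (outer_class n lam ((Wfactors n lam L)
             [t := umodel (CP n (lam ! t)) (Ffun n i (lam ! t) (Wmod n (L ! t)))])))"

definition W_wt :: "nat \<Rightarrow> nat list \<Rightarrow> nat \<Rightarrow> int" where
  "W_wt n mu = (\<lambda>p. \<Sum>j\<le>n. int (mu ! j) * epsw (j + 1) p)"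

definition max_iter :: "('b \<Rightarrow> 'b option) \<Rightarrow> 'b \<Rightarrow> nat" where
  "max_iter g b = Max {j. ((\<lambda>x. Option.bind x g) ^^ j) (Some b) \<noteq> None}"

definition C_crystal :: "nat \<Rightarrow> nat list \<Rightarrow> pmat list umodule set crystal" where
  "C_crystal n lam = \<lparr>
     verts = irreducible_classes (CPlist n lam),
     cwt = (\<lambda>c p. \<Sum>mu\<leftarrow>label_of n lam c. W_wt n mu p),
     ceps = (\<lambda>i c. Fin (int (max_iter (C_e n lam i) c))),
     cphi = (\<lambda>i c. Fin (int (max_iter (C_f n lam i) c))),
     ce = C_e n lam,
     cf = C_f n lam\<rparr>"

end

theory Submission
  imports Defs
begin

text \<open>Condition (b) forces the entries \<open>u_i\<close> of a matrix in \<open>P_m\<close> to form an order-preserving partial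
  injection, so a matrix is determined by the colours of its rows and of its columns (colour \<open>0\<close>
  marking a zero row or column). Summing coefficients over all matrices that contain a given one
  therefore identifies \<open>\<complex>P_m\<close> with the block matrices indexed by the words \<open>s\<close> of length \<open>m\<close> over
  \<open>{0,\<dots>,n}\<close>, two words being in the same block iff they have the same letter multiplicities; \<open>x_d\<close>
  becomes a matrix unit and the embeddings \<open>x \<otimes> (I_i - I_0)\<close>, \<open>x \<otimes> I_0\<close> append a letter. Hence an
  irreducible module is given by its tuple of multiplicities, \<open>Ind_i\<close> adds one to the multiplicity of
  \<open>i\<close> and \<open>Res_i\<close> subtracts one; the same holds componentwise for \<open>\<complex>P_\<lambda>\<close>.

  Reading the tuple of the \<open>j\<close>-th factor as the content of the \<open>j\<close>-th row turns a class of
  \<open>[C_\<lambda>]\<close> into a filling with weakly increasing rows, and the signature rule into the rule on the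
  Middle-Eastern word of the filling. Column strictness is preserved by the operators, and the only
  semistandard filling that no raising operator changes has all entries of row \<open>j\<close> equal to \<open>j\<close>,
  counting rows from \<open>0\<close>. So the component in question consists of the semistandard tableaux.\<close>


section \<open>Modules over algebras of block matrices\<close>

text \<open>The modules in the statement are quotients of free spaces and arbitrarily chosen
  representatives of isomorphism classes, so little can be computed inside them. The proof therefore
  attaches to each algebra one concrete family of modules, the column modules \<open>V k\<close>,
  and uses every other module (\<open>Wmod\<close>, restrictions, inductions, outer tensor products)
  only through an isomorphism with some \<open>V k\<close>. The choices made by
  \<open>umodel\<close> then become harmless, because an isomorphism class depends on
  \<open>k\<close> alone. Irreducibility, classification and non-isomorphism are proved once, in
  \<open>matrix_algebra\<close>; both \<open>CP n m\<close> and \<open>CPlist n lam\<close> are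
  instances of it, obtained from the same triangularity argument in \<open>zeta_semigroup\<close>.

  From then on only labels remain, that is, lists of multiplicity tuples. The two crystals are never
  compared directly: each is described by the semistandard labels together with the signature of
  their reading words (\<open>realizes\<close>), and the isomorphism is the passage through this
  common model.\<close>

definition hom_iso :: "('a, 'r) ring_scheme \<Rightarrow> ('a, 'b, 'm) module_scheme \<Rightarrow>
    ('a, 'c, 'k) module_scheme \<Rightarrow> ('b \<Rightarrow> 'c) \<Rightarrow> bool" where
  "hom_iso R M N h \<longleftrightarrow> bij_betw h (carrier M) (carrier N) \<and>
     (\<forall>x\<in>carrier M. \<forall>y\<in>carrier M. h (x \<oplus>\<^bsub>M\<^esub> y) = h x \<oplus>\<^bsub>N\<^esub> h y) \<and>
     (\<forall>a\<in>carrier R. \<forall>x\<in>carrier M. h (a \<odot>\<^bsub>M\<^esub> x) = a \<odot>\<^bsub>N\<^esub> h x)"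

lemma module_isomorphic_iff: "module_isomorphic R M N \<longleftrightarrow> (\<exists>h. hom_iso R M N h)"
  unfolding module_isomorphic_def hom_iso_def by simp

lemma hom_isoD:
  assumes "hom_iso R M N h"
  shows "bij_betw h (carrier M) (carrier N)" "inj_on h (carrier M)" "h ` carrier M = carrier N"
    "x \<in> carrier M \<Longrightarrow> h x \<in> carrier N"
    "x \<in> carrier M \<Longrightarrow> y \<in> carrier M \<Longrightarrow> h (x \<oplus>\<^bsub>M\<^esub> y) = h x \<oplus>\<^bsub>N\<^esub> h y"
    "a \<in> carrier R \<Longrightarrow> x \<in> carrier M \<Longrightarrow> h (a \<odot>\<^bsub>M\<^esub> x) = a \<odot>\<^bsub>N\<^esub> h x"
  using assms unfolding hom_iso_def bij_betw_def by auto

lemma module_isomorphic_trans: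
  assumes "module_isomorphic R M N" "module_isomorphic R N K"
  shows "module_isomorphic R M K"
proof -
  obtain h g where h: "hom_iso R M N h" and g: "hom_iso R N K g"
    using assms unfolding module_isomorphic_iff by blast
  have "hom_iso R M K (g \<circ> h)"
    unfolding hom_iso_def
    using hom_isoD[OF h] hom_isoD[OF g] bij_betw_trans[OF hom_isoD(1)[OF h] hom_isoD(1)[OF g]] by simp
  then show ?thesis unfolding module_isomorphic_iff by blast
qed

text \<open>Neither side is assumed to be a module. To pull an equation back along the inverse of
  \<open>h\<close> one needs that sums and multiples formed in \<open>M\<close> stay in its carrier,
  where \<open>g (h x) = x\<close> holds.\<close>

lemma module_isomorphic_sym:
  assumes iso: "module_isomorphic R M N"
    and add: "\<And>x y. x \<in> carrier M \<Longrightarrow> y \<in> carrier M \<Longrightarrow> x \<oplus>\<^bsub>M\<^esub> y \<in> carrier M"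
    and smult: "\<And>a x. a \<in> carrier R \<Longrightarrow> x \<in> carrier M \<Longrightarrow> a \<odot>\<^bsub>M\<^esub> x \<in> carrier M"
  shows "module_isomorphic R N M"
proof -
  obtain h where h: "hom_iso R M N h" using iso unfolding module_isomorphic_iff by blast
  define g where "g = inv_into (carrier M) h"
  have gh: "g (h x) = x" if "x \<in> carrier M" for x
    using hom_isoD(2)[OF h] that unfolding g_def by simp
  have ex: "\<exists>x\<in>carrier M. y = h x" if "y \<in> carrier N" for y
    using hom_isoD(3)[OF h] that by blast
  have "hom_iso R N M g"
    unfolding hom_iso_def
  proof (intro conjI ballI)
    show "bij_betw g (carrier N) (carrier M)"
      unfolding g_def using hom_isoD(1)[OF h] by (rule bij_betw_inv_into)
  next
    fix x y assume "x \<in> carrier N" "y \<in> carrier N"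
    then obtain x' y' where xy: "x' \<in> carrier M" "y' \<in> carrier M" "x = h x'" "y = h y'" using ex by metis
    then have "x \<oplus>\<^bsub>N\<^esub> y = h (x' \<oplus>\<^bsub>M\<^esub> y')" using hom_isoD(5)[OF h] by simp
    then show "g (x \<oplus>\<^bsub>N\<^esub> y) = g x \<oplus>\<^bsub>M\<^esub> g y" using xy gh add by simp
  next
    fix a x assume a: "a \<in> carrier R" and "x \<in> carrier N"
    then obtain x' where x: "x' \<in> carrier M" "x = h x'" using ex by metis
    then have "a \<odot>\<^bsub>N\<^esub> x = h (a \<odot>\<^bsub>M\<^esub> x')" using hom_isoD(6)[OF h] a by simp
    then show "g (a \<odot>\<^bsub>N\<^esub> x) = a \<odot>\<^bsub>M\<^esub> g x" using x a gh smult by simp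
  qed
  then show ?thesis unfolding module_isomorphic_iff by blast
qed

text \<open>An isomorphism preserves sums and multiples only, so the zero recorded in
  \<open>N\<close> could be any vector; the hypothesis \<open>zero\<close> ties it down. Every axiom
  is then pulled back along \<open>h\<close>.\<close>

lemma left_module_transfer:
  assumes M: "left_module R M" and h: "hom_iso R M N h" and zero: "\<zero>\<^bsub>N\<^esub> = h \<zero>\<^bsub>M\<^esub>"
  shows "left_module R N"
proof -
  interpret M: left_module R M by fact
  note hD = hom_isoD[OF h]
  have ex: "\<exists>x\<in>carrier M. y = h x" if "y \<in> carrier N" for y
    using hD(3) that by blast
  have N: "P" if "y \<in> carrier N" "\<And>x. x \<in> carrier M \<Longrightarrow> y = h x \<Longrightarrow> P" for y P
    using ex that by blast
  have abel: "abelian_group N"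
  proof (rule abelian_groupI)
    fix x y assume xy: "x \<in> carrier N" "y \<in> carrier N"
    show "x \<oplus>\<^bsub>N\<^esub> y \<in> carrier N"
      using xy by (elim N) (simp add: hD(5)[symmetric] hD(4))
    show "x \<oplus>\<^bsub>N\<^esub> y = y \<oplus>\<^bsub>N\<^esub> x"
      using xy by (elim N) (simp add: hD(5)[symmetric] M.a_comm)
    fix z assume "z \<in> carrier N"
    then show "x \<oplus>\<^bsub>N\<^esub> y \<oplus>\<^bsub>N\<^esub> z = x \<oplus>\<^bsub>N\<^esub> (y \<oplus>\<^bsub>N\<^esub> z)"
      using xy by (elim N) (simp add: hD(5)[symmetric] M.a_assoc)
  next
    show "\<zero>\<^bsub>N\<^esub> \<in> carrier N" by (simp add: zero hD(4))
  next
    fix x assume x: "x \<in> carrier N"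
    show "\<zero>\<^bsub>N\<^esub> \<oplus>\<^bsub>N\<^esub> x = x" using x by (elim N) (simp add: zero hD(5)[symmetric])
    show "\<exists>y\<in>carrier N. y \<oplus>\<^bsub>N\<^esub> x = \<zero>\<^bsub>N\<^esub>"
    proof -
      obtain x' where x': "x' \<in> carrier M" "x = h x'" using ex x by blast
      have "h (\<ominus>\<^bsub>M\<^esub> x') \<oplus>\<^bsub>N\<^esub> x = \<zero>\<^bsub>N\<^esub>"
        using x' by (simp add: zero hD(5)[symmetric] M.l_neg)
      then show ?thesis using x' hD(4) by blast
    qed
  qed
  have R: "ring R" by (rule M.R.ring_axioms)
  show ?thesis
  proof (intro left_module.intro left_module_axioms.intro R abel)
    fix a b x y assume a: "a \<in> carrier R" and x: "x \<in> carrier N"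
    show "a \<odot>\<^bsub>N\<^esub> x \<in> carrier N"
      using x by (elim N) (simp add: hD(6)[symmetric] a hD(4) M.smult_closed)
    show "a \<odot>\<^bsub>N\<^esub> (x \<oplus>\<^bsub>N\<^esub> y) = a \<odot>\<^bsub>N\<^esub> x \<oplus>\<^bsub>N\<^esub> a \<odot>\<^bsub>N\<^esub> y" if "y \<in> carrier N"
      using x that by (elim N) (simp add: hD(6)[symmetric] hD(5)[symmetric] a M.smult_closed M.smult_r_distr)
    assume b: "b \<in> carrier R"
    show "(a \<oplus>\<^bsub>R\<^esub> b) \<odot>\<^bsub>N\<^esub> x = a \<odot>\<^bsub>N\<^esub> x \<oplus>\<^bsub>N\<^esub> b \<odot>\<^bsub>N\<^esub> x"
      using x by (elim N) (simp add: hD(6)[symmetric] hD(5)[symmetric] a b M.smult_closed M.smult_l_distr)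
    show "(a \<otimes>\<^bsub>R\<^esub> b) \<odot>\<^bsub>N\<^esub> x = a \<odot>\<^bsub>N\<^esub> (b \<odot>\<^bsub>N\<^esub> x)"
      using x by (elim N) (simp add: hD(6)[symmetric] hD(5)[symmetric] a b M.smult_closed M.smult_assoc1)
  next
    fix x assume x: "x \<in> carrier N"
    show "\<one>\<^bsub>R\<^esub> \<odot>\<^bsub>N\<^esub> x = x"
      using x by (elim N) (simp add: hD(6)[symmetric] M.smult_one)
  qed
qed

section \<open>Algebras of block matrices and their column modules\<close>

lemma cscale_simps [simp]:
  "cscale c f x = c * f x" "cscale 1 f = f" "cscale 0 f = 0" "cscale c 0 = 0"
  by (auto simp: cscale_def fun_eq_iff)

lemma sum_fun_apply: "sum f A x = (\<Sum>a\<in>A. f a x)" for f :: "'a \<Rightarrow> 'b \<Rightarrow> complex"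
  by (induction A rule: infinite_finite_induct) auto

lemma delta_neq0: "delta x \<noteq> 0"
  by (metis delta_def zero_fun_apply zero_neq_one)

lemma delta_apply: "delta x y = (if y = x then 1 else 0)"
  by (simp add: delta_def)

lemma delta_simps [simp]: "delta x x = 1" "y \<noteq> x \<Longrightarrow> delta x y = 0"
  by (simp_all add: delta_def)

text \<open>\<open>Th f\<close> is the matrix of \<open>f\<close>, with rows and columns in \<open>X\<close> and a full block for each value of \<open>cl\<close>.\<close>

locale matrix_algebra =
  fixes R :: "('s \<Rightarrow> complex) ring" and X :: "'x set" and cl :: "'x \<Rightarrow> 'c"
    and Th :: "('s \<Rightarrow> complex) \<Rightarrow> 'x \<Rightarrow> 'x \<Rightarrow> complex"
  assumes fin: "finite X"
    and add_eq: "add R = (+)" and zero_eq: "zero R = 0"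
    and add_in: "f \<in> carrier R \<Longrightarrow> g \<in> carrier R \<Longrightarrow> f + g \<in> carrier R"
    and scale_in: "f \<in> carrier R \<Longrightarrow> cscale c f \<in> carrier R"
    and mult_in: "f \<in> carrier R \<Longrightarrow> g \<in> carrier R \<Longrightarrow> f \<otimes>\<^bsub>R\<^esub> g \<in> carrier R"
    and one_in: "\<one>\<^bsub>R\<^esub> \<in> carrier R"
    and Th_add: "Th (f + g) s t = Th f s t + Th g s t"
    and Th_scale: "Th (cscale c f) s t = c * Th f s t"
    and Th_supp: "Th f s t \<noteq> 0 \<Longrightarrow> s \<in> X \<and> t \<in> X \<and> cl s = cl t"
    and Th_mult: "f \<in> carrier R \<Longrightarrow> g \<in> carrier R \<Longrightarrow>
      Th (f \<otimes>\<^bsub>R\<^esub> g) s t = (\<Sum>u\<in>X. Th f s u * Th g u t)"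
    and Th_one: "s \<in> X \<Longrightarrow> Th \<one>\<^bsub>R\<^esub> s t = (if s = t then 1 else 0)"
    and Th_inj: "f \<in> carrier R \<Longrightarrow> (\<And>s t. Th f s t = 0) \<Longrightarrow> f = 0"
    and Th_surj: "(\<And>s t. F s t \<noteq> 0 \<Longrightarrow> s \<in> X \<and> t \<in> X \<and> cl s = cl t) \<Longrightarrow>
      \<exists>f\<in>carrier R. Th f = F"
begin

lemma minus_in: "f \<in> carrier R \<Longrightarrow> - f \<in> carrier R"
  using scale_in[of f "-1"] by simp

lemma diff_in: "f \<in> carrier R \<Longrightarrow> g \<in> carrier R \<Longrightarrow> f - g \<in> carrier R"
  using add_in[OF _ minus_in, of f g] by simp

lemma Th_minus: "Th (- f) s t = - Th f s t"
  using Th_scale[of "-1" f s t] by simp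

lemma Th_diff: "Th (f - g) s t = Th f s t - Th g s t"
  using Th_add[of f "- g" s t] by (simp add: Th_minus)

lemma Th_cong: assumes "f \<in> carrier R" "g \<in> carrier R" "\<And>s t. Th f s t = Th g s t" shows "f = g"
proof -
  have "f - g = 0"
    using assms by (intro Th_inj) (auto simp: diff_in Th_diff)
  then show ?thesis by simp
qed

lemma Th_zero [simp]: "Th 0 s t = 0"
  using Th_scale[of 0 0 s t] by simp

lemma zero_in: "0 \<in> carrier R"
  using scale_in[OF one_in, of 0] by simp

lemma one: "Th \<one>\<^bsub>R\<^esub> s t = (if s = t \<and> s \<in> X then 1 else 0)"
  using Th_one[of s t] Th_supp[of "\<one>\<^bsub>R\<^esub>" s t] by (cases "s \<in> X") auto

lemma ring_R: "ring R"
proof (rule ringI)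
  show "abelian_group R"
  proof (rule abelian_groupI, unfold add_eq zero_eq)
    fix x assume "x \<in> carrier R"
    then show "\<exists>y\<in>carrier R. y + x = 0"
      by (intro bexI[of _ "- x"]) (auto simp: minus_in)
  qed (auto simp: add_in zero_in algebra_simps)
  show "monoid R"
  proof (rule monoidI)
    fix x y z assume xyz: "x \<in> carrier R" "y \<in> carrier R" "z \<in> carrier R"
    show "x \<otimes>\<^bsub>R\<^esub> y \<otimes>\<^bsub>R\<^esub> z = x \<otimes>\<^bsub>R\<^esub> (y \<otimes>\<^bsub>R\<^esub> z)"
    proof (rule Th_cong)
      fix s t
      show "Th (x \<otimes>\<^bsub>R\<^esub> y \<otimes>\<^bsub>R\<^esub> z) s t = Th (x \<otimes>\<^bsub>R\<^esub> (y \<otimes>\<^bsub>R\<^esub> z)) s t"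
        using xyz by (simp add: Th_mult mult_in sum_distrib_left sum_distrib_right mult.assoc)
          (subst sum.swap, simp)
    qed (use xyz in \<open>auto simp: mult_in\<close>)
  next
    fix x assume x: "x \<in> carrier R"
    show "\<one>\<^bsub>R\<^esub> \<otimes>\<^bsub>R\<^esub> x = x"
    proof (rule Th_cong)
      fix s t
      have "Th (\<one>\<^bsub>R\<^esub> \<otimes>\<^bsub>R\<^esub> x) s t = (\<Sum>u\<in>X. if s = u then Th x u t else 0)"
        using x one_in by (auto simp: Th_mult one intro!: sum.cong)
      also have "\<dots> = Th x s t" using Th_supp[of x s t] fin by (auto simp: sum.delta)
      finally show "Th (\<one>\<^bsub>R\<^esub> \<otimes>\<^bsub>R\<^esub> x) s t = Th x s t" .
    qed (use x in \<open>auto simp: mult_in one_in\<close>)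
    show "x \<otimes>\<^bsub>R\<^esub> \<one>\<^bsub>R\<^esub> = x"
    proof (rule Th_cong)
      fix s t
      have "Th (x \<otimes>\<^bsub>R\<^esub> \<one>\<^bsub>R\<^esub>) s t = (\<Sum>u\<in>X. if u = t then Th x s u else 0)"
        using x one_in by (auto simp: Th_mult one intro!: sum.cong)
      also have "\<dots> = Th x s t" using Th_supp[of x s t] fin by (auto simp: sum.delta)
      finally show "Th (x \<otimes>\<^bsub>R\<^esub> \<one>\<^bsub>R\<^esub>) s t = Th x s t" .
    qed (use x in \<open>auto simp: mult_in one_in\<close>)
  qed (auto simp: mult_in one_in)
next
  fix x y z assume "x \<in> carrier R" "y \<in> carrier R" "z \<in> carrier R"
  then show "(x \<oplus>\<^bsub>R\<^esub> y) \<otimes>\<^bsub>R\<^esub> z = x \<otimes>\<^bsub>R\<^esub> z \<oplus>\<^bsub>R\<^esub> y \<otimes>\<^bsub>R\<^esub> z"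
    "z \<otimes>\<^bsub>R\<^esub> (x \<oplus>\<^bsub>R\<^esub> y) = z \<otimes>\<^bsub>R\<^esub> x \<oplus>\<^bsub>R\<^esub> z \<otimes>\<^bsub>R\<^esub> y"
    by (auto intro!: Th_cong simp: add_eq add_in mult_in Th_mult Th_add algebra_simps sum.distrib)
qed

text \<open>A chosen preimage under \<open>Th\<close>. Truncating \<open>F\<close> to the blocks
  makes it total, so later witnesses can be written as bare formulas for their entries.\<close>

definition el :: "('x \<Rightarrow> 'x \<Rightarrow> complex) \<Rightarrow> 's \<Rightarrow> complex" where
  "el F = (SOME f. f \<in> carrier R \<and> Th f = (\<lambda>s t. if s \<in> X \<and> t \<in> X \<and> cl s = cl t then F s t else 0))"

lemma el: "el F \<in> carrier R" "Th (el F) s t = (if s \<in> X \<and> t \<in> X \<and> cl s = cl t then F s t else 0)"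
proof -
  have "\<exists>f. f \<in> carrier R \<and> Th f = (\<lambda>s t. if s \<in> X \<and> t \<in> X \<and> cl s = cl t then F s t else 0)"
    using Th_surj[of "\<lambda>s t. if s \<in> X \<and> t \<in> X \<and> cl s = cl t then F s t else 0"]
    by (metis (no_types, lifting))
  note el = someI_ex[OF this, folded el_def]
  show "el F \<in> carrier R" using el by blast
  show "Th (el F) s t = (if s \<in> X \<and> t \<in> X \<and> cl s = cl t then F s t else 0)"
    using el by metis
qed

definition ev :: "('s \<Rightarrow> complex) \<Rightarrow> ('x \<Rightarrow> complex) \<Rightarrow> 'x \<Rightarrow> complex" where
  "ev f p = (\<lambda>s. \<Sum>t\<in>X. Th f s t * p t)"

definition Vc :: "'c \<Rightarrow> ('x \<Rightarrow> complex) set" where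
  "Vc k = {p. \<forall>s. p s \<noteq> 0 \<longrightarrow> s \<in> X \<and> cl s = k}"

text \<open>Column vectors of the block \<open>k\<close>, with the algebra acting by matrix
  multiplication. For \<open>k\<close> outside the image of \<open>cl\<close> the module is zero,
  hence the hypotheses on \<open>k\<close> in the lemmas about irreducibility.\<close>

definition V :: "'c \<Rightarrow> ('s \<Rightarrow> complex, 'x \<Rightarrow> complex) module" where
  "V k = \<lparr>carrier = Vc k, mult = undefined, one = undefined, zero = 0, add = (+), smult = ev\<rparr>"

lemma V_simps [simp]: "carrier (V k) = Vc k" "zero (V k) = 0" "add (V k) = (+)" "smult (V k) = ev"
  by (simp_all add: V_def)

lemma ev_in: assumes "p \<in> Vc k" shows "ev f p \<in> Vc k"
  unfolding Vc_def
proof (intro CollectI allI impI)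
  fix s assume "ev f p s \<noteq> 0"
  then obtain t where "Th f s t * p t \<noteq> 0" unfolding ev_def by (meson sum.neutral)
  then show "s \<in> X \<and> cl s = k" using Th_supp[of f s t] assms by (auto simp: Vc_def)
qed

lemma Vc_add: "p \<in> Vc k \<Longrightarrow> q \<in> Vc k \<Longrightarrow> p + q \<in> Vc k"
  unfolding Vc_def by (auto, metis add.right_neutral add_0, metis add.right_neutral add_0)

lemma Vc_scale: "p \<in> Vc k \<Longrightarrow> cscale c p \<in> Vc k"
  unfolding Vc_def by auto

lemma Vc_minus: "p \<in> Vc k \<Longrightarrow> - p \<in> Vc k"
  unfolding Vc_def by auto

lemma Vc_delta: "s \<in> X \<Longrightarrow> delta s \<in> Vc (cl s)"
  unfolding Vc_def by (auto simp: delta_apply split: if_splits)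

lemma ev_add: "ev (f + g) p = ev f p + ev g p"
  by (auto simp: ev_def fun_eq_iff Th_add algebra_simps sum.distrib)

lemma ev_add2: "ev f (p + q) = ev f p + ev f q"
  by (auto simp: ev_def fun_eq_iff algebra_simps sum.distrib)

lemma ev_scale2: "ev f (cscale c p) = cscale c (ev f p)"
  by (auto simp: ev_def fun_eq_iff algebra_simps sum_distrib_left)

lemma ev_scale: "ev (cscale c f) p = cscale c (ev f p)"
  by (auto simp: ev_def fun_eq_iff Th_scale algebra_simps sum_distrib_left)

lemma ev_mult: "f \<in> carrier R \<Longrightarrow> g \<in> carrier R \<Longrightarrow> ev (f \<otimes>\<^bsub>R\<^esub> g) p = ev f (ev g p)"
  by (auto simp: ev_def fun_eq_iff Th_mult sum_distrib_left sum_distrib_right mult.assoc)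
    (subst sum.swap, simp)

lemma ev_one: "p \<in> Vc k \<Longrightarrow> ev \<one>\<^bsub>R\<^esub> p = p"
proof
  fix s assume p: "p \<in> Vc k"
  have "ev \<one>\<^bsub>R\<^esub> p s = (\<Sum>t\<in>X. if s = t then p t else 0)"
    unfolding ev_def one by (intro sum.cong) auto
  also have "\<dots> = p s" using fin p by (auto simp: Vc_def)
  finally show "ev \<one>\<^bsub>R\<^esub> p s = p s" .
qed

lemma ev_delta: "t \<in> X \<Longrightarrow> ev f (delta t) = (\<lambda>s. Th f s t)"
proof
  fix s assume "t \<in> X"
  have "ev f (delta t) s = (\<Sum>u\<in>X. if t = u then Th f s u else 0)"
    unfolding ev_def by (intro sum.cong) (auto simp: delta_apply)
  also have "\<dots> = Th f s t" using fin \<open>t \<in> X\<close> by simp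
  finally show "ev f (delta t) s = Th f s t" .
qed

lemma left_module_V: "left_module R (V k)"
proof (intro left_module.intro left_module_axioms.intro ring_R)
  show "abelian_group (V k)"
  proof (rule abelian_groupI, unfold V_simps)
    fix x assume "x \<in> Vc k"
    then show "\<exists>y\<in>Vc k. y + x = 0"
      by (intro bexI[of _ "- x"]) (auto simp: Vc_minus)
  qed (auto simp: Vc_add algebra_simps, simp add: Vc_def)
qed (auto simp: ev_in ev_add ev_add2 ev_mult ev_one add_eq)

text \<open>Pick a nonzero coordinate \<open>p t\<close>. The matrix whose only nonzero column is
  \<open>t\<close>, with entries \<open>q s / p t\<close>, sends \<open>p\<close> to
  \<open>q\<close>. So every nonzero vector generates the module.\<close>

lemma V_transitive:
  assumes p: "p \<in> Vc k" "p \<noteq> 0" and q: "q \<in> Vc k"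
  shows "\<exists>f\<in>carrier R. ev f p = q"
proof -
  obtain t where t: "p t \<noteq> 0" using p by (auto simp: fun_eq_iff)
  then have tX: "t \<in> X" "cl t = k" using p by (auto simp: Vc_def)
  define f where "f = el (\<lambda>s u. if u = t then q s / p t else 0)"
  have "ev f p = q"
  proof
    fix s
    have "ev f p s = (\<Sum>u\<in>X. if t = u then Th f s u * p u else 0)"
      unfolding ev_def f_def el by (intro sum.cong) auto
    also have "\<dots> = Th f s t * p t" using fin tX by simp
    also have "\<dots> = q s" unfolding f_def el using tX t q by (auto simp: Vc_def)
    finally show "ev f p s = q s" .
  qed
  moreover have "f \<in> carrier R" unfolding f_def by (rule el)
  ultimately show ?thesis by blast
qed

lemma hom_iso_zero:
  assumes "left_module R N" "hom_iso R (V k) N h" shows "h 0 = \<zero>\<^bsub>N\<^esub>"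
proof -
  interpret N: left_module R N by fact
  note hD = hom_isoD[OF assms(2)]
  have 0: "0 \<in> Vc k" by (simp add: Vc_def)
  have "h 0 \<oplus>\<^bsub>N\<^esub> h 0 = h 0" using hD(5)[of 0 0] 0 by simp
  then show ?thesis using hD(4)[of 0] 0 by (metis N.add.l_cancel_one V_simps(1))
qed

section \<open>Classification of the irreducible modules\<close>

lemma irreducible_of_iso:
  assumes N: "left_module R N" and iso: "module_isomorphic R (V k) N" and k: "k \<in> cl ` X"
  shows "irreducible_module R N"
proof -
  obtain h where h: "hom_iso R (V k) N h" using iso unfolding module_isomorphic_iff by blast
  note hD = hom_isoD[OF h, unfolded V_simps]
  have h0: "h 0 = \<zero>\<^bsub>N\<^esub>" using hom_iso_zero[OF N h] .
  have 0: "0 \<in> Vc k" by (simp add: Vc_def)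
  show ?thesis
    unfolding irreducible_module_def
  proof (intro conjI allI impI)
    obtain s where s: "s \<in> X" "cl s = k" using k by auto
    then have "h (delta s) \<noteq> h 0" using inj_onD[OF hD(2), of "delta s" 0] 0 Vc_delta[OF s(1)] delta_neq0
      by metis
    then show "carrier N \<noteq> {\<zero>\<^bsub>N\<^esub>}" using hD(4)[of "delta s"] Vc_delta[OF s(1)] s h0 by auto
  next
    fix H assume H: "submodule H R N"
    interpret H: submodule H R N by fact
    have sub: "H \<subseteq> carrier N" using H.subset by simp
    have z: "\<zero>\<^bsub>N\<^esub> \<in> H" using H.one_closed by simp
    show "H = {\<zero>\<^bsub>N\<^esub>} \<or> H = carrier N"
    proof (rule disjCI)
      assume "H \<noteq> carrier N"
      show "H = {\<zero>\<^bsub>N\<^esub>}"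
      proof (rule ccontr)
        assume "H \<noteq> {\<zero>\<^bsub>N\<^esub>}"
        then obtain x where x: "x \<in> H" "x \<noteq> \<zero>\<^bsub>N\<^esub>" using z by auto
        then have "x \<in> h ` Vc k" using sub hD(3) by auto
        then obtain p where p: "p \<in> Vc k" "x = h p" by auto
        have p0: "p \<noteq> 0" using p x(2) h0 by auto
        have "y \<in> H" if "y \<in> carrier N" for y
        proof -
          have "y \<in> h ` Vc k" using that hD(3) by auto
          then obtain q where q: "q \<in> Vc k" "y = h q" by auto
          obtain f where "f \<in> carrier R" "ev f p = q" using V_transitive[OF p(1) p0 q(1)] by auto
          then have "y = f \<odot>\<^bsub>N\<^esub> x" using hD(6) p q by auto
          then show ?thesis using H.smult_closed x \<open>f \<in> carrier R\<close> by simp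
        qed
        then show False using \<open>H \<noteq> carrier N\<close> sub by auto
      qed
    qed
  qed
qed

text \<open>The unit is the sum of the diagonal idempotents \<open>E {s}\<close>, so one of them
  fixes some nonzero vector \<open>v\<close> of \<open>M\<close>. Matrices supported in the column
  \<open>s0\<close> form a copy of \<open>V (cl s0)\<close>, and applying them to \<open>v\<close>
  is a homomorphism into \<open>M\<close>: injective because a nonzero column can be moved back to
  \<open>delta s0\<close>, surjective because its image is a nonzero submodule.\<close>

lemma classification:
  assumes M: "left_module R M" and irr: "irreducible_module R M"
  shows "\<exists>k\<in>cl ` X. module_isomorphic R (V k) M"
proof -
  interpret M: left_module R M by fact
  note closed = M.smult_closed
  define E where "E A = el (\<lambda>s t. if s = t \<and> s \<in> A then 1 else 0)" for A
  have E_in: "E A \<in> carrier R" for A unfolding E_def by (rule el)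
  have z0: "0 \<odot>\<^bsub>M\<^esub> v = \<zero>\<^bsub>M\<^esub>" if "v \<in> carrier M" for v
    using M.smult_l_distr[OF zero_in zero_in that] closed[OF zero_in that]
    by (simp add: add_eq M.M.add.l_cancel_one)
  \<comment> \<open>If every \<open>E {s}\<close> annihilated \<open>M\<close>, so would their sum
    over \<open>X\<close>, which is the unit.\<close>
  have "\<exists>s\<in>X. \<exists>v\<in>carrier M. E {s} \<odot>\<^bsub>M\<^esub> v \<noteq> \<zero>\<^bsub>M\<^esub>"
  proof (rule ccontr)
    assume neg: "\<not> ?thesis"
    have "E A \<odot>\<^bsub>M\<^esub> v = \<zero>\<^bsub>M\<^esub>" if "A \<subseteq> X" "v \<in> carrier M" for A v
    proof -
      have "finite A" using that fin finite_subset by blast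
      then show ?thesis using that
      proof (induction A rule: finite_induct)
        case empty
        have "E {} = 0" unfolding E_def by (intro Th_inj el) (simp add: el)
        then show ?case using z0 empty by metis
      next
        case (insert s A)
        have "E (insert s A) = E {s} + E A"
          using insert.hyps by (intro Th_cong add_in E_in) (auto simp: E_def el Th_add)
        then have "E (insert s A) \<odot>\<^bsub>M\<^esub> v = (E {s} \<odot>\<^bsub>M\<^esub> v) \<oplus>\<^bsub>M\<^esub> (E A \<odot>\<^bsub>M\<^esub> v)"
          using M.smult_l_distr[OF E_in E_in] insert.prems by (simp add: add_eq)
        then show ?case using insert neg by auto
      qed
    qed
    moreover have "E X = \<one>\<^bsub>R\<^esub>"
    proof (intro Th_cong E_in one_in)
      fix s t show "Th (E X) s t = Th \<one>\<^bsub>R\<^esub> s t" by (auto simp: E_def el one)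
    qed
    ultimately have "v = \<zero>\<^bsub>M\<^esub>" if "v \<in> carrier M" for v
      using M.smult_one that by (metis subset_refl)
    then have "carrier M = {\<zero>\<^bsub>M\<^esub>}" by auto
    then show False using irr unfolding irreducible_module_def by simp
  qed
  then obtain s0 v0 where s0: "s0 \<in> X" and v0: "v0 \<in> carrier M" and ne0: "E {s0} \<odot>\<^bsub>M\<^esub> v0 \<noteq> \<zero>\<^bsub>M\<^esub>" by blast
  define v where "v = E {s0} \<odot>\<^bsub>M\<^esub> v0"
  have v: "v \<in> carrier M" "v \<noteq> \<zero>\<^bsub>M\<^esub>" using ne0 v0 E_in closed by (auto simp: v_def)
  have EE: "E {s0} \<otimes>\<^bsub>R\<^esub> E {s0} = E {s0}"
  proof (intro Th_cong mult_in E_in)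
    fix s t
    have "Th (E {s0} \<otimes>\<^bsub>R\<^esub> E {s0}) s t = (\<Sum>u\<in>X. if s0 = u then (if s = s0 \<and> t = s0 then 1 else 0) else 0)"
      unfolding Th_mult[OF E_in E_in] using s0 by (intro sum.cong) (auto simp: E_def el)
    then show "Th (E {s0} \<otimes>\<^bsub>R\<^esub> E {s0}) s t = Th (E {s0}) s t" using s0 fin by (auto simp: E_def el)
  qed
  have Ev: "E {s0} \<odot>\<^bsub>M\<^esub> v = v"
    unfolding v_def using M.smult_assoc1[OF E_in E_in v0] EE by metis
  let ?k = "cl s0"
  \<comment> \<open>the elements with a single nonzero column act on \<open>v\<close> like the vectors of that column\<close>
  define C where "C p = el (\<lambda>s t. if t = s0 then p s else 0)" for p
  have C_in: "C p \<in> carrier R" for p unfolding C_def by (rule el)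
  have ThC: "Th (C p) s t = (if t = s0 then p s else 0)" if "p \<in> Vc ?k" for p s t
    using that s0 by (auto simp: C_def el Vc_def)
  define h where "h p = C p \<odot>\<^bsub>M\<^esub> v" for p
  have h_in: "h p \<in> carrier M" for p unfolding h_def using closed[OF C_in v(1)] .
  have h_add: "h (p + q) = h p \<oplus>\<^bsub>M\<^esub> h q" if "p \<in> Vc ?k" "q \<in> Vc ?k" for p q
  proof -
    have "C (p + q) = C p + C q"
      using that by (intro Th_cong add_in C_in) (auto simp: ThC Th_add Vc_add)
    then show ?thesis unfolding h_def using M.smult_l_distr[OF C_in C_in v(1)] by (simp add: add_eq)
  qed
  have h_ev: "h (ev f p) = f \<odot>\<^bsub>M\<^esub> h p" if "p \<in> Vc ?k" "f \<in> carrier R" for f p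
  proof -
    have "C (ev f p) = f \<otimes>\<^bsub>R\<^esub> C p"
    proof (intro Th_cong mult_in C_in that)
      fix s t show "Th (C (ev f p)) s t = Th (f \<otimes>\<^bsub>R\<^esub> C p) s t"
        unfolding Th_mult[OF that(2) C_in] ThC[OF that(1)] ThC[OF ev_in[OF that(1)]]
        by (auto simp: ev_def)
    qed
    then show ?thesis unfolding h_def using M.smult_assoc1[OF that(2) C_in v(1)] by simp
  qed
  \<comment> \<open>Some \<open>f\<close> takes a nonzero \<open>p\<close> to
    \<open>delta s0\<close>, and \<open>C (delta s0)\<close> is \<open>E {s0}\<close>, which fixes
    \<open>v\<close>. So \<open>h p = 0\<close> would force \<open>v = 0\<close>.\<close>
  have h_ker: "p = 0" if "p \<in> Vc ?k" "h p = \<zero>\<^bsub>M\<^esub>" for p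
  proof (rule ccontr)
    assume "p \<noteq> 0"
    from V_transitive[OF that(1) this Vc_delta[OF s0]]
    obtain f where f: "f \<in> carrier R" "ev f p = delta s0" by auto
    have "C (delta s0) = E {s0}"
      by (intro Th_cong C_in E_in) (auto simp: ThC Vc_delta s0 E_def el delta_apply)
    then have "h (delta s0) = v" unfolding h_def using Ev by simp
    then have "v = f \<odot>\<^bsub>M\<^esub> h p" using h_ev[OF that(1) f(1)] f by simp
    also have "\<dots> = f \<odot>\<^bsub>M\<^esub> (0 \<odot>\<^bsub>M\<^esub> v)" using that z0 v by simp
    also have "\<dots> = (f \<otimes>\<^bsub>R\<^esub> 0) \<odot>\<^bsub>M\<^esub> v" using M.smult_assoc1 f zero_in v by simp
    also have "f \<otimes>\<^bsub>R\<^esub> 0 = 0"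
      by (intro Th_inj mult_in f zero_in) (simp add: Th_mult f zero_in)
    finally show False using z0 v by metis
  qed
  note neg_Vc = Vc_minus[of _ ?k]
  have zV: "0 \<in> Vc ?k" by (simp add: Vc_def)
  have "h 0 = h 0 \<oplus>\<^bsub>M\<^esub> h 0" using h_add[OF zV zV] by (metis add_0)
  then have h0: "h 0 = \<zero>\<^bsub>M\<^esub>" by (metis h_in M.M.add.l_cancel_one)
  have h_neg: "h (- p) = \<ominus>\<^bsub>M\<^esub> h p" if "p \<in> Vc ?k" for p
  proof -
    have "h (- p) \<oplus>\<^bsub>M\<^esub> h p = \<zero>\<^bsub>M\<^esub>"
      using h_add[OF neg_Vc[OF that] that] h0 by (metis left_minus)
    then show ?thesis using M.M.minus_equality h_in by metis
  qed
  have inj: "inj_on h (Vc ?k)"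
  proof (rule inj_onI)
    fix p q assume p: "p \<in> Vc ?k" and q: "q \<in> Vc ?k" and "h p = h q"
    then have "h (p + - q) = \<zero>\<^bsub>M\<^esub>"
      using h_add[OF p neg_Vc[OF q]] h_neg[OF q] M.M.r_neg h_in by simp
    then have "p + - q = 0" using h_ker Vc_add[OF p neg_Vc[OF q]] by blast
    then show "p = q" by (metis add.right_inverse add_right_cancel)
  qed
  have "submodule (h ` Vc ?k) R M"
  proof (intro submodule.intro subgroup.intro submodule_axioms.intro)
    show "h ` Vc ?k \<subseteq> carrier (add_monoid M)" using h_in by auto
    show "\<one>\<^bsub>add_monoid M\<^esub> \<in> h ` Vc ?k" using h0 zV by (metis image_eqI monoid.select_convs(2))
    fix x assume x: "x \<in> h ` Vc ?k"
    show "inv\<^bsub>add_monoid M\<^esub> x \<in> h ` Vc ?k"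
      using x h_neg neg_Vc unfolding a_inv_def by force
    show "a \<odot>\<^bsub>M\<^esub> x \<in> h ` Vc ?k" if "a \<in> carrier R" for a
      using x ev_in by (auto simp: h_ev[OF _ that, symmetric])
    fix y assume "y \<in> h ` Vc ?k"
    then show "x \<otimes>\<^bsub>add_monoid M\<^esub> y \<in> h ` Vc ?k"
      using x Vc_add by (auto simp: h_add[symmetric])
  qed
  then have "h ` Vc ?k = {\<zero>\<^bsub>M\<^esub>} \<or> h ` Vc ?k = carrier M"
    using irr unfolding irreducible_module_def by blast
  moreover have "h ` Vc ?k \<noteq> {\<zero>\<^bsub>M\<^esub>}"
  proof
    assume "h ` Vc ?k = {\<zero>\<^bsub>M\<^esub>}"
    then have "h (delta s0) = \<zero>\<^bsub>M\<^esub>" using Vc_delta[OF s0] by blast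
    then have "delta s0 = (0 :: 'x \<Rightarrow> complex)" using h_ker Vc_delta[OF s0] by blast
    then show False by (rule notE[OF delta_neq0])
  qed
  ultimately have "hom_iso R (V ?k) M h"
    unfolding hom_iso_def bij_betw_def using inj h_add h_ev by simp
  then show ?thesis using s0 unfolding module_isomorphic_iff by blast
qed

text \<open>The diagonal matrix that is 1 on the block \<open>k\<close> and 0 elsewhere acts as the
  identity on \<open>V k\<close> and as zero on \<open>V k'\<close>.\<close>

lemma V_noniso:
  assumes "module_isomorphic R (V k) (V k')" "k \<in> cl ` X" "k' \<in> cl ` X"
  shows "k = k'"
proof (rule ccontr)
  assume ne: "k \<noteq> k'"
  obtain h where h: "hom_iso R (V k) (V k') h" using assms unfolding module_isomorphic_iff by blast
  note hD = hom_isoD[OF h, unfolded V_simps]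
  obtain s where s: "s \<in> X" "cl s = k" using assms by auto
  define f where "f = el (\<lambda>u t. if u = t \<and> cl u = k then 1 else 0)"
  have f: "f \<in> carrier R" unfolding f_def by (rule el)
  have d: "delta s \<in> Vc k" using Vc_delta s by blast
  have 1: "ev f (delta s) = delta s"
    using s by (auto simp: ev_delta f_def el fun_eq_iff delta_apply)
  have "ev f (h (delta s)) = 0"
  proof
    fix u show "ev f (h (delta s)) u = (0 :: 'x \<Rightarrow> complex) u"
      using hD(4)[OF d] ne by (auto simp: ev_def f_def el Vc_def intro!: sum.neutral)
  qed
  then have "h (delta s) = 0" using hD(6)[OF f d] 1 by simp
  moreover have "h 0 = 0" using hom_iso_zero[OF left_module_V h] by simp
  ultimately have "delta s = (0 :: 'x \<Rightarrow> complex)"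
    using inj_onD[OF hD(2), of "delta s" 0] d by (simp add: Vc_def)
  then show False by (rule notE[OF delta_neq0])
qed

section \<open>Isomorphism classes and their chosen representatives\<close>

lemma iso_sym:
  "module_isomorphic R (V k) M \<Longrightarrow> module_isomorphic R M (V k)"
  by (rule module_isomorphic_sym) (auto simp: Vc_add ev_in)

lemma iso_class_eq:
  assumes "module_isomorphic R (V k) M"
  shows "iso_class R M = iso_class R (V k)"
  unfolding iso_class_def
  using module_isomorphic_trans[OF assms] module_isomorphic_trans[OF iso_sym[OF assms]] by auto

lemma finite_dim_of_iso:
  assumes N: "left_module R N" and iso: "module_isomorphic R (V k) N"
  shows "finite_dim_module R N"
proof -
  interpret N: left_module R N by fact
  obtain h where h: "hom_iso R (V k) N h" using iso unfolding module_isomorphic_iff by blast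
  note hD = hom_isoD[OF h, unfolded V_simps]
  have h0: "h 0 = \<zero>\<^bsub>N\<^esub>" using hom_iso_zero[OF N h] .
  define D where "D = {s \<in> X. cl s = k}"
  have D_in: "delta s \<in> Vc k" if "s \<in> D" for s using Vc_delta that by (auto simp: D_def)
  have hd: "h (delta s) \<in> carrier N" if "s \<in> D" for s using hD(4) D_in that by blast
  \<comment> \<open>\<open>finite_dim_module\<close> sums over a set of vectors, not over a family.
    Distinct indices must therefore give distinct vectors, so that the coefficient can be read off
    from the vector.\<close>
  have inj: "inj_on (\<lambda>s. h (delta s)) D"
  proof (rule inj_onI)
    fix s t assume st: "s \<in> D" "t \<in> D" "h (delta s) = h (delta t)"
    then have "delta s = (delta t :: 'x \<Rightarrow> complex)" using inj_onD[OF hD(2)] D_in by blast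
    then show "s = t" by (metis delta_apply zero_neq_one)
  qed
  define B where "B = (\<lambda>s. h (delta s)) ` D"
  have cs: "csmult R N c v \<in> carrier N" if "v \<in> carrier N" for c v
    unfolding csmult_def using N.smult_closed scale_in one_in that by blast
  have "\<exists>c. v = finsum N (\<lambda>b. csmult R N (c b) b) B" if v: "v \<in> carrier N" for v
  proof -
    obtain p where p: "p \<in> Vc k" "v = h p" using hD(3) v by blast
    define c where "c b = p (inv_into D (\<lambda>s. h (delta s)) b)" for b
    have c: "c (h (delta s)) = p s" if "s \<in> D" for s
      unfolding c_def using inv_into_f_f[OF inj that] by simp
    have part: "h (\<lambda>s. if s \<in> A then p s else 0) = finsum N (\<lambda>b. csmult R N (c b) b) ((\<lambda>s. h (delta s)) ` A)"
      if "A \<subseteq> D" for A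
    proof -
      have "finite A" using that fin finite_subset unfolding D_def by fastforce
      then show ?thesis using that
      proof (induction A rule: finite_induct)
        case empty
        have "(\<lambda>s. if s \<in> {} then p s else 0) = 0" by auto
        then show ?case using h0 by simp
      next
        case (insert s A)
        let ?r = "\<lambda>s. if s \<in> A then p s else 0"
        have s: "s \<in> D" using insert by auto
        have r: "?r \<in> Vc k" using p by (auto simp: Vc_def)
        have eq: "(\<lambda>t. if t \<in> insert s A then p t else 0) = cscale (p s) (delta s) + ?r"
          using insert by (auto simp: fun_eq_iff delta_apply)
        have "h (cscale (p s) (delta s)) = csmult R N (p s) (h (delta s))"
          unfolding csmult_def using hD(6)[OF scale_in[OF one_in] D_in[OF s]]
          by (simp add: ev_scale ev_one[OF D_in[OF s]])
        then have 1: "h (\<lambda>t. if t \<in> insert s A then p t else 0) =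
            csmult R N (c (h (delta s))) (h (delta s)) \<oplus>\<^bsub>N\<^esub> finsum N (\<lambda>b. csmult R N (c b) b) ((\<lambda>s. h (delta s)) ` A)"
          unfolding eq hD(5)[OF Vc_scale[OF D_in[OF s]] r] using insert c s by simp
        have "h (delta s) \<notin> (\<lambda>s. h (delta s)) ` A"
          using insert inj_onD[OF inj] by blast
        then show ?case unfolding 1 image_insert
          using insert hd cs by (subst N.finsum_insert) (auto simp: image_subset_iff)
      qed
    qed
    have "(\<lambda>s. if s \<in> D then p s else 0) = p" using p by (force simp: Vc_def D_def fun_eq_iff)
    then show ?thesis using part[of D] p B_def by auto
  qed
  moreover have "finite B" "B \<subseteq> carrier N" using fin hd by (auto simp: B_def D_def)
  ultimately show ?thesis unfolding finite_dim_module_def by blast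
qed

text \<open>Vectors of \<open>V k\<close> are functions supported on the finite set
  \<open>X\<close>; numbering \<open>X\<close> turns them into functions on \<open>nat\<close>. This
  makes the classes \<open>iso_class R (V k)\<close> nonempty.\<close>

lemma ex_umodule: "\<exists>N :: 's umodule. left_module R N \<and> module_isomorphic R (V k) N"
proof -
  obtain j :: "'x \<Rightarrow> nat" where j: "inj_on j X" using finite_imp_inj_to_nat_seg[OF fin] by blast
  define g :: "('x \<Rightarrow> complex) \<Rightarrow> nat \<Rightarrow> complex"
    where "g p = (\<lambda>i. if i \<in> j ` X then p (inv_into X j i) else 0)" for p
  have gj: "g p (j s) = p s" if "s \<in> X" for p s using that j by (simp add: g_def)
  have inj: "inj_on g (Vc k)"
  proof (rule inj_onI)
    fix p q assume pq: "p \<in> Vc k" "q \<in> Vc k" "g p = g q"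
    show "p = q"
    proof
      fix s show "p s = q s"
        using gj[of s p] gj[of s q] pq by (cases "s \<in> X") (simp, force simp: Vc_def)
    qed
  qed
  define g' where "g' = inv_into (Vc k) g"
  have g': "g' (g p) = p" if "p \<in> Vc k" for p unfolding g'_def using inj that by simp
  define N :: "'s umodule" where "N = \<lparr>carrier = g ` Vc k, mult = undefined, one = undefined, zero = g 0,
    add = (\<lambda>x y. g (g' x + g' y)), smult = (\<lambda>f x. g (ev f (g' x)))\<rparr>"
  have "hom_iso R (V k) N g"
    unfolding hom_iso_def bij_betw_def using inj g' by (simp add: N_def)
  moreover have "left_module R N"
    using left_module_transfer[OF left_module_V calculation, unfolded V_simps] by (simp add: N_def)
  ultimately show ?thesis unfolding module_isomorphic_iff by blast
qed

text \<open>The choice in \<open>umodel\<close> depends on the module only through its class.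
  Isomorphic modules therefore get the same representative, not merely isomorphic ones.\<close>

lemma umodel:
  assumes "module_isomorphic R (V k) M"
  shows "left_module R (umodel R M)" "module_isomorphic R (V k) (umodel R M)"
    "umodel R M = umodel R (V k)"
proof -
  have "\<exists>N. N \<in> iso_class R (V k)"
    using ex_umodule[of k] finite_dim_of_iso unfolding iso_class_def by blast
  then have "umodel R (V k) \<in> iso_class R (V k)" unfolding umodel_def by (rule someI_ex)
  moreover show "umodel R M = umodel R (V k)" unfolding umodel_def iso_class_eq[OF assms] ..
  ultimately show "left_module R (umodel R M)" "module_isomorphic R (V k) (umodel R M)"
    unfolding iso_class_def by auto
qed

lemma irreducible_classes_eq: "irreducible_classes R = (\<lambda>k. iso_class R (V k)) ` cl ` X"
proof -
  have "iso_class R (V k) \<in> irreducible_classes R" if "k \<in> cl ` X" for k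
  proof -
    obtain N :: "'s umodule" where "left_module R N" "module_isomorphic R (V k) N"
      using ex_umodule by blast
    then show ?thesis unfolding irreducible_classes_def
      using irreducible_of_iso[OF _ _ that] finite_dim_of_iso iso_class_eq by blast
  qed
  moreover have "c \<in> (\<lambda>k. iso_class R (V k)) ` cl ` X" if c: "c \<in> irreducible_classes R" for c
  proof -
    obtain M :: "'s umodule" where "left_module R M" "irreducible_module R M" "c = iso_class R M"
      using c unfolding irreducible_classes_def by blast
    then show ?thesis using classification[of M] iso_class_eq by blast
  qed
  ultimately show ?thesis by blast
qed

lemma iso_class_inj:
  assumes "iso_class R (V k) = iso_class R (V k')" "k \<in> cl ` X" "k' \<in> cl ` X"
  shows "k = k'"
proof -
  obtain N :: "'s umodule" where N: "left_module R N" "module_isomorphic R (V k) N"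
    using ex_umodule by blast
  then have "N \<in> iso_class R (V k)" using finite_dim_of_iso by (auto simp: iso_class_def)
  then have "module_isomorphic R (V k') N" using assms by (auto simp: iso_class_def)
  then show ?thesis using V_noniso[OF module_isomorphic_trans[OF N(2) iso_sym]] assms by blast
qed

end

subsection \<open>Quotients of free spaces\<close>

lemmas fun_simps = cscale_simps(1) plus_fun_apply zero_fun_apply minus_apply uminus_apply

text \<open>As default rules these would also turn unapplied functions into abstractions.\<close>

declare fun_simps [simp del]

lemma cfun_subspaceI:
  assumes "0 \<in> U" "\<And>f g. f \<in> U \<Longrightarrow> g \<in> U \<Longrightarrow> f + g \<in> U" "\<And>c f. f \<in> U \<Longrightarrow> cscale c f \<in> U"
  shows "cfun.subspace U"
  using assms by (auto simp: cfun.subspace_def)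

lemma supp_add_finite: "finite {x. f x \<noteq> 0} \<Longrightarrow> finite {x. g x \<noteq> 0} \<Longrightarrow> finite {x. (f + g) x \<noteq> (0 :: complex)}"
  by (rule finite_subset[of _ "{x. f x \<noteq> 0} \<union> {x. g x \<noteq> 0}"]) (auto simp: fun_simps)

lemma span_delta_iff:
  fixes f :: "'a \<Rightarrow> complex"
  shows "f \<in> cfun.span (delta ` S) \<longleftrightarrow> finite {x. f x \<noteq> 0} \<and> {x. f x \<noteq> 0} \<subseteq> S"
proof
  let ?U = "{f :: 'a \<Rightarrow> complex. finite {x. f x \<noteq> 0} \<and> {x. f x \<noteq> 0} \<subseteq> S}"
  have "cfun.span (delta ` S) \<subseteq> ?U"
  proof (rule cfun.span_minimal)
    show "delta ` S \<subseteq> ?U"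
      by (auto simp: delta_apply split: if_splits)
    show "cfun.subspace ?U"
    proof (rule cfun_subspaceI)
      fix f g assume "f \<in> ?U" "g \<in> ?U"
      moreover have "{x. (f + g) x \<noteq> 0} \<subseteq> {x. f x \<noteq> 0} \<union> {x. g x \<noteq> 0}"
        by (auto simp: plus_fun_apply)
      ultimately show "f + g \<in> ?U" using supp_add_finite[of f g] by blast
    qed (auto simp: fun_simps)
  qed
  then show "f \<in> cfun.span (delta ` S) \<Longrightarrow> finite {x. f x \<noteq> 0} \<and> {x. f x \<noteq> 0} \<subseteq> S" by blast
next
  assume f: "finite {x. f x \<noteq> 0} \<and> {x. f x \<noteq> 0} \<subseteq> S"
  have "f = (\<Sum>x | f x \<noteq> 0. cscale (f x) (delta x))"
  proof
    fix y
    have "(\<Sum>x | f x \<noteq> 0. cscale (f x) (delta x)) y = (\<Sum>x | f x \<noteq> 0. if y = x then f x else 0)"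
      unfolding sum_fun_apply by (intro sum.cong) (auto simp: delta_apply fun_simps)
    also have "\<dots> = f y" using f by simp
    finally show "f y = (\<Sum>x | f x \<noteq> 0. cscale (f x) (delta x)) y" by simp
  qed
  moreover have "(\<Sum>x | f x \<noteq> 0. cscale (f x) (delta x)) \<in> cfun.span (delta ` S)"
    using f by (intro cfun.span_sum cfun.span_scale cfun.span_base) auto
  ultimately show "f \<in> cfun.span (delta ` S)" by metis
qed

lemma lin_ext_eq: assumes "finite A" "\<And>x. f x \<noteq> 0 \<Longrightarrow> x \<in> A"
  shows "lin_ext g f = (\<Sum>x\<in>A. cscale (f x) (g x))"
  unfolding lin_ext_def using assms by (intro sum.mono_neutral_left) (auto simp: cscale_simps)

lemma lin_ext_delta [simp]: "lin_ext g (delta x) = g x"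
  by (subst lin_ext_eq[of "{x}"]) (auto simp: delta_apply split: if_splits)

lemma lin_ext_add:
  assumes "finite {x. f x \<noteq> 0}" "finite {x. f' x \<noteq> 0}"
  shows "lin_ext g (f + f') = lin_ext g f + lin_ext g f'"
proof -
  define A where "A = {x. f x \<noteq> 0} \<union> {x. f' x \<noteq> 0}"
  have A: "finite A" using assms by (simp add: A_def)
  have "lin_ext g (f + f') = (\<Sum>x\<in>A. cscale ((f + f') x) (g x))"
    using A by (intro lin_ext_eq) (auto simp: A_def fun_simps)
  also have "\<dots> = (\<Sum>x\<in>A. cscale (f x) (g x)) + (\<Sum>x\<in>A. cscale (f' x) (g x))"
    by (simp add: sum.distrib cfun.scale_left_distrib plus_fun_apply)
  also have "(\<Sum>x\<in>A. cscale (f x) (g x)) = lin_ext g f"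
    using A by (intro lin_ext_eq[symmetric]) (auto simp: A_def)
  also have "(\<Sum>x\<in>A. cscale (f' x) (g x)) = lin_ext g f'"
    using A by (intro lin_ext_eq[symmetric]) (auto simp: A_def)
  finally show ?thesis .
qed

lemma lin_ext_scale:
  assumes "finite {x. f x \<noteq> 0}"
  shows "lin_ext g (cscale c f) = cscale c (lin_ext g f)"
proof -
  have "lin_ext g (cscale c f) = (\<Sum>x | f x \<noteq> 0. cscale (c * f x) (g x))"
    using assms by (subst lin_ext_eq[of "{x. f x \<noteq> 0}"]) (auto simp: fun_simps)
  then show ?thesis unfolding lin_ext_def by (simp add: cfun.scale_sum_right)
qed

lemma lin_ext_zero [simp]: "lin_ext g 0 = 0"
  by (simp add: lin_ext_def zero_fun_apply)

lemma lin_ext_span: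
  assumes "f \<in> cfun.span (delta ` S)" "f' \<in> cfun.span (delta ` S)"
  shows "lin_ext g (f + f') = lin_ext g f + lin_ext g f'"
    "lin_ext g (cscale c f) = cscale c (lin_ext g f)"
    "lin_ext g (f - f') = lin_ext g f - lin_ext g f'"
proof -
  show 1: "lin_ext g (f + f') = lin_ext g f + lin_ext g f'"
    "lin_ext g (cscale c f) = cscale c (lin_ext g f)" for c
    using assms by (simp_all add: span_delta_iff lin_ext_add lin_ext_scale)
  have "lin_ext g (f + cscale (-1) f') = lin_ext g f + lin_ext g (cscale (-1) f')"
    using assms cfun.span_scale[OF assms(2), of "-1"] by (intro lin_ext_add) (auto simp: span_delta_iff)
  also have "lin_ext g (cscale (-1) f') = cscale (-1) (lin_ext g f')"
    using assms by (simp only: span_delta_iff lin_ext_scale)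
  finally show "lin_ext g (f - f') = lin_ext g f - lin_ext g f'" by simp
qed

context matrix_algebra
begin

lemma Vc_zero: "0 \<in> Vc k"
  by (simp add: Vc_def zero_fun_apply)

lemma V_lin_ext:
  assumes "\<And>x. x \<in> S \<Longrightarrow> ph x \<in> Vc k" "f \<in> cfun.span (delta ` S)"
  shows "lin_ext ph f \<in> Vc k"
proof -
  have "finite A \<Longrightarrow> A \<subseteq> S \<Longrightarrow> (\<Sum>x\<in>A. cscale (f x) (ph x)) \<in> Vc k" for A
  proof (induction A rule: finite_induct)
    case empty
    then show ?case by (simp add: Vc_zero)
  next
    case (insert x A)
    then show ?case using assms(1) by (simp add: Vc_add Vc_scale)
  qed
  then show ?thesis using assms(2) unfolding lin_ext_def span_delta_iff by auto
qed

text \<open>A criterion for a module given by generators and relations. The map \<open>ph\<close>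
  gives the intended value of a generator, and \<open>g\<close> picks a generator above each
  coordinate vector. If the picked generators span everything modulo \<open>Rel\<close>, then the
  kernel of the linear extension of \<open>ph\<close> is exactly the span of \<open>Rel\<close>, and
  cosets are fibres. Induced modules and outer tensor products are both handled by this
  criterion.\<close>

lemma quot_iso:
  assumes ph: "\<And>x. x \<in> S \<Longrightarrow> ph x \<in> Vc k"
    and Rel: "Rel \<subseteq> cfun.span (delta ` S)" "\<And>r. r \<in> Rel \<Longrightarrow> lin_ext ph r = 0"
    and act: "\<And>a x. a \<in> carrier R \<Longrightarrow> x \<in> S \<Longrightarrow> act a x \<in> cfun.span (delta ` S)"
      "\<And>a x. a \<in> carrier R \<Longrightarrow> x \<in> S \<Longrightarrow> lin_ext ph (act a x) = ev a (ph x)"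
    and g: "\<And>t. t \<in> X \<Longrightarrow> cl t = k \<Longrightarrow> g t \<in> S \<and> ph (g t) = delta t"
    and spanning: "\<And>x. x \<in> S \<Longrightarrow> delta x \<in> cfun.span (Rel \<union> (\<lambda>t. delta (g t)) ` {t \<in> X. cl t = k})"
  shows "module_isomorphic R (V k) (quot_module S Rel act)"
proof -
  let ?F = "cfun.span (delta ` S)" and ?K = "cfun.span Rel" and ?P = "lin_ext ph"
  define D where "D = {t \<in> X. cl t = k}"
  have D: "finite D" using fin by (simp add: D_def)
  \<comment> \<open>A linear section of \<open>?P\<close> on \<open>Vc k\<close>, built from the
    picked generators.\<close>
  define sec where "sec p = (\<Sum>t\<in>D. cscale (p t) (delta (g t)))" for p
  have sec_in: "sec p \<in> ?F" for p
    unfolding sec_def using g by (intro cfun.span_sum cfun.span_scale cfun.span_base) (auto simp: D_def)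
  have sec0: "sec 0 = 0" unfolding sec_def by (intro sum.neutral) (simp add: zero_fun_apply)
  have KF: "?K \<subseteq> ?F" using Rel(1) cfun.span_minimal cfun.subspace_span by metis
  have ker: "?P r = 0" if "r \<in> ?K" for r
  proof -
    have "?K \<subseteq> {r \<in> ?F. ?P r = 0}"
    proof (rule cfun.span_minimal)
      show "Rel \<subseteq> {r \<in> ?F. ?P r = 0}" using Rel by auto
      show "cfun.subspace {r \<in> ?F. ?P r = 0}"
        by (rule cfun_subspaceI)
          (auto simp: lin_ext_span cfun.span_zero cfun.span_add cfun.span_scale)
    qed
    then show ?thesis using that by blast
  qed
  have sec_delta: "sec (delta t) = delta (g t)" if "t \<in> D" for t
  proof -
    have "sec (delta t) = (\<Sum>s\<in>D. if s = t then delta (g t) else 0)"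
      unfolding sec_def by (intro sum.cong) (auto simp: delta_apply)
    then show ?thesis using D that by simp
  qed
  have gD: "g t \<in> S" "ph (g t) = delta t" if "t \<in> D" for t using g that by (auto simp: D_def)
  \<comment> \<open>The vectors that agree with their reconstruction \<open>sec (?P f)\<close>
    modulo the relations. This subspace contains the relations and the picked generators, hence by
    \<open>spanning\<close> all of \<open>?F\<close>; on the kernel of \<open>?P\<close> the
    reconstruction is zero.\<close>
  let ?U = "{f \<in> ?F. f - sec (?P f) \<in> ?K}"
  have sub: "cfun.subspace ?U"
  proof (rule cfun_subspaceI)
    show "0 \<in> ?U" by (simp add: sec0 cfun.span_zero)
  next
    fix f f' assume "f \<in> ?U" "f' \<in> ?U"
    then have f: "f \<in> ?F" "f' \<in> ?F" "f - sec (?P f) \<in> ?K" "f' - sec (?P f') \<in> ?K" by auto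
    have "f + f' - sec (?P (f + f')) = (f - sec (?P f)) + (f' - sec (?P f'))"
      unfolding lin_ext_span(1)[OF f(1,2)] sec_def
      by (simp add: cfun.scale_left_distrib sum.distrib plus_fun_apply)
    then show "f + f' \<in> ?U"
      using cfun.span_add[OF f(1,2)] cfun.span_add[OF f(3,4)] by (intro CollectI conjI) (simp_all only:)
  next
    fix c f assume "f \<in> ?U"
    then have f: "f \<in> ?F" "f - sec (?P f) \<in> ?K" by auto
    have "cscale c f - sec (?P (cscale c f)) = cscale c (f - sec (?P f))"
      unfolding lin_ext_span(2)[OF f(1,1)] sec_def
      by (simp add: cfun.scale_right_diff_distrib cfun.scale_sum_right cscale_simps)
    then show "cscale c f \<in> ?U"
      using cfun.span_scale[OF f(1)] cfun.span_scale[OF f(2), of c] by (intro CollectI conjI) (simp_all only:)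
  qed
  have "Rel \<union> (\<lambda>t. delta (g t)) ` D \<subseteq> ?U"
  proof
    fix f assume "f \<in> Rel \<union> (\<lambda>t. delta (g t)) ` D"
    then show "f \<in> ?U"
    proof
      assume f: "f \<in> Rel"
      then have "f - sec (?P f) \<in> ?K" using Rel(2) sec0 cfun.span_base by simp
      then show ?thesis using f Rel(1) by blast
    next
      assume "f \<in> (\<lambda>t. delta (g t)) ` D"
      then obtain t where t: "t \<in> D" "f = delta (g t)" by blast
      then have "f - sec (?P f) = 0" using gD sec_delta by simp
      then have "f - sec (?P f) \<in> ?K" using cfun.span_zero by metis
      moreover have "f \<in> ?F" unfolding t(2) using gD(1)[OF t(1)] by (intro cfun.span_base) blast
      ultimately show ?thesis by blast
    qed
  qed
  from cfun.span_minimal[OF this sub] have "delta ` S \<subseteq> ?U" using spanning unfolding D_def by blast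
  from cfun.span_minimal[OF this sub] have cong: "f - sec (?P f) \<in> ?K" if "f \<in> ?F" for f using that by blast
  have ker_iff: "f \<in> ?K \<longleftrightarrow> f \<in> ?F \<and> ?P f = 0" for f
    using ker KF cong[of f] sec0 by (metis diff_zero subsetD)
  \<comment> \<open>The isomorphism sends a vector to its fibre, which is literally a coset, that
    is, an element of the quotient.\<close>
  define fib where "fib p = {f \<in> ?F. ?P f = p}" for p
  have coset: "{x + r | r. r \<in> ?K} = fib (?P x)" if x: "x \<in> ?F" for x
  proof (rule Set.set_eqI, rule iffI)
    fix f assume "f \<in> {x + r | r. r \<in> ?K}"
    then obtain r where r: "f = x + r" "r \<in> ?K" by auto
    then show "f \<in> fib (?P x)" unfolding fib_def
      using ker_iff x lin_ext_span(1)[OF x, where g=ph and f'=r] cfun.span_add[OF x, of r] by (simp add: fun_simps)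
  next
    fix f assume "f \<in> fib (?P x)"
    then have f: "f \<in> ?F" "?P f = ?P x" unfolding fib_def by auto
    have "f - x \<in> ?K" unfolding ker_iff using cfun.span_diff[OF f(1) x] lin_ext_span(3)[OF f(1) x, where g=ph] f by auto
    moreover have "f = x + (f - x)" by simp
    ultimately show "f \<in> {x + r | r. r \<in> ?K}" by blast
  qed
  have Psec: "?P (sec p) = p" if "p \<in> Vc k" for p
  proof -
    have "?P (sec p) = (\<Sum>t\<in>A. cscale (p t) (delta t))" if "A = D" for A
    proof -
      have *: "finite B \<Longrightarrow> B \<subseteq> D \<Longrightarrow> ?P (\<Sum>t\<in>B. cscale (p t) (delta (g t))) = (\<Sum>t\<in>B. cscale (p t) (delta t))" for B
      proof (induction B rule: finite_induct)
        case (insert t B)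
        have 1: "(\<Sum>t\<in>B. cscale (p t) (delta (g t))) \<in> ?F" 
          using insert g by (intro cfun.span_sum cfun.span_scale cfun.span_base) (auto simp: D_def)
        have 2: "delta (g t) \<in> ?F" using insert g by (intro cfun.span_base) (auto simp: D_def)
        show ?case using insert g
          by (simp add: lin_ext_span(1)[OF cfun.span_scale[OF 2] 1] lin_ext_span(2)[OF 2 2] D_def)
      qed simp
      show ?thesis unfolding sec_def using *[OF D] that by simp
    qed
    moreover have "(\<Sum>t\<in>D. cscale (p t) (delta t)) = p"
    proof
      fix s
      have "(\<Sum>t\<in>D. cscale (p t) (delta t)) s = (\<Sum>t\<in>D. if s = t then p t else 0)"
        unfolding sum_fun_apply by (intro sum.cong) (auto simp: delta_apply fun_simps)
      then show "(\<Sum>t\<in>D. cscale (p t) (delta t)) s = p s"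
        using D that by (auto simp: Vc_def D_def)
    qed
    ultimately show ?thesis by simp
  qed
  have P_in: "?P f \<in> Vc k" if "f \<in> ?F" for f using V_lin_ext[OF ph that] .
  have carr: "carrier (quot_module S Rel act) = fib ` Vc k"
  proof -
    have "carrier (quot_module S Rel act) = (\<lambda>x. {x + r | r. r \<in> ?K}) ` ?F"
      unfolding quot_module_def by auto
    also have "\<dots> = (\<lambda>x. fib (?P x)) ` ?F" by (intro image_cong refl coset)
    also have "\<dots> = fib ` (?P ` ?F)" by (simp only: image_image)
    also have "?P ` ?F = Vc k"
    proof (rule subset_antisym)
      show "?P ` ?F \<subseteq> Vc k" using P_in by blast
      show "Vc k \<subseteq> ?P ` ?F"
      proof
        fix p assume p: "p \<in> Vc k"
        show "p \<in> ?P ` ?F" by (rule image_eqI[of _ _ "sec p"]) (simp_all only: Psec[OF p] sec_in)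
      qed
    qed
    finally show ?thesis .
  qed
  have act_in: "lin_ext (act a) f \<in> ?F \<and> ?P (lin_ext (act a) f) = ev a (?P f)"
    if a: "a \<in> carrier R" and f: "f \<in> ?F" for a f
  proof -
    have "?F \<subseteq> {f \<in> ?F. lin_ext (act a) f \<in> ?F \<and> ?P (lin_ext (act a) f) = ev a (?P f)}"
    proof (rule cfun.span_minimal)
      show "delta ` S \<subseteq> {f \<in> ?F. lin_ext (act a) f \<in> ?F \<and> ?P (lin_ext (act a) f) = ev a (?P f)}"
        using act[OF a] by (auto intro: cfun.span_base)
      have "ev a 0 = 0" by (simp add: ev_def fun_eq_iff fun_simps)
      then show "cfun.subspace {f \<in> ?F. lin_ext (act a) f \<in> ?F \<and> ?P (lin_ext (act a) f) = ev a (?P f)}"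
        by (intro cfun_subspaceI)
          (auto simp: lin_ext_span cfun.span_zero cfun.span_add cfun.span_scale ev_add2 ev_scale2)
    qed
    then show ?thesis using f by blast
  qed
  have "hom_iso R (V k) (quot_module S Rel act) fib"
    unfolding hom_iso_def
  proof (intro conjI ballI)
    have "inj_on fib (Vc k)"
    proof (rule inj_onI)
      fix p q assume "p \<in> Vc k" "q \<in> Vc k" "fib p = fib q"
      then have "sec p \<in> fib q" using sec_in Psec unfolding fib_def by blast
      then show "p = q" using Psec \<open>p \<in> Vc k\<close> unfolding fib_def by auto
    qed
    then show "bij_betw fib (carrier (V k)) (carrier (quot_module S Rel act))"
      unfolding bij_betw_def carr by simp
  next
    fix p q assume "p \<in> carrier (V k)" "q \<in> carrier (V k)"
    then have pq: "p \<in> Vc k" "q \<in> Vc k" by simp_all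
    have "fib (p + q) = {x + y | x y. x \<in> fib p \<and> y \<in> fib q}"
    proof (rule Set.set_eqI, rule iffI)
      fix f assume f: "f \<in> fib (p + q)"
      then have fF: "f \<in> ?F" unfolding fib_def by auto
      have "f - sec p \<in> fib q"
        using f cfun.span_diff[OF fF sec_in] lin_ext_span(3)[OF fF sec_in, where g=ph] Psec[OF pq(1)] unfolding fib_def by auto
      moreover have "sec p \<in> fib p" using sec_in Psec[OF pq(1)] unfolding fib_def by auto
      moreover have "f = sec p + (f - sec p)" by simp
      ultimately show "f \<in> {x + y | x y. x \<in> fib p \<and> y \<in> fib q}" by blast
    qed (auto simp: fib_def lin_ext_span cfun.span_add)
    then show "fib (p \<oplus>\<^bsub>V k\<^esub> q) = fib p \<oplus>\<^bsub>quot_module S Rel act\<^esub> fib q"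
      unfolding quot_module_def by simp
  next
    fix a p assume a: "a \<in> carrier R" and "p \<in> carrier (V k)"
    then have p: "p \<in> Vc k" by simp
    have "fib (ev a p) = {lin_ext (act a) x + r | x r. x \<in> fib p \<and> r \<in> ?K}"
    proof (rule Set.set_eqI, rule iffI)
      fix f assume f: "f \<in> fib (ev a p)"
      let ?y = "lin_ext (act a) (sec p)"
      have y: "?y \<in> ?F" "?P ?y = ev a p" using act_in[OF a sec_in] Psec[OF p] by auto
      then have "f \<in> {?y + r | r. r \<in> ?K}" using f coset[OF y(1)] by simp
      moreover have "sec p \<in> fib p" using sec_in Psec[OF p] unfolding fib_def by auto
      ultimately show "f \<in> {lin_ext (act a) x + r | x r. x \<in> fib p \<and> r \<in> ?K}" by blast
    next
      fix f assume "f \<in> {lin_ext (act a) x + r | x r. x \<in> fib p \<and> r \<in> ?K}"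
      then obtain x r where x: "f = lin_ext (act a) x + r" "x \<in> ?F" "?P x = p" "r \<in> ?K"
        unfolding fib_def by auto
      then have "f \<in> {lin_ext (act a) x + r | r. r \<in> ?K}" by blast
      then show "f \<in> fib (ev a p)" using coset act_in[OF a x(2)] x(3) by simp
    qed
    then show "fib (a \<odot>\<^bsub>V k\<^esub> p) = a \<odot>\<^bsub>quot_module S Rel act\<^esub> fib p"
      unfolding quot_module_def by simp
  qed
  then show ?thesis unfolding module_isomorphic_iff by blast
qed

end

section \<open>Zeta transforms on finite semigroups\<close>

text \<open>Every element acts as a partial injection of \<open>X\<close>: \<open>cov a s t\<close> says that \<open>a\<close> sends \<open>t\<close> to \<open>s\<close>. Each pair
  \<open>(s, t)\<close> in one class is covered by a least element \<open>D s t\<close>, which makes the transform \<open>Z\<close>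
  unitriangular.\<close>

locale zeta_semigroup =
  fixes S :: "'s set" and opr :: "'s \<Rightarrow> 's \<Rightarrow> 's" and X :: "'x set" and cl :: "'x \<Rightarrow> 'c"
    and cov :: "'s \<Rightarrow> 'x \<Rightarrow> 'x \<Rightarrow> bool" and D :: "'x \<Rightarrow> 'x \<Rightarrow> 's" and e :: "'s \<Rightarrow> complex"
  assumes finS: "finite S" and finX: "finite X"
    and closed: "a \<in> S \<Longrightarrow> b \<in> S \<Longrightarrow> opr a b \<in> S"
    and cov_X: "a \<in> S \<Longrightarrow> cov a s t \<Longrightarrow> s \<in> X \<and> t \<in> X \<and> cl s = cl t"
    and cov_mult: "a \<in> S \<Longrightarrow> b \<in> S \<Longrightarrow> cov (opr a b) s t \<longleftrightarrow> (\<exists>u. cov a s u \<and> cov b u t)"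
    and cov_uniq: "a \<in> S \<Longrightarrow> cov a s u \<Longrightarrow> cov a s u' \<Longrightarrow> u = u'"
    and D_in: "s \<in> X \<Longrightarrow> t \<in> X \<Longrightarrow> cl s = cl t \<Longrightarrow> D s t \<in> S"
    and D_cov: "s \<in> X \<Longrightarrow> t \<in> X \<Longrightarrow> cl s = cl t \<Longrightarrow> cov (D s t) s t"
    and D_min: "b \<in> S \<Longrightarrow> cov b s t \<Longrightarrow> cov (D s t) s' t' \<Longrightarrow> cov b s' t'"
    and D_antisym: "s \<in> X \<Longrightarrow> t \<in> X \<Longrightarrow> cl s = cl t \<Longrightarrow> cov (D s t) s' t' \<Longrightarrow> cov (D s' t') s t
      \<Longrightarrow> s = s' \<and> t = t'"
    and D_surj: "a \<in> S \<Longrightarrow> \<exists>s\<in>X. \<exists>t\<in>X. cl s = cl t \<and> a = D s t"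
    and e_supp: "a \<notin> S \<Longrightarrow> e a = 0"
    and e_one: "s \<in> X \<Longrightarrow> t \<in> X \<Longrightarrow> (\<Sum>a\<in>S. if cov a s t then e a else 0) = (if s = t then 1 else 0)"
begin

definition Z :: "('s \<Rightarrow> complex) \<Rightarrow> 'x \<Rightarrow> 'x \<Rightarrow> complex" where
  "Z f s t = (\<Sum>a\<in>S. if cov a s t then f a else 0)"

abbreviation "Alg \<equiv> semigroup_algebra S opr e"

lemma Alg_simps:
  "carrier Alg = {f. \<forall>s. s \<notin> S \<longrightarrow> f s = 0}" "\<one>\<^bsub>Alg\<^esub> = e" "\<zero>\<^bsub>Alg\<^esub> = 0" "add Alg = (+)"
  "f \<otimes>\<^bsub>Alg\<^esub> g = (\<lambda>s. \<Sum>(a, b) \<in> {(a, b). a \<in> S \<and> b \<in> S \<and> opr a b = s}. f a * g b)"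
  by (auto simp: semigroup_algebra_def)

lemma Z_add: "Z (f + g) s t = Z f s t + Z g s t"
  unfolding Z_def sum.distrib[symmetric] by (rule sum.cong) (auto simp: plus_fun_apply)

lemma Z_scale: "Z (cscale c f) s t = c * Z f s t"
  unfolding Z_def sum_distrib_left by (rule sum.cong) (auto simp: fun_simps)

lemma Z_zero: "Z 0 s t = 0"
  unfolding Z_def by (rule sum.neutral) (auto simp: zero_fun_apply)

lemma Z_minus: "Z (- f) s t = - Z f s t"
  using Z_scale[of "-1" f s t] by simp

lemma Z_sum: "Z (\<Sum>i\<in>I. f i) s t = (\<Sum>i\<in>I. Z (f i) s t)"
  by (induction I rule: infinite_finite_induct) (auto simp: Z_add Z_zero)

lemma Z_supp: "Z f s t \<noteq> 0 \<Longrightarrow> s \<in> X \<and> t \<in> X \<and> cl s = cl t"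
proof -
  assume "Z f s t \<noteq> 0"
  then obtain a where "a \<in> S" "(if cov a s t then f a else 0) \<noteq> 0"
    unfolding Z_def by (rule sum.not_neutral_contains_not_neutral)
  then have "a \<in> S" "cov a s t" by (auto split: if_splits)
  then show ?thesis using cov_X by blast
qed

lemma Z_delta: "a \<in> S \<Longrightarrow> Z (delta a) s t = (if cov a s t then 1 else 0)"
proof -
  assume a: "a \<in> S"
  have "Z (delta a) s t = (\<Sum>b\<in>S. if b = a then (if cov a s t then 1 else 0) else 0)"
    unfolding Z_def by (rule sum.cong) (auto simp: delta_apply)
  then show ?thesis using a finS by simp
qed

text \<open>Grouping the pairs of elements by their product writes the left side as one sum over
  pairs. By \<open>cov_mult\<close> a product covers \<open>(s, t)\<close> through some intermediate
  state, and by \<open>cov_uniq\<close> through only one, so the indicator for the product is the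
  sum over \<open>u\<close> of the products of the two indicators.\<close>

lemma Z_mult: "Z (f \<otimes>\<^bsub>Alg\<^esub> g) s t = (\<Sum>u\<in>X. Z f s u * Z g u t)"
proof -
  let ?P = "S \<times> S"
  have fP: "finite ?P" using finS by simp
  have "Z (f \<otimes>\<^bsub>Alg\<^esub> g) s t =
    (\<Sum>d\<in>S. \<Sum>p\<in>{p. p \<in> ?P \<and> opr (fst p) (snd p) = d}.
      if cov (opr (fst p) (snd p)) s t then f (fst p) * g (snd p) else 0)"
    unfolding Z_def Alg_simps
  proof (rule sum.cong[OF refl])
    fix d
    have eq: "{(a, b). a \<in> S \<and> b \<in> S \<and> opr a b = d} = {p. p \<in> ?P \<and> opr (fst p) (snd p) = d}" by auto
    show "(if cov d s t then \<Sum>(a, b)\<in>{(a, b). a \<in> S \<and> b \<in> S \<and> opr a b = d}. f a * g b else 0) =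
      (\<Sum>p\<in>{p. p \<in> ?P \<and> opr (fst p) (snd p) = d}.
      if cov (opr (fst p) (snd p)) s t then f (fst p) * g (snd p) else 0)"
      unfolding eq by (auto simp: case_prod_unfold intro!: sum.cong sum.neutral[symmetric])
  qed
  also have "\<dots> = (\<Sum>p\<in>?P. if cov (opr (fst p) (snd p)) s t then f (fst p) * g (snd p) else 0)"
    using finS fP closed by (intro sum.group) auto
  also have "\<dots> = (\<Sum>p\<in>?P. \<Sum>u\<in>X. (if cov (fst p) s u then f (fst p) else 0) * (if cov (snd p) u t then g (snd p) else 0))"
  proof (rule sum.cong[OF refl])
    fix p assume "p \<in> ?P"
    then have p: "fst p \<in> S" "snd p \<in> S" by auto
    show "(if cov (opr (fst p) (snd p)) s t then f (fst p) * g (snd p) else 0) =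
      (\<Sum>u\<in>X. (if cov (fst p) s u then f (fst p) else 0) * (if cov (snd p) u t then g (snd p) else 0))"
    proof (cases "\<exists>u. cov (fst p) s u \<and> cov (snd p) u t")
      case True
      then obtain u where u: "cov (fst p) s u" "cov (snd p) u t" by blast
      have "(\<Sum>v\<in>X. (if cov (fst p) s v then f (fst p) else 0) * (if cov (snd p) v t then g (snd p) else 0))
        = (\<Sum>v\<in>X. if v = u then f (fst p) * g (snd p) else 0)"
      proof (rule sum.cong[OF refl])
        fix v
        have "\<not> cov (fst p) s v" if "v \<noteq> u" using cov_uniq[OF p(1) u(1)] that by blast
        then show "(if cov (fst p) s v then f (fst p) else 0) * (if cov (snd p) v t then g (snd p) else 0)
          = (if v = u then f (fst p) * g (snd p) else 0)"
          using u by (cases "v = u") simp_all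
      qed
      also have "\<dots> = f (fst p) * g (snd p)" using finX cov_X[OF p(1) u(1)] by simp
      finally show ?thesis using True cov_mult[OF p] by simp
    next
      case False
      then show ?thesis unfolding cov_mult[OF p] if_not_P[OF False] by (intro sum.neutral[symmetric]) auto
    qed
  qed
  also have "\<dots> = (\<Sum>u\<in>X. \<Sum>p\<in>?P. (if cov (fst p) s u then f (fst p) else 0) * (if cov (snd p) u t then g (snd p) else 0))"
    by (rule sum.swap)
  also have "\<dots> = (\<Sum>u\<in>X. Z f s u * Z g u t)"
    unfolding Z_def sum_product sum.cartesian_product by (simp add: case_prod_unfold)
  finally show ?thesis .
qed

text \<open>A numerical height for the order in which \<open>Z\<close> is triangular: by
  \<open>D_min\<close> an element covering the defining pair of another one covers all pairs that
  the other covers.\<close>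

definition ncov :: "'s \<Rightarrow> nat" where "ncov a = card {p \<in> X \<times> X. cov a (fst p) (snd p)}"

lemma fin_cov: "finite {p \<in> X \<times> X. cov a (fst p) (snd p)}"
  using finX by simp

text \<open>Let \<open>a = D s t\<close> cover the largest number of pairs among the elements with
  nonzero coefficient. Another such element covering \<open>(s, t)\<close> covers at least the pairs
  of \<open>a\<close>, hence by maximality the same ones, and equals \<open>a\<close> by
  antisymmetry. So \<open>Z f s t\<close> is the single coefficient \<open>f a\<close>.\<close>

lemma Z_inj: assumes f: "f \<in> carrier Alg" and Z0: "\<And>s t. Z f s t = 0" shows "f = 0"
proof (rule ccontr)
  assume "f \<noteq> 0"
  define A where "A = {a \<in> S. f a \<noteq> 0}"
  have "A \<noteq> {}" using \<open>f \<noteq> 0\<close> f by (auto simp: A_def Alg_simps fun_eq_iff zero_fun_apply)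
  moreover have "finite A" using finS by (simp add: A_def)
  ultimately have "Max (ncov ` A) \<in> ncov ` A" by (intro Max_in) auto
  then obtain a where a: "a \<in> A" and am: "Max (ncov ` A) = ncov a" by blast
  have max: "ncov b \<le> ncov a" if "b \<in> A" for b
    unfolding am[symmetric] using that \<open>finite A\<close> by (intro Max_ge) auto
  have aS: "a \<in> S" using a by (simp add: A_def)
  obtain s t where st: "s \<in> X" "t \<in> X" "cl s = cl t" "a = D s t" using D_surj[OF aS] by blast
  have uniq: "b = a" if b: "b \<in> A" and c: "cov b s t" for b
  proof -
    have bS: "b \<in> S" using b by (simp add: A_def)
    obtain s' t' where st': "s' \<in> X" "t' \<in> X" "cl s' = cl t'" "b = D s' t'" using D_surj[OF bS] by blast
    have "{p \<in> X \<times> X. cov a (fst p) (snd p)} \<subseteq> {p \<in> X \<times> X. cov b (fst p) (snd p)}"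
      using D_min[OF bS c] st by auto
    then have eq: "{p \<in> X \<times> X. cov a (fst p) (snd p)} = {p \<in> X \<times> X. cov b (fst p) (snd p)}"
      using max[OF b] unfolding ncov_def by (intro card_seteq fin_cov)
    have "(s', t') \<in> {p \<in> X \<times> X. cov b (fst p) (snd p)}" using D_cov[OF st'(1-3)] st' by simp
    then have "(s', t') \<in> {p \<in> X \<times> X. cov a (fst p) (snd p)}" by (simp only: eq)
    then have "cov a s' t'" by simp
    then show ?thesis using D_antisym[OF st(1-3), of s' t'] st st' c by simp
  qed
  have "Z f s t = (\<Sum>b\<in>S. if b = a then f a else 0)"
    unfolding Z_def
  proof (rule sum.cong[OF refl])
    fix b assume "b \<in> S"
    then show "(if cov b s t then f b else 0) = (if b = a then f a else 0)"
      using uniq[of b] D_cov[OF st(1-3)] st(4) by (auto simp: A_def)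
  qed
  also have "\<dots> = f a" using aS finS by simp
  finally show False using Z0 a by (simp add: A_def)
qed

lemma Alg_add: "f \<in> carrier Alg \<Longrightarrow> g \<in> carrier Alg \<Longrightarrow> f + g \<in> carrier Alg"
  by (simp add: Alg_simps plus_fun_apply)

lemma Alg_minus: "f \<in> carrier Alg \<Longrightarrow> - f \<in> carrier Alg"
  by (simp add: Alg_simps uminus_apply)

lemma Alg_scale: "f \<in> carrier Alg \<Longrightarrow> cscale c f \<in> carrier Alg"
  by (simp add: Alg_simps cscale_def)

lemma Alg_sum: "(\<And>i. i \<in> I \<Longrightarrow> f i \<in> carrier Alg) \<Longrightarrow> (\<Sum>i\<in>I. f i) \<in> carrier Alg"
  by (induction I rule: infinite_finite_induct) (auto simp: Alg_add, simp_all add: Alg_simps zero_fun_apply)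

text \<open>Moebius inversion without a formula. The transform of \<open>delta (D s t)\<close> is 1
  at every pair covered by \<open>D s t\<close>; the units of the other covered pairs are
  subtracted. They exist by induction, since \<open>D\<close> of such a pair covers fewer pairs: by
  antisymmetry it misses \<open>(s, t)\<close>.\<close>

lemma Z_surj_basis:
  assumes "s \<in> X" "t \<in> X" "cl s = cl t"
  shows "\<exists>f\<in>carrier Alg. \<forall>s' t'. Z f s' t' = (if s' = s \<and> t' = t then 1 else 0)"
  using assms
proof (induction "ncov (D s t)" arbitrary: s t rule: less_induct)
  case less
  let ?C = "{p \<in> X \<times> X. cov (D s t) (fst p) (snd p)}"
  have DS: "D s t \<in> S" using D_in less.prems by blast
  have c0: "cov (D s t) s t" using D_cov less.prems by blast
  have "\<exists>f\<in>carrier Alg. \<forall>s' t'. Z f s' t' = (if s' = fst q \<and> t' = snd q then 1 else 0)" if q: "q \<in> ?C - {(s, t)}" for q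
  proof (rule less.hyps)
    have qX: "fst q \<in> X" "snd q \<in> X" "cl (fst q) = cl (snd q)" using q cov_X[OF DS, of "fst q" "snd q"] by auto
    then show "fst q \<in> X" "snd q \<in> X" "cl (fst q) = cl (snd q)" by auto
    have "{p \<in> X \<times> X. cov (D (fst q) (snd q)) (fst p) (snd p)} \<subseteq> ?C"
      using D_min[OF DS, of "fst q" "snd q"] q by auto
    moreover have "(s, t) \<notin> {p \<in> X \<times> X. cov (D (fst q) (snd q)) (fst p) (snd p)}"
      using D_antisym[OF less.prems, of "fst q" "snd q"] q by auto
    moreover have "(s, t) \<in> ?C" using c0 less.prems by simp
    ultimately show "ncov (D (fst q) (snd q)) < ncov (D s t)"
      unfolding ncov_def by (intro psubset_card_mono fin_cov) blast
  qed
  then have "\<forall>q\<in>?C - {(s, t)}. \<exists>f. f \<in> carrier Alg \<and>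
      (\<forall>s' t'. Z f s' t' = (if s' = fst q \<and> t' = snd q then 1 else 0))" by blast
  from bchoice[OF this] obtain E where E0: "\<forall>q\<in>?C - {(s, t)}. E q \<in> carrier Alg \<and>
      (\<forall>s' t'. Z (E q) s' t' = (if s' = fst q \<and> t' = snd q then 1 else 0))" ..
  have E: "E q \<in> carrier Alg" "Z (E q) s' t' = (if s' = fst q \<and> t' = snd q then 1 else 0)"
    if "q \<in> ?C - {(s, t)}" for q s' t'
    using bspec[OF E0 that] by (simp_all only:)
  define f where "f = delta (D s t) + - (\<Sum>q\<in>?C - {(s, t)}. E q)"
  have "f \<in> carrier Alg"
    unfolding f_def using DS E(1)
    by (intro Alg_add Alg_minus Alg_sum) (auto simp: Alg_simps delta_apply)
  moreover have "Z f s' t' = (if s' = s \<and> t' = t then 1 else 0)" for s' t'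
  proof -
    have "(\<Sum>q\<in>?C - {(s, t)}. Z (E q) s' t') = (\<Sum>q\<in>?C - {(s, t)}. if q = (s', t') then 1 else 0)"
      using E(2) by (intro sum.cong) auto
    also have "\<dots> = (if (s', t') \<in> ?C - {(s, t)} then 1 else 0)" using finX by (simp add: sum.delta')
    finally show ?thesis
      unfolding f_def Z_add Z_minus Z_sum Z_delta[OF DS]
      using cov_X[OF DS, of s' t'] c0 by auto
  qed
  ultimately show ?case by blast
qed

lemma Z_surj:
  assumes F: "\<And>s t. F s t \<noteq> 0 \<Longrightarrow> s \<in> X \<and> t \<in> X \<and> cl s = cl t"
  shows "\<exists>f\<in>carrier Alg. Z f = F"
proof -
  let ?C = "{p \<in> X \<times> X. cl (fst p) = cl (snd p)}"
  have fC: "finite ?C" using finX by simp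
  have "\<exists>f\<in>carrier Alg. \<forall>s t. Z f s t = (if s = fst q \<and> t = snd q then 1 else 0)" if "q \<in> ?C" for q
  proof -
    have "fst q \<in> X" "snd q \<in> X" "cl (fst q) = cl (snd q)" using that by auto
    then show ?thesis by (rule Z_surj_basis)
  qed
  then have "\<forall>q\<in>?C. \<exists>f. f \<in> carrier Alg \<and>
      (\<forall>s t. Z f s t = (if s = fst q \<and> t = snd q then 1 else 0))" by blast
  from bchoice[OF this] obtain E where E0: "\<forall>q\<in>?C. E q \<in> carrier Alg \<and>
      (\<forall>s t. Z (E q) s t = (if s = fst q \<and> t = snd q then 1 else 0))" ..
  have E: "E q \<in> carrier Alg" "Z (E q) s t = (if s = fst q \<and> t = snd q then 1 else 0)"
    if "q \<in> ?C" for q s t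
    using bspec[OF E0 that] by (simp_all only:)
  define f where "f = (\<Sum>q\<in>?C. cscale (F (fst q) (snd q)) (E q))"
  have "f \<in> carrier Alg" unfolding f_def using E by (intro Alg_sum Alg_scale)
  moreover have "Z f s t = F s t" for s t
  proof -
    have "Z f s t = (\<Sum>q\<in>?C. if q = (s, t) then F s t else 0)"
      unfolding f_def Z_sum Z_scale using E by (intro sum.cong) auto
    also have "\<dots> = F s t" using fC F[of s t] by (auto simp: sum.delta')
    finally show ?thesis .
  qed
  ultimately show ?thesis by blast
qed

sublocale matrix_algebra Alg X cl Z
proof
  fix s t assume "s \<in> X"
  then show "Z \<one>\<^bsub>Alg\<^esub> s t = (if s = t then 1 else 0)"
    using e_one[of s t] Z_supp[of e s t] unfolding Alg_simps Z_def by metis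
next
  fix f g assume "f \<in> carrier Alg" "g \<in> carrier Alg"
  show "f \<otimes>\<^bsub>Alg\<^esub> g \<in> carrier Alg"
    unfolding Alg_simps using closed by (auto intro!: sum.neutral)
next
  show "finite X" "add Alg = (+)" "\<zero>\<^bsub>Alg\<^esub> = 0" "\<one>\<^bsub>Alg\<^esub> \<in> carrier Alg"
    using finX e_supp by (simp_all add: Alg_simps)
  show "f + g \<in> carrier Alg" if "f \<in> carrier Alg" "g \<in> carrier Alg" for f g
    using that by (rule Alg_add)
  show "cscale c f \<in> carrier Alg" if "f \<in> carrier Alg" for c f
    using that by (rule Alg_scale)
  show "Z (f + g) s t = Z f s t + Z g s t" for f g s t by (rule Z_add)
  show "Z (cscale c f) s t = c * Z f s t" for c f s t by (rule Z_scale)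
  show "s \<in> X \<and> t \<in> X \<and> cl s = cl t" if "Z f s t \<noteq> 0" for f s t using that by (rule Z_supp)
  show "Z (f \<otimes>\<^bsub>Alg\<^esub> g) s t = (\<Sum>u\<in>X. Z f s u * Z g u t)" for f g s t by (rule Z_mult)
  show "f = 0" if "f \<in> carrier Alg" "\<And>s t. Z f s t = 0" for f using that by (rule Z_inj)
  show "\<exists>f\<in>carrier Alg. Z f = F" if "\<And>s t. F s t \<noteq> 0 \<Longrightarrow> s \<in> X \<and> t \<in> X \<and> cl s = cl t" for F
    using that by (rule Z_surj)
qed

end

section \<open>The semigroups \<open>P_m\<close>\<close>

lemma uvec_eq_iff [simp]: "uvec i = uvec j \<longleftrightarrow> i = j"
  by (auto simp: uvec_def fun_eq_iff)

lemma uvec_neq_0 [simp]: "uvec i \<noteq> 0" "0 \<noteq> uvec i"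
  by (auto simp: uvec_def fun_eq_iff zero_fun_apply)

lemma uvec_mult: "uvec i * uvec j = (if i = j then uvec i else 0)"
  by (auto simp: uvec_def fun_eq_iff zero_fun_apply)

text \<open>A matrix as a coloured relation between rows and columns. The bounds belong to it
  because \<open>$$\<close> says nothing outside the matrix, and \<open>i \<noteq> 0\<close> because
  \<open>0\<close> will be the colour of an empty row or column, while \<open>uvec 0\<close> is not
  the zero entry.\<close>

definition ent :: "pmat \<Rightarrow> nat \<Rightarrow> nat \<Rightarrow> nat \<Rightarrow> bool" where
  "ent d r c i \<longleftrightarrow> r < dim_row d \<and> c < dim_col d \<and> i \<noteq> 0 \<and> d $$ (r, c) = uvec i"

text \<open>In \<open>Pmat_order\<close> condition (b) has become monotonicity. If two entries of
  colour \<open>i\<close> were inverted, the two remaining corners of their rectangle would vanish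
  because a row has at most one nonzero entry, and the rectangle would be the forbidden
  submatrix.\<close>

lemma PmatD:
  assumes d: "d \<in> Pmat n m"
  shows "d \<in> carrier_mat m m" "dim_row d = m" "dim_col d = m"
    and Pmat_entry: "\<And>r c. r < m \<Longrightarrow> c < m \<Longrightarrow> d $$ (r, c) \<noteq> 0 \<Longrightarrow> \<exists>i\<in>{1..n}. ent d r c i"
    and Pmat_ent: "\<And>r c i. ent d r c i \<Longrightarrow> r < m \<and> c < m \<and> i \<in> {1..n}"
    and Pmat_row: "\<And>r c c' i j. ent d r c i \<Longrightarrow> ent d r c' j \<Longrightarrow> c = c' \<and> i = j"
    and Pmat_col: "\<And>r r' c i j. ent d r c i \<Longrightarrow> ent d r' c j \<Longrightarrow> r = r' \<and> i = j"
    and Pmat_order: "\<And>r r' c c' i. ent d r c i \<Longrightarrow> ent d r' c' i \<Longrightarrow> r < r' \<Longrightarrow> c < c'"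
proof -
  show car: "d \<in> carrier_mat m m" using d by (simp add: Pmat_def)
  show dims: "dim_row d = m" "dim_col d = m" using car by auto
  note P = d[unfolded Pmat_def, THEN CollectD, THEN conjunct2]
  note P1 = P[THEN conjunct1] and P2 = P[THEN conjunct2, THEN conjunct1]
    and P3 = P[THEN conjunct2, THEN conjunct2, THEN conjunct1]
    and P4 = P[THEN conjunct2, THEN conjunct2, THEN conjunct2]
  have ent': "d $$ (r, c) \<in> insert 0 (uvec ` {1..n})" if "r < m" "c < m" for r c
    using P1[rule_format, OF that] .
  show "\<exists>i\<in>{1..n}. ent d r c i" if "r < m" "c < m" "d $$ (r, c) \<noteq> 0" for r c
    using ent'[OF that(1,2)] that unfolding ent_def dims by auto
  show P_ent: "r < m \<and> c < m \<and> i \<in> {1..n}" if "ent d r c i" for r c i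
  proof -
    have e: "r < m" "c < m" "d $$ (r, c) = uvec i" using that unfolding ent_def dims by auto
    then show ?thesis using ent'[of r c] by auto
  qed
  have rowu: "c = c'" if "r < m" "c < m" "c' < m" "d $$ (r, c) \<noteq> 0" "d $$ (r, c') \<noteq> 0" for r c c'
    using P2[rule_format, OF that(1-3)] that(4,5) by simp
  have colu: "r = r'" if "r < m" "r' < m" "c < m" "d $$ (r, c) \<noteq> 0" "d $$ (r', c) \<noteq> 0" for r r' c
    using P3[rule_format, OF that(3,1,2)] that(4,5) by simp
  show row: "c = c' \<and> i = j" if "ent d r c i" "ent d r c' j" for r c c' i j
  proof -
    have "c = c'" using rowu[of r c c'] that unfolding ent_def dims by simp
    then show ?thesis using that unfolding ent_def by simp
  qed
  show col: "r = r' \<and> i = j" if "ent d r c i" "ent d r' c j" for r r' c i j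
  proof -
    have "r = r'" using colu[of r r' c] that unfolding ent_def dims by simp
    then show ?thesis using that unfolding ent_def by simp
  qed
  fix r r' c c' i assume e: "ent d r c i" "ent d r' c' i" "r < r'"
  have "c \<noteq> c'" using col[of r c i r' i] e by auto
  moreover have "\<not> c' < c"
  proof
    assume lt: "c' < c"
    have b: "r < m" "c < m" "r' < m" "c' < m" "d $$ (r, c) = uvec i" "d $$ (r', c') = uvec i"
      using e unfolding ent_def dims by auto
    have z1: "d $$ (r, c') = 0" using rowu[of r c c'] b lt by force
    have z2: "d $$ (r', c) = 0" using rowu[of r' c c'] b lt by force
    have "i \<in> {1..n}" using P_ent e by blast
    then have "\<not> (\<exists>r r' c c'. r < r' \<and> r' < m \<and> c < c' \<and> c' < m \<and>
        d $$ (r, c) = 0 \<and> d $$ (r, c') = uvec i \<and> d $$ (r', c) = uvec i \<and> d $$ (r', c') = 0)"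
      by (rule P4[rule_format])
    then show False using z1 z2 b lt e(3) by blast
  qed
  ultimately show "c < c'" by simp
qed

lemma PmatI:
  assumes car: "d \<in> carrier_mat m m"
    and entry: "\<And>r c. r < m \<Longrightarrow> c < m \<Longrightarrow> d $$ (r, c) \<noteq> 0 \<Longrightarrow> \<exists>i\<in>{1..n}. d $$ (r, c) = uvec i"
    and row: "\<And>r c c' i j. ent d r c i \<Longrightarrow> ent d r c' j \<Longrightarrow> c = c'"
    and col: "\<And>r r' c i j. ent d r c i \<Longrightarrow> ent d r' c j \<Longrightarrow> r = r'"
    and order: "\<And>r r' c c' i. ent d r c i \<Longrightarrow> ent d r' c' i \<Longrightarrow> r < r' \<Longrightarrow> \<not> c' < c"
  shows "d \<in> Pmat n m"
proof -
  have dims: "dim_row d = m" "dim_col d = m" using car by auto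
  have e: "\<exists>i. ent d r c i" if "r < m" "c < m" "d $$ (r, c) \<noteq> 0" for r c
    using entry[OF that] that unfolding ent_def dims by force
  show ?thesis
    unfolding Pmat_def
  proof (intro CollectI conjI allI impI ballI car notI)
    fix r c assume "r < m" "c < m"
    then show "d $$ (r, c) \<in> insert 0 (uvec ` {1..n})" using entry[of r c] by blast
    fix c' assume "c' < m" "d $$ (r, c) \<noteq> 0 \<and> d $$ (r, c') \<noteq> 0"
    then show "c = c'" using e[of r c] e[of r c'] row \<open>r < m\<close> \<open>c < m\<close> by blast
  next
    fix r r' c assume "r < m" "r' < m" "c < m" "d $$ (r, c) \<noteq> 0 \<and> d $$ (r', c) \<noteq> 0"
    then show "r = r'" using e[of r c] e[of r' c] col by blast
  next
    fix i assume i: "i \<in> {1..n}" and "\<exists>r r' c c'. r < r' \<and> r' < m \<and> c < c' \<and> c' < m \<and>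
        d $$ (r, c) = 0 \<and> d $$ (r, c') = uvec i \<and> d $$ (r', c) = uvec i \<and> d $$ (r', c') = 0"
    then obtain r r' c c' where b: "r < r'" "r' < m" "c < c'" "c' < m"
      "d $$ (r, c') = uvec i" "d $$ (r', c) = uvec i" by blast
    have "ent d r c' i" "ent d r' c i" using b i unfolding ent_def dims by auto
    then show False using order b by blast
  qed
qed

lemma Pmat_eqI:
  assumes a: "a \<in> Pmat n m" and b: "b \<in> Pmat n m" and eq: "\<And>r c i. ent a r c i \<longleftrightarrow> ent b r c i"
  shows "a = b"
proof (rule eq_matI)
  show "dim_row a = dim_row b" "dim_col a = dim_col b" using PmatD(2,3)[OF a] PmatD(2,3)[OF b] by auto
  fix r c assume "r < dim_row b" "c < dim_col b"
  then have rc: "r < m" "c < m" using PmatD(2,3)[OF b] by auto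
  show "a $$ (r, c) = b $$ (r, c)"
  proof (cases "a $$ (r, c) = 0 \<and> b $$ (r, c) = 0")
    case False
    then obtain i where "ent a r c i" "ent b r c i"
      using Pmat_entry[OF a rc] Pmat_entry[OF b rc] eq by blast
    then show ?thesis unfolding ent_def by simp
  qed simp
qed

text \<open>At most one entry of a row of \<open>a\<close> is nonzero, so at most one summand of the
  matrix product survives and nothing can cancel modulo 2. Since \<open>uvec i * uvec j\<close> is
  zero for different colours, the product is composition of coloured relations.\<close>

lemma ent_mult:
  assumes a: "a \<in> Pmat n m" and b: "b \<in> Pmat n m"
  shows "ent (a * b) r c i \<longleftrightarrow> (\<exists>k. ent a r k i \<and> ent b k c i)"
    and "r < m \<Longrightarrow> c < m \<Longrightarrow> (a * b) $$ (r, c) \<noteq> 0 \<Longrightarrow> \<exists>k i. ent a r k i \<and> ent b k c i"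
proof -
  note da = PmatD(2,3)[OF a] and db = PmatD(2,3)[OF b]
  have prod: "(a * b) $$ (r, c) = (\<Sum>k<m. a $$ (r, k) * b $$ (k, c))" if "r < m" "c < m" for r c
    using that da db by (simp add: scalar_prod_def atLeast0LessThan)
  have one: "(a * b) $$ (r, c) = uvec i" if "ent a r k i" "ent b k c i" for r c k i
  proof -
    have rc: "r < m" "k < m" "c < m" "a $$ (r, k) = uvec i" "b $$ (k, c) = uvec i"
      using that da db unfolding ent_def by auto
    have "(\<Sum>k'<m. a $$ (r, k') * b $$ (k', c)) = (\<Sum>k'<m. if k' = k then uvec i else 0)"
    proof (rule sum.cong[OF refl])
      fix k' assume k': "k' \<in> {..<m}"
      show "a $$ (r, k') * b $$ (k', c) = (if k' = k then uvec i else 0)"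
      proof (cases "k' = k")
        case False
        have "a $$ (r, k') = 0"
        proof (rule ccontr)
          assume "a $$ (r, k') \<noteq> 0"
          then obtain j where "ent a r k' j" using Pmat_entry[OF a] rc k' by blast
          then show False using Pmat_row[OF a that(1)] False by blast
        qed
        then show ?thesis using False by simp
      qed (simp add: rc uvec_mult)
    qed
    then show ?thesis using rc by (simp add: prod)
  qed
  show two: "\<exists>k i. ent a r k i \<and> ent b k c i" if rc: "r < m" "c < m" and nz: "(a * b) $$ (r, c) \<noteq> 0" for r c
  proof -
    have "(\<Sum>k<m. a $$ (r, k) * b $$ (k, c)) \<noteq> 0" using nz rc by (simp add: prod)
    then obtain k where k: "k \<in> {..<m}" "a $$ (r, k) * b $$ (k, c) \<noteq> 0"
      by (rule sum.not_neutral_contains_not_neutral)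
    have "a $$ (r, k) \<noteq> 0" "b $$ (k, c) \<noteq> 0" using k(2) by (metis mult_zero_left, metis mult_zero_right)
    then obtain i j where ij: "ent a r k i" "ent b k c j"
      using Pmat_entry[OF a, of r k] Pmat_entry[OF b, of k c] k(1) rc by blast
    have "i = j"
      using k(2) ij unfolding ent_def by (auto simp: uvec_mult split: if_splits)
    then show ?thesis using ij by blast
  qed
  show "ent (a * b) r c i \<longleftrightarrow> (\<exists>k. ent a r k i \<and> ent b k c i)"
  proof
    assume e: "ent (a * b) r c i"
    then have rc: "r < m" "c < m" "(a * b) $$ (r, c) = uvec i" using da db unfolding ent_def by auto
    then obtain k j where k: "ent a r k j" "ent b k c j" using two[of r c] by auto
    then have "i = j" using one[OF k] rc by simp
    then show "\<exists>k. ent a r k i \<and> ent b k c i" using k by blast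
  next
    assume "\<exists>k. ent a r k i \<and> ent b k c i"
    then obtain k where k: "ent a r k i" "ent b k c i" by blast
    then show "ent (a * b) r c i" using one[OF k] da db unfolding ent_def by simp
  qed
qed

lemma Pmat_mult:
  assumes a: "a \<in> Pmat n m" and b: "b \<in> Pmat n m"
  shows "a * b \<in> Pmat n m"
proof (rule PmatI)
  show "a * b \<in> carrier_mat m m" using PmatD(1)[OF a] PmatD(1)[OF b] by simp
next
  fix r c assume rc: "r < m" "c < m" "(a * b) $$ (r, c) \<noteq> 0"
  then obtain k i where k: "ent a r k i" "ent b k c i" using ent_mult(2)[OF a b] by blast
  then have "ent (a * b) r c i" using ent_mult(1)[OF a b] by blast
  then show "\<exists>i\<in>{1..n}. (a * b) $$ (r, c) = uvec i" using Pmat_ent[OF a k(1)] unfolding ent_def by blast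
next
  fix r c c' i j assume "ent (a * b) r c i" "ent (a * b) r c' j"
  then obtain k k' where "ent a r k i" "ent b k c i" "ent a r k' j" "ent b k' c' j" using ent_mult(1)[OF a b] by blast
  then show "c = c'" using Pmat_row[OF a] Pmat_row[OF b] by metis
next
  fix r r' c i j assume "ent (a * b) r c i" "ent (a * b) r' c j"
  then obtain k k' where "ent a r k i" "ent b k c i" "ent a r' k' j" "ent b k' c j" using ent_mult(1)[OF a b] by blast
  then show "r = r'" using Pmat_col[OF a] Pmat_col[OF b] by metis
next
  fix r r' c c' i assume "ent (a * b) r c i" "ent (a * b) r' c' i" and lt: "r < r'"
  then obtain k k' where k: "ent a r k i" "ent b k c i" "ent a r' k' i" "ent b k' c' i" using ent_mult(1)[OF a b] by blast
  have "k < k'" using Pmat_order[OF a k(1,3) lt] .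
  then show "\<not> c' < c" using Pmat_order[OF b k(2,4)] by simp
qed

section \<open>Words, coverings and minimal matrices\<close>

definition states :: "nat \<Rightarrow> nat \<Rightarrow> nat list set" where
  "states n m = {s. length s = m \<and> set s \<subseteq> {0..n}}"

definition cl :: "nat \<Rightarrow> nat list \<Rightarrow> nat list" where
  "cl n s = map (count_list s) [0..<Suc n]"

text \<open>The submatrix of \<open>d\<close> that has entries \<open>u_i\<close> exactly in the rows \<open>r\<close> with \<open>s ! r = i\<close> and the
  columns \<open>c\<close> with \<open>t ! c = i\<close> is a permutation matrix.\<close>

definition cov :: "nat \<Rightarrow> nat \<Rightarrow> pmat \<Rightarrow> nat list \<Rightarrow> nat list \<Rightarrow> bool" where
  "cov n m d s t \<longleftrightarrow> s \<in> states n m \<and> t \<in> states n m \<and>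
     (\<forall>r<m. s ! r \<noteq> 0 \<longrightarrow> (\<exists>c. ent d r c (s ! r) \<and> t ! c = s ! r)) \<and>
     (\<forall>c<m. t ! c \<noteq> 0 \<longrightarrow> (\<exists>r. ent d r c (t ! c) \<and> s ! r = t ! c))"

lemma statesD: "s \<in> states n m \<Longrightarrow> length s = m" "s \<in> states n m \<Longrightarrow> r < m \<Longrightarrow> s ! r \<le> n"
  using nth_mem[of r s] by (auto simp: states_def subset_iff)

text \<open>A nonzero letter of \<open>u\<close> comes from an entry of \<open>a\<close> in a row
  coloured by \<open>s\<close>, and this entry forces the same letter in \<open>u'\<close>. By
  symmetry the zero letters agree as well.\<close>

lemma cov_row_uniq:
  assumes a: "a \<in> Pmat n m" and c1: "cov n m a s u" and c2: "cov n m a s u'"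
  shows "u = u'"
proof -
  have *: "u' ! c = u ! c" if cov: "cov n m a s u" "cov n m a s u'" and c: "c < m" "u ! c \<noteq> 0" for u u' c
  proof -
    obtain r where r: "ent a r c (u ! c)" "s ! r = u ! c" using cov(1) c unfolding cov_def by blast
    then have "r < m" using Pmat_ent[OF a] by blast
    then obtain c' where c': "ent a r c' (s ! r)" "u' ! c' = s ! r" using cov(2) r c unfolding cov_def by metis
    then show ?thesis using Pmat_row[OF a r(1) c'(1)] r by simp
  qed
  show ?thesis
  proof (rule nth_equalityI)
    show "length u = length u'" using c1 c2 unfolding cov_def states_def by simp
    fix c assume "c < length u"
    then have "c < m" using c1 unfolding cov_def states_def by simp
    then show "u ! c = u' ! c" using *[OF c1 c2] *[OF c2 c1] by metis
  qed
qed

lemma cov_mult: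
  assumes a: "a \<in> Pmat n m" and b: "b \<in> Pmat n m"
  shows "cov n m (a * b) s t \<longleftrightarrow> (\<exists>u. cov n m a s u \<and> cov n m b u t)"
proof
  assume "\<exists>u. cov n m a s u \<and> cov n m b u t"
  then obtain u where u: "cov n m a s u" "cov n m b u t" by blast
  show "cov n m (a * b) s t"
    unfolding cov_def
  proof (intro conjI allI impI)
    show "s \<in> states n m" "t \<in> states n m" using u by (auto simp: cov_def)
    fix r assume r: "r < m" "s ! r \<noteq> 0"
    then obtain k where k: "ent a r k (s ! r)" "u ! k = s ! r" using u(1) unfolding cov_def by blast
    then have "k < m" using Pmat_ent[OF a] by blast
    then obtain c where "ent b k c (s ! r)" "t ! c = s ! r" using u(2) k r unfolding cov_def by metis
    then show "\<exists>c. ent (a * b) r c (s ! r) \<and> t ! c = s ! r" using k ent_mult(1)[OF a b] by blast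
  next
    fix c assume c: "c < m" "t ! c \<noteq> 0"
    then obtain k where k: "ent b k c (t ! c)" "u ! k = t ! c" using u(2) unfolding cov_def by blast
    then have "k < m" using Pmat_ent[OF b] by blast
    then obtain r where "ent a r k (t ! c)" "s ! r = t ! c" using u(1) k c unfolding cov_def by metis
    then show "\<exists>r. ent (a * b) r c (t ! c) \<and> s ! r = t ! c" using k ent_mult(1)[OF a b] by blast
  qed
next
  assume cv: "cov n m (a * b) s t"
  \<comment> \<open>\<open>Q k i\<close> says that the index \<open>k\<close> is the middle of a
    path of colour \<open>i\<close> from a selected row of \<open>a\<close> to a selected column of
    \<open>b\<close>. The intermediate word records these colours, with \<open>0\<close> where no
    path passes.\<close>
  define Q where "Q k i \<longleftrightarrow> (\<exists>r c. ent a r k i \<and> s ! r = i \<and> ent b k c i \<and> t ! c = i)" for k i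
  have Qu: "i = j" if "Q k i" "Q k j" for k i j
    using that Pmat_col[OF a] unfolding Q_def by blast
  have Qn: "i \<in> {1..n}" if "Q k i" for k i using that Pmat_ent[OF a] unfolding Q_def by blast
  define u where "u = map (\<lambda>k. if \<exists>i. Q k i then THE i. Q k i else 0) [0..<m]"
  have uQ: "u ! k = i \<longleftrightarrow> Q k i" if "k < m" "i \<noteq> 0" for k i
  proof (cases "\<exists>i. Q k i")
    case True
    then obtain j where j: "Q k j" by blast
    then have "(THE i. Q k i) = j" using Qu by blast
    then have "u ! k = j" using True that by (simp add: u_def)
    then show ?thesis using j Qu by blast
  qed (use that in \<open>auto simp: u_def\<close>)
  have "u \<in> states n m"
  proof -
    have "u ! k \<le> n" if "k < m" for k
      using uQ[OF that, of "u ! k"] Qn[of k "u ! k"] by (cases "u ! k = 0") auto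
    moreover have "length u = m" by (simp add: u_def)
    ultimately show ?thesis by (auto simp: states_def in_set_conv_nth)
  qed
  have st: "s \<in> states n m" "t \<in> states n m" using cv by (auto simp: cov_def)
  have "cov n m a s u"
    unfolding cov_def
  proof (intro conjI allI impI st \<open>u \<in> states n m\<close>)
    fix r assume r: "r < m" "s ! r \<noteq> 0"
    then obtain c where c: "ent (a * b) r c (s ! r)" "t ! c = s ! r" using cv unfolding cov_def by blast
    then obtain k where k: "ent a r k (s ! r)" "ent b k c (s ! r)" using ent_mult(1)[OF a b] by blast
    then have "Q k (s ! r)" using c unfolding Q_def by blast
    moreover have "k < m" using Pmat_ent[OF a] k by blast
    ultimately show "\<exists>c. ent a r c (s ! r) \<and> u ! c = s ! r" using uQ r k by blast
  next
    fix k assume "k < m" "u ! k \<noteq> 0"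
    then have "Q k (u ! k)" using uQ by blast
    then show "\<exists>r. ent a r k (u ! k) \<and> s ! r = u ! k" unfolding Q_def by blast
  qed
  moreover have "cov n m b u t"
    unfolding cov_def
  proof (intro conjI allI impI st \<open>u \<in> states n m\<close>)
    fix c assume c: "c < m" "t ! c \<noteq> 0"
    then obtain r where r: "ent (a * b) r c (t ! c)" "s ! r = t ! c" using cv unfolding cov_def by blast
    then obtain k where k: "ent a r k (t ! c)" "ent b k c (t ! c)" using ent_mult(1)[OF a b] by blast
    then have "Q k (t ! c)" using r unfolding Q_def by blast
    moreover have "k < m" using Pmat_ent[OF b] k by blast
    ultimately show "\<exists>k. ent b k c (t ! c) \<and> u ! k = t ! c" using uQ c k by blast
  next
    fix k assume "k < m" "u ! k \<noteq> 0"
    then have "Q k (u ! k)" using uQ by blast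
    then show "\<exists>c. ent b k c (u ! k) \<and> t ! c = u ! k" unfolding Q_def by blast
  qed
  ultimately show "\<exists>u. cov n m a s u \<and> cov n m b u t" by blast
qed

lemma count_list_card: "count_list s i = card {r. r < length s \<and> s ! r = i}"
proof (induction s rule: rev_induct)
  case (snoc x s)
  have eq: "{r. r < length (s @ [x]) \<and> (s @ [x]) ! r = i} =
    {r. r < length s \<and> s ! r = i} \<union> (if x = i then {length s} else {})"
    by (auto simp: nth_append less_Suc_eq)
  show ?case unfolding eq using snoc by (simp add: card_insert_if)
qed simp

lemma cl_eq_iff: "cl n s = cl n t \<longleftrightarrow> (\<forall>i\<le>n. count_list s i = count_list t i)"
  by (auto simp: cl_def)

text \<open>The letter \<open>0\<close> need not be compared: its multiplicity is what the common
  length \<open>m\<close> leaves over.\<close>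

lemma cl_eqI:
  assumes s: "s \<in> states n m" and t: "t \<in> states n m"
    and eq: "\<And>i. i \<in> {1..n} \<Longrightarrow> count_list s i = count_list t i"
  shows "cl n s = cl n t"
proof -
  have "sum (count_list s) {0..n} = m" "sum (count_list t) {0..n} = m"
    using s t sum_count_set[of s "{0..n}"] sum_count_set[of t "{0..n}"] by (auto simp: states_def)
  moreover have "{0..n} = insert 0 {1..n}" by auto
  ultimately have "count_list s 0 + sum (count_list s) {1..n} = count_list t 0 + sum (count_list t) {1..n}"
    by simp
  moreover have "sum (count_list s) {1..n} = sum (count_list t) {1..n}" using eq by (intro sum.cong) auto
  ultimately have 0: "count_list s 0 = count_list t 0" by simp
  show ?thesis unfolding cl_eq_iff
  proof (intro allI impI)
    fix i assume "i \<le> n"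
    then show "count_list s i = count_list t i" using 0 eq[of i] by (cases "i = 0") auto
  qed
qed

lemma cov_cl:
  assumes a: "a \<in> Pmat n m" and cv: "cov n m a s t"
  shows "cl n s = cl n t"
proof (rule cl_eqI)
  show s: "s \<in> states n m" and t: "t \<in> states n m" using cv by (auto simp: cov_def)
  fix i assume i: "i \<in> {1..n}"
  note len = statesD(1)[OF s] statesD(1)[OF t]
  show "count_list s i = count_list t i"
    unfolding count_list_card len
  proof (rule antisym)
    show "card {r. r < m \<and> s ! r = i} \<le> card {r. r < m \<and> t ! r = i}"
    proof (rule card_le_if_inj_on_rel[where r = "\<lambda>r c. ent a r c i"])
      fix r assume "r \<in> {r. r < m \<and> s ! r = i}"
      then have "r < m" "s ! r = i" "s ! r \<noteq> 0" using i by auto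
      then obtain c where "ent a r c i" "t ! c = i" using cv unfolding cov_def by blast
      then show "\<exists>c. c \<in> {r. r < m \<and> t ! r = i} \<and> ent a r c i" using Pmat_ent[OF a] by blast
    qed (use Pmat_col[OF a] in auto)
    show "card {r. r < m \<and> t ! r = i} \<le> card {r. r < m \<and> s ! r = i}"
    proof (rule card_le_if_inj_on_rel[where r = "\<lambda>c r. ent a r c i"])
      fix c assume "c \<in> {r. r < m \<and> t ! r = i}"
      then have "c < m" "t ! c = i" "t ! c \<noteq> 0" using i by auto
      then obtain r where "ent a r c i" "s ! r = i" using cv unfolding cov_def by blast
      then show "\<exists>r. r \<in> {r. r < m \<and> s ! r = i} \<and> ent a r c i" using Pmat_ent[OF a] by blast
    qed (use Pmat_row[OF a] in auto)
  qed
qed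

text \<open>By condition (b) a matrix matches the \<open>k\<close>-th row of colour \<open>i\<close> with the \<open>k\<close>-th column of colour \<open>i\<close>.\<close>

definition rank :: "nat list \<Rightarrow> nat \<Rightarrow> nat" where
  "rank s r = card {r'. r' < r \<and> s ! r' = s ! r}"

lemma rank_less: "s ! r = s ! r' \<Longrightarrow> r < r' \<Longrightarrow> rank s r < rank s r'"
  unfolding rank_def by (intro psubset_card_mono) auto

lemma rank_inj: "s ! r = s ! r' \<Longrightarrow> rank s r = rank s r' \<Longrightarrow> r = r'"
  using rank_less[of s r r'] rank_less[of s r' r] by (cases r r' rule: linorder_cases) auto

lemma rank_less_count: "r < length s \<Longrightarrow> rank s r < count_list s (s ! r)"
  unfolding rank_def count_list_card by (intro psubset_card_mono) auto

lemma rank_surj: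
  assumes "k < count_list s i" shows "\<exists>r<length s. s ! r = i \<and> rank s r = k"
proof -
  let ?A = "{r. r < length s \<and> s ! r = i}"
  have "rank s ` ?A \<subseteq> {..<count_list s i}" using rank_less_count[of _ s] by auto
  moreover have "card (rank s ` ?A) = card {..<count_list s i}"
    using rank_inj[of s] by (subst card_image) (auto simp: inj_on_def count_list_card)
  ultimately have "rank s ` ?A = {..<count_list s i}" by (intro card_subset_eq) auto
  then have "k \<in> rank s ` ?A" using assms by simp
  then show ?thesis by auto
qed

text \<open>The least matrix covering \<open>(s, t)\<close>, used as \<open>D\<close> in
  \<open>zeta_semigroup\<close>. It pairs occurrences of equal rank; if the multiplicities disagree,
  the surplus occurrences stay unmatched and the result still lies in \<open>Pmat\<close>.\<close>

definition Dm :: "nat \<Rightarrow> nat list \<Rightarrow> nat list \<Rightarrow> pmat" where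
  "Dm m s t = mat m m (\<lambda>(r, c). if s ! r = t ! c \<and> s ! r \<noteq> 0 \<and> rank s r = rank t c then uvec (s ! r) else 0)"

lemma ent_Dm: "ent (Dm m s t) r c i \<longleftrightarrow>
    r < m \<and> c < m \<and> s ! r = i \<and> t ! c = i \<and> i \<noteq> 0 \<and> rank s r = rank t c"
proof (cases "r < m \<and> c < m")
  case True
  then have D: "Dm m s t $$ (r, c) = (if s ! r = t ! c \<and> s ! r \<noteq> 0 \<and> rank s r = rank t c then uvec (s ! r) else 0)"
    by (simp add: Dm_def)
  have dims: "dim_row (Dm m s t) = m" "dim_col (Dm m s t) = m" by (simp_all add: Dm_def)
  show ?thesis unfolding ent_def D dims using True
    by (cases "s ! r = t ! c \<and> s ! r \<noteq> 0 \<and> rank s r = rank t c") (simp, safe, simp_all)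
qed (auto simp: ent_def Dm_def)

lemma Dm_in:
  assumes s: "s \<in> states n m" and t: "t \<in> states n m"
  shows "Dm m s t \<in> Pmat n m"
proof (rule PmatI)
  show "Dm m s t \<in> carrier_mat m m" by (simp add: Dm_def)
  fix r c assume rc: "r < m" "c < m" "Dm m s t $$ (r, c) \<noteq> 0"
  then have "Dm m s t $$ (r, c) = uvec (s ! r)" "s ! r \<noteq> 0" by (auto simp: Dm_def split: if_splits)
  then show "\<exists>i\<in>{1..n}. Dm m s t $$ (r, c) = uvec i" using statesD(2)[OF s rc(1)] by force
next
  fix r r' c i j assume "ent (Dm m s t) r c i" "ent (Dm m s t) r' c j"
  then show "r = r'" unfolding ent_Dm using rank_inj by metis
next
  fix r c c' i j assume "ent (Dm m s t) r c i" "ent (Dm m s t) r c' j"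
  then show "c = c'" unfolding ent_Dm using rank_inj by metis
next
  fix r r' c c' i assume e: "ent (Dm m s t) r c i" "ent (Dm m s t) r' c' i" and "r < r'"
  then have "rank s r < rank s r'" using rank_less[of s r r'] unfolding ent_Dm by simp
  then have "rank t c < rank t c'" using e unfolding ent_Dm by simp
  then show "\<not> c' < c" using rank_less[of t c' c] e unfolding ent_Dm by auto
qed

lemma Dm_cov:
  assumes s: "s \<in> states n m" and t: "t \<in> states n m" and eq: "cl n s = cl n t"
  shows "cov n m (Dm m s t) s t"
  unfolding cov_def
proof (intro conjI allI impI s t)
  note len = statesD(1)[OF s] statesD(1)[OF t]
  fix r assume r: "r < m" "s ! r \<noteq> 0"
  have "rank s r < count_list t (s ! r)"
    using rank_less_count[of r s] len r eq statesD(2)[OF s r(1)] by (simp add: cl_eq_iff)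
  then show "\<exists>c. ent (Dm m s t) r c (s ! r) \<and> t ! c = s ! r"
    using rank_surj[of "rank s r" t "s ! r"] r len unfolding ent_Dm by metis
next
  note len = statesD(1)[OF s] statesD(1)[OF t]
  fix c assume c: "c < m" "t ! c \<noteq> 0"
  have "rank t c < count_list s (t ! c)"
    using rank_less_count[of c t] len c eq statesD(2)[OF t c(1)] by (simp add: cl_eq_iff)
  then show "\<exists>r. ent (Dm m s t) r c (t ! c) \<and> s ! r = t ! c"
    using rank_surj[of "rank t c" s "t ! c"] c len unfolding ent_Dm by metis
qed

text \<open>By monotonicity within a colour, the selected rows of colour \<open>i\<close> above
  \<open>r\<close> are matched injectively with the selected columns of colour \<open>i\<close> left
  of \<open>c\<close>, and conversely. So both ranks count the same number.\<close>

lemma cov_rank: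
  assumes a: "a \<in> Pmat n m" and cv: "cov n m a s t"
    and e: "ent a r c i" "s ! r = i" "t ! c = i"
  shows "rank s r = rank t c"
  unfolding rank_def e(2,3)
proof (rule antisym)
  have i: "i \<noteq> 0" "r < m" "c < m" using Pmat_ent[OF a e(1)] by auto
  show "card {r'. r' < r \<and> s ! r' = i} \<le> card {r'. r' < c \<and> t ! r' = i}"
  proof (rule card_le_if_inj_on_rel[where r = "\<lambda>r c. ent a r c i"])
    fix r' assume "r' \<in> {r'. r' < r \<and> s ! r' = i}"
    then have r': "r' < r" "r' < m" "s ! r' = i" "s ! r' \<noteq> 0" using i by auto
    then obtain c' where c': "ent a r' c' i" "t ! c' = i" using cv unfolding cov_def by blast
    then show "\<exists>c'. c' \<in> {r'. r' < c \<and> t ! r' = i} \<and> ent a r' c' i"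
      using Pmat_order[OF a c'(1) e(1) r'(1)] by blast
  qed (use Pmat_col[OF a] in auto)
  show "card {r'. r' < c \<and> t ! r' = i} \<le> card {r'. r' < r \<and> s ! r' = i}"
  proof (rule card_le_if_inj_on_rel[where r = "\<lambda>c r. ent a r c i"])
    fix c' assume "c' \<in> {r'. r' < c \<and> t ! r' = i}"
    then have c': "c' < c" "c' < m" "t ! c' = i" "t ! c' \<noteq> 0" using i by auto
    then obtain r' where r': "ent a r' c' i" "s ! r' = i" using cv unfolding cov_def by blast
    have "r' \<noteq> r" using Pmat_row[OF a r'(1), of c i] e c' by auto
    moreover have "\<not> r < r'" using Pmat_order[OF a e(1) r'(1)] c' by auto
    ultimately have "r' < r" by simp
    then show "\<exists>r'. r' \<in> {r'. r' < r \<and> s ! r' = i} \<and> ent a r' c' i" using r' by auto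
  qed (use Pmat_row[OF a] in auto)
qed

text \<open>Minimality of \<open>Dm m s t\<close>. The column that \<open>a\<close> matches with the
  row \<open>r\<close> has the same rank by \<open>cov_rank\<close>, and a column of given colour is
  determined by its rank.\<close>

lemma ent_Dm_imp:
  assumes a: "a \<in> Pmat n m" and cv: "cov n m a s t" and D: "ent (Dm m s t) r c i"
  shows "ent a r c i"
proof -
  have d: "r < m" "c < m" "s ! r = i" "t ! c = i" "i \<noteq> 0" "rank s r = rank t c"
    using D unfolding ent_Dm by auto
  then obtain c' where c': "ent a r c' i" "t ! c' = i" using cv unfolding cov_def by blast
  then have "rank s r = rank t c'" using cov_rank[OF a cv c'(1)] d by simp
  then have "c = c'" using rank_inj[of t c c'] d c' by simp
  then show ?thesis using c' by simp
qed

lemma cov_mono: "cov n m a s t \<Longrightarrow> (\<And>r c i. ent a r c i \<Longrightarrow> ent b r c i) \<Longrightarrow> cov n m b s t"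
  unfolding cov_def by blast

lemma cov_iff:
  assumes a: "a \<in> Pmat n m" and s: "s \<in> states n m" and t: "t \<in> states n m" and eq: "cl n s = cl n t"
  shows "cov n m a s t \<longleftrightarrow> (\<forall>r c i. ent (Dm m s t) r c i \<longrightarrow> ent a r c i)"
  using ent_Dm_imp[OF a] cov_mono[OF Dm_cov[OF s t eq]] by blast

text \<open>Colour each row and column by its entry, and by \<open>0\<close> if it is empty. Then
  every entry of \<open>d\<close> is selected, and \<open>cov_rank\<close> identifies these entries
  with those of \<open>Dm m s t\<close>.\<close>

lemma Pmat_Dm:
  assumes d: "d \<in> Pmat n m"
  shows "\<exists>s\<in>states n m. \<exists>t\<in>states n m. cl n s = cl n t \<and> d = Dm m s t"
proof -
  define f where "f r = (if \<exists>c i. ent d r c i then THE i. \<exists>c. ent d r c i else 0)" for r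
  define g where "g c = (if \<exists>r i. ent d r c i then THE i. \<exists>r. ent d r c i else 0)" for c
  have f: "f r = i" if "ent d r c i" for r c i
  proof -
    have "(THE i. \<exists>c. ent d r c i) = i"
      using that Pmat_row[OF d] by (intro the_equality) blast+
    then show ?thesis using that unfolding f_def by auto
  qed
  have g: "g c = i" if "ent d r c i" for r c i
  proof -
    have "(THE i. \<exists>r. ent d r c i) = i"
      using that Pmat_col[OF d] by (intro the_equality) blast+
    then show ?thesis using that unfolding g_def by auto
  qed
  have f0: "\<exists>c. ent d r c (f r)" if "f r \<noteq> 0" for r
  proof -
    obtain c i where "ent d r c i" using \<open>f r \<noteq> 0\<close> unfolding f_def by presburger
    then show ?thesis using f by blast
  qed
  have g0: "\<exists>r. ent d r c (g c)" if "g c \<noteq> 0" for c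
  proof -
    obtain r i where "ent d r c i" using \<open>g c \<noteq> 0\<close> unfolding g_def by presburger
    then show ?thesis using g by blast
  qed
  define s where "s = map f [0..<m]"
  define t where "t = map g [0..<m]"
  have "f r \<le> n" for r using f0[of r] Pmat_ent[OF d] by (cases "f r = 0") auto
  then have s: "s \<in> states n m" unfolding states_def s_def by auto
  have "g c \<le> n" for c using g0[of c] Pmat_ent[OF d] by (cases "g c = 0") auto
  then have t: "t \<in> states n m" unfolding states_def t_def by auto
  have sn: "s ! r = f r" "t ! r = g r" if "r < m" for r using that by (auto simp: s_def t_def)
  have cv: "cov n m d s t"
    unfolding cov_def
  proof (intro conjI allI impI s t)
    fix r assume "r < m" "s ! r \<noteq> 0"
    then obtain c where c: "r < m" "ent d r c (f r)" using f0[of r] sn(1)[of r] by auto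
    then have "c < m" using Pmat_ent[OF d] by blast
    then show "\<exists>c. ent d r c (s ! r) \<and> t ! c = s ! r"
      using sn(1)[OF c(1)] sn(2)[of c] g[OF c(2)] c(2) by auto
  next
    fix c assume "c < m" "t ! c \<noteq> 0"
    then obtain r where r: "c < m" "ent d r c (g c)" using g0[of c] sn(2)[of c] by auto
    then have "r < m" using Pmat_ent[OF d] by blast
    then show "\<exists>r. ent d r c (t ! c) \<and> s ! r = t ! c"
      using sn(2)[OF r(1)] sn(1)[of r] f[OF r(2)] r(2) by auto
  qed
  have eq: "cl n s = cl n t" using cov_cl[OF d cv] .
  have "d = Dm m s t"
  proof (rule Pmat_eqI[OF d Dm_in[OF s t]])
    fix r c i
    show "ent d r c i \<longleftrightarrow> ent (Dm m s t) r c i"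
    proof
      assume e: "ent d r c i"
      then have rc: "r < m" "c < m" "i \<noteq> 0" using Pmat_ent[OF d e] by auto
      have "s ! r = i" "t ! c = i" using f[OF e] g[OF e] sn rc by auto
      then show "ent (Dm m s t) r c i" unfolding ent_Dm using rc cov_rank[OF d cv e] by simp
    qed (rule ent_Dm_imp[OF d cv])
  qed
  then show ?thesis using s t eq by blast
qed

lemma Dm_antisym:
  assumes st: "s \<in> states n m" "t \<in> states n m" "cl n s = cl n t"
    and c1: "cov n m (Dm m s t) s' t'" and c2: "cov n m (Dm m s' t') s t"
  shows "s = s' \<and> t = t'"
proof -
  have st': "s' \<in> states n m" "t' \<in> states n m" using c1 unfolding cov_def by auto
  note len = statesD(1)[OF st(1)] statesD(1)[OF st(2)] statesD(1)[OF st'(1)] statesD(1)[OF st'(2)]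
  have "s ! r = s' ! r" if "r < m" for r
    using c1 c2 that unfolding cov_def ent_Dm by metis
  moreover have "t ! r = t' ! r" if "r < m" for r
    using c1 c2 that unfolding cov_def ent_Dm by metis
  ultimately show ?thesis using len by (auto intro: nth_equalityI)
qed

lemma finite_states: "finite (states n m)"
  using finite_lists_length_eq[of "{0..n}" m] by (simp add: states_def conj_commute)

lemma finite_Pmat: "finite (Pmat n m)"
proof -
  have "Pmat n m \<subseteq> (\<lambda>(s, t). Dm m s t) ` (states n m \<times> states n m)" using Pmat_Dm by fastforce
  then show ?thesis using finite_states finite_subset by blast
qed

section \<open>The algebras \<open>\<complex>P_m\<close>\<close>

definition Zs :: "nat \<Rightarrow> nat \<Rightarrow> (pmat \<Rightarrow> complex) \<Rightarrow> nat list \<Rightarrow> nat list \<Rightarrow> complex" where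
  "Zs n m f s t = (\<Sum>a\<in>Pmat n m. if cov n m a s t then f a else 0)"

section \<open>Block diagonal sums and the unit\<close>

lemma block_diag_dims:
  assumes "a \<in> Pmat n m1" "b \<in> Pmat n m2"
  shows "dim_row (block_diag a b) = m1 + m2" "dim_col (block_diag a b) = m1 + m2"
  using PmatD(2,3)[OF assms(1)] PmatD(2,3)[OF assms(2)] by (auto simp: block_diag_def)

lemma block_diag_index:
  assumes a: "a \<in> Pmat n m1" and b: "b \<in> Pmat n m2" and rc: "r < m1 + m2" "c < m1 + m2"
  shows "block_diag a b $$ (r, c) = (if r < m1 then if c < m1 then a $$ (r, c) else 0
    else if c < m1 then 0 else b $$ (r - m1, c - m1))"
  using PmatD(2,3)[OF a] PmatD(2,3)[OF b] rc by (auto simp: block_diag_def)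

lemma ent_block_diag:
  assumes a: "a \<in> Pmat n m1" and b: "b \<in> Pmat n m2"
  shows "ent (block_diag a b) r c i \<longleftrightarrow> ent a r c i \<or> m1 \<le> r \<and> m1 \<le> c \<and> ent b (r - m1) (c - m1) i"
proof (cases "r < m1 + m2 \<and> c < m1 + m2")
  case True
  have z: "(0 = uvec i) = False" by simp
  have lt: "\<not> r < m1 \<Longrightarrow> r - m1 < m2" "\<not> c < m1 \<Longrightarrow> c - m1 < m2" using True by auto
  show ?thesis
    unfolding ent_def block_diag_dims[OF a b] PmatD(2,3)[OF a] PmatD(2,3)[OF b]
    using True by (cases "r < m1"; cases "c < m1") (simp_all add: block_diag_index[OF a b] z lt)
next
  case False
  then show ?thesis
    unfolding ent_def block_diag_dims[OF a b] PmatD(2,3)[OF a] PmatD(2,3)[OF b] by auto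
qed

text \<open>Two entries in different blocks are automatically in increasing position, so condition
  (b) can fail only inside one block.\<close>

lemma block_diag_in:
  assumes a: "a \<in> Pmat n m1" and b: "b \<in> Pmat n m2"
  shows "block_diag a b \<in> Pmat n (m1 + m2)"
proof (rule PmatI)
  show "block_diag a b \<in> carrier_mat (m1 + m2) (m1 + m2)" using block_diag_dims[OF a b] by auto
  note e = ent_block_diag[OF a b]
  fix r c assume rc: "r < m1 + m2" "c < m1 + m2" "block_diag a b $$ (r, c) \<noteq> 0"
  have "\<exists>i\<in>{1..n}. ent a r c i \<or> m1 \<le> r \<and> m1 \<le> c \<and> ent b (r - m1) (c - m1) i"
  proof (cases "r < m1")
    case True
    then have "c < m1" "a $$ (r, c) \<noteq> 0" using rc by (auto simp: block_diag_index[OF a b] split: if_splits)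
    then show ?thesis using Pmat_entry[OF a True] by blast
  next
    case False
    then have "\<not> c < m1" "b $$ (r - m1, c - m1) \<noteq> 0"
      using rc by (auto simp: block_diag_index[OF a b] split: if_splits)
    then show ?thesis using Pmat_entry[OF b, of "r - m1" "c - m1"] False rc by force
  qed
  then show "\<exists>i\<in>{1..n}. block_diag a b $$ (r, c) = uvec i" unfolding e[symmetric] by (auto simp: ent_def)
next
  note e = ent_block_diag[OF a b]
  have in_a: "ent a r c i" if "ent (block_diag a b) r c i" "r < m1 \<or> c < m1" for r c i
    using that unfolding e by auto
  have in_b: "m1 \<le> r" "m1 \<le> c" "ent b (r - m1) (c - m1) i"
    if "ent (block_diag a b) r c i" "\<not> r < m1 \<or> \<not> c < m1" for r c i
    using that Pmat_ent[OF a, of r c i] unfolding e by auto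
  {
    fix r c c' i j assume h: "ent (block_diag a b) r c i" "ent (block_diag a b) r c' j"
    show "c = c'"
    proof (cases "r < m1")
      case True
      then show ?thesis using in_a[OF h(1)] in_a[OF h(2)] Pmat_row[OF a] by blast
    next
      case False
      then have "c - m1 = c' - m1" using in_b(3)[OF h(1)] in_b(3)[OF h(2)] Pmat_row[OF b] by blast
      then show ?thesis using in_b(2)[OF h(1)] in_b(2)[OF h(2)] False by simp
    qed
  next
    fix r r' c i j assume h: "ent (block_diag a b) r c i" "ent (block_diag a b) r' c j"
    show "r = r'"
    proof (cases "c < m1")
      case True
      then show ?thesis using in_a[OF h(1)] in_a[OF h(2)] Pmat_col[OF a] by blast
    next
      case False
      then have "r - m1 = r' - m1" using in_b(3)[OF h(1)] in_b(3)[OF h(2)] Pmat_col[OF b] by blast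
      then show ?thesis using in_b(1)[OF h(1)] in_b(1)[OF h(2)] False by simp
    qed
  next
    fix r r' c c' i assume h: "ent (block_diag a b) r c i" "ent (block_diag a b) r' c' i" and lt: "r < r'"
    show "\<not> c' < c"
    proof
      assume lt': "c' < c"
      show False
      proof (cases "c < m1")
        case True
        then have "c < c'" using in_a[OF h(1)] in_a[OF h(2)] Pmat_order[OF a _ _ lt] lt' by auto
        then show False using lt' by simp
      next
        case False
        then have 1: "m1 \<le> r" "ent b (r - m1) (c - m1) i" using in_b[OF h(1)] by auto
        then have 2: "m1 \<le> c'" "ent b (r' - m1) (c' - m1) i" using in_b[OF h(2)] lt by auto
        have "c - m1 < c' - m1" using Pmat_order[OF b 1(2) 2(2)] lt 1(1) by simp
        then show False using lt' by simp
      qed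
    qed
  }
qed

lemma states_append:
  assumes "length s1 = m1" "length s2 = m2"
  shows "s1 @ s2 \<in> states n (m1 + m2) \<longleftrightarrow> s1 \<in> states n m1 \<and> s2 \<in> states n m2"
  using assms by (auto simp: states_def)

lemma cov_block_diag:
  assumes a: "a \<in> Pmat n m1" and b: "b \<in> Pmat n m2"
    and len: "length s1 = m1" "length t1 = m1" "length s2 = m2" "length t2 = m2"
  shows "cov n (m1 + m2) (block_diag a b) (s1 @ s2) (t1 @ t2) \<longleftrightarrow> cov n m1 a s1 t1 \<and> cov n m2 b s2 t2"
proof
  note e = ent_block_diag[OF a b]
  assume c: "cov n (m1 + m2) (block_diag a b) (s1 @ s2) (t1 @ t2)"
  have st: "s1 \<in> states n m1" "s2 \<in> states n m2" "t1 \<in> states n m1" "t2 \<in> states n m2"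
    using c len unfolding cov_def by (auto simp: states_append)
  have R: "\<exists>c. ent (block_diag a b) r c ((s1 @ s2) ! r) \<and> (t1 @ t2) ! c = (s1 @ s2) ! r"
    if "r < m1 + m2" "(s1 @ s2) ! r \<noteq> 0" for r using c that unfolding cov_def by blast
  have C: "\<exists>r. ent (block_diag a b) r c ((t1 @ t2) ! c) \<and> (s1 @ s2) ! r = (t1 @ t2) ! c"
    if "c < m1 + m2" "(t1 @ t2) ! c \<noteq> 0" for c using c that unfolding cov_def by blast
  show "cov n m1 a s1 t1 \<and> cov n m2 b s2 t2"
    unfolding cov_def
  proof (intro conjI allI impI st)
    fix r assume r: "r < m1" "s1 ! r \<noteq> 0"
    then obtain c where "ent (block_diag a b) r c (s1 ! r)" "(t1 @ t2) ! c = s1 ! r"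
      using R[of r] len by (auto simp: nth_append)
    moreover from this have "ent a r c (s1 ! r)" using r unfolding e by auto
    ultimately show "\<exists>c. ent a r c (s1 ! r) \<and> t1 ! c = s1 ! r"
      using Pmat_ent[OF a] len by (auto simp: nth_append)
  next
    fix c assume c: "c < m1" "t1 ! c \<noteq> 0"
    then obtain r where "ent (block_diag a b) r c (t1 ! c)" "(s1 @ s2) ! r = t1 ! c"
      using C[of c] len by (auto simp: nth_append)
    moreover from this have "ent a r c (t1 ! c)" using c unfolding e by auto
    ultimately show "\<exists>r. ent a r c (t1 ! c) \<and> s1 ! r = t1 ! c"
      using Pmat_ent[OF a] len by (auto simp: nth_append)
  next
    fix r assume r: "r < m2" "s2 ! r \<noteq> 0"
    then obtain c where "ent (block_diag a b) (m1 + r) c (s2 ! r)" "(t1 @ t2) ! c = s2 ! r"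
      using R[of "m1 + r"] len by (auto simp: nth_append)
    moreover from this have "m1 \<le> c" "ent b r (c - m1) (s2 ! r)" using r Pmat_ent[OF a, of "m1 + r" c] unfolding e by auto
    ultimately show "\<exists>c. ent b r c (s2 ! r) \<and> t2 ! c = s2 ! r"
      using len by (auto simp: nth_append)
  next
    fix c assume c: "c < m2" "t2 ! c \<noteq> 0"
    then obtain r where "ent (block_diag a b) r (m1 + c) (t2 ! c)" "(s1 @ s2) ! r = t2 ! c"
      using C[of "m1 + c"] len by (auto simp: nth_append)
    moreover from this have "m1 \<le> r" "ent b (r - m1) c (t2 ! c)" using c Pmat_ent[OF a, of r "m1 + c"] unfolding e by auto
    ultimately show "\<exists>r. ent b r c (t2 ! c) \<and> s2 ! r = t2 ! c"
      using len by (auto simp: nth_append)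
  qed
next
  note e = ent_block_diag[OF a b]
  assume "cov n m1 a s1 t1 \<and> cov n m2 b s2 t2"
  then have c1: "cov n m1 a s1 t1" and c2: "cov n m2 b s2 t2" by auto
  show "cov n (m1 + m2) (block_diag a b) (s1 @ s2) (t1 @ t2)"
    unfolding cov_def
  proof (intro conjI allI impI)
    show "s1 @ s2 \<in> states n (m1 + m2)" "t1 @ t2 \<in> states n (m1 + m2)"
      using c1 c2 len unfolding cov_def by (auto simp: states_append)
    fix r assume r: "r < m1 + m2" "(s1 @ s2) ! r \<noteq> 0"
    show "\<exists>c. ent (block_diag a b) r c ((s1 @ s2) ! r) \<and> (t1 @ t2) ! c = (s1 @ s2) ! r"
    proof (cases "r < m1")
      case True
      then have "(s1 @ s2) ! r = s1 ! r" using len by (simp add: nth_append)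
      moreover from this obtain c where "ent a r c (s1 ! r)" "t1 ! c = s1 ! r" using c1 r True unfolding cov_def by auto
      moreover from this have "c < m1" using Pmat_ent[OF a] by blast
      ultimately show ?thesis unfolding e using len by (auto simp: nth_append)
    next
      case False
      then have s: "(s1 @ s2) ! r = s2 ! (r - m1)" using len by (simp add: nth_append)
      moreover obtain c where "ent b (r - m1) c (s2 ! (r - m1))" "t2 ! c = s2 ! (r - m1)"
        using c2 r False s unfolding cov_def by (auto dest: spec[of _ "r - m1"])
      ultimately show ?thesis unfolding e using len False by (intro exI[of _ "m1 + c"]) (simp add: nth_append)
    qed
  next
    fix c assume c: "c < m1 + m2" "(t1 @ t2) ! c \<noteq> 0"
    show "\<exists>r. ent (block_diag a b) r c ((t1 @ t2) ! c) \<and> (s1 @ s2) ! r = (t1 @ t2) ! c"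
    proof (cases "c < m1")
      case True
      then have "(t1 @ t2) ! c = t1 ! c" using len by (simp add: nth_append)
      moreover from this obtain r where "ent a r c (t1 ! c)" "s1 ! r = t1 ! c" using c1 c True unfolding cov_def by auto
      moreover from this have "r < m1" using Pmat_ent[OF a] by blast
      ultimately show ?thesis unfolding e using len by (auto simp: nth_append)
    next
      case False
      then have s: "(t1 @ t2) ! c = t2 ! (c - m1)" using len by (simp add: nth_append)
      moreover obtain r where "ent b r (c - m1) (t2 ! (c - m1))" "s2 ! r = t2 ! (c - m1)"
        using c2 c False s unfolding cov_def by (auto dest: spec[of _ "c - m1"])
      ultimately show ?thesis unfolding e using len False by (intro exI[of _ "m1 + r"]) (simp add: nth_append)
    qed
  qed
qed

text \<open>A block diagonal matrix covers a pair of concatenated words exactly if each block covers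
  its part. The transform is therefore multiplicative, which gives both the unit and the embeddings
  \<open>psi\<close> letter by letter.\<close>

lemma Zs_tens:
  assumes len: "length s1 = m1" "length t1 = m1" "length s2 = m2" "length t2 = m2"
  shows "Zs n (m1 + m2) (tens n m1 m2 f g) (s1 @ s2) (t1 @ t2) = Zs n m1 f s1 t1 * Zs n m2 g s2 t2"
proof -
  let ?P = "Pmat n m1 \<times> Pmat n m2" and ?c = "\<lambda>d. cov n (m1 + m2) d (s1 @ s2) (t1 @ t2)"
    and ?b = "\<lambda>p. block_diag (fst p) (snd p)"
  have "Zs n (m1 + m2) (tens n m1 m2 f g) (s1 @ s2) (t1 @ t2) =
    (\<Sum>d\<in>Pmat n (m1 + m2). \<Sum>p\<in>{p. p \<in> ?P \<and> ?b p = d}. if ?c (?b p) then f (fst p) * g (snd p) else 0)"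
    unfolding Zs_def tens_def
  proof (rule sum.cong[OF refl])
    fix d
    have eq: "{(a, b). a \<in> Pmat n m1 \<and> b \<in> Pmat n m2 \<and> block_diag a b = d} = {p. p \<in> ?P \<and> ?b p = d}" by auto
    show "(if ?c d then \<Sum>(a, b)\<in>{(a, b). a \<in> Pmat n m1 \<and> b \<in> Pmat n m2 \<and> block_diag a b = d}. f a * g b else 0) =
      (\<Sum>p\<in>{p. p \<in> ?P \<and> ?b p = d}. if ?c (?b p) then f (fst p) * g (snd p) else 0)"
      unfolding eq by (auto simp: case_prod_unfold intro!: sum.cong sum.neutral[symmetric])
  qed
  also have "\<dots> = (\<Sum>p\<in>?P. if ?c (?b p) then f (fst p) * g (snd p) else 0)"
    using block_diag_in by (intro sum.group finite_cartesian_product finite_Pmat) auto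
  also have "\<dots> = (\<Sum>p\<in>?P. (if cov n m1 (fst p) s1 t1 then f (fst p) else 0) * (if cov n m2 (snd p) s2 t2 then g (snd p) else 0))"
  proof (rule sum.cong[OF refl])
    fix p assume "p \<in> ?P"
    then have p: "fst p \<in> Pmat n m1" "snd p \<in> Pmat n m2" by auto
    show "(if ?c (?b p) then f (fst p) * g (snd p) else 0) =
      (if cov n m1 (fst p) s1 t1 then f (fst p) else 0) * (if cov n m2 (snd p) s2 t2 then g (snd p) else 0)"
      unfolding cov_block_diag[OF p len] by simp
  qed
  also have "\<dots> = Zs n m1 f s1 t1 * Zs n m2 g s2 t2"
    unfolding Zs_def sum_product sum.cartesian_product by (simp add: case_prod_unfold)
  finally show ?thesis .
qed

lemma tens_supp: "d \<notin> Pmat n (m1 + m2) \<Longrightarrow> tens n m1 m2 f g d = 0"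
  unfolding tens_def using block_diag_in by (intro sum.neutral) auto

lemma Zs_delta: "a \<in> Pmat n m \<Longrightarrow> Zs n m (delta a) s t = (if cov n m a s t then 1 else 0)"
proof -
  assume a: "a \<in> Pmat n m"
  have "Zs n m (delta a) s t = (\<Sum>b\<in>Pmat n m. if b = a then (if cov n m a s t then 1 else 0) else 0)"
    unfolding Zs_def by (rule sum.cong) (auto simp: delta_apply)
  then show ?thesis using a finite_Pmat by simp
qed

lemma Zs_add: "Zs n m (f + g) s t = Zs n m f s t + Zs n m g s t"
  unfolding Zs_def sum.distrib[symmetric] by (rule sum.cong) (auto simp: plus_fun_apply)

lemma Zs_scale: "Zs n m (cscale c f) s t = c * Zs n m f s t"
  unfolding Zs_def sum_distrib_left by (rule sum.cong) (auto simp: fun_simps)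

lemma Zs_diff: "Zs n m (f - g) s t = Zs n m f s t - Zs n m g s t"
  unfolding Zs_def sum_subtractf[symmetric] by (rule sum.cong) (auto simp: minus_apply)

lemma Zs_sum: "Zs n m (\<Sum>i\<in>I. f i) s t = (\<Sum>i\<in>I. Zs n m (f i) s t)"
proof (induction I rule: infinite_finite_induct)
  case empty
  then show ?case by (simp add: Zs_def zero_fun_apply cong: if_cong)
next
  case (infinite I)
  then show ?case by (simp add: Zs_def zero_fun_apply cong: if_cong)
qed (simp add: Zs_add)

definition imat :: "nat \<Rightarrow> pmat" where "imat k = mat 1 1 (\<lambda>_. if k = 0 then 0 else uvec k)"

lemma ent_imat: "ent (imat k) r c i \<longleftrightarrow> r = 0 \<and> c = 0 \<and> i = k \<and> k \<noteq> 0"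
  by (cases "r = 0 \<and> c = 0"; cases "k = 0") (auto simp: ent_def imat_def)

lemma imat_in: "k \<le> n \<Longrightarrow> imat k \<in> Pmat n 1"
  by (rule PmatI, unfold ent_imat) (auto simp: imat_def split: if_splits)

lemma Zs_Ielt:
  assumes "k \<le> n" "i \<le> n" "j \<le> n"
  shows "Zs n 1 (Ielt k) [i] [j] = (if i = j \<and> (i = 0 \<or> i = k) then 1 else 0)"
proof -
  have "Ielt k = delta (imat k)" by (simp add: Ielt_def imat_def)
  moreover have "cov n 1 (imat k) [i] [j] \<longleftrightarrow> i = j \<and> (i = 0 \<or> i = k)"
    unfolding cov_def ent_imat states_def using assms by auto
  ultimately show ?thesis using Zs_delta[OF imat_in[OF assms(1)]] by simp
qed

text \<open>This explains the coefficient in \<open>unit1\<close>: at the letter \<open>0\<close>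
  all \<open>n\<close> matrices \<open>(u_k)\<close> and the zero matrix cover, giving
  \<open>n - (n - 1) = 1\<close>; at a letter \<open>i > 0\<close> only \<open>(u_i)\<close>
  does.\<close>

lemma Zs_unit1:
  assumes "i \<le> n" "j \<le> n"
  shows "Zs n 1 (unit1 n) [i] [j] = (if i = j then 1 else 0)"
proof -
  have "Zs n 1 (unit1 n) [i] [j] = (\<Sum>k\<in>{1..n}. if i = j \<and> (i = 0 \<or> i = k) then 1 else 0)
      - (of_nat n - 1) * (if i = j \<and> i = 0 then 1 else 0)"
    unfolding unit1_def Zs_diff Zs_sum Zs_scale using assms by (simp add: Zs_Ielt[where n=n] del: One_nat_def cong: if_cong)
  also have "\<dots> = (if i = j then 1 else 0)"
  proof (cases "i = j \<and> i \<noteq> 0")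
    case True
    then have "(\<Sum>k\<in>{1..n}. if i = j \<and> (i = 0 \<or> i = k) then 1 else 0 :: complex) = (\<Sum>k\<in>{1..n}. if k = i then 1 else 0)"
      by (intro sum.cong) auto
    also have "\<dots> = 1" using True assms by simp
    finally show ?thesis using True by simp
  next
    case False
    then show ?thesis by (cases "i = j") simp_all
  qed
  finally show ?thesis .
qed

lemma states_Suc: "s \<in> states n (Suc m) \<longleftrightarrow> (\<exists>s' i. s = s' @ [i] \<and> s' \<in> states n m \<and> i \<le> n)"
proof
  assume s: "s \<in> states n (Suc m)"
  then have "s \<noteq> []" by (auto simp: states_def)
  then have "s = butlast s @ [last s]" by simp
  moreover have "last s \<le> n" "butlast s \<in> states n m"
    using s last_in_set[OF \<open>s \<noteq> []\<close>] in_set_butlastD[of _ s] by (fastforce simp: states_def)+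
  ultimately show "\<exists>s' i. s = s' @ [i] \<and> s' \<in> states n m \<and> i \<le> n" by blast
qed (auto simp: states_def)

lemma unit_supp: "d \<notin> Pmat n m \<Longrightarrow> unit_elt n m d = 0"
proof (cases m)
  case 0
  assume "d \<notin> Pmat n m"
  moreover have "0\<^sub>m 0 0 \<in> Pmat n 0" by (auto simp: Pmat_def)
  ultimately show ?thesis using 0 by (auto simp: delta_apply)
next
  case (Suc k)
  assume "d \<notin> Pmat n m"
  then show ?thesis using Suc tens_supp[of d n k 1] by simp
qed

lemma Zs_unit:
  "s \<in> states n m \<Longrightarrow> t \<in> states n m \<Longrightarrow> Zs n m (unit_elt n m) s t = (if s = t then 1 else 0)"
proof (induction m arbitrary: s t)
  case 0
  then have "s = []" "t = []" by (auto simp: states_def)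
  moreover have "0\<^sub>m 0 0 \<in> Pmat n 0" by (auto simp: Pmat_def)
  moreover have "cov n 0 (0\<^sub>m 0 0) [] []" by (simp add: cov_def states_def)
  ultimately show ?case by (simp add: Zs_delta)
next
  case (Suc m)
  obtain s' i where s: "s = s' @ [i]" "s' \<in> states n m" "i \<le> n" using Suc.prems states_Suc by blast
  obtain t' j where t: "t = t' @ [j]" "t' \<in> states n m" "j \<le> n" using Suc.prems states_Suc by blast
  have "Zs n (m + 1) (tens n m 1 (unit_elt n m) (unit1 n)) (s' @ [i]) (t' @ [j]) =
      Zs n m (unit_elt n m) s' t' * Zs n 1 (unit1 n) [i] [j]"
    using s t by (intro Zs_tens) (auto simp: states_def)
  then show ?case using Suc.IH[OF s(2) t(2)] Zs_unit1[OF s(3) t(3)] s(1) t(1) by simp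
qed

lemma CP_matrix_algebra: "matrix_algebra (CP n m) (states n m) (cl n) (Zs n m)"
proof -
  have "zeta_semigroup (Pmat n m) (\<lambda>a b. a * b) (states n m) (cl n) (cov n m) (Dm m) (unit_elt n m)"
  proof
    show "finite (Pmat n m)" by (rule finite_Pmat)
    show "finite (states n m)" by (rule finite_states)
    fix a assume a: "a \<in> Pmat n m"
    show "a * b \<in> Pmat n m" if "b \<in> Pmat n m" for b using Pmat_mult[OF a that] .
    show "s \<in> states n m \<and> t \<in> states n m \<and> cl n s = cl n t" if "cov n m a s t" for s t
      using cov_cl[OF a that] that by (simp add: cov_def)
    show "cov n m (a * b) s t \<longleftrightarrow> (\<exists>u. cov n m a s u \<and> cov n m b u t)" if "b \<in> Pmat n m" for b s t
      using cov_mult[OF a that] .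
    show "u = u'" if "cov n m a s u" "cov n m a s u'" for s u u' using cov_row_uniq[OF a that] .
    show "cov n m a s' t'" if "cov n m a s t" "cov n m (Dm m s t) s' t'" for s t s' t'
      using cov_mono[OF that(2)] ent_Dm_imp[OF a that(1)] by blast
    show "\<exists>s\<in>states n m. \<exists>t\<in>states n m. cl n s = cl n t \<and> a = Dm m s t" using Pmat_Dm[OF a] .
  next
    fix s t assume st: "s \<in> states n m" "t \<in> states n m"
    show "(\<Sum>a\<in>Pmat n m. if cov n m a s t then unit_elt n m a else 0) = (if s = t then 1 else 0)"
      using Zs_unit[OF st] by (simp add: Zs_def)
    assume eq: "cl n s = cl n t"
    show "Dm m s t \<in> Pmat n m" using Dm_in[OF st] .
    show "cov n m (Dm m s t) s t" using Dm_cov[OF st eq] .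
    show "s = s' \<and> t = t'" if "cov n m (Dm m s t) s' t'" "cov n m (Dm m s' t') s t" for s' t'
      using Dm_antisym[OF st eq that] .
  next
    show "unit_elt n m a = 0" if "a \<notin> Pmat n m" for a using unit_supp that .
  qed
  then interpret Z: zeta_semigroup "Pmat n m" "\<lambda>a b. a * b" "states n m" "cl n" "cov n m" "Dm m" "unit_elt n m" .
  have "Z.Z = Zs n m" by (intro ext) (simp add: Z.Z_def Zs_def)
  then show ?thesis using Z.matrix_algebra_axioms by (simp add: CP_def)
qed

global_interpretation CP: matrix_algebra "CP n m" "states n m" "cl n" "Zs n m" for n m
  by (rule CP_matrix_algebra)

section \<open>The modules \<open>W\<close> and the functors\<close>

abbreviation "CPV n m \<equiv> matrix_algebra.V (states n m) (cl n) (Zs n m)"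
abbreviation "CPVc n m \<equiv> matrix_algebra.Vc (states n m) (cl n)"
abbreviation "CPev n m \<equiv> matrix_algebra.ev (states n m) (Zs n m)"
abbreviation "CPel n m \<equiv> matrix_algebra.el (CP n m) (states n m) (cl n) (Zs n m)"

section \<open>The elements \<open>xelt d\<close> as matrix units\<close>

text \<open>If some \<open>x\<close> lies in \<open>C\<close> but not in \<open>A\<close>, adding or
  removing \<open>x\<close> is an involution of the interval that changes every sign.\<close>

lemma alternating_sum_interval:
  fixes A C :: "'a set"
  assumes fin: "finite C" and AC: "A \<subseteq> C"
  shows "(\<Sum>R | A \<subseteq> R \<and> R \<subseteq> C. (- 1) ^ (card C - card R)) = (if A = C then 1 else 0 :: complex)"
proof (cases "A = C")
  case True
  then have "{R. A \<subseteq> R \<and> R \<subseteq> C} = {C}" by auto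
  then show ?thesis using True by simp
next
  case False
  then obtain x where x: "x \<in> C" "x \<notin> A" using AC by auto
  let ?I = "{R. A \<subseteq> R \<and> R \<subseteq> C}" and ?t = "\<lambda>R. if x \<in> R then R - {x} else insert x R"
    and ?g = "\<lambda>R. (- 1 :: complex) ^ (card C - card R)"
  have g: "?g (?t R) = - ?g R" if R: "R \<in> ?I" for R
  proof -
    have fR: "finite R" using R fin finite_subset by auto
    have le: "card R \<le> card C" using R fin by (auto intro: card_mono)
    show ?thesis
    proof (cases "x \<in> R")
      case True
      have "card C - card (R - {x}) = Suc (card C - card R)"
        using True fR le card_gt_0_iff[of R] by (auto simp: card_Diff_singleton)
      then show ?thesis using True by simp
    next
      case False
      then have "insert x R \<subseteq> C" using R x by auto
      then have "Suc (card R) \<le> card C" using card_mono[OF fin, of "insert x R"] False fR by simp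
      then have "card C - card R = Suc (card C - card (insert x R))" using False fR by simp
      then show ?thesis using False by simp
    qed
  qed
  have "?t (?t R) = R" for R by auto
  moreover have "?t R \<in> ?I" if "R \<in> ?I" for R using that x by auto
  ultimately have "bij_betw ?t ?I ?I" by (intro bij_betw_byWitness[where f' = ?t]) blast+
  then have "sum ?g ?I = (\<Sum>R\<in>?I. ?g (?t R))" by (rule sum.reindex_bij_betw[symmetric])
  also have "\<dots> = (\<Sum>R\<in>?I. - ?g R)" by (rule sum.cong[OF refl]) (rule g)
  also have "\<dots> = - sum ?g ?I" by (simp add: sum_negf)
  finally show ?thesis using False by simp
qed

definition nz :: "nat \<Rightarrow> pmat \<Rightarrow> (nat \<times> nat) set" where
  "nz m d = {(r, c). r < m \<and> c < m \<and> d $$ (r, c) \<noteq> 0}"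

text \<open>Submatrices of \<open>d\<close> correspond to sets of positions inside
  \<open>nz m d\<close>, so the sum in \<open>xelt\<close> becomes an alternating sum over
  subsets.\<close>

definition msub :: "nat \<Rightarrow> pmat \<Rightarrow> (nat \<times> nat) set \<Rightarrow> pmat" where
  "msub m d R = mat m m (\<lambda>(r, c). if (r, c) \<in> R then d $$ (r, c) else 0)"

lemma finite_nz: "finite (nz m d)"
  by (rule finite_subset[of _ "{..<m} \<times> {..<m}"]) (auto simp: nz_def)

lemma dsize_nz: "d \<in> carrier_mat m m \<Longrightarrow> dsize d = card (nz m d)"
  unfolding dsize_def nz_def by auto

lemma nz_msub: "R \<subseteq> nz m d \<Longrightarrow> nz m (msub m d R) = R"
  unfolding nz_def msub_def by (fastforce split: if_splits)

lemma ent_msub: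
  assumes d: "d \<in> Pmat n m"
  shows "ent (msub m d R) r c i \<longleftrightarrow> ent d r c i \<and> (r, c) \<in> R"
proof (cases "r < m \<and> c < m")
  case True
  have z: "(0 = uvec i) = False" by simp
  show ?thesis unfolding ent_def PmatD(2,3)[OF d] msub_def using True by (simp add: z)
qed (auto simp: ent_def PmatD(2,3)[OF d] msub_def)

lemma msub_in:
  assumes d: "d \<in> Pmat n m" shows "msub m d R \<in> Pmat n m"
proof (rule PmatI, unfold ent_msub[OF d])
  show "msub m d R \<in> carrier_mat m m" by (simp add: msub_def)
  fix r c assume "r < m" "c < m" "msub m d R $$ (r, c) \<noteq> 0"
  then have "d $$ (r, c) \<noteq> 0" "msub m d R $$ (r, c) = d $$ (r, c)" by (auto simp: msub_def split: if_splits)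
  then show "\<exists>i\<in>{1..n}. msub m d R $$ (r, c) = uvec i"
    using Pmat_entry[OF d \<open>r < m\<close> \<open>c < m\<close>] by (auto simp: ent_def)
next
  fix r c c' i j assume "ent d r c i \<and> (r, c) \<in> R" "ent d r c' j \<and> (r, c') \<in> R"
  then show "c = c'" using Pmat_row[OF d] by blast
next
  fix r r' c i j assume "ent d r c i \<and> (r, c) \<in> R" "ent d r' c j \<and> (r', c) \<in> R"
  then show "r = r'" using Pmat_col[OF d] by blast
next
  fix r r' c c' i assume "ent d r c i \<and> (r, c) \<in> R" "ent d r' c' i \<and> (r', c') \<in> R" "r < r'"
  then show "\<not> c' < c" using Pmat_order[OF d, of r c i r' c'] by simp
qed

lemma dsub_iff:
  assumes d: "d \<in> Pmat n m"
  shows "dsub a d \<longleftrightarrow> a \<in> carrier_mat m m \<and> msub m d (nz m a) = a \<and> nz m a \<subseteq> nz m d"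
proof
  assume "dsub a d"
  then have a: "a \<in> carrier_mat m m" and e: "\<And>r c. r < m \<Longrightarrow> c < m \<Longrightarrow> a $$ (r, c) = 0 \<or> a $$ (r, c) = d $$ (r, c)"
    unfolding dsub_def PmatD(2,3)[OF d] by auto
  have "msub m d (nz m a) = a"
  proof (rule eq_matI)
    fix r c assume "r < dim_row a" "c < dim_col a"
    then have rc: "r < m" "c < m" using a by auto
    then show "msub m d (nz m a) $$ (r, c) = a $$ (r, c)"
      using e[OF rc] by (auto simp: msub_def nz_def)
  qed (use a in \<open>auto simp: msub_def\<close>)
  moreover have "nz m a \<subseteq> nz m d" using e unfolding nz_def by fastforce
  ultimately show "a \<in> carrier_mat m m \<and> msub m d (nz m a) = a \<and> nz m a \<subseteq> nz m d" using a by blast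
next
  assume h: "a \<in> carrier_mat m m \<and> msub m d (nz m a) = a \<and> nz m a \<subseteq> nz m d"
  have "a $$ (r, c) = 0 \<or> a $$ (r, c) = d $$ (r, c)" if "r < m" "c < m" for r c
  proof -
    have "msub m d (nz m a) $$ (r, c) = 0 \<or> msub m d (nz m a) $$ (r, c) = d $$ (r, c)"
      using that by (simp add: msub_def)
    then show ?thesis using h by simp
  qed
  then show "dsub a d" unfolding dsub_def PmatD(2,3)[OF d] using h by blast
qed

lemma nz_ent: "d \<in> Pmat n m \<Longrightarrow> (r, c) \<in> nz m d \<longleftrightarrow> (\<exists>i. ent d r c i)"
proof (rule iffI)
  assume d: "d \<in> Pmat n m" and "(r, c) \<in> nz m d"
  then show "\<exists>i. ent d r c i" using Pmat_entry[OF d, of r c] unfolding nz_def by auto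
next
  assume d: "d \<in> Pmat n m" and "\<exists>i. ent d r c i"
  then obtain i where i: "ent d r c i" by blast
  then show "(r, c) \<in> nz m d" using Pmat_ent[OF d i] unfolding nz_def ent_def by simp
qed

text \<open>The transform at \<open>(s, t)\<close> sums the signs of the submatrices lying between
  \<open>Dm m s t\<close> and the given matrix. These form an interval of sets, so the sum vanishes
  unless its two ends coincide, and then antisymmetry identifies the pairs.\<close>

lemma Zs_xelt:
  assumes st0: "s0 \<in> states n m" "t0 \<in> states n m" "cl n s0 = cl n t0"
  shows "Zs n m (xelt (Dm m s0 t0)) s t = (if s = s0 \<and> t = t0 then 1 else 0)"
proof (cases "s \<in> states n m \<and> t \<in> states n m \<and> cl n s = cl n t")
  case False
  then show ?thesis using CP.Th_supp[of n m "xelt (Dm m s0 t0)" s t] st0 by auto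
next
  case True
  then have st: "s \<in> states n m" "t \<in> states n m" "cl n s = cl n t" by auto
  define d where "d = Dm m s0 t0"
  define D where "D = Dm m s t"
  have d: "d \<in> Pmat n m" and D: "D \<in> Pmat n m"
    using Dm_in st0 st unfolding d_def D_def by blast+
  note car = PmatD(1)
  have img: "{a \<in> Pmat n m. dsub a d} = msub m d ` {R. R \<subseteq> nz m d}"
  proof (intro subset_antisym subsetI)
    fix a assume "a \<in> {a \<in> Pmat n m. dsub a d}"
    then have "msub m d (nz m a) = a" "nz m a \<in> {R. R \<subseteq> nz m d}" unfolding dsub_iff[OF d] by simp_all
    then show "a \<in> msub m d ` {R. R \<subseteq> nz m d}" by (metis image_eqI)
  next
    fix a assume "a \<in> msub m d ` {R. R \<subseteq> nz m d}"
    then obtain R where R: "R \<subseteq> nz m d" "a = msub m d R" by blast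
    then show "a \<in> {a \<in> Pmat n m. dsub a d}"
      unfolding dsub_iff[OF d] using msub_in[OF d] nz_msub[OF R(1)] car[OF msub_in[OF d]] by simp
  qed
  have inj: "inj_on (msub m d) {R. R \<subseteq> nz m d}"
    using nz_msub[of _ m d] by (intro inj_on_inverseI[where g = "nz m"]) simp
  \<comment> \<open>The submatrix must contain \<open>D\<close>: the matrix \<open>d\<close> has the
    entries of \<open>D\<close>, and \<open>R\<close> keeps their positions.\<close>
  have cv: "cov n m (msub m d R) s t \<longleftrightarrow> (\<forall>r c i. ent D r c i \<longrightarrow> ent d r c i) \<and> nz m D \<subseteq> R" for R
    unfolding cov_iff[OF msub_in[OF d] st] D_def[symmetric] ent_msub[OF d]
    using nz_ent[OF D] by (metis subrelI subsetD)
  have "Zs n m (xelt d) s t = (\<Sum>a\<in>Pmat n m. if dsub a d then (if cov n m a s t then (- 1) ^ (dsize d - dsize a) else 0) else 0)"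
    unfolding Zs_def by (rule sum.cong) (auto simp: xelt_def)
  also have "\<dots> = (\<Sum>a\<in>{a \<in> Pmat n m. dsub a d}. if cov n m a s t then (- 1) ^ (dsize d - dsize a) else 0)"
    using finite_Pmat by (intro sum.inter_filter[symmetric])
  also have "\<dots> = (\<Sum>R\<in>{R. R \<subseteq> nz m d}. if cov n m (msub m d R) s t then (- 1) ^ (dsize d - dsize (msub m d R)) else 0)"
    unfolding img by (simp add: sum.reindex[OF inj])
  also have "\<dots> = (\<Sum>R\<in>{R. R \<subseteq> nz m d}. if (\<forall>r c i. ent D r c i \<longrightarrow> ent d r c i) \<and> nz m D \<subseteq> R
      then (- 1) ^ (card (nz m d) - card R) else 0)"
    by (rule sum.cong[OF refl]) (simp add: cv dsize_nz[OF car[OF d]] dsize_nz[OF car[OF msub_in[OF d]]] nz_msub)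
  also have "\<dots> = (if s = s0 \<and> t = t0 then 1 else 0)"
  proof (cases "\<forall>r c i. ent D r c i \<longrightarrow> ent d r c i")
    case sub: True
    then have nsub: "nz m D \<subseteq> nz m d" using nz_ent[OF D] nz_ent[OF d] by (metis subrelI)
    have fP: "finite {R. R \<subseteq> nz m d}" using finite_nz by simp
    have eq: "{R. nz m D \<subseteq> R \<and> R \<subseteq> nz m d} = {R \<in> {R. R \<subseteq> nz m d}. nz m D \<subseteq> R}" by blast
    have "(\<Sum>R\<in>{R. R \<subseteq> nz m d}. if nz m D \<subseteq> R then (- 1) ^ (card (nz m d) - card R) else 0) =
      (\<Sum>R | nz m D \<subseteq> R \<and> R \<subseteq> nz m d. (- 1 :: complex) ^ (card (nz m d) - card R))"
      unfolding eq using fP by (rule sum.inter_filter[symmetric])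
    also have "\<dots> = (if nz m D = nz m d then 1 else 0)"
      using alternating_sum_interval[OF finite_nz nsub] .
    also have "nz m D = nz m d \<longleftrightarrow> s = s0 \<and> t = t0"
    proof
      assume eq: "nz m D = nz m d"
      have "ent D r c i" if "ent d r c i" for r c i
      proof -
        have "(r, c) \<in> nz m D" using that nz_ent[OF d] eq by blast
        then obtain j where "ent D r c j" using nz_ent[OF D] by blast
        moreover from this have "ent d r c j" using sub by blast
        ultimately show ?thesis using Pmat_row[OF d that] by blast
      qed
      then have "cov n m D s0 t0" using cov_iff[OF D st0] unfolding d_def by blast
      moreover have "cov n m d s t" using cov_iff[OF d st] sub unfolding D_def by blast
      ultimately show "s = s0 \<and> t = t0" using Dm_antisym[OF st] unfolding D_def d_def by blast
    qed (simp add: D_def d_def)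
    finally show ?thesis using sub by simp
  next
    case False
    then have "\<not> (s = s0 \<and> t = t0)" unfolding D_def d_def by blast
    moreover have "(\<Sum>R\<in>{R. R \<subseteq> nz m d}. if (\<forall>r c i. ent D r c i \<longrightarrow> ent d r c i) \<and> nz m D \<subseteq> R
      then (- 1) ^ (card (nz m d) - card R) else 0 :: complex) = 0"
      by (simp only: False simp_thms if_False sum.neutral_const)
    ultimately show ?thesis by simp
  qed
  finally show ?thesis unfolding d_def .
qed

lemma CP_carrier: "carrier (CP n m) = {f. \<forall>s. s \<notin> Pmat n m \<longrightarrow> f s = 0}"
  by (simp add: CP_def semigroup_algebra_def)

lemma xelt_in: assumes d: "d \<in> Pmat n m" shows "xelt d \<in> carrier (CP n m)"
proof -
  have "a \<in> Pmat n m" if "dsub a d" for a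
    using that msub_in[OF d, of "nz m a"] unfolding dsub_iff[OF d] by simp
  then show ?thesis by (auto simp: CP_carrier xelt_def)
qed

text \<open>Words of length \<open>m\<close> and ordered set partitions of the columns are the same
  data; this passes from a column word to the tuple \<open>T\<close>.\<close>

definition fibres :: "nat \<Rightarrow> nat list \<Rightarrow> nat set list" where
  "fibres n t = map (\<lambda>k. {c. c < length t \<and> t ! c = k}) [0..<Suc n]"

lemma beta_Dm:
  assumes s: "s \<in> states n m" and t: "t \<in> states n m" and eq: "cl n s = cl n t"
  shows "map (\<lambda>k. beta k (Dm m s t)) [0..<Suc n] = fibres n t"
proof -
  have D: "Dm m s t \<in> Pmat n m" using Dm_in[OF s t] .
  have cv: "cov n m (Dm m s t) s t" using Dm_cov[OF s t eq] .
  have col: "\<exists>r. ent (Dm m s t) r c (t ! c)" if "c < m" "t ! c \<noteq> 0" for c using cv that unfolding cov_def by blast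
  have "beta k (Dm m s t) = {c. c < length t \<and> t ! c = k}" for k
  proof (cases "k = 0")
    case True
    have "(\<forall>r<m. Dm m s t $$ (r, c) = 0) \<longleftrightarrow> t ! c = 0" if c: "c < m" for c
    proof
      assume z: "\<forall>r<m. Dm m s t $$ (r, c) = 0"
      show "t ! c = 0"
      proof (rule ccontr)
        assume "t ! c \<noteq> 0"
        then obtain r where r: "ent (Dm m s t) r c (t ! c)" using col c by blast
        then have "r < m" using Pmat_ent[OF D] by blast
        then show False using r z unfolding ent_def by simp
      qed
    qed (use c in \<open>auto simp: Dm_def\<close>)
    then show ?thesis using True statesD(1)[OF t] PmatD(2,3)[OF D] unfolding beta_def by auto
  next
    case False
    have "(\<exists>r<m. Dm m s t $$ (r, c) = uvec k) \<longleftrightarrow> t ! c = k" if c: "c < m" for c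
    proof
      assume "\<exists>r<m. Dm m s t $$ (r, c) = uvec k"
      then obtain r where "ent (Dm m s t) r c k" using False c PmatD(2,3)[OF D] unfolding ent_def by auto
      then show "t ! c = k" unfolding ent_Dm by simp
    next
      assume "t ! c = k"
      then obtain r where "ent (Dm m s t) r c k" using col[OF c] False by blast
      then show "\<exists>r<m. Dm m s t $$ (r, c) = uvec k" using PmatD(2,3)[OF D] unfolding ent_def by auto
    qed
    then show ?thesis using False statesD(1)[OF t] PmatD(2,3)[OF D] unfolding beta_def by auto
  qed
  then show ?thesis unfolding fibres_def by simp
qed

lemma fibres_inj:
  assumes s: "s \<in> states n m" and t: "t \<in> states n m" and eq: "fibres n s = fibres n t"
  shows "s = t"
proof (rule nth_equalityI)
  show "length s = length t" using s t by (simp add: states_def)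
  fix c assume c: "c < length s"
  then have k: "s ! c \<in> set [0..<Suc n]" using statesD(1)[OF s] statesD(2)[OF s, of c] by (simp del: upt_Suc add: less_Suc_eq_le)
  have "{c'. c' < length s \<and> s ! c' = s ! c} = {c'. c' < length t \<and> t ! c' = s ! c}"
    using eq k unfolding fibres_def map_eq_conv by blast
  moreover have "c \<in> {c'. c' < length s \<and> s ! c' = s ! c}" using c by simp
  ultimately have "c \<in> {c'. c' < length t \<and> t ! c' = s ! c}" by (simp only:)
  then show "s ! c = t ! c" by simp
qed

text \<open>Prescribing \<open>beta\<close> of \<open>d\<close> fixes the column word
  \<open>t\<close>. As the \<open>xelt\<close> are matrix units, the span consists of the elements
  whose matrix is supported in the column \<open>t\<close>, and left multiplication on a single
  column is the column module.\<close>

lemma WT_iso: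
  assumes t: "t \<in> states n m"
  shows "module_isomorphic (CP n m) (CPV n m (cl n t)) (WT n m (fibres n t))"
proof -
  let ?R = "CP n m" and ?W = "WT n m (fibres n t)" and ?Z = "Zs n m"
  define C where "C = {s \<in> states n m. cl n s = cl n t}"
  have finC: "finite C" unfolding C_def using finite_states by simp
  define U where "U = {f \<in> carrier ?R. \<forall>s t'. ?Z f s t' \<noteq> 0 \<longrightarrow> t' = t}"
  have gens: "{d \<in> Pmat n m. map (\<lambda>k. beta k d) [0..<Suc n] = fibres n t} = (\<lambda>s. Dm m s t) ` C"
  proof (intro subset_antisym subsetI)
    fix d assume "d \<in> {d \<in> Pmat n m. map (\<lambda>k. beta k d) [0..<Suc n] = fibres n t}"
    then have d: "d \<in> Pmat n m" "map (\<lambda>k. beta k d) [0..<Suc n] = fibres n t" by auto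
    obtain s t' where st: "s \<in> states n m" "t' \<in> states n m" "cl n s = cl n t'" "d = Dm m s t'"
      using Pmat_Dm[OF d(1)] by blast
    then have "fibres n t' = fibres n t" using d beta_Dm[OF st(1-3)] by simp
    then have "t' = t" using fibres_inj st t by blast
    then show "d \<in> (\<lambda>s. Dm m s t) ` C" using st unfolding C_def by blast
  next
    fix d assume "d \<in> (\<lambda>s. Dm m s t) ` C"
    then obtain s where "s \<in> states n m" "cl n s = cl n t" "d = Dm m s t" unfolding C_def by blast
    then show "d \<in> {d \<in> Pmat n m. map (\<lambda>k. beta k d) [0..<Suc n] = fibres n t}"
      using beta_Dm[of s n m t] Dm_in t by simp
  qed
  have Zx: "?Z (xelt (Dm m s t)) s' t' = (if s' = s \<and> t' = t then 1 else 0)" if "s \<in> C" for s s' t'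
    using Zs_xelt that t unfolding C_def by blast
  have xin: "xelt (Dm m s t) \<in> carrier ?R" if "s \<in> C" for s
    using that t unfolding C_def by (intro xelt_in Dm_in) auto
  have carr: "carrier ?W = U"
  proof -
    have "cfun.span (xelt ` (\<lambda>s. Dm m s t) ` C) = U"
    proof (rule subset_antisym)
      show "cfun.span (xelt ` (\<lambda>s. Dm m s t) ` C) \<subseteq> U"
      proof (rule cfun.span_minimal)
        show "xelt ` (\<lambda>s. Dm m s t) ` C \<subseteq> U" unfolding U_def using Zx xin by (auto split: if_splits)
        show "cfun.subspace U"
        proof (rule cfun_subspaceI)
          show "0 \<in> U" unfolding U_def using CP.zero_in CP.Th_zero by auto
          fix f g assume "f \<in> U" "g \<in> U"
          then have f: "f \<in> carrier ?R" "\<And>s t'. ?Z f s t' \<noteq> 0 \<Longrightarrow> t' = t"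
            and g: "g \<in> carrier ?R" "\<And>s t'. ?Z g s t' \<noteq> 0 \<Longrightarrow> t' = t" unfolding U_def by blast+
          show "f + g \<in> U" unfolding U_def
          proof (intro CollectI conjI allI impI CP.add_in f(1) g(1))
            fix s t' assume "?Z (f + g) s t' \<noteq> 0"
            then have "?Z f s t' \<noteq> 0 \<or> ?Z g s t' \<noteq> 0" unfolding Zs_add by auto
            then show "t' = t" using f(2) g(2) by blast
          qed
        next
          fix c f assume "f \<in> U"
          then show "cscale c f \<in> U" unfolding U_def using CP.scale_in by (auto simp: Zs_scale)
        qed
      qed
      show "U \<subseteq> cfun.span (xelt ` (\<lambda>s. Dm m s t) ` C)"
      proof
        fix f assume f: "f \<in> U"
        let ?g = "\<Sum>s\<in>C. cscale (?Z f s t) (xelt (Dm m s t))"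
        have gs: "?g \<in> cfun.span (xelt ` (\<lambda>s. Dm m s t) ` C)"
          by (intro cfun.span_sum cfun.span_scale cfun.span_base) auto
        have gU: "?g \<in> carrier ?R"
          using xin by (simp add: CP_carrier sum_fun_apply cscale_def)
        have "f = ?g"
        proof (rule CP.Th_cong)
          show "f \<in> carrier ?R" using f unfolding U_def by simp
          fix s' t'
          have "?Z ?g s' t' = (\<Sum>s\<in>C. ?Z f s t * (if s' = s \<and> t' = t then 1 else 0))"
            unfolding Zs_sum Zs_scale using Zx by (intro sum.cong) auto
          also have "\<dots> = (\<Sum>s\<in>C. if s = s' then (if t' = t then ?Z f s' t else 0) else 0)"
            by (intro sum.cong) auto
          also have "\<dots> = (if s' \<in> C then (if t' = t then ?Z f s' t else 0) else 0)" using finC by simp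
          also have "\<dots> = ?Z f s' t'"
            using CP.Th_supp[of n m f s' t'] f unfolding U_def C_def by auto
          finally show "?Z f s' t' = ?Z ?g s' t'" by simp
        qed (rule gU)
        then show "f \<in> cfun.span (xelt ` (\<lambda>s. Dm m s t) ` C)" using gs by simp
      qed
    qed
    then show ?thesis unfolding WT_def gens by simp
  qed
  define h where "h p = CPel n m (\<lambda>s t'. if t' = t then p s else 0)" for p
  have Zh: "?Z (h p) s t' = (if t' = t then p s else 0)" if "p \<in> CPVc n m (cl n t)" for p s t'
    using that t unfolding h_def CP.el CP.Vc_def by auto
  have h_in: "h p \<in> carrier ?R" for p unfolding h_def by (rule CP.el)
  have "hom_iso ?R (CPV n m (cl n t)) ?W h"
    unfolding hom_iso_def CP.V_simps carr
  proof (intro conjI ballI)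
    show "bij_betw h (CPVc n m (cl n t)) U"
      unfolding bij_betw_def
    proof
      show "inj_on h (CPVc n m (cl n t))"
      proof (rule inj_onI)
        fix p q assume pq: "p \<in> CPVc n m (cl n t)" "q \<in> CPVc n m (cl n t)" "h p = h q"
        show "p = q"
        proof
          fix s show "p s = q s" using Zh[OF pq(1), of s t] Zh[OF pq(2), of s t] pq(3) by simp
        qed
      qed
      show "h ` CPVc n m (cl n t) = U"
      proof (intro subset_antisym subsetI)
        fix f assume "f \<in> h ` CPVc n m (cl n t)"
        then show "f \<in> U" unfolding U_def using h_in Zh by (auto split: if_splits)
      next
        fix f assume f: "f \<in> U"
        let ?p = "\<lambda>s. ?Z f s t"
        have p: "?p \<in> CPVc n m (cl n t)" unfolding CP.Vc_def using CP.Th_supp by blast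
        have "f = h ?p"
        proof (rule CP.Th_cong)
          show "f \<in> carrier ?R" using f unfolding U_def by simp
          fix s t' show "?Z f s t' = ?Z (h ?p) s t'" using f unfolding Zh[OF p] U_def by auto
        qed (rule h_in)
        then show "f \<in> h ` CPVc n m (cl n t)" using p by blast
      qed
    qed
  next
    fix p q assume pq: "p \<in> CPVc n m (cl n t)" "q \<in> CPVc n m (cl n t)"
    have "h (p + q) = h p + h q"
      by (rule CP.Th_cong[OF h_in CP.add_in[OF h_in h_in]])
        (simp add: Zs_add Zh[OF pq(1)] Zh[OF pq(2)] Zh[OF CP.Vc_add[OF pq]] plus_fun_apply)
    then show "h (p + q) = h p \<oplus>\<^bsub>?W\<^esub> h q" unfolding WT_def by simp
  next
    fix a p assume a: "a \<in> carrier ?R" and p: "p \<in> CPVc n m (cl n t)"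
    have "h (CPev n m a p) = a \<otimes>\<^bsub>?R\<^esub> h p"
    proof (rule CP.Th_cong[OF h_in CP.mult_in[OF a h_in]])
      fix s t' show "?Z (h (CPev n m a p)) s t' = ?Z (a \<otimes>\<^bsub>?R\<^esub> h p) s t'"
        unfolding Zh[OF CP.ev_in[OF p]] CP.Th_mult[OF a h_in] Zh[OF p]
        by (cases "t' = t") (simp_all add: CP.ev_def)
    qed
    then show "h (CPev n m a p) = a \<odot>\<^bsub>?W\<^esub> h p" unfolding WT_def by simp
  qed
  then show ?thesis unfolding module_isomorphic_iff by blast
qed

section \<open>Rows of given content and the modules \<open>Wmod\<close>\<close>

text \<open>It serves twice: as a standard word in the block with multiplicities \<open>mu\<close>,
  and later as the row of a tableau with content \<open>mu\<close>.\<close>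

definition mrow :: "nat list \<Rightarrow> nat list" where
  "mrow mu = concat (map (\<lambda>i. replicate (mu ! i) i) [0..<length mu])"

lemma row_snoc: "mrow (mu @ [x]) = mrow mu @ replicate x (length mu)"
proof -
  have "map (\<lambda>i. replicate ((mu @ [x]) ! i) i) [0..<length mu] = map (\<lambda>i. replicate (mu ! i) i) [0..<length mu]"
    by (rule map_cong) (auto simp: nth_append)
  moreover have "[0..<length (mu @ [x])] = [0..<length mu] @ [length mu]" by simp
  ultimately show ?thesis by (simp only: mrow_def map_append concat_append) simp
qed

lemma length_row: "length (mrow mu) = sum_list mu"
  by (induction mu rule: rev_induct) (simp add: mrow_def, simp add: row_snoc)

lemma count_row: "count_list (mrow mu) i = (if i < length mu then mu ! i else 0)"
proof (induction mu rule: rev_induct)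
  case (snoc x mu)
  have "count_list (replicate x j) i = (if i = j then x else 0)" for j :: nat
    by (induction x) auto
  then show ?case using snoc by (auto simp: row_snoc nth_append)
qed (simp add: mrow_def)

lemma set_row: "set (mrow mu) \<subseteq> {..<length mu}"
  by (auto simp: mrow_def)

lemma row_states: "length mu = Suc n \<Longrightarrow> mrow mu \<in> states n (sum_list mu)"
  using set_row[of mu] by (auto simp: states_def length_row)

lemma cl_row: "length mu = Suc n \<Longrightarrow> cl n (mrow mu) = mu"
  by (rule nth_equalityI) (simp_all add: cl_def count_row del: upt_Suc)

lemma mrow_interval:
  "k < length mu \<Longrightarrow> {sum_list (take k mu)..<sum_list (take (Suc k) mu)} = {c. c < length (mrow mu) \<and> mrow mu ! c = k}"
proof (induction mu rule: rev_induct)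
  case (snoc x mu)
  show ?case
  proof (cases "k < length mu")
    case True
    have "c < length (mrow (mu @ [x])) \<and> mrow (mu @ [x]) ! c = k \<longleftrightarrow> c < length (mrow mu) \<and> mrow mu ! c = k" for c
      using True by (cases "c < sum_list mu") (auto simp: row_snoc nth_append length_row)
    then have "{c. c < length (mrow (mu @ [x])) \<and> mrow (mu @ [x]) ! c = k} = {c. c < length (mrow mu) \<and> mrow mu ! c = k}"
      by (simp only:)
    then show ?thesis using snoc.IH[OF True] True by simp
  next
    case False
    then have k: "k = length mu" using snoc.prems by simp
    have lt: "mrow mu ! c < length mu" if "c < sum_list mu" for c
      using set_row[of mu] nth_mem[of c "mrow mu"] that by (auto simp: length_row subset_iff)
    have iff: "c < length (mrow (mu @ [x])) \<and> mrow (mu @ [x]) ! c = k \<longleftrightarrow> sum_list mu \<le> c \<and> c < sum_list mu + x" for c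
    proof (cases "c < sum_list mu")
      case True
      then show ?thesis using lt[OF True] k
        by (simp add: row_snoc nth_append length_row)
    next
      case False
      then show ?thesis unfolding k by (auto simp: row_snoc nth_append length_row)
    qed
    have "{c. c < length (mrow (mu @ [x])) \<and> mrow (mu @ [x]) ! c = k} = {sum_list mu..<sum_list mu + x}"
      by (rule Set.set_eqI, unfold mem_Collect_eq atLeastLessThan_iff, rule iff)
    then show ?thesis using k by simp
  qed
qed simp

lemma intervals_row:
  assumes len: "length mu = Suc n"
  shows "intervals mu = fibres n (mrow mu)"
  unfolding intervals_def fibres_def len
proof (rule map_cong[OF refl])
  fix k assume "k \<in> set [0..<Suc n]"
  then have "k < length mu" using len by (simp del: upt_Suc)
  then show "{sum_list (take k mu)..<sum_list (take (Suc k) mu)} = {c. c < length (mrow mu) \<and> mrow mu ! c = k}"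
    by (rule mrow_interval)
qed

lemma Wmod_iso:
  assumes "length mu = Suc n" "sum_list mu = m"
  shows "module_isomorphic (CP n m) (CPV n m mu) (Wmod n mu)"
  using WT_iso[OF row_states[OF assms(1)]] cl_row[OF assms(1)] intervals_row[OF assms(1)] assms(2)
  unfolding Wmod_def by simp

section \<open>Restriction and induction on column vectors\<close>

definition incr :: "nat \<Rightarrow> nat list \<Rightarrow> nat list" where
  "incr i mu = mu[i := Suc (mu ! i)]"

lemma cl_append: "i \<le> n \<Longrightarrow> cl n (s @ [i]) = incr i (cl n s)"
  by (rule nth_equalityI) (auto simp: cl_def incr_def nth_list_update simp del: upt_Suc)

lemma length_cl [simp]: "length (cl n s) = Suc n"
  by (simp add: cl_def)

lemma incr_inj:
  assumes "incr i mu = incr i nu" "length mu = length nu"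
  shows "mu = nu"
proof (rule nth_equalityI)
  fix j assume j: "j < length mu"
  have "incr i mu ! j = incr i nu ! j" using assms by simp
  then show "mu ! j = nu ! j" using j assms(2) by (cases "i = j") (auto simp: incr_def)
qed (rule assms)

text \<open>Extension by zero to words ending in \<open>i\<close>, with left inverse
  \<open>slice\<close>. The embedding \<open>psi\<close> with index \<open>i\<close> acts on column
  vectors through this pair, see \<open>ev_psi\<close>.\<close>

definition ext :: "nat \<Rightarrow> (nat list \<Rightarrow> complex) \<Rightarrow> nat list \<Rightarrow> complex" where
  "ext i p = (\<lambda>s. if s \<noteq> [] \<and> last s = i then p (butlast s) else 0)"

definition slice :: "nat \<Rightarrow> (nat list \<Rightarrow> complex) \<Rightarrow> nat list \<Rightarrow> complex" where
  "slice i p = (\<lambda>s. p (s @ [i]))"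

lemma slice_ext [simp]: "slice i (ext i p) = p"
  by (simp add: slice_def ext_def)

lemma ext_inj: "ext i p = ext i q \<Longrightarrow> p = q"
  by (metis slice_ext)

lemma ext_add: "ext i (p + q) = ext i p + ext i q"
  by (auto simp: ext_def fun_eq_iff plus_fun_apply)

lemma ext_delta: "ext i (delta s) = delta (s @ [i])"
proof
  fix t show "ext i (delta s) t = delta (s @ [i]) t"
    by (cases t rule: rev_cases) (auto simp: ext_def delta_apply)
qed

lemma ext_in:
  assumes p: "p \<in> CPVc n m mu" and i: "i \<le> n"
  shows "ext i p \<in> CPVc n (Suc m) (incr i mu)"
  unfolding CP.Vc_def
proof (intro CollectI allI impI)
  fix s assume "ext i p s \<noteq> 0"
  then obtain s' where s: "s = s' @ [i]" "p s' \<noteq> 0"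
    by (cases s rule: rev_cases) (auto simp: ext_def split: if_splits)
  then have "s' \<in> states n m" "cl n s' = mu" using p unfolding CP.Vc_def by auto
  then show "s \<in> states n (Suc m) \<and> cl n s = incr i mu" using s(1) i cl_append[OF i] states_Suc by auto
qed

lemma slice_in:
  assumes p: "p \<in> CPVc n (Suc m) (incr i mu)" and i: "i \<le> n" and len: "length mu = Suc n"
  shows "slice i p \<in> CPVc n m mu"
  unfolding CP.Vc_def
proof (intro CollectI allI impI)
  fix s assume "slice i p s \<noteq> 0"
  then have s: "s @ [i] \<in> states n (Suc m)" "cl n (s @ [i]) = incr i mu" using p unfolding CP.Vc_def slice_def by auto
  then have "incr i (cl n s) = incr i mu" using cl_append[OF i] by simp
  then have "cl n s = mu" using incr_inj len by simp
  then show "s \<in> states n m \<and> cl n s = mu" using s states_Suc by auto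
qed

text \<open>The reason for the difference \<open>I_i - I_0\<close>: the matrix \<open>(u_i)\<close>
  covers the pairs of letters \<open>(i, i)\<close> and \<open>(0, 0)\<close>, and subtracting the
  zero matrix removes the latter. Thus only the letter \<open>i\<close> can be appended.\<close>

lemma Zs_psi:
  assumes "i \<le> n" "a \<le> n" "b \<le> n" "length s = m" "length t = m"
  shows "Zs n (Suc m) (psi n i (Suc m) x) (s @ [a]) (t @ [b]) = (if a = i \<and> b = i then Zs n m x s t else 0)"
proof -
  have "Zs n (m + 1) (psi n i (Suc m) x) (s @ [a]) (t @ [b]) =
      Zs n m x s t * Zs n 1 (if i = 0 then Ielt 0 else Ielt i - Ielt 0) [a] [b]"
    unfolding psi_def diff_Suc_1 using assms by (intro Zs_tens) auto
  also have "Zs n 1 (if i = 0 then Ielt 0 else Ielt i - Ielt 0) [a] [b] = (if a = i \<and> b = i then 1 else 0)"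
    using assms Zs_Ielt[of i n a b] Zs_Ielt[of 0 n a b]
    by (cases "i = 0") (auto simp: Zs_diff simp del: One_nat_def)
  finally show ?thesis by simp
qed

lemma psi_in: "i \<le> n \<Longrightarrow> psi n i (Suc m) x \<in> carrier (CP n (Suc m))"
  using tens_supp[of _ n m 1] by (simp add: CP_carrier psi_def)

lemma states_Suc_image: "states n (Suc m) = (\<lambda>(s, a). s @ [a]) ` (states n m \<times> {0..n})"
  using states_Suc by (fastforce simp: image_iff)

lemma ev_psi:
  assumes i: "i \<le> n"
  shows "CPev n (Suc m) (psi n i (Suc m) x) p = ext i (CPev n m x (slice i p))"
proof
  fix s
  show "CPev n (Suc m) (psi n i (Suc m) x) p s = ext i (CPev n m x (slice i p)) s"
  proof (cases "s \<in> states n (Suc m)")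
    case True
    then obtain s' a where s: "s = s' @ [a]" "s' \<in> states n m" "a \<le> n" using states_Suc by blast
    have inj: "inj_on (\<lambda>(s, a). s @ [a]) (states n m \<times> {0..n})" by (auto simp: inj_on_def)
    have "CPev n (Suc m) (psi n i (Suc m) x) p s =
      (\<Sum>q\<in>states n m \<times> {0..n}. Zs n (Suc m) (psi n i (Suc m) x) s (fst q @ [snd q]) * p (fst q @ [snd q]))"
      unfolding CP.ev_def unfolding states_Suc_image sum.reindex[OF inj] by (simp add: case_prod_unfold)
    also have "\<dots> = (\<Sum>t\<in>states n m. \<Sum>b\<in>{0..n}. Zs n (Suc m) (psi n i (Suc m) x) s (t @ [b]) * p (t @ [b]))"
      by (simp add: sum.cartesian_product case_prod_unfold)
    also have "\<dots> = (\<Sum>t\<in>states n m. \<Sum>b\<in>{0..n}. if b = i then (if a = i then Zs n m x s' t * p (t @ [i]) else 0) else 0)"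
    proof (intro sum.cong refl)
      fix t b assume "t \<in> states n m" "b \<in> {0..n}"
      then show "Zs n (Suc m) (psi n i (Suc m) x) s (t @ [b]) * p (t @ [b]) =
          (if b = i then (if a = i then Zs n m x s' t * p (t @ [i]) else 0) else 0)"
        unfolding s(1) using Zs_psi[OF i s(3), of b s' m t x] s(2) by (auto simp: states_def)
    qed
    also have "\<dots> = (\<Sum>t\<in>states n m. if a = i then Zs n m x s' t * p (t @ [i]) else 0)"
      using i by simp
    also have "\<dots> = ext i (CPev n m x (slice i p)) s"
      unfolding s(1) by (simp add: ext_def CP.ev_def slice_def)
    finally show ?thesis .
  next
    case False
    have "CPev n (Suc m) (psi n i (Suc m) x) p s = 0"
      unfolding CP.ev_def using False CP.Th_supp[of n "Suc m" _ s] by (intro sum.neutral) fastforce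
    moreover have "ext i (CPev n m x (slice i p)) s = 0"
    proof (cases s rule: rev_cases)
      case (snoc s' a)
      have "CPev n m x (slice i p) s' = 0" if "a = i"
        unfolding CP.ev_def using False snoc that i CP.Th_supp[of n m x s'] states_Suc
        by (intro sum.neutral) fastforce
      then show ?thesis using snoc by (simp add: ext_def)
    qed (simp add: ext_def)
    ultimately show ?thesis by simp
  qed
qed

text \<open>The image of the unit under \<open>psi\<close> is the projection onto the words ending
  in \<open>i\<close>. Deleting that last letter identifies the image with the column module having
  one \<open>i\<close> fewer.\<close>

lemma Res_iso:
  assumes iso: "module_isomorphic (CP n (Suc m)) (CPV n (Suc m) (incr i mu)) M"
    and i: "i \<le> n" and len: "length mu = Suc n"
  shows "module_isomorphic (CP n m) (CPV n m mu) (Res n i (Suc m) M)"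
proof -
  obtain h where h: "hom_iso (CP n (Suc m)) (CPV n (Suc m) (incr i mu)) M h"
    using iso unfolding module_isomorphic_iff by blast
  note hD = hom_isoD[OF h, unfolded CP.V_simps]
  have ein: "ext i p \<in> CPVc n (Suc m) (incr i mu)" if "p \<in> CPVc n m mu" for p
    using ext_in[OF that i] .
  have "carrier (Res n i (Suc m) M) = (\<lambda>v. psi n i (Suc m) \<one>\<^bsub>CP n m\<^esub> \<odot>\<^bsub>M\<^esub> v) ` h ` CPVc n (Suc m) (incr i mu)"
    unfolding Res_def res_module_def hD(3) by simp
  also have "\<dots> = (\<lambda>p. h (CPev n (Suc m) (psi n i (Suc m) \<one>\<^bsub>CP n m\<^esub>) p)) ` CPVc n (Suc m) (incr i mu)"
    unfolding image_image using hD(6)[OF psi_in[OF i]] by (intro image_cong) auto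
  also have "\<dots> = (\<lambda>p. h (ext i (slice i p))) ` CPVc n (Suc m) (incr i mu)"
    by (intro image_cong refl) (simp add: ev_psi[OF i] CP.ev_one[OF slice_in[OF _ i len]])
  also have "\<dots> = (\<lambda>p. h (ext i p)) ` CPVc n m mu"
  proof (intro subset_antisym image_subsetI)
    fix p assume "p \<in> CPVc n (Suc m) (incr i mu)"
    then show "h (ext i (slice i p)) \<in> (\<lambda>p. h (ext i p)) ` CPVc n m mu" using slice_in[OF _ i len] by blast
  next
    fix p assume p: "p \<in> CPVc n m mu"
    have "h (ext i p) = h (ext i (slice i (ext i p)))" by simp
    then show "h (ext i p) \<in> (\<lambda>p. h (ext i (slice i p))) ` CPVc n (Suc m) (incr i mu)"
      using ein[OF p] by (rule image_eqI)
  qed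
  finally have carr: "carrier (Res n i (Suc m) M) = (\<lambda>p. h (ext i p)) ` CPVc n m mu" .
  have "hom_iso (CP n m) (CPV n m mu) (Res n i (Suc m) M) (\<lambda>p. h (ext i p))"
    unfolding hom_iso_def CP.V_simps
  proof (intro conjI ballI)
    have "inj_on (\<lambda>p. h (ext i p)) (CPVc n m mu)"
    proof (rule inj_onI)
      fix p q assume pq: "p \<in> CPVc n m mu" "q \<in> CPVc n m mu" "h (ext i p) = h (ext i q)"
      then have "ext i p = ext i q" using inj_onD[OF hD(2)] ein by blast
      then show "p = q" by (rule ext_inj)
    qed
    then show "bij_betw (\<lambda>p. h (ext i p)) (CPVc n m mu) (carrier (Res n i (Suc m) M))"
      unfolding bij_betw_def carr by simp
  next
    fix p q assume pq: "p \<in> CPVc n m mu" "q \<in> CPVc n m mu"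
    show "h (ext i (p + q)) = h (ext i p) \<oplus>\<^bsub>Res n i (Suc m) M\<^esub> h (ext i q)"
      using hD(5)[OF ein[OF pq(1)] ein[OF pq(2)]] by (simp add: ext_add Res_def res_module_def)
  next
    fix a p assume p: "p \<in> CPVc n m mu"
    have "h (ext i (CPev n m a p)) = psi n i (Suc m) a \<odot>\<^bsub>M\<^esub> h (ext i p)"
      using hD(6)[OF psi_in[OF i] ein[OF p], of a] by (simp add: ev_psi[OF i])
    then show "h (ext i (CPev n m a p)) = a \<odot>\<^bsub>Res n i (Suc m) M\<^esub> h (ext i p)"
      by (simp add: Res_def res_module_def)
  qed
  then show ?thesis unfolding module_isomorphic_iff by blast
qed

text \<open>The generator \<open>(a, v)\<close> goes to \<open>a\<close> applied to the extension of
  \<open>v\<close> by the letter \<open>i\<close>. For spanning, every \<open>v\<close> is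
  \<open>b v0\<close> with one fixed coordinate vector \<open>v0\<close>, so the balancing relation
  replaces \<open>(a, v)\<close> by \<open>(a psi(b), v0)\<close>. The matrix of
  \<open>a psi(b)\<close> lives in one column and is a combination of the matrix units
  \<open>E t\<close> of that column.\<close>

lemma Ind_iso:
  assumes iso: "module_isomorphic (CP n m) (CPV n m mu) M"
    and i: "i \<le> n" and mu: "mu \<in> cl n ` states n m"
  shows "module_isomorphic (CP n (Suc m)) (CPV n (Suc m) (incr i mu)) (Ind n i (Suc m) M)"
proof -
  let ?A = "CP n (Suc m)" and ?B = "CP n m" and ?ps = "psi n i (Suc m)"
  obtain h where h: "hom_iso ?B (CPV n m mu) M h"
    using iso unfolding module_isomorphic_iff by blast
  note hD = hom_isoD[OF h, unfolded CP.V_simps]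
  define g where "g = inv_into (CPVc n m mu) h"
  have gh: "g (h p) = p" if "p \<in> CPVc n m mu" for p using hD(2) that unfolding g_def by simp
  have g_in: "g v \<in> CPVc n m mu" and hg: "h (g v) = v" if "v \<in> carrier M" for v
    using that hD(3) unfolding g_def by (metis inv_into_into, metis f_inv_into_f)
  have g_add: "g (v \<oplus>\<^bsub>M\<^esub> w) = g v + g w" and M_add: "v \<oplus>\<^bsub>M\<^esub> w \<in> carrier M"
    if "v \<in> carrier M" "w \<in> carrier M" for v w
  proof -
    have *: "v \<oplus>\<^bsub>M\<^esub> w = h (g v + g w)" using hD(5)[OF g_in g_in] hg that by simp
    have "g v + g w \<in> CPVc n m mu" using CP.Vc_add g_in that by blast
    then show "g (v \<oplus>\<^bsub>M\<^esub> w) = g v + g w" "v \<oplus>\<^bsub>M\<^esub> w \<in> carrier M"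
      unfolding * by (rule gh, rule hD(4))
  qed
  have g_act: "g (b \<odot>\<^bsub>M\<^esub> v) = CPev n m b (g v)" and M_act: "b \<odot>\<^bsub>M\<^esub> v \<in> carrier M"
    if "b \<in> carrier ?B" "v \<in> carrier M" for b v
  proof -
    have *: "b \<odot>\<^bsub>M\<^esub> v = h (CPev n m b (g v))" using hD(6)[OF that(1) g_in[OF that(2)]] hg[OF that(2)] by simp
    have "CPev n m b (g v) \<in> CPVc n m mu" using CP.ev_in g_in that by blast
    then show "g (b \<odot>\<^bsub>M\<^esub> v) = CPev n m b (g v)" "b \<odot>\<^bsub>M\<^esub> v \<in> carrier M"
      unfolding * by (rule gh, rule hD(4))
  qed
  obtain s0 where s0: "s0 \<in> states n m" "cl n s0 = mu" using mu by blast
  have d0: "delta s0 \<in> CPVc n m mu" using CP.Vc_delta s0 by blast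
  define v0 where "v0 = h (delta s0)"
  have v0: "v0 \<in> carrier M" "g v0 = delta s0" unfolding v0_def using hD(4) gh d0 by auto
  let ?u = "s0 @ [i]"
  have u: "?u \<in> states n (Suc m)" "cl n ?u = incr i mu" using s0 i states_Suc cl_append by auto
  define E where "E t = CPel n (Suc m) (\<lambda>s t'. if s = t \<and> t' = ?u then 1 else 0)" for t
  have E_in: "E t \<in> carrier ?A" for t unfolding E_def by (rule CP.el)
  define ph where "ph x = CPev n (Suc m) (fst x) (ext i (g (snd x)))"
    for x :: "(pmat \<Rightarrow> complex) \<times> 'a"
  let ?S = "carrier ?A \<times> carrier M"
  let ?Rel = "balanced_rel ?A ?ps ?B M"
  let ?F = "cfun.span (delta ` ?S)" and ?K = "cfun.span ?Rel"
  have dF: "delta (a, v) \<in> ?F" if "a \<in> carrier ?A" "v \<in> carrier M" for a v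
    using that by (intro cfun.span_base) auto
  note A_add = CP.add_in[of _ n "Suc m"] and A_scale = CP.scale_in[of _ n "Suc m"]
    and A_mult = CP.mult_in[of _ n "Suc m"]
  have rel1: "delta (a + a', v) - delta (a, v) - delta (a', v) \<in> ?K"
    if "a \<in> carrier ?A" "a' \<in> carrier ?A" "v \<in> carrier M" for a a' v
  proof -
    have "delta (a \<oplus>\<^bsub>?A\<^esub> a', v) - delta (a, v) - delta (a', v) \<in> ?Rel"
      unfolding balanced_rel_def using that by blast
    then show ?thesis unfolding CP.add_eq by (rule cfun.span_base)
  qed
  have rel3: "delta (cscale c a, v) - cscale c (delta (a, v)) \<in> ?K"
    if "a \<in> carrier ?A" "v \<in> carrier M" for c a v
    by (rule cfun.span_base) (unfold balanced_rel_def, use that in blast)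
  have rel4: "delta (a \<otimes>\<^bsub>?A\<^esub> ?ps b, v) - delta (a, b \<odot>\<^bsub>M\<^esub> v) \<in> ?K"
    if "a \<in> carrier ?A" "b \<in> carrier ?B" "v \<in> carrier M" for a b v
    by (rule cfun.span_base) (unfold balanced_rel_def, use that in blast)
  have "module_isomorphic ?A (CPV n (Suc m) (incr i mu))
    (quot_module ?S ?Rel (\<lambda>a (a', v). delta (a \<otimes>\<^bsub>?A\<^esub> a', v)))"
  proof (rule CP.quot_iso[where ph = ph and g = "\<lambda>t. (E t, v0)"])
    fix x assume "x \<in> ?S"
    then show "ph x \<in> CPVc n (Suc m) (incr i mu)"
      unfolding ph_def using CP.ev_in ext_in[OF g_in i] by auto
  next
    show "?Rel \<subseteq> ?F"
      unfolding balanced_rel_def CP.add_eq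
      by (auto intro!: cfun.span_diff cfun.span_scale dF A_add A_scale A_mult psi_in[OF i] M_add M_act)
  next
    fix r assume "r \<in> ?Rel"
    then consider
        (1) a a' v where "a \<in> carrier ?A" "a' \<in> carrier ?A" "v \<in> carrier M"
          "r = delta (a + a', v) - delta (a, v) - delta (a', v)"
      | (2) a v v' where "a \<in> carrier ?A" "v \<in> carrier M" "v' \<in> carrier M"
          "r = delta (a, v \<oplus>\<^bsub>M\<^esub> v') - delta (a, v) - delta (a, v')"
      | (3) c a v where "a \<in> carrier ?A" "v \<in> carrier M" "r = delta (cscale c a, v) - cscale c (delta (a, v))"
      | (4) a b v where "a \<in> carrier ?A" "b \<in> carrier ?B" "v \<in> carrier M"
          "r = delta (a \<otimes>\<^bsub>?A\<^esub> ?ps b, v) - delta (a, b \<odot>\<^bsub>M\<^esub> v)"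
      unfolding balanced_rel_def CP.add_eq by blast
    then show "lin_ext ph r = 0"
    proof cases
      case 1
      note d = dF[OF A_add[OF 1(1,2)] 1(3)] dF[OF 1(1,3)] dF[OF 1(2,3)]
      show ?thesis unfolding 1(4) lin_ext_span(3)[OF cfun.span_diff[OF d(1,2)] d(3)]
          lin_ext_span(3)[OF d(1,2)] lin_ext_delta ph_def
        by (simp add: CP.ev_add)
    next
      case 2
      note d = dF[OF 2(1) M_add[OF 2(2,3)]] dF[OF 2(1,2)] dF[OF 2(1,3)]
      show ?thesis unfolding 2(4) lin_ext_span(3)[OF cfun.span_diff[OF d(1,2)] d(3)]
          lin_ext_span(3)[OF d(1,2)] lin_ext_delta ph_def
        by (simp add: g_add[OF 2(2,3)] ext_add CP.ev_add2)
    next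
      case 3
      note d = dF[OF A_scale[OF 3(1)] 3(2)] dF[OF 3(1,2)]
      show ?thesis unfolding 3(3) lin_ext_span(3)[OF d(1) cfun.span_scale[OF d(2)]]
          lin_ext_span(2)[OF d(2) d(2)] lin_ext_delta ph_def
        by (simp add: CP.ev_scale)
    next
      case 4
      note d = dF[OF A_mult[OF 4(1) psi_in[OF i]] 4(3)] dF[OF 4(1) M_act[OF 4(2,3)]]
      show ?thesis unfolding 4(4) lin_ext_span(3)[OF d] lin_ext_delta ph_def
        by (simp add: CP.ev_mult[OF 4(1) psi_in[OF i]] ev_psi[OF i] g_act[OF 4(2,3)])
    qed
  next
    fix a x assume a: "a \<in> carrier ?A" and "x \<in> ?S"
    then obtain a' v where x: "x = (a', v)" "a' \<in> carrier ?A" "v \<in> carrier M" by blast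
    show "(case x of (a', v) \<Rightarrow> delta (a \<otimes>\<^bsub>?A\<^esub> a', v)) \<in> ?F"
      unfolding x(1) using dF[OF A_mult[OF a x(2)] x(3)] by simp
    show "lin_ext ph (case x of (a', v) \<Rightarrow> delta (a \<otimes>\<^bsub>?A\<^esub> a', v)) = CPev n (Suc m) a (ph x)"
      unfolding x(1) by (simp add: ph_def CP.ev_mult[OF a x(2)])
  next
    fix t assume t: "t \<in> states n (Suc m)" "cl n t = incr i mu"
    have "ph (E t, v0) = CPev n (Suc m) (E t) (delta ?u)" unfolding ph_def by (simp add: v0 ext_delta)
    also have "\<dots> = delta t"
      unfolding CP.ev_delta[OF u(1)] E_def CP.el using t u by (auto simp: delta_apply fun_eq_iff)
    finally show "(E t, v0) \<in> ?S \<and> ph (E t, v0) = delta t" using E_in v0 by simp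
  next
    fix x assume "x \<in> ?S"
    then obtain a v where x: "x = (a, v)" and a: "a \<in> carrier ?A" and v: "v \<in> carrier M" by blast
    \<comment> \<open>The matrix with the single column \<open>s0\<close> equal to
      \<open>g v\<close>; it carries \<open>delta s0\<close> to \<open>g v\<close>, hence
      \<open>v0\<close> to \<open>v\<close>.\<close>
    define b where "b = CPel n m (\<lambda>s t. if t = s0 then g v s else 0)"
    have b: "b \<in> carrier ?B" unfolding b_def by (rule CP.el)
    have bs: "CPev n m b (delta s0) = g v"
      unfolding CP.ev_delta[OF s0(1)] b_def CP.el using s0 g_in[OF v] by (auto simp: fun_eq_iff CP.Vc_def)
    have "b \<odot>\<^bsub>M\<^esub> v0 = h (g (b \<odot>\<^bsub>M\<^esub> v0))" using hg M_act[OF b v0(1)] by simp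
    also have "\<dots> = v" using g_act[OF b v0(1)] v0(2) bs hg[OF v] by simp
    finally have bv: "b \<odot>\<^bsub>M\<^esub> v0 = v" .
    define a' where "a' = a \<otimes>\<^bsub>?A\<^esub> ?ps b"
    have a': "a' \<in> carrier ?A" unfolding a'_def using A_mult[OF a psi_in[OF i]] .
    define D where "D = {t \<in> states n (Suc m). cl n t = incr i mu}"
    have D: "finite D" unfolding D_def using finite_states by simp
    let ?W = "cfun.span (?Rel \<union> (\<lambda>t. delta (E t, v0)) ` D)"
    have KW: "?K \<subseteq> ?W" by (intro cfun.span_mono) blast
    \<comment> \<open>\<open>b\<close> is supported in the column \<open>s0\<close>, and
      \<open>psi\<close> with index \<open>i\<close> forces the last letter \<open>i\<close>.
      Multiplication by it from the right leaves only the column \<open>s0 @ [i]\<close>.\<close>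
    have col: "Zs n (Suc m) a' t t' = 0" if "t' \<noteq> ?u" for t t'
    proof -
      have "Zs n (Suc m) (?ps b) r t' = 0" for r
      proof (rule ccontr)
        assume nz: "Zs n (Suc m) (?ps b) r t' \<noteq> 0"
        then obtain r' x t'' y where rt: "r = r' @ [x]" "r' \<in> states n m" "x \<le> n"
          "t' = t'' @ [y]" "t'' \<in> states n m" "y \<le> n"
          using CP.Th_supp[of n "Suc m" "?ps b" r t'] unfolding states_Suc by blast
        then have "y = i" "Zs n m b r' t'' \<noteq> 0"
          using nz Zs_psi[OF i rt(3,6), of r' m t'' b] by (auto simp: states_def split: if_splits)
        then show False using \<open>t' \<noteq> ?u\<close> rt(4) unfolding b_def CP.el by (auto split: if_splits)
      qed
      then show ?thesis unfolding a'_def CP.Th_mult[OF a psi_in[OF i]] by simp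
    qed
    have eq: "a' = (\<Sum>t\<in>D. cscale (Zs n (Suc m) a' t ?u) (E t))"
    proof (rule CP.Th_cong[OF a'])
      show "(\<Sum>t\<in>D. cscale (Zs n (Suc m) a' t ?u) (E t)) \<in> carrier ?A"
        using E_in by (simp add: CP_carrier sum_fun_apply cscale_def)
      fix t t'
      have "Zs n (Suc m) (\<Sum>t\<in>D. cscale (Zs n (Suc m) a' t ?u) (E t)) t t' =
          (\<Sum>r\<in>D. if r = t then (if t' = ?u then Zs n (Suc m) a' t ?u else 0) else 0)"
        unfolding Zs_sum Zs_scale E_def CP.el using u by (intro sum.cong) (auto simp: D_def)
      also have "\<dots> = (if t' = ?u then Zs n (Suc m) a' t ?u else 0)"
        using D CP.Th_supp[of n "Suc m" a' t ?u] u by (auto simp: D_def)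
      also have "\<dots> = Zs n (Suc m) a' t t'" using col by simp
      finally show "Zs n (Suc m) a' t t' = Zs n (Suc m) (\<Sum>t\<in>D. cscale (Zs n (Suc m) a' t ?u) (E t)) t t'" ..
    qed
    have sum: "delta (\<Sum>t\<in>B. cscale (c t) (E t), v0) \<in> ?W" if "finite B" "B \<subseteq> D" for B c
      using that
    proof (induction B rule: finite_induct)
      \<comment> \<open>The scalar relation with scalar 0 reduces to the generator
        \<open>(0, v0)\<close> itself.\<close>
      case empty
      show ?case using KW rel3[OF E_in v0(1), of 0] by simp blast
    next
      case (insert t B)
      let ?q = "\<Sum>t\<in>B. cscale (c t) (E t)" and ?p = "cscale (c t) (E t)"
      have q: "?q \<in> carrier ?A" using E_in by (simp add: CP_carrier sum_fun_apply cscale_def)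
      have "delta (E t, v0) \<in> ?W" using insert.prems by (intro cfun.span_base) blast
      note W = subsetD[OF KW rel1[OF A_scale[OF E_in] q v0(1)]] subsetD[OF KW rel3[OF E_in v0(1)]]
        cfun.span_scale[OF this]
      have "delta (?q, v0) \<in> ?W" using insert by blast
      then have "(delta (?p + ?q, v0) - delta (?p, v0) - delta (?q, v0)) +
          (delta (?p, v0) - cscale (c t) (delta (E t, v0))) + cscale (c t) (delta (E t, v0)) + delta (?q, v0) \<in> ?W"
        by (intro cfun.span_add W)
      then show ?case using insert.hyps by simp
    qed
    have "delta (a', v0) - delta (a, v) \<in> ?W" using KW rel4[OF a b v0(1)] unfolding bv a'_def by blast
    moreover have "delta (a', v0) \<in> ?W" by (subst eq) (rule sum[OF D subset_refl])
    ultimately have "delta (a', v0) - (delta (a', v0) - delta (a, v)) \<in> ?W" using cfun.span_diff by blast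
    then show "delta x \<in> cfun.span (?Rel \<union> (\<lambda>t. delta (E t, v0)) ` {t \<in> states n (Suc m). cl n t = incr i mu})"
      unfolding x D_def by simp
  qed
  then show ?thesis unfolding Ind_def ind_module_def by simp
qed

text \<open>The name refers to the letters: one \<open>i\<close> becomes \<open>i - 1\<close>. This
  is the effect of the raising operator of colour \<open>i\<close>, and \<open>raise\<close> is that
  of the lowering operator.\<close>

definition lower :: "nat \<Rightarrow> nat list \<Rightarrow> nat list" where
  "lower i mu = mu[i := mu ! i - 1, i - 1 := Suc (mu ! (i - 1))]"

definition raise :: "nat \<Rightarrow> nat list \<Rightarrow> nat list" where
  "raise i mu = mu[i - 1 := mu ! (i - 1) - 1, i := Suc (mu ! i)]"

lemma incr_lower:
  assumes "1 \<le> i" "i < length mu" "mu ! i > 0" shows "incr i (lower i mu) = incr (i - 1) mu"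
  using assms by (intro nth_equalityI) (auto simp: incr_def lower_def nth_list_update)

lemma incr_raise:
  assumes "1 \<le> i" "i < length mu" "mu ! (i - 1) > 0" shows "incr (i - 1) (raise i mu) = incr i mu"
  using assms by (intro nth_equalityI) (auto simp: incr_def raise_def nth_list_update)

lemma cl_image_iff: "mu \<in> cl n ` states n m \<longleftrightarrow> length mu = Suc n \<and> sum_list mu = m"
proof
  assume "length mu = Suc n \<and> sum_list mu = m"
  then show "mu \<in> cl n ` states n m" using row_states[of mu n] cl_row[of mu n] by (metis image_eqI)
next
  assume "mu \<in> cl n ` states n m"
  then obtain s where s: "s \<in> states n m" "mu = cl n s" by blast
  have "sum_list mu = (\<Sum>i<Suc n. count_list s i)"
    unfolding s(2) cl_def by (simp add: sum_list_distinct_conv_sum_set atLeast0LessThan del: upt_Suc)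
  also have "\<dots> = length s" using s(1) by (intro sum_count_set) (auto simp: states_def)
  finally show "length mu = Suc n \<and> sum_list mu = m" using s by (simp add: states_def)
qed

text \<open>Induction adds a letter \<open>i - 1\<close> and restriction removes a letter
  \<open>i\<close>. The intermediate tuple \<open>incr (i - 1) mu\<close> has the form
  \<open>incr i _\<close> required by \<open>Res_iso\<close> because \<open>mu\<close> contains an
  \<open>i\<close>.\<close>

lemma Efun_iso:
  assumes "1 \<le> i" "i \<le> n" "length mu = Suc n" "sum_list mu = m" "mu ! i > 0"
  shows "module_isomorphic (CP n m) (CPV n m (lower i mu)) (Efun n i m (Wmod n mu))"
proof -
  have "module_isomorphic (CP n (Suc m)) (CPV n (Suc m) (incr i (lower i mu))) (Ind n (i - 1) (Suc m) (Wmod n mu))"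
    using assms Ind_iso[OF Wmod_iso[OF assms(3,4)], of "i - 1"] incr_lower[of i mu]
    by (simp add: cl_image_iff)
  then show ?thesis unfolding Efun_def Suc_eq_plus1[symmetric] using assms
    by (intro Res_iso) (auto simp: lower_def)
qed

lemma Ffun_iso:
  assumes "1 \<le> i" "i \<le> n" "length mu = Suc n" "sum_list mu = m" "mu ! (i - 1) > 0"
  shows "module_isomorphic (CP n m) (CPV n m (raise i mu)) (Ffun n i m (Wmod n mu))"
proof -
  have "module_isomorphic (CP n (Suc m)) (CPV n (Suc m) (incr (i - 1) (raise i mu))) (Ind n i (Suc m) (Wmod n mu))"
    using assms Ind_iso[OF Wmod_iso[OF assms(3,4)], of i] incr_raise[of i mu]
    by (simp add: cl_image_iff)
  then show ?thesis unfolding Ffun_def Suc_eq_plus1[symmetric] using assms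
    by (intro Res_iso) (auto simp: raise_def)
qed

section \<open>Outer tensor products\<close>

definition lprod :: "('b \<Rightarrow> 'a set) \<Rightarrow> 'b list \<Rightarrow> 'a list set" where
  "lprod A ms = {xs. list_all2 (\<lambda>x m. x \<in> A m) xs ms}"

lemma lprod_iff: "xs \<in> lprod A ms \<longleftrightarrow> length xs = length ms \<and> (\<forall>j<length ms. xs ! j \<in> A (ms ! j))"
  by (auto simp: lprod_def list_all2_conv_all_nth)

lemma lprod_Cons: "lprod A (m # ms) = (\<lambda>(x, xs). x # xs) ` (A m \<times> lprod A ms)"
  by (auto simp: lprod_def list_all2_Cons2)

lemma lprod_Nil: "lprod A [] = {[]}"
  by (auto simp: lprod_def)

lemma finite_lprod: "(\<And>m. finite (A m)) \<Longrightarrow> finite (lprod A ms)"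
  by (induction ms) (auto simp: lprod_Nil lprod_Cons)

text \<open>The distributive law for tuples; it allows transforms of pure tensors to be computed one
  factor at a time.\<close>

lemma sum_prod_lprod:
  fixes F :: "nat \<Rightarrow> 'a \<Rightarrow> complex"
  shows "(\<Sum>xs\<in>lprod A ms. \<Prod>j<length ms. F j (xs ! j)) = (\<Prod>j<length ms. \<Sum>x\<in>A (ms ! j). F j x)"
proof (induction ms arbitrary: F)
  case Nil
  then show ?case by (simp add: lprod_Nil)
next
  case (Cons m ms)
  have inj: "inj_on (\<lambda>(x, xs). x # xs) (A m \<times> lprod A ms)" by (auto simp: inj_on_def)
  have "(\<Sum>xs\<in>lprod A (m # ms). \<Prod>j<length (m # ms). F j (xs ! j)) =
      (\<Sum>(x, xs)\<in>A m \<times> lprod A ms. F 0 x * (\<Prod>j<length ms. F (Suc j) (xs ! j)))"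
    unfolding lprod_Cons sum.reindex[OF inj]
    by (rule sum.cong) (auto simp del: prod.lessThan_Suc simp add: prod.lessThan_Suc_shift)
  also have "\<dots> = (\<Sum>x\<in>A m. F 0 x) * (\<Sum>xs\<in>lprod A ms. \<Prod>j<length ms. F (Suc j) (xs ! j))"
    unfolding sum_product sum.cartesian_product ..
  also have "\<dots> = (\<Prod>j<length (m # ms). \<Sum>x\<in>A ((m # ms) ! j). F j x)"
    using Cons.IH[of "\<lambda>j. F (Suc j)"] by (simp del: prod.lessThan_Suc add: prod.lessThan_Suc_shift)
  finally show ?case .
qed

lemma Plist_lprod: "Plist n lam = lprod (Pmat n) lam"
  by (simp add: Plist_def lprod_def)

definition Lcov :: "nat \<Rightarrow> nat list \<Rightarrow> pmat list \<Rightarrow> nat list list \<Rightarrow> nat list list \<Rightarrow> bool" where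
  "Lcov n lam ds ss tt \<longleftrightarrow> length ss = length lam \<and> length tt = length lam \<and>
     (\<forall>j<length lam. cov n (lam ! j) (ds ! j) (ss ! j) (tt ! j))"

definition LZ :: "nat \<Rightarrow> nat list \<Rightarrow> (pmat list \<Rightarrow> complex) \<Rightarrow> nat list list \<Rightarrow> nat list list \<Rightarrow> complex" where
  "LZ n lam f ss tt = (\<Sum>ds\<in>Plist n lam. if Lcov n lam ds ss tt then f ds else 0)"

abbreviation "Lst n lam \<equiv> lprod (states n) lam"

lemma Lcov_prod:
  assumes "length ss = length lam" "length tt = length lam"
  shows "(if Lcov n lam ds ss tt then \<Prod>j<length lam. f j (ds ! j) else 0) =
    (\<Prod>j<length lam. if cov n (lam ! j) (ds ! j) (ss ! j) (tt ! j) then f j (ds ! j) else (0 :: complex))"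
proof (cases "Lcov n lam ds ss tt")
  case True
  then show ?thesis unfolding Lcov_def by (auto intro!: prod.cong)
next
  case False
  then obtain j where "j < length lam" "\<not> cov n (lam ! j) (ds ! j) (ss ! j) (tt ! j)"
    using assms unfolding Lcov_def by blast
  then have "(\<Prod>j<length lam. if cov n (lam ! j) (ds ! j) (ss ! j) (tt ! j) then f j (ds ! j) else (0 :: complex)) = 0"
    by (intro prod_zero) auto
  then show ?thesis using False by simp
qed

text \<open>Coverings, least elements and blocks are all taken componentwise. The axiom about the
  unit is a sum over all tuples; it factors into the corresponding sums for the single algebras by
  \<open>sum_prod_lprod\<close>.\<close>

lemma CPlist_matrix_algebra: "matrix_algebra (CPlist n lam) (Lst n lam) (map (cl n)) (LZ n lam)"
proof -
  let ?k = "length lam"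
  let ?D = "\<lambda>ss tt. map (\<lambda>j. Dm (lam ! j) (ss ! j) (tt ! j)) [0..<?k]"
  let ?e = "\<lambda>ds. if length ds = ?k then \<Prod>j<?k. unit_elt n (lam ! j) (ds ! j) else 0"
  have cle: "cl n (ss ! j) = cl n (tt ! j)" if "map (cl n) ss = map (cl n) tt" "length ss = ?k" "j < ?k" for ss tt j
  proof -
    have "length tt = ?k" using that by (metis length_map)
    then show ?thesis using that by (metis nth_map)
  qed
  have "zeta_semigroup (Plist n lam) (map2 (\<lambda>a b. a * b)) (Lst n lam) (map (cl n)) (Lcov n lam) ?D ?e"
    unfolding Plist_lprod
  proof
    show "finite (lprod (Pmat n) lam)" "finite (Lst n lam)"
      by (intro finite_lprod finite_Pmat, intro finite_lprod finite_states)
    fix a assume a: "a \<in> lprod (Pmat n) lam"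
    then have aj: "a ! j \<in> Pmat n (lam ! j)" if "j < ?k" for j using that by (auto simp: lprod_iff)
    have la: "length a = ?k" using a by (simp add: lprod_iff)
    show "map2 (\<lambda>a b. a * b) a b \<in> lprod (Pmat n) lam" if "b \<in> lprod (Pmat n) lam" for b
      using aj la that Pmat_mult by (auto simp: lprod_iff)
    show "ss \<in> Lst n lam \<and> tt \<in> Lst n lam \<and> map (cl n) ss = map (cl n) tt" if c: "Lcov n lam a ss tt" for ss tt
    proof (intro conjI)
      show "ss \<in> Lst n lam" "tt \<in> Lst n lam" using c unfolding Lcov_def lprod_iff cov_def by auto
      show "map (cl n) ss = map (cl n) tt"
        using c cov_cl[OF aj] unfolding Lcov_def by (intro nth_equalityI) auto
    qed
    show "Lcov n lam (map2 (\<lambda>a b. a * b) a b) ss tt \<longleftrightarrow> (\<exists>uu. Lcov n lam a ss uu \<and> Lcov n lam b uu tt)"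
      if "b \<in> lprod (Pmat n) lam" for b ss tt
    proof -
      have bj: "b ! j \<in> Pmat n (lam ! j)" if "j < ?k" for j using that \<open>b \<in> lprod (Pmat n) lam\<close> by (auto simp: lprod_iff)
      have lb: "length b = ?k" using that by (simp add: lprod_iff)
      have cm: "cov n (lam ! j) (map2 (\<lambda>a b. a * b) a b ! j) s t \<longleftrightarrow>
        (\<exists>u. cov n (lam ! j) (a ! j) s u \<and> cov n (lam ! j) (b ! j) u t)" if "j < ?k" for j s t
        using that la lb cov_mult[OF aj bj] by simp
      show ?thesis
      proof
        assume c: "Lcov n lam (map2 (\<lambda>a b. a * b) a b) ss tt"
        then have "\<forall>j<?k. \<exists>u. cov n (lam ! j) (a ! j) (ss ! j) u \<and> cov n (lam ! j) (b ! j) u (tt ! j)"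
          using cm unfolding Lcov_def by blast
        then obtain u where "\<forall>j<?k. cov n (lam ! j) (a ! j) (ss ! j) (u j) \<and> cov n (lam ! j) (b ! j) (u j) (tt ! j)"
          by metis
        then have "Lcov n lam a ss (map u [0..<?k]) \<and> Lcov n lam b (map u [0..<?k]) tt"
          using c unfolding Lcov_def by simp
        then show "\<exists>uu. Lcov n lam a ss uu \<and> Lcov n lam b uu tt" by blast
      next
        assume "\<exists>uu. Lcov n lam a ss uu \<and> Lcov n lam b uu tt"
        then show "Lcov n lam (map2 (\<lambda>a b. a * b) a b) ss tt"
          using cm unfolding Lcov_def by blast
      qed
    qed
    show "uu = vv" if "Lcov n lam a ss uu" "Lcov n lam a ss vv" for ss uu vv
    proof (rule nth_equalityI)
      show "length uu = length vv" using that unfolding Lcov_def by simp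
      fix j assume "j < length uu"
      then show "uu ! j = vv ! j" using that cov_row_uniq[OF aj, of j] unfolding Lcov_def by metis
    qed
    show "Lcov n lam a ss' tt'" if c: "Lcov n lam a ss tt" "Lcov n lam (?D ss tt) ss' tt'" for ss tt ss' tt'
    proof -
      have "cov n (lam ! j) (a ! j) (ss' ! j) (tt' ! j)" if j: "j < ?k" for j
      proof (rule cov_mono)
        show "cov n (lam ! j) (Dm (lam ! j) (ss ! j) (tt ! j)) (ss' ! j) (tt' ! j)"
          using c(2) j unfolding Lcov_def by simp
        show "ent (a ! j) r c i" if "ent (Dm (lam ! j) (ss ! j) (tt ! j)) r c i" for r c i
          using ent_Dm_imp[OF aj[OF j] _ that] c(1) j unfolding Lcov_def by blast
      qed
      then show ?thesis using c unfolding Lcov_def by blast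
    qed
    show "\<exists>ss\<in>Lst n lam. \<exists>tt\<in>Lst n lam. map (cl n) ss = map (cl n) tt \<and> a = ?D ss tt"
    proof -
      have "\<forall>j<?k. \<exists>s t. s \<in> states n (lam ! j) \<and> t \<in> states n (lam ! j) \<and> cl n s = cl n t \<and> a ! j = Dm (lam ! j) s t"
        using Pmat_Dm[OF aj] by blast
      then obtain s t where st: "\<And>j. j < ?k \<Longrightarrow> s j \<in> states n (lam ! j) \<and> t j \<in> states n (lam ! j) \<and>
          cl n (s j) = cl n (t j) \<and> a ! j = Dm (lam ! j) (s j) (t j)" by metis
      have "a = ?D (map s [0..<?k]) (map t [0..<?k])" using st la by (intro nth_equalityI) auto
      moreover have "map (cl n) (map s [0..<?k]) = map (cl n) (map t [0..<?k])"
        using st by (intro nth_equalityI) auto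
      ultimately show ?thesis using st
        by (intro bexI[of _ "map s [0..<?k]"] bexI[of _ "map t [0..<?k]"]) (auto simp: lprod_iff)
    qed
  next
    fix ss tt assume s: "ss \<in> Lst n lam" and t: "tt \<in> Lst n lam"
    then have len: "length ss = ?k" "length tt = ?k" by (auto simp: lprod_iff)
    have sj: "ss ! j \<in> states n (lam ! j)" and tj: "tt ! j \<in> states n (lam ! j)" if "j < ?k" for j
      using s t that by (auto simp: lprod_iff)
    show "(\<Sum>ds\<in>lprod (Pmat n) lam. if Lcov n lam ds ss tt then ?e ds else 0) = (if ss = tt then 1 else 0)"
    proof -
      have "(\<Sum>ds\<in>lprod (Pmat n) lam. if Lcov n lam ds ss tt then ?e ds else 0) =
        (\<Sum>ds\<in>lprod (Pmat n) lam. \<Prod>j<?k. if cov n (lam ! j) (ds ! j) (ss ! j) (tt ! j) then unit_elt n (lam ! j) (ds ! j) else 0)"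
      proof (rule sum.cong[OF refl])
        fix ds assume "ds \<in> lprod (Pmat n) lam"
        then have "length ds = ?k" by (simp add: lprod_iff)
        then show "(if Lcov n lam ds ss tt then ?e ds else 0) =
          (\<Prod>j<?k. if cov n (lam ! j) (ds ! j) (ss ! j) (tt ! j) then unit_elt n (lam ! j) (ds ! j) else 0)"
          using Lcov_prod[OF len, of n ds "\<lambda>j d. unit_elt n (lam ! j) d"]
          by (simp only: simp_thms if_True)
      qed
      also have "\<dots> = (\<Prod>j<?k. Zs n (lam ! j) (unit_elt n (lam ! j)) (ss ! j) (tt ! j))"
        unfolding Zs_def
        by (rule sum_prod_lprod[where F = "\<lambda>j d. if cov n (lam ! j) d (ss ! j) (tt ! j) then unit_elt n (lam ! j) d else 0"])
      also have "\<dots> = (\<Prod>j<?k. if ss ! j = tt ! j then 1 else 0)"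
        using Zs_unit[OF sj tj] by (intro prod.cong) auto
      also have "\<dots> = (if ss = tt then 1 else 0)"
      proof (cases "ss = tt")
        case False
        then obtain j where "j < ?k" "ss ! j \<noteq> tt ! j" using len by (metis nth_equalityI)
        then have "(\<Prod>j<?k. if ss ! j = tt ! j then 1 else (0 :: complex)) = 0" by (intro prod_zero) auto
        then show ?thesis using False by simp
      qed simp
      finally show ?thesis .
    qed
    assume eq: "map (cl n) ss = map (cl n) tt"
    note eqj = cle[OF eq len(1)]
    show "?D ss tt \<in> lprod (Pmat n) lam" using Dm_in sj tj by (auto simp: lprod_iff)
    show "Lcov n lam (?D ss tt) ss tt" using Dm_cov sj tj eqj len by (auto simp: Lcov_def)
    show "ss = ss' \<and> tt = tt'" if c: "Lcov n lam (?D ss tt) ss' tt'" "Lcov n lam (?D ss' tt') ss tt" for ss' tt'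
    proof -
      have "ss ! j = ss' ! j \<and> tt ! j = tt' ! j" if j: "j < ?k" for j
        using Dm_antisym[OF sj[OF j] tj[OF j] eqj[OF j], of "ss' ! j" "tt' ! j"] c j unfolding Lcov_def by simp
      moreover have "length ss' = ?k" "length tt' = ?k" using c unfolding Lcov_def by auto
      ultimately show ?thesis using len by (auto intro!: nth_equalityI)
    qed
  next
    fix ds assume "ds \<notin> lprod (Pmat n) lam"
    then have "length ds = ?k \<Longrightarrow> \<exists>j<?k. ds ! j \<notin> Pmat n (lam ! j)" by (auto simp: lprod_iff)
    then have "length ds = ?k \<Longrightarrow> \<exists>j<?k. unit_elt n (lam ! j) (ds ! j) = 0" using unit_supp by blast
    then show "?e ds = 0" by (auto intro!: prod_zero)
  qed
  then interpret Z: zeta_semigroup "Plist n lam" "map2 (\<lambda>a b. a * b)" "Lst n lam" "map (cl n)" "Lcov n lam" ?D ?e .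
  have "Z.Z = LZ n lam" by (intro ext) (simp add: Z.Z_def LZ_def)
  then show ?thesis using Z.matrix_algebra_axioms by (simp add: CPlist_def)
qed

global_interpretation CPL: matrix_algebra "CPlist n lam" "Lst n lam" "map (cl n)" "LZ n lam" for n lam
  by (rule CPlist_matrix_algebra)

abbreviation "CPLV n lam \<equiv> matrix_algebra.V (Lst n lam) (map (cl n)) (LZ n lam)"

lemma Lcl_image_iff: "L \<in> map (cl n) ` Lst n lam \<longleftrightarrow> L \<in> labels n lam"
proof
  assume "L \<in> map (cl n) ` Lst n lam"
  then obtain ss where ss: "ss \<in> Lst n lam" "L = map (cl n) ss" by blast
  then have "cl n (ss ! j) \<in> cl n ` states n (lam ! j)" if "j < length lam" for j
    using that by (auto simp: lprod_iff)
  then show "L \<in> labels n lam" using ss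
    by (auto simp: labels_def list_all2_conv_all_nth lprod_iff cl_image_iff)
next
  assume L: "L \<in> labels n lam"
  then have lj: "length L = length lam" "\<And>j. j < length lam \<Longrightarrow> length (L ! j) = Suc n \<and> sum_list (L ! j) = lam ! j"
    by (auto simp: labels_def list_all2_conv_all_nth)
  have "map mrow L \<in> Lst n lam" using lj row_states by (auto simp: lprod_iff) metis
  moreover have "L = map (cl n) (map mrow L)" using lj cl_row by (intro nth_equalityI) auto
  ultimately show "L \<in> map (cl n) ` Lst n lam" by blast
qed

section \<open>Outer tensor products of column modules\<close>

lemma outer_gens_iff:
  "vs \<in> outer_gens Ms \<longleftrightarrow> length vs = length Ms \<and> (\<forall>j<length Ms. vs ! j \<in> carrier (Ms ! j))"
  by (auto simp: outer_gens_def list_all2_conv_all_nth)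

lemma outer_gens_update:
  "vs \<in> outer_gens Ms \<Longrightarrow> j < length Ms \<Longrightarrow> v \<in> carrier (Ms ! j) \<Longrightarrow> vs[j := v] \<in> outer_gens Ms"
  by (auto simp: outer_gens_iff nth_list_update)

lemma lin_ext_sum_delta:
  assumes "finite I"
  shows "lin_ext ph (\<Sum>i\<in>I. cscale (c i) (delta (y i))) = (\<Sum>i\<in>I. cscale (c i) (ph (y i)))"
  using assms
proof (induction I rule: finite_induct)
  case (insert i I)
  have d: "cscale (c i) (delta (y i)) \<in> cfun.span (delta ` UNIV)"
    "delta (y i) \<in> cfun.span (delta ` UNIV)"
    by (auto intro: cfun.span_scale cfun.span_base)
  have s: "(\<Sum>i\<in>I. cscale (c i) (delta (y i))) \<in> cfun.span (delta ` UNIV)"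
    by (intro cfun.span_sum cfun.span_scale cfun.span_base) auto
  show ?case using insert lin_ext_span(1)[OF d(1) s, of ph] lin_ext_span(2)[OF d(2,2), of ph] by simp
qed simp

text \<open>A list of vectors goes to the product of their coordinate functions, a function on
  tuples of words. Compatibility with the action is the distributive law; spanning is shown by
  expanding one entry of the list at a time in coordinate vectors.\<close>

lemma outer_tensor_iso:
  fixes Ms :: "(pmat \<Rightarrow> complex, 'v) module list"
  assumes len: "length Ms = length lam" "length mus = length lam"
    and iso: "\<And>j. j < length lam \<Longrightarrow> module_isomorphic (CP n (lam ! j)) (CPV n (lam ! j) (mus ! j)) (Ms ! j)"
  shows "module_isomorphic (CPlist n lam) (CPLV n lam mus) (outer_tensor n lam Ms)"
proof -
  let ?k = "length lam" and ?A = "CPlist n lam"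
  let ?V = "\<lambda>j. CPVc n (lam ! j) (mus ! j)"
  have "\<forall>j<?k. \<exists>h. hom_iso (CP n (lam ! j)) (CPV n (lam ! j) (mus ! j)) (Ms ! j) h"
    using iso unfolding module_isomorphic_iff by blast
  then obtain h where h: "\<And>j. j < ?k \<Longrightarrow> hom_iso (CP n (lam ! j)) (CPV n (lam ! j) (mus ! j)) (Ms ! j) (h j)" by metis
  note hD = hom_isoD[OF h, unfolded CP.V_simps]
  define g where "g j = inv_into (?V j) (h j)" for j
  have gh: "g j (h j p) = p" if "j < ?k" "p \<in> ?V j" for j p using hD(2) that unfolding g_def by simp
  have g_in: "g j v \<in> ?V j" and hg: "h j (g j v) = v" if "j < ?k" "v \<in> carrier (Ms ! j)" for j v
    using that hD(3)[OF that(1)] unfolding g_def by (metis inv_into_into, metis f_inv_into_f)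
  have g_add: "g j (v \<oplus>\<^bsub>Ms ! j\<^esub> w) = g j v + g j w" and M_add: "v \<oplus>\<^bsub>Ms ! j\<^esub> w \<in> carrier (Ms ! j)"
    if "j < ?k" "v \<in> carrier (Ms ! j)" "w \<in> carrier (Ms ! j)" for j v w
  proof -
    have *: "v \<oplus>\<^bsub>Ms ! j\<^esub> w = h j (g j v + g j w)"
      using hD(5)[OF that(1) g_in g_in] hg that by simp
    have "g j v + g j w \<in> ?V j" using CP.Vc_add g_in that by blast
    then show "g j (v \<oplus>\<^bsub>Ms ! j\<^esub> w) = g j v + g j w" "v \<oplus>\<^bsub>Ms ! j\<^esub> w \<in> carrier (Ms ! j)"
      unfolding * by (rule gh[OF that(1)], rule hD(4)[OF that(1)])
  qed
  have g_act: "g j (b \<odot>\<^bsub>Ms ! j\<^esub> v) = CPev n (lam ! j) b (g j v)" and M_act: "b \<odot>\<^bsub>Ms ! j\<^esub> v \<in> carrier (Ms ! j)"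
    if "j < ?k" "b \<in> carrier (CP n (lam ! j))" "v \<in> carrier (Ms ! j)" for j b v
  proof -
    have *: "b \<odot>\<^bsub>Ms ! j\<^esub> v = h j (CPev n (lam ! j) b (g j v))"
      using hD(6)[OF that(1,2) g_in[OF that(1,3)]] hg[OF that(1,3)] by simp
    have "CPev n (lam ! j) b (g j v) \<in> ?V j" using CP.ev_in g_in that by blast
    then show "g j (b \<odot>\<^bsub>Ms ! j\<^esub> v) = CPev n (lam ! j) b (g j v)" "b \<odot>\<^bsub>Ms ! j\<^esub> v \<in> carrier (Ms ! j)"
      unfolding * by (rule gh[OF that(1)], rule hD(4)[OF that(1)])
  qed
  let ?cs = "\<lambda>j c v. csmult (CP n (lam ! j)) (Ms ! j) c v"
  have one_c: "cscale c \<one>\<^bsub>CP n m\<^esub> \<in> carrier (CP n m)" for c m using CP.scale_in CP.one_in by blast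
  have g_cs: "g j (?cs j c v) = cscale c (g j v)" and M_cs: "?cs j c v \<in> carrier (Ms ! j)"
    if "j < ?k" "v \<in> carrier (Ms ! j)" for j c v
    using g_act[OF that(1) one_c that(2)] M_act[OF that(1) one_c that(2)] CP.ev_one[OF g_in[OF that]]
    unfolding csmult_def by (simp_all add: CP.ev_scale)
  define ph :: "'v list \<Rightarrow> nat list list \<Rightarrow> complex"
    where "ph vs = (\<lambda>ss. if length ss = ?k then \<Prod>j<?k. g j (vs ! j) (ss ! j) else 0)" for vs
  have ph_upd: "ph (vs[j := v]) ss = (if length ss = ?k then g j v (ss ! j) * (\<Prod>i\<in>{..<?k} - {j}. g i (vs ! i) (ss ! i)) else 0)"
    if "j < ?k" "length vs = ?k" for vs j v ss
  proof -
    have "(\<Prod>i<?k. g i (vs[j := v] ! i) (ss ! i)) = g j (vs[j := v] ! j) (ss ! j) * (\<Prod>i\<in>{..<?k} - {j}. g i (vs[j := v] ! i) (ss ! i))"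
      using that by (intro prod.remove) auto
    also have "(\<Prod>i\<in>{..<?k} - {j}. g i (vs[j := v] ! i) (ss ! i)) = (\<Prod>i\<in>{..<?k} - {j}. g i (vs ! i) (ss ! i))"
      by (rule prod.cong) auto
    finally show ?thesis using that by (simp add: ph_def)
  qed
  let ?S = "outer_gens Ms" and ?Rel = "multilinear_rel n lam Ms"
  let ?F = "cfun.span (delta ` ?S)"
  have lenS: "length vs = ?k" if "vs \<in> ?S" for vs using that len by (simp add: outer_gens_iff)
  have Sj: "vs ! j \<in> carrier (Ms ! j)" if "vs \<in> ?S" "j < ?k" for vs j using that len by (simp add: outer_gens_iff)
  have upd: "vs[j := v] \<in> ?S" if "vs \<in> ?S" "j < ?k" "v \<in> carrier (Ms ! j)" for vs j v
    using outer_gens_update that len by metis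
  have dF: "delta vs \<in> ?F" if "vs \<in> ?S" for vs using that by (intro cfun.span_base) auto
  have Relc: "(\<exists>vs j v w. vs \<in> ?S \<and> j < ?k \<and> v \<in> carrier (Ms ! j) \<and> w \<in> carrier (Ms ! j) \<and>
      r = delta (vs[j := v \<oplus>\<^bsub>Ms ! j\<^esub> w]) - delta (vs[j := v]) - delta (vs[j := w])) \<or>
    (\<exists>vs j c v. vs \<in> ?S \<and> j < ?k \<and> v \<in> carrier (Ms ! j) \<and> r = delta (vs[j := ?cs j c v]) - cscale c (delta (vs[j := v])))"
    if "r \<in> ?Rel" for r
    using that unfolding multilinear_rel_def len(1) by blast
  define C where "C = {tt \<in> Lst n lam. map (cl n) tt = mus}"
  have Cj: "tt ! j \<in> states n (lam ! j)" "cl n (tt ! j) = mus ! j" if "tt \<in> C" "j < ?k" for tt j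
  proof -
    show "tt ! j \<in> states n (lam ! j)" using that by (simp add: C_def lprod_iff)
    have "length tt = ?k" "map (cl n) tt = mus" using that by (auto simp: C_def lprod_iff)
    then show "cl n (tt ! j) = mus ! j" using that(2) by (metis nth_map)
  qed
  have dV: "delta t \<in> ?V j" if "t \<in> states n (lam ! j)" "cl n t = mus ! j" for t j
    using CP.Vc_delta that by metis
  define bas where "bas tt = map (\<lambda>j. h j (delta (tt ! j))) [0..<?k]" for tt
  let ?act = "\<lambda>f vs. \<Sum>ds\<in>Plist n lam. cscale (f ds) (delta (map2 (\<lambda>(M, d) v. delta d \<odot>\<^bsub>M\<^esub> v) (zip Ms ds) vs))"
  have dc: "delta d \<in> carrier (CP n m)" if "d \<in> Pmat n m" for d m
    using that by (auto simp: CP_carrier delta_apply)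
  have act1: "map2 (\<lambda>(M, d) v. delta d \<odot>\<^bsub>M\<^esub> v) (zip Ms ds) vs \<in> ?S \<and>
      (\<forall>j<?k. map2 (\<lambda>(M, d) v. delta d \<odot>\<^bsub>M\<^esub> v) (zip Ms ds) vs ! j = delta (ds ! j) \<odot>\<^bsub>Ms ! j\<^esub> (vs ! j))"
    if vs: "vs \<in> ?S" and ds: "ds \<in> Plist n lam" for vs ds
  proof -
    have l: "length ds = ?k" "length vs = ?k" using ds lenS[OF vs] by (auto simp: Plist_lprod lprod_iff)
    have nth: "map2 (\<lambda>(M, d) v. delta d \<odot>\<^bsub>M\<^esub> v) (zip Ms ds) vs ! j = delta (ds ! j) \<odot>\<^bsub>Ms ! j\<^esub> (vs ! j)"
      if "j < ?k" for j using that l len by simp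
    have "delta (ds ! j) \<odot>\<^bsub>Ms ! j\<^esub> (vs ! j) \<in> carrier (Ms ! j)" if "j < ?k" for j
      using M_act[OF that dc Sj[OF vs that]] ds that by (simp add: Plist_lprod lprod_iff)
    then show ?thesis using nth l len by (auto simp: outer_gens_iff)
  qed
  have "module_isomorphic ?A (CPLV n lam mus) (quot_module ?S ?Rel ?act)"
  proof (rule CPL.quot_iso[where ph = ph and g = bas])
    fix vs assume vs: "vs \<in> ?S"
    show "ph vs \<in> matrix_algebra.Vc (Lst n lam) (map (cl n)) mus"
      unfolding CPL.Vc_def
    proof (intro CollectI allI impI)
      fix ss assume nz: "ph vs ss \<noteq> 0"
      then have l: "length ss = ?k" unfolding ph_def by presburger
      then have "(\<Prod>j<?k. g j (vs ! j) (ss ! j)) \<noteq> 0" using nz unfolding ph_def by simp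
      then have "g j (vs ! j) (ss ! j) \<noteq> 0" if "j < ?k" for j using that by auto
      then have *: "ss ! j \<in> states n (lam ! j) \<and> cl n (ss ! j) = mus ! j" if "j < ?k" for j
        using g_in[OF that Sj[OF vs that]] that unfolding CP.Vc_def by blast
      then show "ss \<in> Lst n lam \<and> map (cl n) ss = mus"
        using l len by (auto simp: lprod_iff intro!: nth_equalityI)
    qed
  next
    show "?Rel \<subseteq> ?F"
    proof
      fix r assume "r \<in> ?Rel"
      from Relc[OF this] show "r \<in> ?F"
      proof (elim disjE exE conjE)
        fix vs j v w assume "vs \<in> ?S" "j < ?k" "v \<in> carrier (Ms ! j)" "w \<in> carrier (Ms ! j)"
          "r = delta (vs[j := v \<oplus>\<^bsub>Ms ! j\<^esub> w]) - delta (vs[j := v]) - delta (vs[j := w])"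
        then show "r \<in> ?F" using upd M_add dF by (simp only:) (intro cfun.span_diff; blast)
      next
        fix vs j c v assume "vs \<in> ?S" "j < ?k" "v \<in> carrier (Ms ! j)"
          "r = delta (vs[j := ?cs j c v]) - cscale c (delta (vs[j := v]))"
        then show "r \<in> ?F" using upd M_cs dF by (simp only:) (intro cfun.span_diff cfun.span_scale; blast)
      qed
    qed
  next
    fix r assume "r \<in> ?Rel"
    from Relc[OF this] show "lin_ext ph r = 0"
    proof (elim disjE exE conjE)
      fix vs j v w assume a: "vs \<in> ?S" "j < ?k" "v \<in> carrier (Ms ! j)" "w \<in> carrier (Ms ! j)"
        and r: "r = delta (vs[j := v \<oplus>\<^bsub>Ms ! j\<^esub> w]) - delta (vs[j := v]) - delta (vs[j := w])"
      note d = dF[OF upd[OF a(1,2) M_add[OF a(2,3,4)]]] dF[OF upd[OF a(1,2,3)]] dF[OF upd[OF a(1,2,4)]]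
      have "lin_ext ph r = ph (vs[j := v \<oplus>\<^bsub>Ms ! j\<^esub> w]) - ph (vs[j := v]) - ph (vs[j := w])"
        unfolding r lin_ext_span(3)[OF cfun.span_diff[OF d(1,2)] d(3)] lin_ext_span(3)[OF d(1,2)] lin_ext_delta ..
      also have "\<dots> = 0"
      proof
        fix ss show "(ph (vs[j := v \<oplus>\<^bsub>Ms ! j\<^esub> w]) - ph (vs[j := v]) - ph (vs[j := w])) ss = 0 ss"
          unfolding minus_apply ph_upd[OF a(2) lenS[OF a(1)]] g_add[OF a(2,3,4)]
          by (simp add: fun_simps algebra_simps)
      qed
      finally show "lin_ext ph r = 0" .
    next
      fix vs j c v assume a: "vs \<in> ?S" "j < ?k" "v \<in> carrier (Ms ! j)"
        and r: "r = delta (vs[j := ?cs j c v]) - cscale c (delta (vs[j := v]))"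
      note d = dF[OF upd[OF a(1,2) M_cs[OF a(2,3)]]] dF[OF upd[OF a(1,2,3)]]
      have "lin_ext ph r = ph (vs[j := ?cs j c v]) - cscale c (ph (vs[j := v]))"
        unfolding r lin_ext_span(3)[OF d(1) cfun.span_scale[OF d(2)]] lin_ext_span(2)[OF d(2,2)] lin_ext_delta ..
      also have "\<dots> = 0"
      proof
        fix ss show "(ph (vs[j := ?cs j c v]) - cscale c (ph (vs[j := v]))) ss = 0 ss"
          unfolding minus_apply cscale_simps(1) ph_upd[OF a(2) lenS[OF a(1)]] g_cs[OF a(2,3)]
          by (simp add: fun_simps)
      qed
      finally show "lin_ext ph r = 0" .
    qed
  next
    fix f vs assume f: "f \<in> carrier ?A" and vs: "vs \<in> ?S"
    show "?act f vs \<in> ?F"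
      using act1[OF vs] dF by (intro cfun.span_sum cfun.span_scale) blast
    have fP: "finite (Plist n lam)" unfolding Plist_lprod by (intro finite_lprod finite_Pmat)
    show "lin_ext ph (?act f vs) = matrix_algebra.ev (Lst n lam) (LZ n lam) f (ph vs)"
    proof
      fix ss
      have 1: "lin_ext ph (?act f vs) ss =
        (\<Sum>ds\<in>Plist n lam. f ds * ph (map2 (\<lambda>(M, d) v. delta d \<odot>\<^bsub>M\<^esub> v) (zip Ms ds) vs) ss)"
        unfolding lin_ext_sum_delta[OF fP] sum_fun_apply by (simp add: cscale_simps)
      show "lin_ext ph (?act f vs) ss = matrix_algebra.ev (Lst n lam) (LZ n lam) f (ph vs) ss"
      proof (cases "length ss = ?k")
        case False
        have "LZ n lam f ss tt = 0" for tt
          using CPL.Th_supp[of n lam f ss tt] False by (auto simp: lprod_iff)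
        then show ?thesis unfolding 1 CPL.ev_def using False by (simp add: ph_def)
      next
        case True
        \<comment> \<open>Each factor acts by a sum over the words covered by its matrix.
          Multiplying out gives the sum over the tuples covered by \<open>ds\<close>.\<close>
        have ph2: "ph (map2 (\<lambda>(M, d) v. delta d \<odot>\<^bsub>M\<^esub> v) (zip Ms ds) vs) ss =
            (\<Sum>tt\<in>Lst n lam. if Lcov n lam ds ss tt then ph vs tt else 0)" if ds: "ds \<in> Plist n lam" for ds
        proof -
          have dj: "ds ! j \<in> Pmat n (lam ! j)" if "j < ?k" for j using ds that by (simp add: Plist_lprod lprod_iff)
          have "ph (map2 (\<lambda>(M, d) v. delta d \<odot>\<^bsub>M\<^esub> v) (zip Ms ds) vs) ss =
            (\<Prod>j<?k. \<Sum>t\<in>states n (lam ! j). Zs n (lam ! j) (delta (ds ! j)) (ss ! j) t * g j (vs ! j) t)"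
            unfolding ph_def using True act1[OF vs ds]
            by (simp add: g_act[OF _ dc[OF dj] Sj[OF vs]] CP.ev_def)
          also have "\<dots> = (\<Prod>j<?k. \<Sum>t\<in>states n (lam ! j). if cov n (lam ! j) (ds ! j) (ss ! j) t then g j (vs ! j) t else 0)"
            using Zs_delta[OF dj] by (intro prod.cong sum.cong) auto
          also have "\<dots> = (\<Sum>tt\<in>Lst n lam. \<Prod>j<?k. if cov n (lam ! j) (ds ! j) (ss ! j) (tt ! j) then g j (vs ! j) (tt ! j) else 0)"
            by (rule sum_prod_lprod[symmetric])
          also have "\<dots> = (\<Sum>tt\<in>Lst n lam. if Lcov n lam ds ss tt then ph vs tt else 0)"
          proof (rule sum.cong[OF refl])
            fix tt assume "tt \<in> Lst n lam"
            then have lt: "length tt = ?k" by (simp add: lprod_iff)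
            show "(\<Prod>j<?k. if cov n (lam ! j) (ds ! j) (ss ! j) (tt ! j) then g j (vs ! j) (tt ! j) else 0) =
              (if Lcov n lam ds ss tt then ph vs tt else 0)"
            proof (cases "Lcov n lam ds ss tt")
              case True
              then show ?thesis using lt unfolding Lcov_def ph_def by (auto intro!: prod.cong)
            next
              case False
              then obtain j where "j < ?k" "\<not> cov n (lam ! j) (ds ! j) (ss ! j) (tt ! j)"
                using \<open>length ss = ?k\<close> lt unfolding Lcov_def by blast
              then have "(\<Prod>j<?k. if cov n (lam ! j) (ds ! j) (ss ! j) (tt ! j) then g j (vs ! j) (tt ! j) else 0) = 0"
                by (intro prod_zero) auto
              then show ?thesis using False by simp
            qed
          qed
          finally show ?thesis .
        qed
        have "lin_ext ph (?act f vs) ss =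
          (\<Sum>ds\<in>Plist n lam. \<Sum>tt\<in>Lst n lam. (if Lcov n lam ds ss tt then f ds else 0) * ph vs tt)"
          unfolding 1 using ph2 by (auto simp: sum_distrib_left intro!: sum.cong)
        also have "\<dots> = (\<Sum>tt\<in>Lst n lam. \<Sum>ds\<in>Plist n lam. (if Lcov n lam ds ss tt then f ds else 0) * ph vs tt)"
          by (rule sum.swap)
        also have "\<dots> = matrix_algebra.ev (Lst n lam) (LZ n lam) f (ph vs) ss"
          unfolding CPL.ev_def LZ_def sum_distrib_right ..
        finally show ?thesis .
      qed
    qed
  next
    fix tt assume "tt \<in> Lst n lam" "map (cl n) tt = mus"
    then have tt: "tt \<in> C" by (simp add: C_def)
    then have lt: "length tt = ?k" by (simp add: C_def lprod_iff)
    have "bas tt \<in> ?S"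
      using hD(4) dV Cj[OF tt] len by (auto simp: bas_def outer_gens_iff)
    moreover have "ph (bas tt) = delta tt"
    proof
      fix ss
      have "g j (bas tt ! j) = delta (tt ! j)" if "j < ?k" for j
        using that gh[OF that dV[OF Cj[OF tt that]]] by (simp add: bas_def)
      then have "ph (bas tt) ss = (if length ss = ?k then \<Prod>j<?k. delta (tt ! j) (ss ! j) else 0)"
        unfolding ph_def by simp
      also have "\<dots> = delta tt ss"
      proof (cases "length ss = ?k \<and> ss \<noteq> tt")
        case True
        then obtain j where "j < ?k" "ss ! j \<noteq> tt ! j" using lt by (metis nth_equalityI)
        then have "delta (tt ! j) (ss ! j) = 0" by simp
        then have "(\<Prod>j<?k. delta (tt ! j) (ss ! j)) = 0"
          using \<open>j < ?k\<close> by (intro prod_zero) auto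
        then show ?thesis using True by simp
      next
        case False
        then show ?thesis using lt by (cases "ss = tt") auto
      qed
      finally show "ph (bas tt) ss = delta tt ss" .
    qed
    ultimately show "bas tt \<in> ?S \<and> ph (bas tt) = delta tt" by blast
  next
    let ?W = "cfun.span (?Rel \<union> (\<lambda>tt. delta (bas tt)) ` C)"
    have relW: "r \<in> ?W" if "r \<in> ?Rel" for r using that by (intro cfun.span_base) blast
    \<comment> \<open>The isomorphism with the column module says nothing about the zero recorded in
      \<open>Ms ! j\<close>, so the zero vector is obtained as a multiple by 0.\<close>
    have cs0: "?cs j 0 v = h j 0" if "j < ?k" "v \<in> carrier (Ms ! j)" for j v
      using hg[OF that(1) M_cs[OF that], of 0] g_cs[OF that, of 0] by simp
    have h_scale: "h j (cscale c p) = ?cs j c (h j p)" if "j < ?k" "p \<in> ?V j" for j c p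
    proof -
      have "?cs j c (h j p) = h j (g j (?cs j c (h j p)))" using hg[OF that(1) M_cs[OF that(1) hD(4)[OF that]]] by simp
      also have "\<dots> = h j (cscale c p)" using g_cs[OF that(1) hD(4)[OF that]] gh[OF that] by simp
      finally show ?thesis by simp
    qed
    \<comment> \<open>The first \<open>r\<close> entries are still arbitrary, while those from
      \<open>r\<close> on are already coordinate vectors. The induction step expands the last
      arbitrary entry.\<close>
    have claim: "delta vs \<in> ?W" if "r \<le> ?k" "vs \<in> ?S"
        "\<forall>j. r \<le> j \<and> j < ?k \<longrightarrow> (\<exists>t. t \<in> states n (lam ! j) \<and> cl n t = mus ! j \<and> vs ! j = h j (delta t))" for r vs
      using that
    proof (induction r arbitrary: vs)
      case 0
      then have "\<forall>j<?k. \<exists>t. t \<in> states n (lam ! j) \<and> cl n t = mus ! j \<and> vs ! j = h j (delta t)" by simp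
      then obtain t where t: "\<And>j. j < ?k \<Longrightarrow> t j \<in> states n (lam ! j) \<and> cl n (t j) = mus ! j \<and> vs ! j = h j (delta (t j))"
        by metis
      let ?tt = "map t [0..<?k]"
      have "?tt \<in> C" unfolding C_def using t len by (auto simp: lprod_iff intro!: nth_equalityI)
      moreover have "bas ?tt = vs" using t lenS[OF 0(2)] by (intro nth_equalityI) (auto simp: bas_def)
      ultimately show ?case by (intro cfun.span_base) blast
    next
      case (Suc r)
      then have rk: "r < ?k" by simp
      let ?Vr = "?V r"
      define Cr where "Cr = {t \<in> states n (lam ! r). cl n t = mus ! r}"
      have finCr: "finite Cr" unfolding Cr_def using finite_states by simp
      have vr: "vs ! r \<in> carrier (Ms ! r)" using Sj[OF Suc.prems(2) rk] .
      let ?p = "g r (vs ! r)"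
      have p: "?p \<in> ?Vr" using g_in[OF rk vr] .
      have base: "delta (vs[r := h r (delta t)]) \<in> ?W" if t: "t \<in> Cr" for t
      proof (rule Suc.IH)
        show "r \<le> ?k" using rk by simp
        show "vs[r := h r (delta t)] \<in> ?S" using upd[OF Suc.prems(2) rk hD(4)[OF rk dV]] t by (simp add: Cr_def)
        show "\<forall>j. r \<le> j \<and> j < ?k \<longrightarrow> (\<exists>ta. ta \<in> states n (lam ! j) \<and> cl n ta = mus ! j \<and> vs[r := h r (delta t)] ! j = h j (delta ta))"
        proof (intro allI impI)
          fix j assume j: "r \<le> j \<and> j < ?k"
          show "\<exists>ta. ta \<in> states n (lam ! j) \<and> cl n ta = mus ! j \<and> vs[r := h r (delta t)] ! j = h j (delta ta)"
          proof (cases "j = r")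
            case True
            then show ?thesis using t rk lenS[OF Suc.prems(2)] by (auto simp: Cr_def)
          next
            case False
            then show ?thesis using Suc.prems(3) j by auto
          qed
        qed
      qed
      have part: "delta (vs[r := h r (\<lambda>s. if s \<in> B then ?p s else 0)]) \<in> ?W" if "finite B" "B \<subseteq> Cr" for B
        using that
      proof (induction B rule: finite_induct)
        case empty
        have "delta (vs[r := ?cs r 0 (vs ! r)]) - cscale 0 (delta (vs[r := vs ! r])) \<in> ?Rel"
          unfolding multilinear_rel_def len(1) using Suc.prems(2) rk vr by blast
        then have "delta (vs[r := h r 0]) - cscale 0 (delta (vs[r := vs ! r])) \<in> ?W"
          unfolding cs0[OF rk vr] by (rule relW)
        moreover have "(\<lambda>s. if s \<in> {} then ?p s else 0) = 0" by (auto simp: zero_fun_apply)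
        ultimately show ?case by simp
      next
        case (insert t B)
        let ?q = "\<lambda>s. if s \<in> B then ?p s else 0"
        have tC: "t \<in> Cr" using insert by simp
        have dt: "delta t \<in> ?Vr" using dV tC by (simp add: Cr_def)
        have q: "?q \<in> ?Vr" using p by (auto simp: CP.Vc_def)
        have eq: "(\<lambda>s. if s \<in> insert t B then ?p s else 0) = cscale (?p t) (delta t) + ?q"
          using insert.hyps by (auto simp: fun_eq_iff delta_apply fun_simps)
        let ?x = "?cs r (?p t) (h r (delta t))"
        have x: "?x \<in> carrier (Ms ! r)" using M_cs[OF rk hD(4)[OF rk dt]] .
        have "h r (cscale (?p t) (delta t) + ?q) = ?x \<oplus>\<^bsub>Ms ! r\<^esub> h r ?q"
          using hD(5)[OF rk CP.Vc_scale[OF dt] q] h_scale[OF rk dt] by simp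
        then have h1: "h r (\<lambda>s. if s \<in> insert t B then ?p s else 0) = ?x \<oplus>\<^bsub>Ms ! r\<^esub> h r ?q" unfolding eq .
        have r1: "delta (vs[r := ?x \<oplus>\<^bsub>Ms ! r\<^esub> h r ?q]) - delta (vs[r := ?x]) - delta (vs[r := h r ?q]) \<in> ?W"
          by (rule relW) (unfold multilinear_rel_def len(1), use Suc.prems(2) rk x hD(4)[OF rk q] in blast)
        have r2: "delta (vs[r := ?x]) - cscale (?p t) (delta (vs[r := h r (delta t)])) \<in> ?W"
          by (rule relW) (unfold multilinear_rel_def len(1), use Suc.prems(2) rk hD(4)[OF rk dt] in blast)
        have r3: "cscale (?p t) (delta (vs[r := h r (delta t)])) \<in> ?W" using base[OF tC] cfun.span_scale by blast
        have r4: "delta (vs[r := h r ?q]) \<in> ?W" using insert by blast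
        have "(delta (vs[r := ?x \<oplus>\<^bsub>Ms ! r\<^esub> h r ?q]) - delta (vs[r := ?x]) - delta (vs[r := h r ?q]))
          + (delta (vs[r := ?x]) - cscale (?p t) (delta (vs[r := h r (delta t)])))
          + cscale (?p t) (delta (vs[r := h r (delta t)])) + delta (vs[r := h r ?q]) \<in> ?W"
          by (intro cfun.span_add r1 r2 r3 r4)
        then show ?case unfolding h1 by simp
      qed
      have "(\<lambda>s. if s \<in> Cr then ?p s else 0) = ?p" using p by (force simp: CP.Vc_def Cr_def fun_eq_iff)
      then have "delta (vs[r := h r ?p]) \<in> ?W" using part[OF finCr subset_refl] by simp
      then show ?case unfolding hg[OF rk vr] by simp
    qed
    fix vs assume "vs \<in> ?S"
    then have "delta vs \<in> ?W" by (intro claim[of ?k]) auto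
    then show "delta vs \<in> cfun.span (?Rel \<union> (\<lambda>t. delta (bas t)) ` {t \<in> Lst n lam. map (cl n) t = mus})"
      unfolding C_def .
  qed
  then show ?thesis unfolding outer_tensor_def .
qed

section \<open>Signatures of words and labels\<close>

text \<open>\<open>word_eps\<close> and \<open>word_phi\<close> count the signs \<open>-\<close> and \<open>+\<close> left after cancellation in the \<open>i\<close>-signature of
  a word, where a letter \<open>i\<close> carries \<open>-\<close> and a letter \<open>i - 1\<close> carries \<open>+\<close>.\<close>

fun word_eps :: "nat \<Rightarrow> nat list \<Rightarrow> nat" where
  "word_eps i [] = 0"
| "word_eps i (b # w) = (if b = i then 1 else 0) + (word_eps i w - (if Suc b = i then 1 else 0))"

fun word_phi :: "nat \<Rightarrow> nat list \<Rightarrow> nat" where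
  "word_phi i [] = 0"
| "word_phi i (b # w) = word_phi i w + ((if Suc b = i then 1 else 0) - word_eps i w)"

text \<open>The tensor product rule for a box \<open>b\<close> followed by the word
  \<open>w\<close>: \<open>phi_i\<close> of the box is 1 exactly if \<open>Suc b = i\<close>, and it
  is compared with \<open>word_eps i w\<close>, weakly here and strictly in
  \<open>word_f\<close>.\<close>

fun word_e :: "nat \<Rightarrow> nat list \<Rightarrow> nat list option" where
  "word_e i [] = None"
| "word_e i (b # w) = (if word_eps i w \<le> (if Suc b = i then 1 else 0)
     then (if b = i then Some ((i - 1) # w) else None) else map_option ((#) b) (word_e i w))"

fun word_f :: "nat \<Rightarrow> nat list \<Rightarrow> nat list option" where
  "word_f i [] = None"
| "word_f i (b # w) = (if word_eps i w < (if Suc b = i then 1 else 0)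
     then Some (i # w) else map_option ((#) b) (word_f i w))"

fun word_wt :: "nat list \<Rightarrow> nat \<Rightarrow> int" where
  "word_wt [] = 0"
| "word_wt (b # w) = epsw (b + 1) + word_wt w"

text \<open>Crystal axiom (a) for words. It also reconciles the recursion of \<open>word_phi\<close>
  with the maximum in the tensor product rule.\<close>

lemma word_wt_diff: "1 \<le> i \<Longrightarrow> word_wt w i - word_wt w (i + 1) = int (word_phi i w) - int (word_eps i w)"
  by (induction w) (auto simp: fun_simps epsw_def)

lemma word_e_None: "word_e i w = None \<longleftrightarrow> word_eps i w = 0"
  by (induction w) auto

lemma word_f_None: "word_f i w = None \<longleftrightarrow> word_phi i w = 0"
  by (induction w) auto

text \<open>Besides the inverse and the string lengths, the drop of \<open>sum_list\<close> by one
  is recorded: it is the measure for the climb to the highest weight label in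
  \<open>component_verts\<close>.\<close>

lemma word_e_Some:
  "1 \<le> i \<Longrightarrow> word_e i w = Some w' \<Longrightarrow> word_f i w' = Some w \<and> word_eps i w = Suc (word_eps i w') \<and>
     word_phi i w' = Suc (word_phi i w) \<and> sum_list w = Suc (sum_list w') \<and> length w' = length w \<and>
     word_wt w' = word_wt w + epsw i - epsw (i + 1)"
proof (induction w arbitrary: w')
  case (Cons b w)
  show ?case
  proof (cases "word_eps i w \<le> (if Suc b = i then 1 else 0)")
    case True
    then show ?thesis using Cons.prems by (auto split: if_splits simp: fun_eq_iff fun_simps)
  next
    case False
    then obtain w1 where w1: "word_e i w = Some w1" "w' = b # w1" using Cons.prems by auto
    have IH: "word_f i w1 = Some w \<and> word_eps i w = Suc (word_eps i w1) \<and>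
     word_phi i w1 = Suc (word_phi i w) \<and> sum_list w = Suc (sum_list w1) \<and> length w1 = length w \<and>
     word_wt w1 = word_wt w + epsw i - epsw (i + 1)"
      using Cons.IH[OF Cons.prems(1) w1(1)] .
    then show ?thesis using False w1(2) by (auto split: if_splits simp: fun_eq_iff fun_simps)
  qed
qed simp

lemma word_f_Some:
  "1 \<le> i \<Longrightarrow> word_f i w = Some w' \<Longrightarrow> word_e i w' = Some w \<and> word_eps i w' = Suc (word_eps i w)"
proof (induction w arbitrary: w')
  case (Cons b w)
  show ?case
  proof (cases "word_eps i w < (if Suc b = i then 1 else 0)")
    case True
    then have "Suc b = i" "word_eps i w = 0" by (auto split: if_splits)
    then show ?thesis using Cons.prems by auto
  next
    case False
    then obtain w1 where w1: "word_f i w = Some w1" "w' = b # w1" using Cons.prems by auto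
    have IH: "word_e i w1 = Some w \<and> word_eps i w1 = Suc (word_eps i w)"
      using Cons.IH[OF Cons.prems(1) w1(1)] .
    then show ?thesis using False w1(2) by (auto split: if_splits)
  qed
qed simp

lemma word_f_weight:
  assumes "1 \<le> i" "word_f i w = Some w'"
  shows "word_wt w' = word_wt w - epsw i + epsw (i + 1)" "length w' = length w"
  using word_e_Some[OF assms(1), of w' w] word_f_Some[OF assms] by auto

lemma word_e_set: "1 \<le> i \<Longrightarrow> word_e i w = Some w' \<Longrightarrow> set w \<subseteq> {0..n} \<Longrightarrow> set w' \<subseteq> {0..n}"
proof (induction w arbitrary: w')
  case (Cons b w)
  then have b: "b \<le> n" "set w \<subseteq> {0..n}" by auto
  show ?case
  proof (cases "word_e i w")
    case None
    then show ?thesis using Cons.prems b by (auto split: if_splits simp: subset_iff intro: diff_le_self[THEN le_trans])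
  next
    case (Some w1)
    then have "set w1 \<subseteq> {0..n}" using Cons.IH[OF Cons.prems(1) Some b(2)] by simp
    then show ?thesis using Cons.prems Some b
      by (auto split: if_splits simp: subset_iff intro: diff_le_self[THEN le_trans])
  qed
qed simp

lemma word_f_set: "i \<le> n \<Longrightarrow> word_f i w = Some w' \<Longrightarrow> set w \<subseteq> {0..n} \<Longrightarrow> set w' \<subseteq> {0..n}"
proof (induction w arbitrary: w')
  case (Cons b w)
  then have b: "b \<le> n" "set w \<subseteq> {0..n}" by auto
  show ?case
  proof (cases "word_f i w")
    case None
    then show ?thesis using Cons.prems b by (auto split: if_splits simp: subset_iff intro: diff_le_self[THEN le_trans])
  next
    case (Some w1)
    then have "set w1 \<subseteq> {0..n}" using Cons.IH[OF Cons.prems(1) Some b(2)] by simp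
    then show ?thesis using Cons.prems Some b
      by (auto split: if_splits simp: subset_iff intro: diff_le_self[THEN le_trans])
  qed
qed simp

lemma word_f_e_iff: "1 \<le> i \<Longrightarrow> word_f i w' = Some w \<longleftrightarrow> word_e i w = Some w'"
  using word_e_Some word_f_Some by blast

section \<open>Tensor powers of the box crystal\<close>

lemma max_Fin: "max (Fin a) (Fin b) = Fin (max a b)"
  by (auto simp: max_def)

lemma inv_into_map_option:
  assumes "inj_on g S" "\<And>y. z = Some y \<Longrightarrow> y \<in> S"
  shows "map_option (inv_into S g) (map_option g z) = z"
  using assms by (cases z) auto

lemma box_simps:
  "verts (box_crystal n) = {0..n}" "cwt (box_crystal n) j = epsw (j + 1)"
  "ceps (box_crystal n) i j = Fin (if i = j then 1 else 0)"
  "cphi (box_crystal n) i j = Fin (if i = j + 1 then 1 else 0)"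
  "ce (box_crystal n) i j = (if i \<in> {1..n} \<and> j = i then Some (i - 1) else None)"
  "cf (box_crystal n) i j = (if i \<in> {1..n} \<and> j = i - 1 then Some i else None)"
  by (simp_all add: box_crystal_def)

text \<open>Each step unfolds one tensor product with a box. The maxima of the tensor rule become
  truncated subtractions of natural numbers, and \<open>inv_into\<close> only glues head and tail
  together again.\<close>

lemma crystal_power_words:
  assumes "N > 0"
  shows "verts (crystal_power (box_crystal n) N) = {w. length w = N \<and> set w \<subseteq> {0..n}} \<and>
    (\<forall>w. length w = N \<longrightarrow> set w \<subseteq> {0..n} \<longrightarrow>
      cwt (crystal_power (box_crystal n) N) w = word_wt w \<and>
      (\<forall>i\<in>{1..n}. ceps (crystal_power (box_crystal n) N) i w = Fin (int (word_eps i w)) \<and>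
        cphi (crystal_power (box_crystal n) N) i w = Fin (int (word_phi i w)) \<and>
        ce (crystal_power (box_crystal n) N) i w = word_e i w \<and>
        cf (crystal_power (box_crystal n) N) i w = word_f i w))"
  using assms
proof (induction "box_crystal n" N rule: crystal_power.induct)
  case 1
  then show ?case by simp
next
  case 2
  let ?S = "{[b] | b. b \<in> {0..n}}"
  have S: "?S = {w. length w = Suc 0 \<and> set w \<subseteq> {0..n}}"
    by (auto simp: length_Suc_conv)
  have inv: "inv_into ?S hd b = [b]" if "b \<le> n" for b
  proof -
    have "inj_on hd ?S" by (auto simp: inj_on_def)
    then show ?thesis using inv_into_f_f[of hd ?S "[b]"] that by auto
  qed
  show ?case
  proof (intro conjI allI impI ballI)
    show "verts (crystal_power (box_crystal n) (Suc 0)) = {w. length w = Suc 0 \<and> set w \<subseteq> {0..n}}"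
      using S by (simp add: crystal_induced_def box_simps)
    fix w :: "nat list" assume "length w = Suc 0" "set w \<subseteq> {0..n}"
    then obtain b where b: "w = [b]" "b \<le> n" by (auto simp: length_Suc_conv)
    show "cwt (crystal_power (box_crystal n) (Suc 0)) w = word_wt w"
      by (simp add: crystal_induced_def box_simps b)
    fix i assume i: "i \<in> {1..n}"
    show "ceps (crystal_power (box_crystal n) (Suc 0)) i w = Fin (int (word_eps i w))"
      "cphi (crystal_power (box_crystal n) (Suc 0)) i w = Fin (int (word_phi i w))"
      by (auto simp add: crystal_induced_def box_simps b)
    show "ce (crystal_power (box_crystal n) (Suc 0)) i w = word_e i w"
      "cf (crystal_power (box_crystal n) (Suc 0)) i w = word_f i w"
      using i inv[of "i - 1"] inv[of i] by (auto simp add: crystal_induced_def box_simps b)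
  qed
next
  case (3 N)
  let ?P = "crystal_power (box_crystal n) (Suc N)" and ?Q = "crystal_power (box_crystal n) (Suc (Suc N))"
  have vP: "verts ?P = {w. length w = Suc N \<and> set w \<subseteq> {0..n}}"
    and P: "\<And>w. length w = Suc N \<Longrightarrow> set w \<subseteq> {0..n} \<Longrightarrow> cwt ?P w = word_wt w \<and>
      (\<forall>i\<in>{1..n}. ceps ?P i w = Fin (int (word_eps i w)) \<and> cphi ?P i w = Fin (int (word_phi i w)) \<and>
        ce ?P i w = word_e i w \<and> cf ?P i w = word_f i w)"
    using 3 by blast+
  let ?S = "{b # bs | b bs. b \<in> verts (box_crystal n) \<and> bs \<in> verts ?P}"
  have S: "?S = {w. length w = Suc (Suc N) \<and> set w \<subseteq> {0..n}}"
    unfolding vP by (auto simp: length_Suc_conv box_simps)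
  have inv: "inv_into ?S (\<lambda>w. (hd w, tl w)) (b, bs) = b # bs" if "b \<le> n" "length bs = Suc N" "set bs \<subseteq> {0..n}" for b bs
  proof -
    have "inj_on (\<lambda>w. (hd w, tl w)) ?S" by (auto simp: inj_on_def)
    moreover have "b # bs \<in> ?S" using that unfolding S by auto
    ultimately show ?thesis using inv_into_f_f[of "\<lambda>w. (hd w, tl w)" ?S "b # bs"] by simp
  qed
  note Q_def = crystal_power.simps(3)[of "box_crystal n" N]
  show ?case
  proof (intro conjI allI impI ballI)
    show "verts ?Q = {w. length w = Suc (Suc N) \<and> set w \<subseteq> {0..n}}"
      unfolding Q_def crystal_induced_def using S by simp
    fix w :: "nat list" assume "length w = Suc (Suc N)" "set w \<subseteq> {0..n}"
    then obtain b bs where b: "w = b # bs" "b \<le> n" "length bs = Suc N" "set bs \<subseteq> {0..n}"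
      by (auto simp: length_Suc_conv)
    note Pb = P[OF b(3,4)]
    show "cwt ?Q w = word_wt w"
      unfolding Q_def crystal_induced_def crystal_tensor_def using Pb by (simp add: b(1) box_simps)
    fix i assume i: "i \<in> {1..n}"
    have wt: "word_wt bs i - word_wt bs (Suc i) = int (word_phi i bs) - int (word_eps i bs)" using word_wt_diff[of i bs] i by simp
    have Pi: "ceps ?P i bs = Fin (int (word_eps i bs))" "cphi ?P i bs = Fin (int (word_phi i bs))"
      "ce ?P i bs = word_e i bs" "cf ?P i bs = word_f i bs" "cwt ?P bs = word_wt bs" using Pb i by auto
    show "ceps ?Q i w = Fin (int (word_eps i w))"
      unfolding Q_def crystal_induced_def crystal_tensor_def
      by (simp add: b(1) Pi box_simps epsw_def max_Fin) (auto simp: max_def)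
    show "cphi ?Q i w = Fin (int (word_phi i w))"
      unfolding Q_def crystal_induced_def crystal_tensor_def
      by (simp add: b(1) Pi wt box_simps epsw_def max_Fin) (auto simp: max_def)
    have tens_e: "ce ?Q i w = map_option (inv_into ?S (\<lambda>w. (hd w, tl w)))
        (ce (crystal_tensor (box_crystal n) ?P) i (b, bs))"
      "cf ?Q i w = map_option (inv_into ?S (\<lambda>w. (hd w, tl w)))
        (cf (crystal_tensor (box_crystal n) ?P) i (b, bs))"
      unfolding Q_def crystal_induced_def by (simp_all add: b(1))
    have e: "ce (crystal_tensor (box_crystal n) ?P) i (b, bs) = map_option (\<lambda>w. (hd w, tl w)) (word_e i w)"
      unfolding crystal_tensor_def using i
      by (simp add: Pi b(1) box_simps option.map_comp comp_def; auto split: if_splits)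
    have f: "cf (crystal_tensor (box_crystal n) ?P) i (b, bs) = map_option (\<lambda>w. (hd w, tl w)) (word_f i w)"
      unfolding crystal_tensor_def using i
      by (simp add: Pi b(1) box_simps option.map_comp comp_def; auto split: if_splits)
    have inj: "inj_on (\<lambda>w. (hd w, tl w)) ?S" by (auto simp: inj_on_def)
    have wS: "length w = Suc (Suc N)" "set w \<subseteq> {0..n}" using b by auto
    show "ce ?Q i w = word_e i w" unfolding tens_e e
    proof (rule inv_into_map_option[OF inj])
      fix y assume "word_e i w = Some y"
      then show "y \<in> ?S" unfolding S using word_e_Some[of i w y] word_e_set[of i w y n] wS i by auto
    qed
    show "cf ?Q i w = word_f i w" unfolding tens_e f
    proof (rule inv_into_map_option[OF inj])
      fix y assume "word_f i w = Some y"
      then show "y \<in> ?S" unfolding S using word_f_weight(2)[of i w y] word_f_set[of i n w y] wS i by auto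
    qed
  qed
qed

subsection \<open>Concatenations of rows\<close>

lemma append_fun:
  "(@) [] = (\<lambda>w. w)" "(@) (x # u) = (\<lambda>w. x # u @ w)" "(@) (u @ v) = (\<lambda>w. u @ v @ w)"
  by auto

lemma neutral_append:
  assumes "\<forall>b\<in>set u. b \<noteq> i \<and> Suc b \<noteq> i"
  shows "word_eps i (u @ w) = word_eps i w \<and> word_phi i (u @ w) = word_phi i w \<and>
    word_e i (u @ w) = map_option ((@) u) (word_e i w) \<and> word_f i (u @ w) = map_option ((@) u) (word_f i w)"
  using assms
proof (induction u)
  case Nil
  then show ?case by (simp add: option.map_ident append_fun)
next
  case (Cons b u)
  then show ?case using word_e_None[of i w] by (auto simp: option.map_comp comp_def append_fun)
qed

text \<open>A run of \<open>k\<close> letters \<open>i - 1\<close> puts \<open>k\<close> signs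
  \<open>+\<close> in front of \<open>w\<close>. They cancel as many of the remaining
  \<open>-\<close> of \<open>w\<close> as they can, and only the surplus counts.\<close>

lemma plus_append:
  assumes "Suc b = i"
  shows "word_eps i (replicate k b @ w) = word_eps i w - k \<and> word_phi i (replicate k b @ w) = word_phi i w + (k - word_eps i w) \<and>
    word_e i (replicate k b @ w) = (if word_eps i w \<le> k then None else map_option ((@) (replicate k b)) (word_e i w)) \<and>
    word_f i (replicate k b @ w) = (if word_eps i w < k then Some (i # replicate (k - 1) b @ w)
      else map_option ((@) (replicate k b)) (word_f i w))"
proof (induction k)
  case 0
  then show ?case using word_e_None[of i w] by (auto simp: option.map_ident append_fun)
next
  case (Suc k)
  then show ?case using assms by (auto simp: option.map_comp comp_def append_fun)
qed

text \<open>If no \<open>-\<close> remains further right, the last \<open>i\<close> of the run is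
  changed, so that a weakly decreasing word stays weakly decreasing.\<close>

lemma minus_append:
  shows "word_eps i (replicate a i @ v) = a + word_eps i v \<and> word_phi i (replicate a i @ v) = word_phi i v \<and>
    word_e i (replicate a i @ v) = (if word_eps i v = 0 then if a = 0 then None else Some (replicate (a - 1) i @ (i - 1) # v)
      else map_option ((@) (replicate a i)) (word_e i v)) \<and>
    word_f i (replicate a i @ v) = map_option ((@) (replicate a i)) (word_f i v)"
proof (induction a)
  case 0
  then show ?case using word_e_None[of i v] by (auto simp: option.map_ident append_fun)
next
  case (Suc a)
  have "a \<noteq> 0 \<Longrightarrow> i # replicate (a - 1) i @ z = replicate a i @ z" for z by (cases a) auto
  then show ?case using Suc by (cases "a = 0") (auto simp: option.map_comp comp_def append_fun option.map_ident)
qed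

text \<open>In a reversed row all letters \<open>i\<close> stand directly before the letters
  \<open>i - 1\<close>, with neutral letters around them. The same \<open>A\<close> and
  \<open>B\<close> serve all multiplicities, so that the row and its images under
  \<open>lower\<close> and \<open>raise\<close> are handled together.\<close>

lemma mrow_split:
  assumes "1 \<le> i" "i < length mu"
  shows "\<exists>A B. (\<forall>b\<in>set A. b \<noteq> i \<and> Suc b \<noteq> i) \<and> (\<forall>b\<in>set B. b \<noteq> i \<and> Suc b \<noteq> i) \<and>
    (\<forall>x y. rev (mrow (mu[i - 1 := x, i := y])) = A @ replicate y i @ replicate x (i - 1) @ B)"
proof -
  have upt: "[0..<length mu] = [0..<i - 1] @ [i - 1, i] @ [Suc i..<length mu]"
  proof -
    have "[0..<length mu] = [0..<i - 1] @ [i - 1..<length mu]"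
      using assms upt_add_eq_append[of 0 "i - 1" "length mu - (i - 1)"] by simp
    also have "[i - 1..<length mu] = (i - 1) # i # [Suc i..<length mu]"
      using assms by (simp add: upt_conv_Cons)
    finally show ?thesis by simp
  qed
  let ?f = "\<lambda>mu i. replicate (mu ! i) i"
  let ?A = "concat (map (?f mu) [Suc i..<length mu])" and ?B = "concat (map (?f mu) [0..<i - 1])"
  have "mrow (mu[i - 1 := x, i := y]) = ?B @ replicate x (i - 1) @ replicate y i @ ?A" for x y
  proof -
    have 1: "map (?f (mu[i - 1 := x, i := y])) [Suc i..<length mu] = map (?f mu) [Suc i..<length mu]"
      using assms by (intro map_cong) auto
    have 2: "map (?f (mu[i - 1 := x, i := y])) [0..<i - 1] = map (?f mu) [0..<i - 1]"
      using assms by (intro map_cong) auto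
    have 3: "mu[i - 1 := x, i := y] ! (i - 1) = x" "mu[i - 1 := x, i := y] ! i = y" using assms by auto
    show ?thesis unfolding mrow_def length_list_update upt map_append concat_append 1 2 using assms by (auto simp add: nth_list_update)
  qed
  then have "rev (mrow (mu[i - 1 := x, i := y])) = rev ?A @ replicate y i @ replicate x (i - 1) @ rev ?B" for x y
    by simp
  moreover have "\<forall>b\<in>set (rev ?A). b \<noteq> i \<and> Suc b \<noteq> i" "\<forall>b\<in>set (rev ?B). b \<noteq> i \<and> Suc b \<noteq> i"
    using assms by auto
  ultimately show ?thesis by blast
qed

text \<open>A reversed row contributes \<open>mu ! i\<close> signs \<open>-\<close> followed by
  \<open>mu ! (i - 1)\<close> signs \<open>+\<close>, which is the sign pattern assigned to a tensor
  factor on the module side. Hence a whole row can be treated as one factor.\<close>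

lemma row_append:
  assumes i: "1 \<le> i" "i < length mu"
  shows "word_eps i (rev (mrow mu) @ w) = mu ! i + (word_eps i w - mu ! (i - 1))"
    "word_phi i (rev (mrow mu) @ w) = word_phi i w + (mu ! (i - 1) - word_eps i w)"
    "word_e i (rev (mrow mu) @ w) = (if word_eps i w \<le> mu ! (i - 1)
      then (if mu ! i > 0 then Some (rev (mrow (lower i mu)) @ w) else None)
      else map_option ((@) (rev (mrow mu))) (word_e i w))"
    "word_f i (rev (mrow mu) @ w) = (if word_eps i w < mu ! (i - 1) then Some (rev (mrow (raise i mu)) @ w)
      else map_option ((@) (rev (mrow mu))) (word_f i w))"
proof -
  obtain A B where A: "\<forall>b\<in>set A. b \<noteq> i \<and> Suc b \<noteq> i" and B: "\<forall>b\<in>set B. b \<noteq> i \<and> Suc b \<noteq> i"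
    and AB: "\<And>x y. rev (mrow (mu[i - 1 := x, i := y])) = A @ replicate y i @ replicate x (i - 1) @ B"
    using mrow_split[OF i] by metis
  let ?a = "mu ! i" and ?b = "mu ! (i - 1)"
  have m: "rev (mrow mu) = A @ replicate ?a i @ replicate ?b (i - 1) @ B" using AB[of ?b ?a] by simp
  have l: "rev (mrow (lower i mu)) = A @ replicate (?a - 1) i @ replicate (Suc ?b) (i - 1) @ B"
    unfolding lower_def using AB[of "Suc ?b" "?a - 1"] i by (simp add: list_update_swap)
  have r: "rev (mrow (raise i mu)) = A @ replicate (Suc ?a) i @ replicate (?b - 1) (i - 1) @ B"
    unfolding raise_def using AB[of "?b - 1" "Suc ?a"] .
  note NA = neutral_append[OF A] and NB = neutral_append[OF B, of w]
  note PL = plus_append[of "i - 1" i ?b "B @ w"] and MI = minus_append[of i ?a "replicate ?b (i - 1) @ B @ w"]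
  have i1: "Suc (i - 1) = i" using i by simp
  note PL' = PL[OF i1]
  have ep: "word_eps i (replicate ?b (i - 1) @ B @ w) = word_eps i w - ?b" using PL' NB by simp
  show "word_eps i (rev (mrow mu) @ w) = ?a + (word_eps i w - ?b)"
    "word_phi i (rev (mrow mu) @ w) = word_phi i w + (?b - word_eps i w)"
    unfolding m using NA MI PL' NB by simp_all
  show "word_e i (rev (mrow mu) @ w) = (if word_eps i w \<le> ?b
      then (if ?a > 0 then Some (rev (mrow (lower i mu)) @ w) else None)
      else map_option ((@) (rev (mrow mu))) (word_e i w))"
    unfolding m l using NA MI PL' NB by (auto simp: option.map_comp comp_def append_fun)
  have rot: "replicate ?a i @ i # v = i # replicate ?a i @ v" for v by (simp add: replicate_app_Cons_same)
  show "word_f i (rev (mrow mu) @ w) = (if word_eps i w < ?b then Some (rev (mrow (raise i mu)) @ w)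
      else map_option ((@) (rev (mrow mu))) (word_f i w))"
    unfolding m r using NA MI PL' NB rot by (auto simp: option.map_comp comp_def append_fun)
qed

definition Lword :: "nat list list \<Rightarrow> nat list" where
  "Lword L = concat (map (\<lambda>mu. rev (mrow mu)) L)"

lemma Lword_simps [simp]: "Lword [] = []" "Lword (mu # L) = rev (mrow mu) @ Lword L"
  by (simp_all add: Lword_def)

text \<open>The tensor product rule with a whole row as left factor: for the row alone
  \<open>phi_i\<close> is \<open>mu ! (i - 1)\<close> and \<open>eps_i\<close> is
  \<open>mu ! i\<close>. This mediates between operators on words and the signature rule on
  labels.\<close>

fun eL :: "nat \<Rightarrow> nat list list \<Rightarrow> nat list list option" where
  "eL i [] = None"
| "eL i (mu # L) = (if word_eps i (Lword L) \<le> mu ! (i - 1)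
     then (if mu ! i > 0 then Some (lower i mu # L) else None) else map_option ((#) mu) (eL i L))"

fun fL :: "nat \<Rightarrow> nat list list \<Rightarrow> nat list list option" where
  "fL i [] = None"
| "fL i (mu # L) = (if word_eps i (Lword L) < mu ! (i - 1)
     then Some (raise i mu # L) else map_option ((#) mu) (fL i L))"

lemma word_e_Lword:
  assumes "1 \<le> i" "\<forall>mu\<in>set L. i < length mu"
  shows "word_e i (Lword L) = map_option Lword (eL i L)"
  using assms(2)
proof (induction L)
  case (Cons mu L)
  then show ?case using row_append(3)[OF assms(1), of mu "Lword L"] by (simp add: option.map_comp comp_def append_fun)
qed simp

lemma word_f_Lword:
  assumes "1 \<le> i" "\<forall>mu\<in>set L. i < length mu"
  shows "word_f i (Lword L) = map_option Lword (fL i L)"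
  using assms(2)
proof (induction L)
  case (Cons mu L)
  then show ?case using row_append(4)[OF assms(1), of mu "Lword L"] by (simp add: option.map_comp comp_def append_fun)
qed simp

lemma word_wt_append: "word_wt (u @ w) = word_wt u + word_wt w"
  by (induction u) (auto simp: algebra_simps)

lemma word_wt_rev: "word_wt (rev u) = word_wt u"
  by (induction u) (auto simp: word_wt_append algebra_simps)

lemma word_wt_replicate: "word_wt (replicate k b) = (\<lambda>p. int k * epsw (b + 1) p)"
  by (induction k) (auto simp: fun_eq_iff fun_simps algebra_simps)

lemma word_wt_row: "length mu = Suc n \<Longrightarrow> word_wt (mrow mu) = W_wt n mu"
proof -
  have "word_wt (mrow mu) = (\<lambda>p. \<Sum>j<length mu. int (mu ! j) * epsw (j + 1) p)"
  proof (induction mu rule: rev_induct)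
    case Nil
    then show ?case by (simp add: mrow_def fun_eq_iff zero_fun_apply)
  next
    case (snoc x mu)
    then show ?case by (auto simp: row_snoc word_wt_append word_wt_replicate fun_eq_iff plus_fun_apply nth_append)
  qed
  then show "length mu = Suc n \<Longrightarrow> word_wt (mrow mu) = W_wt n mu"
    by (simp add: W_wt_def lessThan_Suc_atMost)
qed

subsection \<open>Signatures of labels\<close>

text \<open>The tags of the signs \<open>-\<close> and \<open>+\<close> in the reduced sequence.\<close>

fun red :: "(sign \<times> nat) list \<Rightarrow> nat list \<times> nat list" where
  "red [] = ([], [])"
| "red ((Minus, j) # xs) = (j # fst (red xs), snd (red xs))"
| "red ((Plus, j) # xs) = (if fst (red xs) = [] then ([], j # snd (red xs)) else (tl (fst (red xs)), snd (red xs)))"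

definition nf :: "(sign \<times> nat) list \<Rightarrow> (sign \<times> nat) list" where
  "nf xs = map (Pair Minus) (fst (red xs)) @ map (Pair Plus) (snd (red xs))"

text \<open>\<open>red\<close> works from right to left, so a prefix sees the rest of the sequence
  only through its value.\<close>

lemma red_cong: "red xs = red ys \<Longrightarrow> red (us @ xs) = red (us @ ys)"
proof (induction us)
  case (Cons u us)
  then show ?case by (cases u; cases "fst u") auto
qed simp

lemma red_sign_cancel: "sign_cancel xs ys \<Longrightarrow> red xs = red ys"
  unfolding sign_cancel_def by (auto intro!: red_cong)

lemma red_sign_cancel_rtrancl: "sign_cancel\<^sup>*\<^sup>* xs ys \<Longrightarrow> red xs = red ys"
  by (induction rule: rtranclp_induct) (auto dest: red_sign_cancel)

lemma sign_cancel_Cons: "sign_cancel xs ys \<Longrightarrow> sign_cancel (x # xs) (x # ys)"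
  unfolding sign_cancel_def by (metis append_Cons)

lemma sign_cancel_rtrancl_Cons: "sign_cancel\<^sup>*\<^sup>* xs ys \<Longrightarrow> sign_cancel\<^sup>*\<^sup>* (x # xs) (x # ys)"
  by (induction rule: rtranclp_induct) (auto intro: rtranclp.rtrancl_into_rtrancl sign_cancel_Cons)

lemma sign_cancel_nf: "sign_cancel\<^sup>*\<^sup>* xs (nf xs)"
proof (induction xs rule: red.induct)
  case 1
  then show ?case by (simp add: nf_def)
next
  case (2 j xs)
  then show ?case using sign_cancel_rtrancl_Cons[OF 2(1), of "(Minus, j)"] by (simp add: nf_def)
next
  case (3 j xs)
  then have *: "sign_cancel\<^sup>*\<^sup>* ((Plus, j) # xs) ((Plus, j) # nf xs)" by (intro sign_cancel_rtrancl_Cons) auto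
  show ?case
  proof (cases "fst (red xs)")
    case Nil
    then show ?thesis using * by (simp add: nf_def)
  next
    case (Cons k M)
    then have "sign_cancel ((Plus, j) # nf xs) (nf ((Plus, j) # xs))"
      unfolding sign_cancel_def nf_def
      by (intro exI[of _ "[]"] exI[of _ "map (Pair Minus) M @ map (Pair Plus) (snd (red xs))"] exI[of _ j] exI[of _ k]) simp
    then show ?thesis using * by (rule rtranclp.rtrancl_into_rtrancl[rotated])
  qed
qed

lemma red_length: "length (fst (red xs)) + length (snd (red xs)) \<le> length xs"
  by (induction xs rule: red.induct) auto

text \<open>Cancellation preserves \<open>red\<close>, and \<open>red\<close> never has more signs
  than the sequence it is computed from. The normal form already attains this bound, whereas a
  cancellation would shorten it by two.\<close>

lemma nf_irreducible: "\<not> sign_cancel (nf xs) zs"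
proof
  assume c: "sign_cancel (nf xs) zs"
  have "red xs = red (nf xs)" using red_sign_cancel_rtrancl[OF sign_cancel_nf] .
  also have "\<dots> = red zs" using red_sign_cancel[OF c] .
  finally have "length (nf xs) \<le> length zs" using red_length[of zs] by (simp add: nf_def)
  moreover have "length (nf xs) = Suc (Suc (length zs))" using c unfolding sign_cancel_def by auto
  ultimately show False by simp
qed

text \<open>An irreducible \<open>ys\<close> admits no step, so the reduction from \<open>ys\<close>
  to \<open>nf ys\<close> is trivial and \<open>ys = nf ys\<close>. As \<open>red\<close> is
  invariant, the result does not depend on the order of deletions.\<close>

lemma reduced_seq_nf: "reduced_seq xs = nf xs"
  unfolding reduced_seq_def
proof (rule the_equality)
  show "sign_cancel\<^sup>*\<^sup>* xs (nf xs) \<and> \<not> (\<exists>zs. sign_cancel (nf xs) zs)"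
    using sign_cancel_nf nf_irreducible by blast
  fix ys assume ys: "sign_cancel\<^sup>*\<^sup>* xs ys \<and> \<not> (\<exists>zs. sign_cancel ys zs)"
  then have "ys = nf ys" using sign_cancel_nf[of ys] by (metis converse_rtranclpE)
  moreover have "red ys = red xs" using red_sign_cancel_rtrancl ys by metis
  ultimately show "ys = nf xs" by (simp add: nf_def)
qed

fun sseq :: "nat \<Rightarrow> nat \<Rightarrow> nat list list \<Rightarrow> (sign \<times> nat) list" where
  "sseq i k [] = []"
| "sseq i k (mu # L) = replicate (mu ! i) (Minus, k) @ replicate (mu ! (i - 1)) (Plus, k) @ sseq i (Suc k) L"

lemma sign_seq_sseq: "sign_seq i L = sseq i 0 L"
proof -
  have "sseq i k L = concat (map (\<lambda>j. replicate (L ! j ! i) (Minus, k + j) @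
     replicate (L ! j ! (i - 1)) (Plus, k + j)) [0..<length L])" for k
  proof (induction L arbitrary: k)
    case (Cons mu L)
    have "[0..<length (mu # L)] = 0 # map Suc [0..<length L]" by (simp add: map_Suc_upt upt_conv_Cons del: upt_Suc)
    then show ?case using Cons[of "Suc k"] by (simp add: comp_def del: upt_Suc)
  qed simp
  from this[of 0] show ?thesis by (simp add: sign_seq_def)
qed

lemma red_block:
  "red (replicate a (Minus, k) @ replicate b (Plus, k) @ xs) =
    (replicate a k @ drop b (fst (red xs)), replicate (b - length (fst (red xs))) k @ snd (red xs))"
proof -
  have "red (replicate b (Plus, k) @ xs) =
    (drop b (fst (red xs)), replicate (b - length (fst (red xs))) k @ snd (red xs))"
  proof (induction b)
    case (Suc b)
    then show ?case by (auto simp: drop_Suc drop_tl Suc_diff_le not_le)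
  qed simp
  moreover have "red (replicate a (Minus, k) @ ys) = (replicate a k @ fst (red ys), snd (red ys))" for ys
    by (induction a) auto
  ultimately show ?thesis by simp
qed

text \<open>The first component is chosen for \<open>e\<close> if its signs \<open>+\<close> cancel
  every \<open>-\<close> left in the tail, and for \<open>f\<close> if one of its own
  \<open>+\<close> survives; this is the case distinction of \<open>eL\<close> and
  \<open>fL\<close>. The offset \<open>k\<close> lets the tail keep its numbering, and the
  positivity clauses supply the hypotheses of \<open>Efun_iso\<close> and
  \<open>Ffun_iso\<close>.\<close>

lemma red_sseq:
  assumes i: "1 \<le> i" and "\<forall>mu\<in>set L. i < length mu"
  shows "length (fst (red (sseq i k L))) = word_eps i (Lword L) \<and>
    (\<forall>j\<in>set (fst (red (sseq i k L))) \<union> set (snd (red (sseq i k L))). k \<le> j \<and> j < k + length L) \<and>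
    (fst (red (sseq i k L)) = [] \<longrightarrow> eL i L = None) \<and>
    (fst (red (sseq i k L)) \<noteq> [] \<longrightarrow> (let s = last (fst (red (sseq i k L))) - k in
      eL i L = Some (L[s := lower i (L ! s)]) \<and> L ! s ! i > 0)) \<and>
    (snd (red (sseq i k L)) = [] \<longrightarrow> fL i L = None) \<and>
    (snd (red (sseq i k L)) \<noteq> [] \<longrightarrow> (let s = hd (snd (red (sseq i k L))) - k in
      fL i L = Some (L[s := raise i (L ! s)]) \<and> L ! s ! (i - 1) > 0))"
  using assms(2)
proof (induction L arbitrary: k)
  case (Cons mu L)
  define M where "M = fst (red (sseq i (Suc k) L))"
  define P where "P = snd (red (sseq i (Suc k) L))"
  define M' where "M' = fst (red (sseq i k (mu # L)))"
  define P' where "P' = snd (red (sseq i k (mu # L)))"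
  let ?a = "mu ! i" and ?b = "mu ! (i - 1)"
  have M': "M' = replicate ?a k @ drop ?b M" and P': "P' = replicate (?b - length M) k @ P"
    unfolding M'_def P'_def M_def P_def by (simp_all add: red_block)
  have mu: "i < length mu" and L: "\<forall>mu\<in>set L. i < length mu" using Cons.prems by auto
  note IH = Cons.IH[OF L, of "Suc k", folded M_def P_def]
  have lenM: "length M = word_eps i (Lword L)" using IH by blast
  have tags: "Suc k \<le> j \<and> j < Suc k + length L" if "j \<in> set M \<union> set P" for j using IH that by blast
  have len: "length M' = word_eps i (Lword (mu # L))"
    using row_append(1)[OF i mu, of "Lword L"] lenM by (simp add: M')
  have tags': "\<forall>j\<in>set M' \<union> set P'. k \<le> j \<and> j < k + length (mu # L)"
  proof
    fix j assume "j \<in> set M' \<union> set P'"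
    then have "j = k \<or> j \<in> set M \<union> set P" unfolding M' P' by (auto dest: in_set_dropD)
    then show "k \<le> j \<and> j < k + length (mu # L)" using tags[of j] by auto
  qed
  have e: "(M' = [] \<longrightarrow> eL i (mu # L) = None) \<and> (M' \<noteq> [] \<longrightarrow> (let s = last M' - k in
      eL i (mu # L) = Some ((mu # L)[s := lower i ((mu # L) ! s)]) \<and> (mu # L) ! s ! i > 0))"
  proof (cases "length M \<le> ?b")
    case True
    then have M'': "M' = replicate ?a k" by (simp add: M')
    show ?thesis using True lenM unfolding M'' by (cases ?a) auto
  next
    case False
    then have ne: "drop ?b M \<noteq> []" "M \<noteq> []" by auto
    then have last: "last M' = last M" by (simp add: M')
    have "last M \<in> set M" using ne by simp
    then have ge: "Suc k \<le> last M" using tags by blast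
    define s where "s = last M - Suc k"
    have s: "last M' - k = Suc s" using ge last s_def by simp
    have "eL i L = Some (L[s := lower i (L ! s)]) \<and> L ! s ! i > 0"
      using IH ne unfolding s_def by (simp add: Let_def)
    then show ?thesis unfolding s Let_def using False lenM M' ne by simp
  qed
  have f: "(P' = [] \<longrightarrow> fL i (mu # L) = None) \<and> (P' \<noteq> [] \<longrightarrow> (let s = hd P' - k in
      fL i (mu # L) = Some ((mu # L)[s := raise i ((mu # L) ! s)]) \<and> (mu # L) ! s ! (i - 1) > 0))"
  proof (cases "length M < ?b")
    case True
    then obtain c where c: "?b - length M = Suc c" by (metis Suc_diff_Suc)
    then have "P' \<noteq> []" "hd P' = k" by (simp_all add: P')
    then show ?thesis using True lenM by simp
  next
    case False
    then have P'': "P' = P" by (simp add: P')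
    show ?thesis
    proof (cases "P = []")
      case True
      then show ?thesis using IH False lenM P'' by simp
    next
      case ne: False
      then have "hd P \<in> set P" by simp
      then have ge: "Suc k \<le> hd P" using tags by blast
      define s where "s = hd P - Suc k"
      have s: "hd P' - k = Suc s" using ge s_def P'' by simp
      have "fL i L = Some (L[s := raise i (L ! s)]) \<and> L ! s ! (i - 1) > 0"
        using IH ne unfolding s_def by (simp add: Let_def)
      then show ?thesis unfolding s Let_def using False lenM P'' ne by simp
    qed
  qed
  show ?case unfolding M'_def[symmetric] P'_def[symmetric] using len tags' e f by blast
qed simp

section \<open>Partial sums, sizes and injectivity of labels\<close>

text \<open>For a row of content \<open>mu\<close> this is the number of entries less than
  \<open>a\<close>.\<close>

definition psum :: "nat list \<Rightarrow> nat \<Rightarrow> nat" where "psum mu a = sum_list (take a mu)"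

lemma psum_simps: "psum mu 0 = 0" "a < length mu \<Longrightarrow> psum mu (Suc a) = psum mu a + mu ! a"
  by (simp_all add: psum_def take_Suc_conv_app_nth)

lemma psum_length: "psum mu (length mu) = sum_list mu"
  by (simp add: psum_def)

lemma psum_mono: "a \<le> b \<Longrightarrow> psum mu a \<le> psum mu b"
proof -
  assume "a \<le> b"
  then have "take b mu = take a mu @ take (b - a) (drop a mu)"
    by (metis le_add_diff_inverse take_add)
  then show ?thesis by (simp add: psum_def)
qed

lemma psum_incr: "i < length mu \<Longrightarrow> psum (incr i mu) a = psum mu a + (if i < a then 1 else 0)"
proof (cases "i < a")
  case True
  assume i: "i < length mu"
  \<comment> \<open>Guards the truncated subtraction in \<open>sum_list_update\<close>.\<close>
  have "mu ! i \<le> sum_list (take a mu)"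
    using i True by (intro member_le_sum_list) (auto simp: in_set_conv_nth)
  then show ?thesis using i True by (simp add: psum_def incr_def take_update_swap sum_list_update)
qed (simp add: psum_def incr_def)

lemma psum_lower:
  assumes "1 \<le> i" "i < length mu" "mu ! i > 0"
  shows "psum (lower i mu) a = psum mu a + (if a = i then 1 else 0)"
proof -
  have "psum (lower i mu) a + (if i < a then 1 else 0) = psum mu a + (if i - 1 < a then 1 else 0)"
    using psum_incr[of i "lower i mu" a] psum_incr[of "i - 1" mu a] incr_lower[OF assms] assms
    by (simp add: lower_def)
  then show ?thesis using assms by (auto split: if_splits)
qed

lemma psum_raise:
  assumes "1 \<le> i" "i < length mu" "mu ! (i - 1) > 0"
  shows "psum (raise i mu) a + (if a = i then 1 else 0) = psum mu a"
proof -
  have "psum (raise i mu) a + (if i - 1 < a then 1 else 0) = psum mu a + (if i < a then 1 else 0)"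
    using psum_incr[of "i - 1" "raise i mu" a] psum_incr[of i mu a] incr_raise[OF assms] assms
    by (simp add: raise_def)
  then show ?thesis using assms by (auto split: if_splits)
qed

lemma sum_lower: "1 \<le> i \<Longrightarrow> i < length mu \<Longrightarrow> mu ! i > 0 \<Longrightarrow> sum_list (lower i mu) = sum_list mu"
  using psum_lower[of i mu "length mu"] psum_length[of mu] psum_length[of "lower i mu"] by (simp add: lower_def)

lemma sum_raise: "1 \<le> i \<Longrightarrow> i < length mu \<Longrightarrow> mu ! (i - 1) > 0 \<Longrightarrow> sum_list (raise i mu) = sum_list mu"
  using psum_raise[of i mu "length mu"] psum_length[of mu] psum_length[of "raise i mu"] by (simp add: raise_def)

lemma length_lower_raise [simp]: "length (lower i mu) = length mu" "length (raise i mu) = length mu"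
  by (simp_all add: lower_def raise_def)

lemma eL_maps:
  "1 \<le> i \<Longrightarrow> \<forall>mu\<in>set L. i < length mu \<Longrightarrow> eL i L = Some L' \<Longrightarrow>
    map length L' = map length L \<and> map sum_list L' = map sum_list L"
  by (induction L arbitrary: L') (auto split: if_splits simp: sum_lower)

lemma fL_maps:
  "1 \<le> i \<Longrightarrow> \<forall>mu\<in>set L. i < length mu \<Longrightarrow> fL i L = Some L' \<Longrightarrow>
    map length L' = map length L \<and> map sum_list L' = map sum_list L"
  by (induction L arbitrary: L') (auto split: if_splits simp: sum_raise)

lemma labels_iff: "L \<in> labels n lam \<longleftrightarrow> map sum_list L = lam \<and> map length L = replicate (length lam) (Suc n)"
proof -
  have "L \<in> labels n lam \<longleftrightarrow> length L = length lam \<and> (\<forall>j<length lam. length (L ! j) = Suc n \<and> sum_list (L ! j) = lam ! j)"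
    by (auto simp: labels_def list_all2_conv_all_nth)
  also have "\<dots> \<longleftrightarrow> map sum_list L = lam \<and> map length L = replicate (length lam) (Suc n)"
    by (auto simp: list_eq_iff_nth_eq)
  finally show ?thesis .
qed

lemma labels_lengths: "L \<in> labels n lam \<Longrightarrow> \<forall>mu\<in>set L. length mu = Suc n"
proof
  fix mu assume "L \<in> labels n lam" "mu \<in> set L"
  then have "length mu \<in> set (replicate (length lam) (Suc n))"
    unfolding labels_iff by (metis image_eqI list.set_map)
  then show "length mu = Suc n" by simp
qed

lemma labels_less: "L \<in> labels n lam \<Longrightarrow> i \<le> n \<Longrightarrow> \<forall>mu\<in>set L. i < length mu"
  using labels_lengths by fastforce

lemma eL_labels:
  assumes "L \<in> labels n lam" "i \<in> {1..n}" "eL i L = Some L'" shows "L' \<in> labels n lam"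
  using assms eL_maps[of i L L'] labels_less[OF assms(1), of i] unfolding labels_iff by simp

lemma fL_labels:
  assumes "L \<in> labels n lam" "i \<in> {1..n}" "fL i L = Some L'" shows "L' \<in> labels n lam"
  using assms fL_maps[of i L L'] labels_less[OF assms(1), of i] unfolding labels_iff by simp

lemma mrow_inj: "length mu = length nu \<Longrightarrow> mrow mu = mrow nu \<Longrightarrow> mu = nu"
proof (rule nth_equalityI)
  fix i assume "length mu = length nu" "mrow mu = mrow nu" "i < length mu"
  then show "mu ! i = nu ! i" using count_row[of mu i] count_row[of nu i] by simp
qed

lemma map_mrow_inj:
  assumes "L \<in> labels n lam" "L' \<in> labels n lam" "map mrow L = map mrow L'"
  shows "L = L'"
proof (rule map_inj_on[OF assms(3)])
  have len: "length mu = Suc n" if "mu \<in> set L \<union> set L'" for mu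
    using labels_lengths[OF assms(1)] labels_lengths[OF assms(2)] that by blast
  show "inj_on mrow (set L \<union> set L')"
  proof (rule inj_onI)
    fix x y assume xy: "x \<in> set L \<union> set L'" "y \<in> set L \<union> set L'" "mrow x = mrow y"
    show "x = y" using len[OF xy(1)] len[OF xy(2)] xy(3) by (simp add: mrow_inj)
  qed
qed

text \<open>The row lengths are prescribed by \<open>lam\<close>, so the word can be cut back into
  its rows, and a row determines its multiplicities.\<close>

lemma Lword_inj:
  assumes L: "L \<in> labels n lam" and L': "L' \<in> labels n lam" and eq: "Lword L = Lword L'"
  shows "L = L'"
proof -
  have len: "length L = length L'" and sums: "map sum_list L = map sum_list L'"
    using L L' unfolding labels_iff by (metis length_map, metis)
  have "map (\<lambda>mu. rev (mrow mu)) L = map (\<lambda>mu. rev (mrow mu)) L'"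
  proof (rule concat_injective)
    show "concat (map (\<lambda>mu. rev (mrow mu)) L) = concat (map (\<lambda>mu. rev (mrow mu)) L')"
      using eq by (simp add: Lword_def)
    show "length (map (\<lambda>mu. rev (mrow mu)) L) = length (map (\<lambda>mu. rev (mrow mu)) L')" using len by simp
    show "\<forall>(x, y)\<in>set (zip (map (\<lambda>mu. rev (mrow mu)) L) (map (\<lambda>mu. rev (mrow mu)) L')). length x = length y"
    proof
      fix p assume "p \<in> set (zip (map (\<lambda>mu. rev (mrow mu)) L) (map (\<lambda>mu. rev (mrow mu)) L'))"
      then obtain j where j: "j < length L" "p = (rev (mrow (L ! j)), rev (mrow (L' ! j)))"
        using len by (auto simp: set_zip)
      have "sum_list (L ! j) = sum_list (L' ! j)" using sums j(1) len by (metis nth_map)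
      then show "case p of (x, y) \<Rightarrow> length x = length y" using j by (simp add: length_row)
    qed
  qed
  then have "map rev (map (\<lambda>mu. rev (mrow mu)) L) = map rev (map (\<lambda>mu. rev (mrow mu)) L')" by simp
  then have "map mrow L = map mrow L'" by (simp add: comp_def)
  then show ?thesis using map_mrow_inj L L' by blast
qed

text \<open>Inherited from words: the operators on words are mutually inverse, and
  \<open>Lword_inj\<close> brings the statement back to labels.\<close>

lemma eL_fL_iff:
  assumes L: "L \<in> labels n lam" and L': "L' \<in> labels n lam" and i: "i \<in> {1..n}"
  shows "fL i L' = Some L \<longleftrightarrow> eL i L = Some L'"
proof -
  have i1: "1 \<le> i" "i \<le> n" using i by auto
  note e = word_e_Lword[OF i1(1) labels_less[OF L i1(2)]] and f = word_f_Lword[OF i1(1) labels_less[OF L' i1(2)]]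
  show ?thesis
  proof
    assume "fL i L' = Some L"
    then have "word_f i (Lword L') = Some (Lword L)" using f by simp
    then have "word_e i (Lword L) = Some (Lword L')" using word_f_e_iff[OF i1(1)] by simp
    then obtain L'' where L'': "eL i L = Some L''" "Lword L'' = Lword L'" using e by auto
    then show "eL i L = Some L'" using Lword_inj[OF eL_labels[OF L i L''(1)] L'] by simp
  next
    assume "eL i L = Some L'"
    then have "word_e i (Lword L) = Some (Lword L')" using e by simp
    then have "word_f i (Lword L') = Some (Lword L)" using word_f_e_iff[OF i1(1)] by simp
    then obtain L'' where L'': "fL i L' = Some L''" "Lword L'' = Lword L" using f by auto
    then show "fL i L' = Some L" using Lword_inj[OF fL_labels[OF L' i L''(1)] L] by simp
  qed
qed

subsection \<open>Semistandard labels\<close>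

text \<open>The row \<open>nu\<close> may stand below \<open>mu\<close>: there are at most as many
  entries \<open>\<le> a\<close> in \<open>nu\<close> as entries \<open>< a\<close> in
  \<open>mu\<close>. Counts are used because an operator changes just one of them;
  \<open>domn_iff\<close> translates to entries.\<close>

definition domn :: "nat list \<Rightarrow> nat list \<Rightarrow> bool" where
  "domn mu nu \<longleftrightarrow> (\<forall>a. psum nu (Suc a) \<le> psum mu a)"

text \<open>Column strictness of the tableau with \<open>L ! r ! j\<close> entries \<open>j\<close> in row \<open>r\<close>.\<close>

abbreviation "semistd L \<equiv> successively domn L"

text \<open>The only danger is to the row above, at the count of entries \<open>< i\<close>. The
  operator reaches a row only if the row above has too few letters \<open>i - 1\<close> to cancel
  its letters \<open>i\<close>, and the column condition for entries \<open>\<le> i\<close> then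
  leaves a spare unit. The clause about \<open>mu0\<close> keeps this available in the induction for
  a row placed above the list.\<close>

lemma eL_semistd:
  assumes i: "1 \<le> i"
  shows "\<forall>mu\<in>set L. i < length mu \<Longrightarrow> semistd L \<Longrightarrow> eL i L = Some L' \<Longrightarrow>
    L' \<noteq> [] \<and> semistd L' \<and> (\<forall>mu0. domn mu0 (hd L) \<longrightarrow> i < length mu0 \<longrightarrow>
      \<not> word_eps i (Lword L) \<le> mu0 ! (i - 1) \<longrightarrow> domn mu0 (hd L'))"
proof (induction L arbitrary: L')
  case (Cons mu K)
  have mu: "i < length mu" using Cons.prems by simp
  have ssK: "semistd K" using Cons.prems(2) by (cases K) auto
  show ?case
  proof (cases "word_eps i (Lword K) \<le> mu ! (i - 1)")
    case True
    then have pos: "mu ! i > 0" and L': "L' = lower i mu # K" using Cons.prems(3) by (auto split: if_splits)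
    note pl = psum_lower[OF i mu pos]
    have "semistd L'"
      using Cons.prems(2) unfolding L' by (cases K) (auto simp: domn_def pl intro: le_trans)
    moreover have "domn mu0 (lower i mu)"
      if d: "domn mu0 mu" and l0: "i < length mu0" and big: "\<not> word_eps i (Lword (mu # K)) \<le> mu0 ! (i - 1)" for mu0
      unfolding domn_def
    proof
      fix a
      have da: "psum mu (Suc a) \<le> psum mu0 a" for a using d by (simp add: domn_def)
      show "psum (lower i mu) (Suc a) \<le> psum mu0 a"
      proof (cases "Suc a = i")
        case False
        then show ?thesis using da pl by simp
      next
        case eq: True
        have "word_eps i (Lword (mu # K)) = mu ! i"
          using row_append(1)[OF i mu, of "Lword K"] True by simp
        then have "mu0 ! a < mu ! i" using big eq by auto
        moreover have "psum mu (Suc i) = psum mu i + mu ! i" "psum mu0 i = psum mu0 a + mu0 ! a"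
          using psum_simps(2)[of i mu] psum_simps(2)[of a mu0] mu l0 eq by auto
        ultimately have "psum mu i < psum mu0 a" using da[of i] by simp
        then show ?thesis using pl eq by simp
      qed
    qed
    ultimately show ?thesis unfolding L' by simp
  next
    case False
    then obtain K' where K': "eL i K = Some K'" "L' = mu # K'" using Cons.prems(3) by auto
    have IH: "K' \<noteq> [] \<and> semistd K' \<and> (\<forall>mu0. domn mu0 (hd K) \<longrightarrow> i < length mu0 \<longrightarrow>
      \<not> word_eps i (Lword K) \<le> mu0 ! (i - 1) \<longrightarrow> domn mu0 (hd K'))"
      using Cons.IH[OF _ ssK K'(1)] Cons.prems(1) by simp
    have "K \<noteq> []" using K' by auto
    then have "domn mu (hd K)" using Cons.prems(2) by (cases K) auto
    then have "domn mu (hd K')" using IH False mu by blast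
    then have "semistd L'" unfolding K'(2) using IH by (cases K') auto
    then show ?thesis unfolding K'(2) by simp
  qed
qed simp

text \<open>Now the danger is to the row below. The operator acts on \<open>mu\<close> only if its
  letters \<open>i - 1\<close> outnumber the signs \<open>-\<close> coming from below, in particular
  the letters \<open>i\<close> of the next row; this leaves a spare unit. Towards the row above,
  increasing an entry can only help.\<close>

lemma fL_semistd:
  assumes i: "1 \<le> i"
  shows "\<forall>mu\<in>set L. i < length mu \<Longrightarrow> semistd L \<Longrightarrow> fL i L = Some L' \<Longrightarrow>
    L' \<noteq> [] \<and> semistd L' \<and> (\<forall>mu0. domn mu0 (hd L) \<longrightarrow> domn mu0 (hd L'))"
proof (induction L arbitrary: L')
  case (Cons mu K)
  have mu: "i < length mu" using Cons.prems by simp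
  have ssK: "semistd K" using Cons.prems(2) by (cases K) auto
  show ?case
  proof (cases "word_eps i (Lword K) < mu ! (i - 1)")
    case True
    then have pos: "mu ! (i - 1) > 0" and L': "L' = raise i mu # K" using Cons.prems(3) by auto
    note pr = psum_raise[OF i mu pos]
    have le: "psum (raise i mu) a \<le> psum mu a" for a using pr[of a] by simp
    have "semistd L'"
    proof (cases K)
      case Nil
      then show ?thesis unfolding L' by simp
    next
      case K: (Cons nu K')
      have nu: "i < length nu" using Cons.prems(1) K by simp
      have d: "psum nu (Suc a) \<le> psum mu a" for a using Cons.prems(2) K by (simp add: domn_def)
      have "psum nu (Suc a) \<le> psum (raise i mu) a" for a
      proof (cases "a = i")
        case False
        then show ?thesis using d[of a] pr[of a] by simp
      next
        case eq: True
        have "nu ! i \<le> word_eps i (Lword K)" using row_append(1)[OF i nu, of "Lword K'"] K by simp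
        then have "nu ! i < mu ! (i - 1)" using True by simp
        moreover have "psum nu (Suc i) = psum nu i + nu ! i" "psum mu i = psum mu (i - 1) + mu ! (i - 1)"
          using psum_simps(2)[of i nu] psum_simps(2)[of "i - 1" mu] mu nu i by auto
        moreover have "psum nu i \<le> psum mu (i - 1)" using d[of "i - 1"] i by simp
        ultimately show ?thesis using pr[of i] eq by simp
      qed
      then show ?thesis using Cons.prems(2) K unfolding L' by (simp add: domn_def)
    qed
    moreover have "domn mu0 (raise i mu)" if "domn mu0 mu" for mu0
      using that le unfolding domn_def by (meson le_trans)
    ultimately show ?thesis unfolding L' by simp
  next
    case False
    then obtain K' where K': "fL i K = Some K'" "L' = mu # K'" using Cons.prems(3) by auto
    have IH: "K' \<noteq> [] \<and> semistd K' \<and> (\<forall>mu0. domn mu0 (hd K) \<longrightarrow> domn mu0 (hd K'))"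
      using Cons.IH[OF _ ssK K'(1)] Cons.prems(1) by simp
    have "K \<noteq> []" using K' by auto
    then have "domn mu (hd K)" using Cons.prems(2) by (cases K) auto
    then have "semistd L'" unfolding K'(2) using IH by (cases K') auto
    then show ?thesis unfolding K'(2) by simp
  qed
qed simp

text \<open>The offset \<open>p\<close> is the letter filling the first row; with
  \<open>p = 0\<close> this is the label of the class in the theorem.\<close>

fun hwrows :: "nat \<Rightarrow> nat \<Rightarrow> nat list \<Rightarrow> nat list list" where
  "hwrows n p [] = []"
| "hwrows n p (l # ls) = (replicate (Suc n) 0)[p := l] # hwrows n (Suc p) ls"

lemma hwrows_map: "hwrows n 0 lam = map (\<lambda>j. (replicate (n + 1) 0)[j := lam ! j]) [0..<length lam]"
proof -
  have "hwrows n p lam = map (\<lambda>j. (replicate (n + 1) 0)[p + j := lam ! j]) [0..<length lam]" for p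
  proof (induction lam arbitrary: p)
    case (Cons l ls)
    have "[0..<length (l # ls)] = 0 # map Suc [0..<length ls]" by (simp add: map_Suc_upt upt_conv_Cons del: upt_Suc)
    then show ?case using Cons[of "Suc p"] by (simp add: comp_def del: upt_Suc replicate_Suc)
  qed simp
  from this[of 0] show ?thesis by simp
qed

lemma psum_hwrow: "p \<le> n \<Longrightarrow> psum ((replicate (Suc n) 0)[p := l]) a = (if p < a then l else 0)"
proof (cases "p < a")
  case True
  assume "p \<le> n"
  then have "p < length (take a (replicate (Suc n) (0 :: nat)))" using True by (simp del: replicate_Suc)
  then show ?thesis using True unfolding psum_def take_update_swap
    by (subst sum_list_update) (auto simp: sum_list_replicate simp del: replicate_Suc)
next
  case False
  then show ?thesis by (simp add: psum_def sum_list_replicate del: replicate_Suc)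
qed

lemma hwrows_labels: "length lam \<le> n + 1 \<Longrightarrow> hwrows n 0 lam \<in> labels n lam"
proof -
  have "p + length lam \<le> Suc n \<Longrightarrow> map sum_list (hwrows n p lam) = lam \<and>
    map length (hwrows n p lam) = replicate (length lam) (Suc n)" for p
  proof (induction lam arbitrary: p)
    case (Cons l ls)
    have "sum_list ((replicate (Suc n) 0)[p := l]) = l"
      using psum_hwrow[of p n l "Suc n"] psum_length[of "(replicate (Suc n) 0)[p := l]"] Cons.prems
      by (simp del: replicate_Suc)
    then show ?case using Cons.IH[of "Suc p"] Cons.prems by (simp del: replicate_Suc) simp
  qed simp
  from this[of 0] show "length lam \<le> n + 1 \<Longrightarrow> hwrows n 0 lam \<in> labels n lam" by (simp add: labels_iff)
qed

lemma hwrows_semistd: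
  "sorted_wrt (\<ge>) lam \<Longrightarrow> p + length lam \<le> Suc n \<Longrightarrow> semistd (hwrows n p lam)"
proof (induction lam arbitrary: p)
  case (Cons l ls)
  show ?case
  proof (cases ls)
    case Nil
    then show ?thesis by simp
  next
    case ls: (Cons l' ls')
    have "domn ((replicate (Suc n) 0)[p := l]) ((replicate (Suc n) 0)[Suc p := l'])"
      unfolding domn_def using psum_hwrow[of p n l] psum_hwrow[of "Suc p" n l'] Cons.prems ls
      by (simp del: replicate_Suc)
    then show ?thesis using Cons.IH[of "Suc p"] Cons.prems ls by (simp del: replicate_Suc)
  qed
qed simp

text \<open>The induction behind the uniqueness of the highest weight tableau: if the entries of the first
  row are at least \<open>p\<close> and no operator of colour above \<open>p\<close> applies, then row \<open>r\<close> is constant \<open>p + r\<close>.\<close>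

lemma hw_unique:
  "\<forall>mu\<in>set L. length mu = Suc n \<Longrightarrow> p + length L \<le> Suc n \<Longrightarrow> semistd L \<Longrightarrow>
   (L \<noteq> [] \<Longrightarrow> psum (hd L) p = 0) \<Longrightarrow> (\<And>i. p < i \<Longrightarrow> i \<le> n \<Longrightarrow> word_eps i (Lword L) = 0) \<Longrightarrow>
   L = hwrows n p (map sum_list L)"
proof (induction L arbitrary: p)
  case (Cons mu K)
  have len: "length mu = Suc n" and pn: "p \<le> n" using Cons.prems by auto
  \<comment> \<open>Nothing stands to the left of the signs \<open>-\<close> of the first row, so
    they all survive. If none is left, the row has no entry \<open>i > p\<close>.\<close>
  have z: "mu ! i = 0 \<and> word_eps i (Lword K) \<le> mu ! (i - 1)" if "p < i" "i \<le> n" for i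
    using Cons.prems(5)[OF that] row_append(1)[of i mu "Lword K"] that len by simp
  have z': "mu ! j = 0" if "j < p" for j
  proof -
    have "psum mu p = 0" using Cons.prems(4) by simp
    then have "\<forall>x\<in>set (take p mu). x = 0" by (simp add: psum_def)
    moreover have "mu ! j \<in> set (take p mu)" using that pn len by (auto simp: in_set_conv_nth intro!: exI[of _ j])
    ultimately show ?thesis by blast
  qed
  have mu: "mu = (replicate (Suc n) 0)[p := mu ! p]"
  proof (rule nth_equalityI)
    fix j assume j: "j < length mu"
    consider "j < p" | "j = p" | "p < j" by linarith
    then show "mu ! j = (replicate (Suc n) 0)[p := mu ! p] ! j"
    proof cases
      case 1
      then show ?thesis using z'[of j] j len by (simp del: replicate_Suc)
    next
      case 2
      then show ?thesis using j len by (simp del: replicate_Suc)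
    next
      case 3
      then show ?thesis using z[of j] j len by (simp del: replicate_Suc)
    qed
  qed (simp add: len del: replicate_Suc)
  have "sum_list mu = psum ((replicate (Suc n) 0)[p := mu ! p]) (Suc n)"
    using psum_length[of mu] mu len by metis
  then have sum: "sum_list mu = mu ! p" using psum_hwrow[OF pn, of "mu ! p" "Suc n"] pn by simp
  have "K = hwrows n (Suc p) (map sum_list K)"
  proof (rule Cons.IH)
    show "\<forall>mu\<in>set K. length mu = Suc n" "Suc p + length K \<le> Suc n" using Cons.prems by auto
    show "semistd K" using Cons.prems(3) by (cases K) auto
    show "psum (hd K) (Suc p) = 0" if "K \<noteq> []"
    proof -
      have "domn mu (hd K)" using Cons.prems(3) that by (cases K) auto
      then have "psum (hd K) (Suc p) \<le> psum mu p" by (simp add: domn_def)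
      then show ?thesis using Cons.prems(4) by simp
    qed
    \<comment> \<open>The first row has no letter \<open>i - 1\<close> either, since
      \<open>i - 1 > p\<close>, so it cannot have cancelled a sign \<open>-\<close> of the
      tail.\<close>
    show "word_eps i (Lword K) = 0" if "Suc p < i" "i \<le> n" for i
      using z[of i] z[of "i - 1"] that by simp
  qed
  then show ?case using mu sum by simp
qed simp

subsection \<open>Tableaux\<close>

definition sslab :: "nat \<Rightarrow> nat list \<Rightarrow> nat list list set" where
  "sslab n lam = {L \<in> labels n lam. semistd L}"

lemma sorted_mrow: "sorted (mrow mu)"
proof (induction mu rule: rev_induct)
  case Nil
  then show ?case by (simp add: mrow_def)
next
  case (snoc x mu)
  then show ?case using set_row[of mu] by (auto simp: row_snoc sorted_append subset_iff less_imp_le)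
qed

lemma mrow_cl: assumes "sorted r" "set r \<subseteq> {0..n}" shows "mrow (cl n r) = r"
proof -
  have "count_list (mrow (cl n r)) i = count_list r i" for i
  proof (cases "i \<le> n")
    case True
    then show ?thesis by (simp add: count_row cl_def del: upt_Suc)
  next
    case False
    then have "i \<notin> set r" using assms by auto
    then show ?thesis using False by (simp add: count_row count_notin)
  qed
  then have "mset (mrow (cl n r)) = mset r" by (intro multiset_eqI) (simp add: count_mset)
  then have "sort r = mrow (cl n r)" using sorted_mrow by (rule properties_for_sort)
  then show ?thesis using assms(1) sorted_sort_id by metis
qed

text \<open>The row is weakly increasing, so its entries below \<open>a\<close> fill an initial
  segment, of length \<open>psum mu a\<close>.\<close>

lemma mrow_less_iff:
  assumes "c < sum_list mu" shows "mrow mu ! c < a \<longleftrightarrow> c < psum mu a"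
proof -
  define k where "k = mrow mu ! c"
  have "k < length mu" using set_row[of mu] nth_mem[of c "mrow mu"] assms by (auto simp: k_def length_row subset_iff)
  then have "c \<in> {sum_list (take k mu)..<sum_list (take (Suc k) mu)}"
    using mrow_interval[of k mu] assms by (simp add: k_def length_row)
  then have "psum mu k \<le> c" "c < psum mu (Suc k)" by (auto simp: psum_def)
  then show ?thesis using psum_mono[of "Suc k" a mu] psum_mono[of a k mu] unfolding k_def[symmetric]
    by (cases "k < a") auto
qed

lemma domn_iff:
  assumes le: "sum_list nu \<le> sum_list mu"
  shows "domn mu nu \<longleftrightarrow> (\<forall>c<sum_list nu. mrow mu ! c < mrow nu ! c)"
proof
  assume d: "domn mu nu"
  show "\<forall>c<sum_list nu. mrow mu ! c < mrow nu ! c"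
  proof (intro allI impI)
    fix c assume c: "c < sum_list nu"
    have "c < psum nu (Suc (mrow nu ! c))" using mrow_less_iff[OF c, of "Suc (mrow nu ! c)"] by simp
    also have "\<dots> \<le> psum mu (mrow nu ! c)" using d by (simp add: domn_def)
    finally show "mrow mu ! c < mrow nu ! c" using mrow_less_iff[of c mu] c le by simp
  qed
next
  assume col: "\<forall>c<sum_list nu. mrow mu ! c < mrow nu ! c"
  show "domn mu nu" unfolding domn_def
  proof
    fix a
    show "psum nu (Suc a) \<le> psum mu a"
    proof (cases "psum nu (Suc a)")
      \<comment> \<open>\<open>c\<close> is the position of the last entry \<open>\<le> a\<close> of
        \<open>nu\<close>. The entry above it is less than \<open>a\<close>, so \<open>mu\<close>
        has more than \<open>c\<close> entries below \<open>a\<close>.\<close>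
      case (Suc c)
      have "psum nu (Suc a) \<le> sum_list nu"
        using psum_mono[of "Suc a" "max (Suc a) (length nu)" nu] by (simp add: psum_def)
      then have c: "c < sum_list nu" using Suc by simp
      have "mrow nu ! c < Suc a" using mrow_less_iff[OF c] Suc by simp
      then have "mrow mu ! c < a" using col c by fastforce
      then have "c < psum mu a" using mrow_less_iff[of c mu a] c le by simp
      then show ?thesis using Suc by simp
    qed simp
  qed
qed

lemma tableau_iff:
  assumes lam: "sorted_wrt (\<ge>) lam" and L: "L \<in> labels n lam"
  shows "map mrow L \<in> SSYT n lam \<longleftrightarrow> semistd L"
proof -
  have sums: "map sum_list L = lam" using L by (simp add: labels_iff)
  have len: "length L = length lam" using sums by (metis length_map)
  have sj: "sum_list (L ! j) = lam ! j" if "j < length lam" for j using sums len that by (metis nth_map)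
  have dec: "lam ! Suc r \<le> lam ! r" if "Suc r < length lam" for r
    using lam that sorted_wrt_nth_less[of "(\<ge>)" lam r "Suc r"] by simp
  have "map length (map mrow L) = lam" using sums by (simp add: comp_def length_row)
  moreover have "\<forall>row\<in>set (map mrow L). sorted row \<and> set row \<subseteq> {0..n}"
    using sorted_mrow set_row labels_lengths[OF L] by fastforce
  moreover have "(\<forall>r c. Suc r < length (map mrow L) \<and> c < length (map mrow L ! Suc r) \<longrightarrow>
      map mrow L ! r ! c < map mrow L ! Suc r ! c) \<longleftrightarrow> semistd L"
    unfolding successively_conv_nth
    using domn_iff[of "L ! Suc r" "L ! r" for r] sj dec len by (auto simp: length_row)
  ultimately show ?thesis unfolding SSYT_def by blast
qed

lemma SSYT_eq:
  assumes lam: "sorted_wrt (\<ge>) lam"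
  shows "SSYT n lam = map mrow ` sslab n lam"
proof (intro subset_antisym subsetI)
  fix t assume t: "t \<in> SSYT n lam"
  then have rows: "map length t = lam" "\<forall>row\<in>set t. sorted row \<and> set row \<subseteq> {0..n}" by (auto simp: SSYT_def)
  define L where "L = map (cl n) t"
  have tL: "t = map mrow L" unfolding L_def using rows(2) mrow_cl by (simp add: map_idI)
  have "map sum_list L = lam" using rows(1) unfolding tL by (simp add: comp_def length_row)
  moreover have "map length L = replicate (length lam) (Suc n)"
    using rows(1) by (auto simp: L_def comp_def map_replicate_const)
  ultimately have "L \<in> labels n lam" by (simp add: labels_iff)
  then show "t \<in> map mrow ` sslab n lam" using t tableau_iff[OF lam] tL by (auto simp: sslab_def)
qed (use tableau_iff[OF lam] in \<open>auto simp: sslab_def\<close>)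

subsection \<open>Crystals on semistandard labels\<close>

lemma Lword_set: "L \<in> labels n lam \<Longrightarrow> set (Lword L) \<subseteq> {0..n}"
  using labels_lengths[of L n lam] set_row by (fastforce simp: Lword_def)

lemma Lword_length: "L \<in> labels n lam \<Longrightarrow> length (Lword L) = sum_list lam"
  by (auto simp: Lword_def length_concat comp_def length_row labels_iff)

lemma sslab_eL:
  assumes "L \<in> sslab n lam" "i \<in> {1..n}" "eL i L = Some L'" shows "L' \<in> sslab n lam"
  using assms eL_labels[of L n lam i L'] eL_semistd[of i L L'] labels_less[of L n lam i] by (auto simp: sslab_def)

lemma sslab_fL:
  assumes "L \<in> sslab n lam" "i \<in> {1..n}" "fL i L = Some L'" shows "L' \<in> sslab n lam"
  using assms fL_labels[of L n lam i L'] fL_semistd[of i L L'] labels_less[of L n lam i] by (auto simp: sslab_def)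

lemma word_wt_supp: "set w \<subseteq> {0..n} \<Longrightarrow> p \<notin> {1..n + 1} \<Longrightarrow> word_wt w p = 0"
  by (induction w) (auto simp: fun_simps epsw_def)

text \<open>A crystal with this property is determined up to isomorphism by \<open>n\<close> and
  \<open>lam\<close>: its vertices are named by the semistandard labels and all its maps are read
  off from the labels.\<close>

definition realizes :: "nat \<Rightarrow> nat list \<Rightarrow> 'b crystal \<Rightarrow> (nat list list \<Rightarrow> 'b) \<Rightarrow> bool" where
  "realizes n lam B h \<longleftrightarrow> inj_on h (sslab n lam) \<and> verts B = h ` sslab n lam \<and>
     (\<forall>L\<in>sslab n lam. cwt B (h L) = word_wt (Lword L) \<and>
       (\<forall>i\<in>{1..n}. ceps B i (h L) = Fin (int (word_eps i (Lword L))) \<and>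
          cphi B i (h L) = Fin (int (word_phi i (Lword L))) \<and>
          ce B i (h L) = map_option h (eL i L) \<and> cf B i (h L) = map_option h (fL i L)))"

lemma realizes_is_crystal:
  assumes real: "realizes n lam B h"
  shows "is_crystal n B"
proof -
  have inj: "inj_on h (sslab n lam)" and verts: "verts B = h ` sslab n lam"
    using real by (auto simp: realizes_def)
  have lab: "L \<in> labels n lam" if "L \<in> sslab n lam" for L using that by (simp add: sslab_def)
  show ?thesis
    unfolding is_crystal_def verts
  proof (intro conjI ballI allI impI)
    fix b p assume "b \<in> h ` sslab n lam" "p \<notin> {1..n + 1}"
    then show "cwt B b p = 0" using real word_wt_supp[OF Lword_set[OF lab]] by (auto simp: realizes_def)
  next
    fix i b assume i: "i \<in> {1..n}" and "b \<in> h ` sslab n lam"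
    then obtain L where L: "L \<in> sslab n lam" "b = h L" by blast
    have i1: "1 \<le> i" "i \<le> n" using i by auto
    have B: "cwt B (h L) = word_wt (Lword L)" "ceps B i (h L) = Fin (int (word_eps i (Lword L)))"
      "cphi B i (h L) = Fin (int (word_phi i (Lword L)))"
      "ce B i (h L) = map_option h (eL i L)" "cf B i (h L) = map_option h (fL i L)" if "L \<in> sslab n lam" for L
      using real that i unfolding realizes_def by blast+
    note BL = B[OF L(1)]
    note e = word_e_Lword[OF i1(1) labels_less[OF lab[OF L(1)] i1(2)]]
      and f = word_f_Lword[OF i1(1) labels_less[OF lab[OF L(1)] i1(2)]]
    show "ceps B i b \<noteq> Pinf" "cphi B i b \<noteq> Pinf" using BL L by auto
    show "set_option (ce B i b) \<subseteq> h ` sslab n lam" using BL L sslab_eL[OF L(1) i] by (auto simp: option.set_map)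
    show "set_option (cf B i b) \<subseteq> h ` sslab n lam" using BL L sslab_fL[OF L(1) i] by (auto simp: option.set_map)
    show "cphi B i b = ceps B i b + Fin (cwt B b i - cwt B b (i + 1))"
      using BL L word_wt_diff[OF i1(1), of "Lword L"] by simp
    show "cwt B b' = cwt B b + epsw i - epsw (i + 1)" if ce: "ce B i b = Some b'" for b'
    proof -
      obtain L' where L': "eL i L = Some L'" "b' = h L'" using ce unfolding L(2) BL(4) by auto
      then show ?thesis using B(1)[OF sslab_eL[OF L(1) i L'(1)]] BL L word_e_Some[OF i1(1), of "Lword L" "Lword L'"] e
        by simp
    qed
    show "cwt B b' = cwt B b - epsw i + epsw (i + 1)" if cf: "cf B i b = Some b'" for b'
    proof -
      obtain L' where L': "fL i L = Some L'" "b' = h L'" using cf unfolding L(2) BL(5) by auto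
      then show ?thesis using B(1)[OF sslab_fL[OF L(1) i L'(1)]] BL L word_f_weight(1)[OF i1(1), of "Lword L" "Lword L'"] f
        by simp
    qed
    show "cf B i b' = Some b \<longleftrightarrow> ce B i b = Some b'" if b': "b' \<in> h ` sslab n lam" for b'
    proof -
      obtain L' where L': "L' \<in> sslab n lam" "b' = h L'" using b' by blast
      have "cf B i b' = Some b \<longleftrightarrow> fL i L' = Some L"
        unfolding L'(2) B(5)[OF L'(1)] L(2) using sslab_fL[OF L'(1) i] inj_onD[OF inj] L(1) by auto
      moreover have "ce B i b = Some b' \<longleftrightarrow> eL i L = Some L'"
        unfolding L(2) BL(4) L'(2) using sslab_eL[OF L(1) i] inj_onD[OF inj] L'(1) by auto
      ultimately show ?thesis using eL_fL_iff[OF lab[OF L(1)] lab[OF L'(1)] i] by simp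
    qed
    assume "ceps B i b = Minf"
    then show "ce B i b = None" "cf B i b = None" using BL L by auto
  qed
qed

lemma realizes_isomorphic:
  assumes B: "realizes n lam B h" and C: "realizes n lam C g"
  shows "crystal_isomorphic n B C"
proof -
  let ?S = "sslab n lam"
  define k where "k b = g (inv_into ?S h b)" for b
  have injh: "inj_on h ?S" and injg: "inj_on g ?S" and vB: "verts B = h ` ?S" and vC: "verts C = g ` ?S"
    using B C by (auto simp: realizes_def)
  have k: "k (h L) = g L" if "L \<in> ?S" for L using injh that by (simp add: k_def)
  have "bij_betw k (verts B) (verts C)"
    unfolding bij_betw_def vB vC
  proof
    show "inj_on k (h ` ?S)"
    proof (rule inj_onI)
      fix x y assume "x \<in> h ` ?S" "y \<in> h ` ?S" and eq: "k x = k y"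
      then obtain L L' where L: "L \<in> ?S" "x = h L" "L' \<in> ?S" "y = h L'" by blast
      then have "g L = g L'" using eq k by simp
      then show "x = y" using inj_onD[OF injg] L by blast
    qed
    show "k ` h ` ?S = g ` ?S" using k by (auto simp: image_image)
  qed
  moreover have "\<forall>b\<in>verts B. cwt C (k b) = cwt B b \<and>
      (\<forall>i\<in>{1..n}. ceps C i (k b) = ceps B i b \<and> cphi C i (k b) = cphi B i b \<and>
        ce C i (k b) = map_option k (ce B i b) \<and> cf C i (k b) = map_option k (cf B i b))"
    unfolding vB
  proof (intro ballI conjI)
    fix b assume "b \<in> h ` ?S"
    then obtain L where L: "L \<in> ?S" "b = h L" by blast
    show "cwt C (k b) = cwt B b" using B C L k by (simp add: realizes_def)
    fix i assume i: "i \<in> {1..n}"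
    show "ceps C i (k b) = ceps B i b" "cphi C i (k b) = cphi B i b" using B C L k i by (simp_all add: realizes_def)
    have "ce C i (g L) = map_option g (eL i L)" "ce B i (h L) = map_option h (eL i L)"
      "cf C i (g L) = map_option g (fL i L)" "cf B i (h L) = map_option h (fL i L)"
      using B C L i unfolding realizes_def by blast+
    then show "ce C i (k b) = map_option k (ce B i b)" "cf C i (k b) = map_option k (cf B i b)"
      unfolding L(2) k[OF L(1)]
      using k sslab_eL[OF L(1) i] sslab_fL[OF L(1) i] by (auto simp: option.map_comp intro!: option.map_cong)
  qed
  ultimately show ?thesis
    unfolding crystal_isomorphic_def using realizes_is_crystal[OF B] realizes_is_crystal[OF C]
    by (intro conjI exI[of _ k])
qed

text \<open>The reading is injective on tableaux of a fixed shape, and the operators keep labels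
  semistandard. So \<open>inv_into\<close> in \<open>crystal_induced\<close> always meets the
  reading of a tableau and returns that tableau.\<close>

lemma B_crystal_realizes:
  assumes lam: "sorted_wrt (\<ge>) lam" and pos: "sum_list lam > 0"
  shows "realizes n lam (B_crystal n lam) (map mrow)"
proof -
  let ?S = "sslab n lam" and ?P = "crystal_power (box_crystal n) (sum_list lam)"
  have lab: "L \<in> labels n lam" if "L \<in> ?S" for L using that by (simp add: sslab_def)
  have read: "middle_eastern_reading (map mrow L) = Lword L" for L
    by (simp add: middle_eastern_reading_def Lword_def comp_def)
  have inj: "inj_on middle_eastern_reading (SSYT n lam)"
  proof (rule inj_onI)
    fix t u assume "t \<in> SSYT n lam" "u \<in> SSYT n lam" and eq: "middle_eastern_reading t = middle_eastern_reading u"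
    then obtain L M where L: "L \<in> ?S" "t = map mrow L" "M \<in> ?S" "u = map mrow M"
      unfolding SSYT_eq[OF lam] by blast
    then have "Lword L = Lword M" using eq read by simp
    then show "t = u" using Lword_inj[OF lab[OF L(1)] lab[OF L(3)]] L by simp
  qed
  have inv: "inv_into (SSYT n lam) middle_eastern_reading (Lword L) = map mrow L" if "L \<in> ?S" for L
  proof -
    have "map mrow L \<in> SSYT n lam" using that unfolding SSYT_eq[OF lam] by blast
    from inv_into_f_f[OF inj this] show ?thesis unfolding read .
  qed
  note cp = crystal_power_words[OF pos, of n, THEN conjunct2, rule_format]
  show ?thesis
    unfolding realizes_def
  proof (intro conjI ballI)
    show "inj_on (map mrow) ?S" using map_mrow_inj lab by (intro inj_onI) blast
    show "verts (B_crystal n lam) = map mrow ` ?S"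
      using SSYT_eq[OF lam] by (simp add: B_crystal_def crystal_induced_def)
    fix L assume L: "L \<in> ?S"
    note cpL = cp[OF Lword_length[OF lab[OF L]] Lword_set[OF lab[OF L]]]
    show "cwt (B_crystal n lam) (map mrow L) = word_wt (Lword L)"
      using cpL by (simp add: B_crystal_def crystal_induced_def read)
    fix i assume i: "i \<in> {1..n}"
    then have i1: "1 \<le> i" "i \<le> n" by auto
    have P: "ceps ?P i (Lword L) = Fin (int (word_eps i (Lword L)))" "cphi ?P i (Lword L) = Fin (int (word_phi i (Lword L)))"
      "ce ?P i (Lword L) = word_e i (Lword L)" "cf ?P i (Lword L) = word_f i (Lword L)"
      using cpL i by blast+
    show "ceps (B_crystal n lam) i (map mrow L) = Fin (int (word_eps i (Lword L)))"
      "cphi (B_crystal n lam) i (map mrow L) = Fin (int (word_phi i (Lword L)))"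
      by (simp_all add: B_crystal_def crystal_induced_def read P)
    show "ce (B_crystal n lam) i (map mrow L) = map_option (map mrow) (eL i L)"
      using inv sslab_eL[OF L i]
      by (auto simp: B_crystal_def crystal_induced_def read P option.map_comp
          word_e_Lword[OF i1(1) labels_less[OF lab[OF L] i1(2)]] intro!: option.map_cong)
    show "cf (B_crystal n lam) i (map mrow L) = map_option (map mrow) (fL i L)"
      using inv sslab_fL[OF L i]
      by (auto simp: B_crystal_def crystal_induced_def read P option.map_comp
          word_f_Lword[OF i1(1) labels_less[OF lab[OF L] i1(2)]] intro!: option.map_cong)
  qed
qed

section \<open>The crystal of irreducible classes\<close>

lemma label_nth:
  assumes "L \<in> labels n lam" "j < length lam"
  shows "length (L ! j) = Suc n" "sum_list (L ! j) = lam ! j"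
  using assms by (auto simp: labels_def list_all2_conv_all_nth)

lemma label_length: "L \<in> labels n lam \<Longrightarrow> length L = length lam"
  by (auto simp: labels_def list_all2_lengthD)

lemma length_Wfactors: "L \<in> labels n lam \<Longrightarrow> length (Wfactors n lam L) = length lam"
  by (simp add: Wfactors_def label_length)

lemma Wfactors_nth:
  assumes "L \<in> labels n lam" "j < length lam"
  shows "Wfactors n lam L ! j = umodel (CP n (lam ! j)) (CPV n (lam ! j) (L ! j))"
  using CP.umodel(3)[OF Wmod_iso[OF label_nth[OF assms]]] assms
  by (simp add: Wfactors_def label_length)

lemma Wclass_eq:
  assumes L: "L \<in> labels n lam"
  shows "Wclass n lam L = iso_class (CPlist n lam) (CPLV n lam L)"
proof -
  have "module_isomorphic (CPlist n lam) (CPLV n lam L) (outer_tensor n lam (Wfactors n lam L))"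
  proof (rule outer_tensor_iso)
    fix j assume j: "j < length lam"
    have "module_isomorphic (CP n (lam ! j)) (CPV n (lam ! j) (L ! j)) (Wmod n (L ! j))"
      using Wmod_iso[OF label_nth[OF L j]] .
    from CP.umodel(2)[OF this] CP.umodel(3)[OF this]
    show "module_isomorphic (CP n (lam ! j)) (CPV n (lam ! j) (L ! j)) (Wfactors n lam L ! j)"
      unfolding Wfactors_nth[OF L j] by simp
  qed (simp_all add: length_Wfactors[OF L] label_length[OF L])
  from CPL.iso_class_eq[OF this] show ?thesis unfolding Wclass_def outer_class_def .
qed

lemma verts_C: "verts (C_crystal n lam) = Wclass n lam ` labels n lam"
proof -
  have "map (cl n) ` Lst n lam = labels n lam" by (rule Set.set_eqI) (rule Lcl_image_iff)
  then have "verts (C_crystal n lam) = (\<lambda>k. iso_class (CPlist n lam) (CPLV n lam k)) ` labels n lam"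
    using CPL.irreducible_classes_eq[of n lam] by (simp add: C_crystal_def)
  also have "\<dots> = Wclass n lam ` labels n lam" using Wclass_eq by (intro image_cong) auto
  finally show ?thesis .
qed

lemma Wclass_inj:
  assumes L: "L \<in> labels n lam" "M \<in> labels n lam" and eq: "Wclass n lam L = Wclass n lam M"
  shows "L = M"
  using CPL.iso_class_inj[of n lam L M] eq Wclass_eq L Lcl_image_iff by metis

lemma label_of_Wclass: "L \<in> labels n lam \<Longrightarrow> label_of n lam (Wclass n lam L) = L"
  unfolding label_of_def using Wclass_inj by (intro the_equality) auto

text \<open>Because \<open>umodel\<close> yields the same representative for isomorphic modules,
  replacing one factor produces literally the factor list of the new label. The operators therefore
  land in classes of the form \<open>Wclass\<close>.\<close>

lemma Wfactors_update:
  assumes L: "L \<in> labels n lam" and L': "L[s := mu] \<in> labels n lam" and s: "s < length lam"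
    and M: "module_isomorphic (CP n (lam ! s)) (CPV n (lam ! s) mu) M"
  shows "(Wfactors n lam L)[s := umodel (CP n (lam ! s)) M] = Wfactors n lam (L[s := mu])"
proof (rule nth_equalityI)
  show "length ((Wfactors n lam L)[s := umodel (CP n (lam ! s)) M]) = length (Wfactors n lam (L[s := mu]))"
    using length_Wfactors L L' by simp
  fix j assume "j < length ((Wfactors n lam L)[s := umodel (CP n (lam ! s)) M])"
  then have j: "j < length lam" using length_Wfactors[OF L] by simp
  show "(Wfactors n lam L)[s := umodel (CP n (lam ! s)) M] ! j = Wfactors n lam (L[s := mu]) ! j"
    using Wfactors_nth[OF L j] Wfactors_nth[OF L' j] CP.umodel(3)[OF M] j s label_length[OF L] length_Wfactors[OF L]
    by (cases "j = s") auto
qed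

lemma filter_nf:
  "filter (\<lambda>x. fst x = Minus) (nf xs) = map (Pair Minus) (fst (red xs))"
  "filter (\<lambda>x. fst x = Plus) (nf xs) = map (Pair Plus) (snd (red xs))"
  by (simp_all add: nf_def filter_map comp_def)

lemma C_e_Wclass:
  assumes L: "L \<in> labels n lam" and i: "i \<in> {1..n}"
  shows "C_e n lam i (Wclass n lam L) = map_option (Wclass n lam) (eL i L)"
proof -
  have i1: "1 \<le> i" "i \<le> n" using i by auto
  define M where "M = fst (red (sseq i 0 L))"
  note R = red_sseq[OF i1(1) labels_less[OF L i1(2)], of 0, folded M_def]
  have fl: "filter (\<lambda>x. fst x = Minus) (reduced_seq (sign_seq i L)) = map (Pair Minus) M"
    by (simp add: reduced_seq_nf sign_seq_sseq filter_nf M_def)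
  show ?thesis
  proof (cases "M = []")
    case True
    then show ?thesis using R unfolding C_e_def label_of_Wclass[OF L] Let_def fl by simp
  next
    case False
    define s where "s = last M"
    have s: "s < length lam" using R False label_length[OF L] by (simp add: s_def)
    have eL: "eL i L = Some (L[s := lower i (L ! s)])" and pos: "L ! s ! i > 0"
      using R False by (simp_all add: s_def Let_def)
    have "module_isomorphic (CP n (lam ! s)) (CPV n (lam ! s) (lower i (L ! s))) (Efun n i (lam ! s) (Wmod n (L ! s)))"
      using Efun_iso[OF i1 label_nth[OF L s] pos] .
    from Wfactors_update[OF L eL_labels[OF L i eL] s this]
    show ?thesis using False unfolding C_e_def label_of_Wclass[OF L] Let_def fl eL
      by (simp add: last_map s_def[symmetric] Wclass_def)
  qed
qed

lemma C_f_Wclass: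
  assumes L: "L \<in> labels n lam" and i: "i \<in> {1..n}"
  shows "C_f n lam i (Wclass n lam L) = map_option (Wclass n lam) (fL i L)"
proof -
  have i1: "1 \<le> i" "i \<le> n" using i by auto
  define P where "P = snd (red (sseq i 0 L))"
  note R = red_sseq[OF i1(1) labels_less[OF L i1(2)], of 0, folded P_def]
  have fl: "filter (\<lambda>x. fst x = Plus) (reduced_seq (sign_seq i L)) = map (Pair Plus) P"
    by (simp add: reduced_seq_nf sign_seq_sseq filter_nf P_def)
  show ?thesis
  proof (cases "P = []")
    case True
    then show ?thesis using R unfolding C_f_def label_of_Wclass[OF L] Let_def fl by simp
  next
    case False
    define s where "s = hd P"
    have s: "s < length lam" using R False label_length[OF L] by (simp add: s_def)
    have fL: "fL i L = Some (L[s := raise i (L ! s)])" and pos: "L ! s ! (i - 1) > 0"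
      using R False by (simp_all add: s_def Let_def)
    have "module_isomorphic (CP n (lam ! s)) (CPV n (lam ! s) (raise i (L ! s))) (Ffun n i (lam ! s) (Wmod n (L ! s)))"
      using Ffun_iso[OF i1 label_nth[OF L s] pos] .
    from Wfactors_update[OF L fL_labels[OF L i fL] s this]
    show ?thesis using False unfolding C_f_def label_of_Wclass[OF L] Let_def fl fL
      by (simp add: hd_map s_def[symmetric] Wclass_def)
  qed
qed

text \<open>If \<open>rk\<close> drops by one at each application and is 0 where \<open>g\<close>
  stops, the \<open>j\<close>-th iterate exists exactly for \<open>j \<le> rk x\<close>. The set
  under \<open>Max\<close> is thus a finite initial segment. The predicate \<open>P\<close>
  restricts attention to the orbit.\<close>

lemma max_iter_eq:
  assumes iter: "\<And>x y. P x \<Longrightarrow> g x = Some y \<Longrightarrow> P y \<and> rk x = Suc (rk y)"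
    and stop: "\<And>x. P x \<Longrightarrow> g x = None \<Longrightarrow> rk x = 0" and "P x"
  shows "max_iter g x = rk x"
proof -
  let ?F = "\<lambda>x. Option.bind x g"
  have None: "(?F ^^ j) None = None" for j by (induction j) auto
  have "(?F ^^ j) (Some x) \<noteq> None \<longleftrightarrow> j \<le> rk x" if "P x" for j x
    using that
  proof (induction j arbitrary: x)
    case (Suc j)
    show ?case
    proof (cases "g x")
      case None
      then show ?thesis using stop[OF Suc.prems None] \<open>\<And>j. (?F ^^ j) None = None\<close>
        by (simp add: funpow_Suc_right del: funpow.simps)
    next
      case (Some y)
      then show ?thesis using iter[OF Suc.prems Some] Suc.IH[of y]
        by (simp add: funpow_Suc_right del: funpow.simps)
    qed
  qed simp
  then have "{j. (?F ^^ j) (Some x) \<noteq> None} = {..rk x}" using \<open>P x\<close> by auto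
  then show ?thesis unfolding max_iter_def by (simp only:) (intro Max_eqI; simp)
qed

lemma max_iter_C:
  assumes L: "L \<in> labels n lam" and i: "i \<in> {1..n}"
  shows "max_iter (C_e n lam i) (Wclass n lam L) = word_eps i (Lword L)"
    "max_iter (C_f n lam i) (Wclass n lam L) = word_phi i (Lword L)"
proof -
  have i1: "1 \<le> i" "i \<le> n" using i by auto
  let ?P = "\<lambda>c. c \<in> Wclass n lam ` labels n lam"
  let ?w = "\<lambda>c. Lword (label_of n lam c)"
  note e = word_e_Lword[OF i1(1) labels_less[OF _ i1(2)]] and f = word_f_Lword[OF i1(1) labels_less[OF _ i1(2)]]
  have "max_iter (C_e n lam i) (Wclass n lam L) = word_eps i (?w (Wclass n lam L))"
  proof (rule max_iter_eq[where P = ?P])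
    fix c d assume "?P c" and cd: "C_e n lam i c = Some d"
    then obtain M where M: "M \<in> labels n lam" "c = Wclass n lam M" by blast
    then obtain M' where M': "eL i M = Some M'" "d = Wclass n lam M'" using cd C_e_Wclass[OF M(1) i] by auto
    have M'l: "M' \<in> labels n lam" using eL_labels[OF M(1) i M'(1)] .
    have "word_e i (Lword M) = Some (Lword M')" using e[OF M(1)] M' by simp
    then show "?P d \<and> word_eps i (?w c) = Suc (word_eps i (?w d))"
      using M M' M'l word_e_Some[OF i1(1)] by (simp add: label_of_Wclass)
  next
    fix c assume "?P c" and c: "C_e n lam i c = None"
    then obtain M where M: "M \<in> labels n lam" "c = Wclass n lam M" by blast
    then have "word_e i (Lword M) = None" using e[OF M(1)] c C_e_Wclass[OF M(1) i] by simp
    then show "word_eps i (?w c) = 0" using M by (simp add: label_of_Wclass word_e_None)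
  qed (use L in blast)
  then show "max_iter (C_e n lam i) (Wclass n lam L) = word_eps i (Lword L)" by (simp add: label_of_Wclass[OF L])
  have "max_iter (C_f n lam i) (Wclass n lam L) = word_phi i (?w (Wclass n lam L))"
  proof (rule max_iter_eq[where P = ?P])
    fix c d assume "?P c" and cd: "C_f n lam i c = Some d"
    then obtain M where M: "M \<in> labels n lam" "c = Wclass n lam M" by blast
    then obtain M' where M': "fL i M = Some M'" "d = Wclass n lam M'" using cd C_f_Wclass[OF M(1) i] by auto
    have M'l: "M' \<in> labels n lam" using fL_labels[OF M(1) i M'(1)] .
    have "word_f i (Lword M) = Some (Lword M')" using f[OF M(1)] M' by simp
    then have "word_e i (Lword M') = Some (Lword M)" using word_f_Some[OF i1(1)] by blast
    then show "?P d \<and> word_phi i (?w c) = Suc (word_phi i (?w d))"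
      using M M' M'l word_e_Some[OF i1(1)] by (simp add: label_of_Wclass)
  next
    fix c assume "?P c" and c: "C_f n lam i c = None"
    then obtain M where M: "M \<in> labels n lam" "c = Wclass n lam M" by blast
    then have "word_f i (Lword M) = None" using f[OF M(1)] c C_f_Wclass[OF M(1) i] by simp
    then show "word_phi i (?w c) = 0" using M by (simp add: label_of_Wclass word_f_None)
  qed (use L in blast)
  then show "max_iter (C_f n lam i) (Wclass n lam L) = word_phi i (Lword L)" by (simp add: label_of_Wclass[OF L])
qed

lemma word_wt_Lword:
  assumes "\<forall>mu\<in>set L. length mu = Suc n"
  shows "(\<lambda>p. \<Sum>mu\<leftarrow>L. W_wt n mu p) = word_wt (Lword L)"
  using assms
proof (induction L)
  case Nil
  then show ?case by (simp add: fun_eq_iff zero_fun_apply)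
next
  case (Cons mu L)
  then have "(\<lambda>p. \<Sum>mu\<leftarrow>L. W_wt n mu p) = word_wt (Lword L)" "length mu = Suc n" by auto
  then show ?case by (auto simp: word_wt_append word_wt_rev word_wt_row fun_eq_iff plus_fun_apply)
qed

section \<open>The connected component of the highest weight class\<close>

lemma C_arrow:
  assumes L: "L \<in> labels n lam" and M: "M \<in> labels n lam"
  shows "crystal_arrow n (C_crystal n lam) (Wclass n lam L) (Wclass n lam M) \<longleftrightarrow>
    (\<exists>i\<in>{1..n}. fL i L = Some M)"
proof -
  have "cf (C_crystal n lam) i (Wclass n lam L) = Some (Wclass n lam M) \<longleftrightarrow> fL i L = Some M" if "i \<in> {1..n}" for i
    using C_f_Wclass[OF L that] fL_labels[OF L that] Wclass_inj[OF _ M] by (auto simp: C_crystal_def)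
  then show ?thesis unfolding crystal_arrow_def using L M by (auto simp: verts_C)
qed

lemma component_verts:
  assumes lam: "sorted_wrt (\<ge>) lam" and len: "length lam \<le> n + 1"
  shows "{c \<in> verts (C_crystal n lam). equivclp (crystal_arrow n (C_crystal n lam)) (Wclass n lam (hwrows n 0 lam)) c}
    = Wclass n lam ` sslab n lam"
proof -
  let ?C = "C_crystal n lam" and ?H = "hwrows n 0 lam"
  let ?c0 = "Wclass n lam ?H"
  have H: "?H \<in> sslab n lam"
    using hwrows_labels[OF len] hwrows_semistd[OF lam, of 0 n] len by (simp add: sslab_def)
  have lab: "L \<in> labels n lam" if "L \<in> sslab n lam" for L using that by (simp add: sslab_def)
  have down: "c \<in> Wclass n lam ` sslab n lam" if "equivclp (crystal_arrow n ?C) ?c0 c" for c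
    using that
  proof (induction rule: equivclp_induct)
    case base
    then show ?case using H by blast
  next
    case (step b c)
    then obtain L where L: "L \<in> sslab n lam" "b = Wclass n lam L" by blast
    have "c \<in> verts ?C" using step(2) unfolding crystal_arrow_def by blast
    then obtain M where M: "M \<in> labels n lam" "c = Wclass n lam M" unfolding verts_C by blast
    from step(2) show ?case
    proof
      assume "crystal_arrow n ?C b c"
      then obtain i where "i \<in> {1..n}" "fL i L = Some M" using C_arrow[OF lab[OF L(1)] M(1)] L M by blast
      then show ?thesis using sslab_fL[OF L(1)] M by blast
    next
      assume "crystal_arrow n ?C c b"
      then obtain i where i: "i \<in> {1..n}" "fL i M = Some L" using C_arrow[OF M(1) lab[OF L(1)]] L M by blast
      then have "eL i L = Some M" using eL_fL_iff[OF lab[OF L(1)] M(1) i(1)] by simp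
      then show ?thesis using sslab_eL[OF L(1) i(1)] M by blast
    qed
  qed
  have up: "equivclp (crystal_arrow n ?C) ?c0 (Wclass n lam L)" if "L \<in> sslab n lam" for L
    using that
  \<comment> \<open>Each raising operator lowers the sum of the letters by one, so the climb ends,
    and by \<open>hw_unique\<close> it can end only at \<open>?H\<close>.\<close>
  proof (induction "sum_list (Lword L)" arbitrary: L rule: less_induct)
    case less
    note Ll = lab[OF less.prems]
    show ?case
    proof (cases "\<exists>i\<in>{1..n}. word_eps i (Lword L) > 0")
      case True
      then obtain i where i: "i \<in> {1..n}" "word_eps i (Lword L) > 0" by blast
      have i1: "1 \<le> i" "i \<le> n" using i by auto
      note e = word_e_Lword[OF i1(1) labels_less[OF Ll i1(2)]]
      obtain M where M: "eL i L = Some M" using i(2) word_e_None[of i "Lword L"] e by (cases "eL i L") auto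
      have Ms: "M \<in> sslab n lam" using sslab_eL[OF less.prems i(1) M] .
      have "sum_list (Lword M) < sum_list (Lword L)"
        using word_e_Some[OF i1(1), of "Lword L" "Lword M"] e M by simp
      then have "equivclp (crystal_arrow n ?C) ?c0 (Wclass n lam M)" using less.hyps Ms by blast
      moreover have "crystal_arrow n ?C (Wclass n lam M) (Wclass n lam L)"
        unfolding C_arrow[OF lab[OF Ms] Ll] using eL_fL_iff[OF Ll lab[OF Ms] i(1)] M i(1) by blast
      ultimately show ?thesis by (blast intro: equivclp_into_equivclp)
    next
      case False
      have "L = hwrows n 0 (map sum_list L)"
      proof (rule hw_unique)
        show "\<forall>mu\<in>set L. length mu = Suc n" using labels_lengths[OF Ll] .
        show "0 + length L \<le> Suc n" using label_length[OF Ll] len by simp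
        show "semistd L" using less.prems by (simp add: sslab_def)
        show "word_eps i (Lword L) = 0" if "0 < i" "i \<le> n" for i using False that by auto
      qed (simp add: psum_simps)
      moreover have "map sum_list L = lam" using Ll by (simp add: labels_iff)
      ultimately have "L = ?H" by simp
      then show ?thesis by simp
    qed
  qed
  show ?thesis
  proof (intro subset_antisym subsetI)
    fix c assume "c \<in> Wclass n lam ` sslab n lam"
    then show "c \<in> {c \<in> verts ?C. equivclp (crystal_arrow n ?C) ?c0 c}" using up lab by (auto simp: verts_C)
  qed (use down in blast)
qed

lemma C_component_realizes:
  assumes lam: "sorted_wrt (\<ge>) lam" and len: "length lam \<le> n + 1"
  shows "realizes n lam (crystal_component n (C_crystal n lam) (Wclass n lam (hwrows n 0 lam))) (Wclass n lam)"
proof -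
  have lab: "L \<in> labels n lam" if "L \<in> sslab n lam" for L using that by (simp add: sslab_def)
  show ?thesis
    unfolding realizes_def
  proof (intro conjI ballI)
    show "inj_on (Wclass n lam) (sslab n lam)" using Wclass_inj lab by (intro inj_onI) blast
    show "verts (crystal_component n (C_crystal n lam) (Wclass n lam (hwrows n 0 lam))) = Wclass n lam ` sslab n lam"
      using component_verts[OF assms] by (simp add: crystal_component_def)
    fix L assume L: "L \<in> sslab n lam"
    show "cwt (crystal_component n (C_crystal n lam) (Wclass n lam (hwrows n 0 lam))) (Wclass n lam L) = word_wt (Lword L)"
      using word_wt_Lword[OF labels_lengths[OF lab[OF L]]] label_of_Wclass[OF lab[OF L]]
      by (simp add: crystal_component_def C_crystal_def)
    fix i assume i: "i \<in> {1..n}"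
    show "ceps (crystal_component n (C_crystal n lam) (Wclass n lam (hwrows n 0 lam))) i (Wclass n lam L) = Fin (int (word_eps i (Lword L)))"
      "cphi (crystal_component n (C_crystal n lam) (Wclass n lam (hwrows n 0 lam))) i (Wclass n lam L) = Fin (int (word_phi i (Lword L)))"
      "ce (crystal_component n (C_crystal n lam) (Wclass n lam (hwrows n 0 lam))) i (Wclass n lam L) = map_option (Wclass n lam) (eL i L)"
      "cf (crystal_component n (C_crystal n lam) (Wclass n lam (hwrows n 0 lam))) i (Wclass n lam L) = map_option (Wclass n lam) (fL i L)"
      using max_iter_C[OF lab[OF L] i] C_e_Wclass[OF lab[OF L] i] C_f_Wclass[OF lab[OF L] i]
      by (simp_all add: crystal_component_def C_crystal_def)
  qed
qed

theorem mainTheorem2: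
  fixes n l :: nat and lam :: "nat list"
  assumes "n \<ge> 1"
    and "l > 0"
    and "sorted_wrt (\<ge>) lam" and "\<forall>p\<in>set lam. p > 0" and "sum_list lam = l"
    and "length lam \<le> n + 1"
  shows "crystal_isomorphic n
    (crystal_component n (C_crystal n lam)
      (Wclass n lam (map (\<lambda>j. (replicate (n + 1) 0)[j := lam ! j]) [0..<length lam])))
    (B_crystal n lam)"
proof -
  have "sum_list lam > 0" using assms(2,5) by simp
  from realizes_isomorphic[OF C_component_realizes[OF assms(3,6)] B_crystal_realizes[OF assms(3) this]]
  show ?thesis unfolding hwrows_map .
qed

end
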